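(* In the setting described in the context, suppose $\mathbb E[\mu^p]<\infty$ for some $p>1$, and suppose that there are a measurable even function $K$ on $\mathbb R^d$ with $C_1\le K(z)\le C_2$ for some constants $C_1,C_2>0$, and a set $\Omega_0\subset\Omega$ of full probability measure such that for every $\omega\in\Omega_0$ the following (i)--(iv) hold. (i) If $\{f_\varepsilon:\varepsilon\in(0,1]\}$ are functions with $f_\varepsilon\in\mathcal F^{\varepsilon,\omega}$ for all $\varepsilon\in(0,1]$ and $\limsup_{\varepsilon\to0}(\|f_\varepsilon\|_\infty+\mathcal E^{\varepsilon,\omega}(f_\varepsilon,f_\varepsilon))<\infty$, then for any sequence $\{\varepsilon_n\}\subset(0,1]$ with $\lim_{n\to\infty}\varepsilon_n=0$ there are a subsequence $\{\varepsilon_{n_k}\}$ and $f\in L^1_{loc}(\mathbb R^d;dx)$ such that $f_{\varepsilon_{n_k}}\to f$ in $L^1(B(0,r);dx)$ for every $r>1$. (ii) For any $g\in C_c^\infty(\mathbb R^d)$, $$\lim_{\eta\to0}\limsup_{\varepsilon\to0}\iint_{\mathbb R^d\times\mathbb R^d\setminus\Delta}(g(x)-g(y))^2\frac{\kappa(x/\varepsilon,y/\varepsilon;\omega)}{|x-y|^{d+\alpha}}\mathbf 1_{\{|x-y|\le\eta\}}\,dx\,dy=0$$ and $$\lim_{\eta\to0}\limsup_{\varepsilon\to0}\iint_{\mathbb R^d\times\mathbb R^d}(g(x)-g(y))^2\frac{\kappa(x/\varepsilon,y/\varepsilon;\omega)}{|x-y|^{d+\alpha}}\mathbf 1_{\{|x-y|\ge1/\eta\}}\,dx\,dy=0.$$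 (iii) There is a constant $p>1$ such that $\limsup_{\varepsilon\to0}\int_{B(0,R)}\big(\int_{B(0,R)}\kappa(x/\varepsilon,y/\varepsilon;\omega)\,dy\big)^p\,dx<\infty$ for every $R\ge1$. (iv) For every $\eta>0$, every bounded measurable $f$ on $\mathbb R^d$ and every $g\in C_c^\infty(\mathbb R^d)$, $$\lim_{\varepsilon\to0}\iint_{\mathbb R^d\times\mathbb R^d}(f(x)-f(y))(g(x)-g(y))\frac{\kappa(x/\varepsilon,y/\varepsilon;\omega)}{|x-y|^{d+\alpha}}\mathbf 1_{\{\eta<|x-y|<1/\eta,\,x-y\in\Gamma\}}\,dx\,dy$$ $$=\iint_{\mathbb R^d\times\mathbb R^d}(f(x)-f(y))(g(x)-g(y))\frac{K(x-y)}{|x-y|^{d+\alpha}}\mathbf 1_{\{\eta<|x-y|<1/\eta,\,x-y\in\Gamma\}}\,dx\,dy.$$ Then there is a subset $\Omega_2\subset\Omega$ of full probability measure such that for every $\omega\in\Omega_2$, every $\lambda>0$ and every $f\in C_c(\mathbb R^d)$, $$\lim_{\varepsilon\to0}\|U^K_\lambda f\|_{L^2(\mathbb R^d;\mu^{\varepsilon,\omega}(dx))}=\|U^K_\lambda f\|_{L^2(\mathbb R^d;dx)},\qquad \lim_{\varepsilon\to0}\|U^{\varepsilon,\omega}_\lambda f-U^K_\lambda f\|_{L^2(\mathbb R^d;\mu^{\varepsilon,\omega}(dx))}=0,$$ and in particular $$\lim_{\varepsilon\to0}\|U^{\varepsilon,\omega}_\lambda f\|_{L^2(\mathbb R^d;\mu^{\varepsilon,\omega}(dx))}=\|U^K_\lambda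 f\|_{L^2(\mathbb R^d;dx)}.$$
   Context: Environment. $d\ge1$; $(\Omega,\mathcal F,\mathbb P)$ is a probability space with expectation $\mathbb E$, carrying a group of transformations $\{\tau_x\}_{x\in\mathbb R^d}$ of $\Omega$ with $\tau_0=\mathrm{id}$, $\tau_x\circ\tau_y=\tau_{x+y}$, such that (1) $\mathbb P(\tau_xA)=\mathbb P(A)$ for all $A\in\mathcal F$, $x\in\mathbb R^d$; (2) if $A\in\mathcal F$ and $\tau_xA=A$ for all $x$, then $\mathbb P(A)\in\{0,1\}$; (3) $(x,\omega)\mapsto\tau_x\omega$ is $\mathscr B(\mathbb R^d)\times\mathcal F$-measurable. Coefficients. $\alpha\in(0,2)$. $\mu:\Omega\to[0,\infty)$ is a random variable with $\mathbb E[\mu]=1$ and, for every $\omega$, $\mu(\tau_x\omega)>0$ for a.e. $x\in\mathbb R^d$. $\kappa:\mathbb R^d\times\mathbb R^d\times\Omega\to[0,\infty)$ is a (measurable) random function such that for every $\omega$ and all $x,y,z$: $\kappa(x,y;\omega)=\kappa(y,x;\omega)$, $\kappa(x+z,y+z;\omega)=\kappa(x,y;\tau_z\omega)$; and for $\mathbb P$-a.e. $\omega$ the function $x\mapsto\int_{\mathbb R^d}(1\wedge|z|^2)\frac{\kappa(x,x+z;\omega)}{|z|^{d+\alpha}}\,dz$ is in $L^1_{loc}(\mathbb R^d;dx)$. $\Gamma\subset\mathbb R^d$ is a non-empty open symmetric cone: $rx\in\Gamma$ for every $x\in\Gamma$ and $r\in\mathbb R\setminus\{0\}$. Forms. $\Delta=\{(x,x):x\in\mathbb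 R^d\}$. For $\varepsilon>0$, $\mu^{\varepsilon,\omega}(dx)=\mu(\tau_{x/\varepsilon}\omega)\,dx$, and $(\mathcal E^{\varepsilon,\omega},\mathcal F^{\varepsilon,\omega})$ is the regular symmetric Dirichlet form on $L^2(\mathbb R^d;\mu^{\varepsilon,\omega}(dx))$ given by $$\mathcal E^{\varepsilon,\omega}(f,g)=\frac12\iint_{\mathbb R^d\times\mathbb R^d\setminus\Delta}(f(x)-f(y))(g(x)-g(y))\frac{\kappa(x/\varepsilon,y/\varepsilon;\omega)}{|x-y|^{d+\alpha}}\mathbf 1_{\{x-y\in\Gamma\}}\,dx\,dy,$$ with $\mathcal F^{\varepsilon,\omega}$ the closure of $C^1_c(\mathbb R^d)$ (compactly supported $C^1$ functions) under the norm $(\mathcal E^{\varepsilon,\omega}(\cdot,\cdot)+\|\cdot\|^2_{L^2(\mathbb R^d;\mu^{\varepsilon,\omega}(dx))})^{1/2}$. $(\mathcal E^K,\mathcal F^K)$ is the regular Dirichlet form on $L^2(\mathbb R^d;dx)$ given by $$\mathcal E^K(f,g)=\frac12\iint_{\mathbb R^d\times\mathbb R^d\setminus\Delta}(f(x)-f(y))(g(x)-g(y))\frac{K(x-y)}{|x-y|^{d+\alpha}}\mathbf 1_{\{x-y\in\Gamma\}}\,dx\,dy,$$ with $\mathcal F^K$ the closure of $C^1_c(\mathbb R^d)$ under $(\mathcal E^K(\cdot,\cdot)+\|\cdot\|^2_{L^2(\mathbb R^d;dx)})^{1/2}$. $U^{\varepsilon,\omega}_\lambda$ and $U^K_\lambda$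 are the $\lambda$-order resolvents of $(\mathcal E^{\varepsilon,\omega},\mathcal F^{\varepsilon,\omega})$ on $L^2(\mathbb R^d;\mu^{\varepsilon,\omega}(dx))$ and of $(\mathcal E^K,\mathcal F^K)$ on $L^2(\mathbb R^d;dx)$. The $\lambda$-order resolvent $U_\lambda$ of a Dirichlet form $(\mathcal E,\mathcal F)$ on $L^2(m)$ sends $f\in L^2(m)$ to the unique $u\in\mathcal F$ with $\mathcal E(u,g)+\lambda\langle u,g\rangle_{L^2(m)}=\langle f,g\rangle_{L^2(m)}$ for all $g\in\mathcal F$. $C_c$, $C_c^\infty$: continuous, resp. smooth, compactly supported functions; $B(x,r)$: open ball; $a\wedge b=\min(a,b)$. *)

theory Defs
  imports "HOL-Probability.Probability"
begin

text \<open>The state space $\mathbb{R}^d$, $d \ge 1$, is a type \<open>'a :: euclidean_space\<close> with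
  $d =$ \<open>DIM('a)\<close>; the sample space $\Omega$ is \<open>space M\<close>.\<close>

locale ergodic_environment = prob_space M
  for M :: "'w measure" +
  fixes \<tau> :: "'a::euclidean_space \<Rightarrow> 'w \<Rightarrow> 'w"
  assumes tau_zero: "\<And>\<omega>. \<omega> \<in> space M \<Longrightarrow> \<tau> 0 \<omega> = \<omega>"
    and tau_add: "\<And>x y \<omega>. \<omega> \<in> space M \<Longrightarrow> \<tau> x (\<tau> y \<omega>) = \<tau> (x + y) \<omega>"
    and tau_preserving: "\<And>x A. A \<in> sets M \<Longrightarrow> measure M (\<tau> x ` A) = measure M A"
    and tau_ergodic: "\<And>A. A \<in> sets M \<Longrightarrow> (\<forall>x. \<tau> x ` A = A) \<Longrightarrow> measure M A \<in> {0, 1}"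
    and tau_measurable: "(\<lambda>(x, \<omega>). \<tau> x \<omega>) \<in> (borel \<Otimes>\<^sub>M M) \<rightarrow>\<^sub>M M"

locale random_coefficients = ergodic_environment M \<tau>
  for M :: "'w measure" and \<tau> :: "'a::euclidean_space \<Rightarrow> 'w \<Rightarrow> 'w" +
  fixes \<alpha> :: real
    and \<mu> :: "'w \<Rightarrow> real"
    and \<kappa> :: "'a \<Rightarrow> 'a \<Rightarrow> 'w \<Rightarrow> real"
    and \<Gamma> :: "'a set"
  assumes alpha: "0 < \<alpha>" "\<alpha> < 2"
    and mu_measurable: "\<mu> \<in> borel_measurable M"
    and mu_nonneg: "\<And>\<omega>. \<omega> \<in> space M \<Longrightarrow> 0 \<le> \<mu> \<omega>"
    and mu_integrable: "integrable M \<mu>"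
    and mu_mean: "integral\<^sup>L M \<mu> = 1"
    and mu_pos: "\<And>\<omega>. \<omega> \<in> space M \<Longrightarrow> AE x in lborel. 0 < \<mu> (\<tau> x \<omega>)"
    and kappa_measurable:
      "(\<lambda>(x, y, \<omega>). \<kappa> x y \<omega>) \<in> borel_measurable (borel \<Otimes>\<^sub>M (borel \<Otimes>\<^sub>M M))"
    and kappa_nonneg: "\<And>x y \<omega>. \<omega> \<in> space M \<Longrightarrow> 0 \<le> \<kappa> x y \<omega>"
    and kappa_sym: "\<And>x y \<omega>. \<omega> \<in> space M \<Longrightarrow> \<kappa> x y \<omega> = \<kappa> y x \<omega>"
    and kappa_shift: "\<And>x y z \<omega>. \<omega> \<in> space M \<Longrightarrow> \<kappa> (x + z) (y + z) \<omega> = \<kappa> x y (\<tau> z \<omega>)"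
    and kappa_L1_loc:
      "AE \<omega> in M. \<forall>C. compact C \<longrightarrow>
         (\<integral>\<^sup>+x\<in>C. (\<integral>\<^sup>+z. ennreal (min 1 ((norm z)\<^sup>2) * \<kappa> x (x + z) \<omega>
                                / norm z powr (real DIM('a) + \<alpha>)) \<partial>lborel) \<partial>lborel) < \<infinity>"
    and cone_open: "open \<Gamma>"
    and cone_nonempty: "\<Gamma> \<noteq> {}"
    and cone_symmetric: "\<And>x r. x \<in> \<Gamma> \<Longrightarrow> r \<noteq> 0 \<Longrightarrow> r *\<^sub>R x \<in> \<Gamma>"

text \<open>$f$ is $C^{k+1}$ iff it is differentiable and every directional derivative
  $x \mapsto Df(x)v$ is $C^k$.\<close>

fun C_k :: "nat \<Rightarrow> ('a::euclidean_space \<Rightarrow> real) \<Rightarrow> bool" where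
  "C_k 0 f \<longleftrightarrow> continuous_on UNIV f"
| "C_k (Suc k) f \<longleftrightarrow> (\<forall>x. f differentiable (at x)) \<and>
     (\<forall>v. C_k k (\<lambda>x. frechet_derivative f (at x) v))"

definition Cc :: "nat \<Rightarrow> ('a::euclidean_space \<Rightarrow> real) set" where
  "Cc k = {f. C_k k f \<and> compact (closure (support_on UNIV f))}"

definition Cc_inf :: "('a::euclidean_space \<Rightarrow> real) set" where
  "Cc_inf = (\<Inter>k. Cc k)"

definition L1_loc :: "('a::euclidean_space \<Rightarrow> real) set" where
  "L1_loc = {f \<in> borel_measurable borel. \<forall>C. compact C \<longrightarrow> set_integrable lborel C f}"

text \<open>Intended for exponents \<open>p > 0\<close>.\<close>

definition ennreal_powr :: "ennreal \<Rightarrow> real \<Rightarrow> ennreal" where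
  "ennreal_powr t p = (if t = \<infinity> then \<infinity> else ennreal (enn2real t powr p))"

text \<open>The norm is \<open>\<infinity>\<close> for functions that are not square integrable, so
  convergence of norms to a finite limit includes membership in $L^2$.\<close>

definition L2_norm :: "'a measure \<Rightarrow> ('a \<Rightarrow> real) \<Rightarrow> ennreal" where
  "L2_norm m u = ennreal_powr (\<integral>\<^sup>+x. ennreal ((u x)\<^sup>2) \<partial>m) (1 / 2)"

definition Linf_norm :: "('a::euclidean_space \<Rightarrow> real) \<Rightarrow> ennreal" where
  "Linf_norm f = esssup lborel (\<lambda>x. ennreal \<bar>f x\<bar>)"

definition stable_kernel :: "real \<Rightarrow> ('a \<Rightarrow> 'a \<Rightarrow> real) \<Rightarrow> 'a::euclidean_space \<Rightarrow> 'a \<Rightarrow> real" where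
  "stable_kernel \<alpha> c x y = c x y / norm (x - y) powr (real DIM('a) + \<alpha>)"

definition cone_kernel ::
  "real \<Rightarrow> 'a set \<Rightarrow> ('a \<Rightarrow> 'a \<Rightarrow> real) \<Rightarrow> 'a::euclidean_space \<Rightarrow> 'a \<Rightarrow> real" where
  "cone_kernel \<alpha> \<Gamma> c x y = stable_kernel \<alpha> c x y * indicator \<Gamma> (x - y)"

definition rescaled_coeff ::
  "('a \<Rightarrow> 'a \<Rightarrow> 'w \<Rightarrow> real) \<Rightarrow> real \<Rightarrow> 'w \<Rightarrow> 'a::euclidean_space \<Rightarrow> 'a \<Rightarrow> real" where
  "rescaled_coeff \<kappa> \<epsilon> \<omega> x y = \<kappa> (x /\<^sub>R \<epsilon>) (y /\<^sub>R \<epsilon>) \<omega>"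

definition rescaled_measure ::
  "('a \<Rightarrow> 'w \<Rightarrow> 'w) \<Rightarrow> ('w \<Rightarrow> real) \<Rightarrow> real \<Rightarrow> 'w \<Rightarrow> 'a::euclidean_space measure" where
  "rescaled_measure \<tau> \<mu> \<epsilon> \<omega> = density lborel (\<lambda>x. ennreal (\<mu> (\<tau> (x /\<^sub>R \<epsilon>) \<omega>)))"

text \<open>In the definitions below, \<open>- Id\<close> is the complement of the diagonal $\Delta$.\<close>

definition jump_form ::
  "('a::euclidean_space \<Rightarrow> 'a \<Rightarrow> real) \<Rightarrow> ('a \<Rightarrow> real) \<Rightarrow> ('a \<Rightarrow> real) \<Rightarrow> real" where
  "jump_form J f g = 1 / 2 *
     set_lebesgue_integral (lborel \<Otimes>\<^sub>M lborel) (- Id) (\<lambda>(x, y). (f x - f y) * (g x - g y) * J x y)"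

text \<open>The quadratic form $\mathcal{E}(f,f)$ with value \<open>\<infinity>\<close> where the integral diverges.\<close>

definition jump_energy :: "('a::euclidean_space \<Rightarrow> 'a \<Rightarrow> real) \<Rightarrow> ('a \<Rightarrow> real) \<Rightarrow> ennreal" where
  "jump_energy J f = ennreal (1 / 2) *
     set_nn_integral (lborel \<Otimes>\<^sub>M lborel) (- Id) (\<lambda>(x, y). ennreal ((f x - f y)\<^sup>2 * J x y))"

text \<open>The closure of $C^1_c$ under $(\mathcal{E}(\cdot,\cdot) + \|\cdot\|_{L^2(m)}^2)^{1/2}$.
  Elements of $L^2(m)$ are represented by Borel functions, and the set is closed under
  modification on null sets. If Lebesgue-null and \<open>m\<close>-null sets agree, Fatou's lemma shows that
  the functions of finite energy in $L^2(m)$ are complete under this norm, so the closure taken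
  inside this space agrees with the abstract completion of $C^1_c$.\<close>

definition form_domain ::
  "'a measure \<Rightarrow> ('a \<Rightarrow> 'a \<Rightarrow> real) \<Rightarrow> ('a::euclidean_space \<Rightarrow> real) set" where
  "form_domain m J = {f \<in> borel_measurable borel.
     jump_energy J f < \<infinity> \<and> (\<integral>\<^sup>+x. ennreal ((f x)\<^sup>2) \<partial>m) < \<infinity> \<and>
     (\<exists>\<phi>. (\<forall>n::nat. \<phi> n \<in> Cc 1) \<and>
       (\<lambda>n. jump_energy J (\<lambda>x. \<phi> n x - f x) + (\<integral>\<^sup>+x. ennreal ((\<phi> n x - f x)\<^sup>2) \<partial>m))
         \<longlonglongrightarrow> 0)}"

text \<open>The resolvent $U_\lambda f$ is unique as an element of $L^2(m)$; \<open>SOME\<close> picks a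
  representative function.\<close>

definition is_resolvent ::
  "'a measure \<Rightarrow> ('a \<Rightarrow> 'a \<Rightarrow> real) \<Rightarrow> real \<Rightarrow> ('a \<Rightarrow> real) \<Rightarrow> ('a::euclidean_space \<Rightarrow> real) \<Rightarrow> bool" where
  "is_resolvent m J l f u \<longleftrightarrow> u \<in> form_domain m J \<and>
     (\<forall>g\<in>form_domain m J.
        jump_form J u g + l * (\<integral>x. u x * g x \<partial>m) = (\<integral>x. f x * g x \<partial>m))"

definition resolvent ::
  "'a measure \<Rightarrow> ('a \<Rightarrow> 'a \<Rightarrow> real) \<Rightarrow> real \<Rightarrow> ('a \<Rightarrow> real) \<Rightarrow> ('a::euclidean_space \<Rightarrow> real)" where
  "resolvent m J l f = (SOME u. is_resolvent m J l f u)"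

definition random_kernel ::
  "real \<Rightarrow> 'a set \<Rightarrow> ('a \<Rightarrow> 'a \<Rightarrow> 'w \<Rightarrow> real) \<Rightarrow> real \<Rightarrow> 'w \<Rightarrow> 'a::euclidean_space \<Rightarrow> 'a \<Rightarrow> real" where
  "random_kernel \<alpha> \<Gamma> \<kappa> \<epsilon> \<omega> = cone_kernel \<alpha> \<Gamma> (rescaled_coeff \<kappa> \<epsilon> \<omega>)"

definition limit_kernel ::
  "real \<Rightarrow> 'a set \<Rightarrow> ('a \<Rightarrow> real) \<Rightarrow> 'a::euclidean_space \<Rightarrow> 'a \<Rightarrow> real" where
  "limit_kernel \<alpha> \<Gamma> K = cone_kernel \<alpha> \<Gamma> (\<lambda>x y. K (x - y))"

definition random_resolvent ::
  "('a \<Rightarrow> 'w \<Rightarrow> 'w) \<Rightarrow> real \<Rightarrow> ('w \<Rightarrow> real) \<Rightarrow> ('a \<Rightarrow> 'a \<Rightarrow> 'w \<Rightarrow> real) \<Rightarrow> 'a set \<Rightarrow>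
   real \<Rightarrow> 'w \<Rightarrow> real \<Rightarrow> ('a \<Rightarrow> real) \<Rightarrow> ('a::euclidean_space \<Rightarrow> real)" where
  "random_resolvent \<tau> \<alpha> \<mu> \<kappa> \<Gamma> \<epsilon> \<omega> =
     resolvent (rescaled_measure \<tau> \<mu> \<epsilon> \<omega>) (random_kernel \<alpha> \<Gamma> \<kappa> \<epsilon> \<omega>)"

definition limit_resolvent ::
  "real \<Rightarrow> 'a set \<Rightarrow> ('a \<Rightarrow> real) \<Rightarrow> real \<Rightarrow> ('a \<Rightarrow> real) \<Rightarrow> ('a::euclidean_space \<Rightarrow> real)" where
  "limit_resolvent \<alpha> \<Gamma> K = resolvent lborel (limit_kernel \<alpha> \<Gamma> K)"

end

theory Submission
  imports Defs
begin

text \<open>The resolvents are uniformly bounded in $L^\infty$ and in energy, so (i) gives a subsequential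
 limit $h$. Lower semicontinuity of the energy on the bands $\eta < |x-y| < 1/\eta$ comes from (iv)
 applied to test functions; (ii) and (iii) pass the weak equation to the limit, and density of
 $C_c^\infty$ in the form domain of $K$ identifies $h = U^K_\lambda f$. Comparing energy identities
 turns weak into strong convergence. The random measures converge on bounded sets by the ergodic
 theorem, which is proved here for the action of $\mathbb{R}^d$ (Vitali covering for the maximal
 inequality, a minimal-norm argument for the mean part). What is left is the tail of
 $\int (U^K_\lambda f)^2 d\mu^{\varepsilon}$: a barrier $(1+|x|^2)^{-(d+\alpha)/2}$ gives pointwise decay
 of $U^K_\lambda f$, and the maximal inequality bounds $\mu^{\varepsilon}$ of large balls.\<close>

text \<open>The spaces L2(m a) move with the scale a and their weights have no uniform bounds, so
  Lebesgue estimates do not carry over by themselves. Two devices replace them. A p-th moment with p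
  > 1 makes the weights equi-integrable: for 0 <= v <= C one has v w <= T v + C T^(1-p) w^p, so
  whatever is bounded and L1 small is small against every weight. The same splitting handles the
  coefficients through (iii). Secondly, the tail of the limit resolvent has to be controlled for
  measures of which only mass at most K L^d on balls of radius L >= 1 is known; a pointwise rate
  |x|^-(d+alpha) suffices because 2 (d+alpha) > d. Stretching the barrier by R multiplies its error
  by R^-alpha, so every l > 0 is reached.

  In (iv) one factor must be smooth. The limit h therefore enters as the other, bounded factor, and
  its own energy is reached by approximating h for a kernel truncated to an annulus, where every L2
  function has finite energy.

  One null set serves all l and f, because pointwise ergodic averages are taken only over countably
  many sets fixed beforehand.\<close>

abbreviation (input) nnint :: "('a::euclidean_space => ennreal) => ennreal" where
 "nnint == nn_integral lborel"

abbreviation (input) set_nnint :: "'a::euclidean_space set => ('a => ennreal) => ennreal" where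
 "set_nnint A f == set_nn_integral lborel A f"

abbreviation (input) ind :: "'a set => 'a => 'b::zero_neq_one" where "ind == indicator"

abbreviation (input) lborel2 :: "('a::euclidean_space \<times> 'b::euclidean_space) measure" where "lborel2 == lborel \<Otimes>\<^sub>M lborel"

abbreviation (input) borel2 :: "('a::topological_space \<times> 'b::topological_space) measure" where "borel2 == borel \<Otimes>\<^sub>M borel"

abbreviation (input) Borel :: "('a::topological_space => 'b::topological_space) set" where "Borel == borel_measurable borel"

abbreviation (input) Borel2 :: "('a::topological_space \<times> 'b::topological_space => 'c::topological_space) set" where "Borel2 == borel_measurable borel2"

abbreviation (input) ann :: "real => 'a::real_normed_vector set" where "ann r == {z. r < norm z \<and> norm z < 1 / r}"

abbreviation (input) at0 :: "real filter" where "at0 == at_right 0"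

lemmas bint_cong = Bochner_Integration.integral_cong
 and bint_nonneg = Bochner_Integration.integral_nonneg
 and bint_bound = Bochner_Integration.integrable_bound

abbreviation (input) seqlim :: "(nat => 'a::topological_space) => 'a => bool" (infix "~>" 60) where
 "X ~> L == X \<longlonglongrightarrow> L"

section \<open>Square-integrable functions\<close>

definition sqint :: "'a measure => ('a => real) => bool" where
 "sqint M f \<longleftrightarrow> f : borel_measurable M \<and> integrable M (%x. (f x)^2)"

lemma sqintD [dest]:
 assumes "sqint M f"
 shows "f : borel_measurable M" "integrable M (%x. (f x)^2)"
 using assms by (auto simp: sqint_def)

lemma sqint_iff_nn:
 "sqint M f \<longleftrightarrow> f : borel_measurable M \<and> (nn_integral M (%x. ennreal ((f x)^2))) < \<infinity>"
 unfolding sqint_def by (auto simp: integrable_iff_bounded)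

lemma nn_integral_sq:
 assumes "sqint M f"
 shows "(nn_integral M (%x. ennreal ((f x)^2))) = ennreal (LINT x|M. (f x)^2)"
 using assms by (intro nn_integral_eq_integral) auto

lemma sqint_mult:
 assumes f: "sqint M f" and g: "sqint M g"
 shows "integrable M (%x. f x * g x)"
proof -
 have [measurable]: "f : borel_measurable M" "g : borel_measurable M" using f g by auto
 have "integrable M (%x. (f x)^2 + (g x)^2)" using f g by auto
 then show ?thesis
 proof (rule bint_bound)
  show "AE x in M. norm (f x * g x) <= norm ((f x)^2 + (g x)^2)"
  proof (rule AE_I2, goal_cases)
   case (1 x)
   have "0 <= (\<bar>f x\<bar> - \<bar>g x\<bar>)^2" by simp
   then have "2 * (\<bar>f x\<bar> * \<bar>g x\<bar>) <= (f x)^2 + (g x)^2"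
    by (simp add: power2_diff algebra_simps)
   then have "\<bar>f x\<bar> * \<bar>g x\<bar> <= (f x)^2 + (g x)^2"
    by (smt (verit) mult_nonneg_nonneg abs_ge_zero)
   then show ?case
    by (simp add: abs_mult)
  qed
 qed simp
qed

lemma sqint_add:
 assumes f: "sqint M f" and g: "sqint M g"
 shows "sqint M (%x. f x + g x)"
proof -
 have "integrable M (%x. (f x)^2 + (g x)^2 + 2 * (f x * g x))"
  using sqintD(2)[OF f] sqintD(2)[OF g] sqint_mult[OF f g] by simp
 then have "integrable M (%x. (f x + g x)^2)"
  by (simp add: power2_eq_square algebra_simps)
 with f g show ?thesis by (auto simp: sqint_def)
qed

lemma sqint_cmult:
 assumes f: "sqint M f"
 shows "sqint M (%x. c * f x)"
 using f by (auto simp: sqint_def power_mult_distrib)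

lemma sqint_diff:
 assumes f: "sqint M f" and g: "sqint M g"
 shows "sqint M (%x. f x - g x)"
 using sqint_add[OF f sqint_cmult[OF g, of "-1"]] by simp

lemma sqint_bound:
 assumes f: "sqint M f" and g: "g : borel_measurable M"
  and le: "AE x in M. \<bar>g x\<bar> <= \<bar>f x\<bar>"
 shows "sqint M g"
proof -
 have "integrable M (%x. (g x)^2)"
 proof (rule bint_bound)
  show "integrable M (%x. (f x)^2)" using f by auto
  show "AE x in M. norm ((g x)^2) <= norm ((f x)^2)"
   using le by eventually_elim (simp add: abs_le_square_iff)
 qed (use g in auto)
 with g show ?thesis by (auto simp: sqint_def)
qed

lemma integral_sq_add:
 assumes f: "sqint M f" and g: "sqint M g"
 shows "(LINT x|M. (f x + g x)^2) = (LINT x|M. (f x)^2) + 2 * (LINT x|M. f x * g x) + (LINT x|M. (g x)^2)"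
proof -
 have "(LINT x|M. (f x + g x)^2) = (LINT x|M. (f x)^2 + 2 * (f x * g x) + (g x)^2)"
  by (simp add: power2_sum algebra_simps)
 also have "... = (LINT x|M. (f x)^2) + 2 * (LINT x|M. f x * g x) + (LINT x|M. (g x)^2)"
  using sqintD(2)[OF f] sqintD(2)[OF g] sqint_mult[OF f g] by simp
 finally show ?thesis .
qed

text \<open>Includes the degenerate case c = 0, where the expression is affine in t. Cauchy-Schwarz
  for integrals and for the forms comes from it, and so does the resolvent equation, out of almost
  minimisers.\<close>

lemma nonneg_quadratic_discr:
 fixes a b c :: real
 assumes "!!t. 0 <= a + 2 * t * b + t^2 * c" and c: "0 <= c"
 shows "b^2 <= a * c"
proof (cases "c = 0")
 case True
 have "b = 0"
 proof (rule ccontr)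
  assume b: "b \<noteq> 0"
  \<comment> \<open>This value of t makes the affine expression equal to -1.\<close>
  have "0 <= a + 2 * (-(a + 1) / (2 * b)) * b" using assms(1)[of "-(a + 1) / (2 * b)"] True by simp
  then show False using b by (simp add: field_simps)
 qed
 with True show ?thesis by simp
next
 case False
 with c have c: "c > 0" by simp
 have "0 <= a + 2 * (- b / c) * b + (- b / c)^2 * c" by (rule assms(1))
 also have "... = a - b^2 / c" using c by (simp add: field_simps power2_eq_square)
 finally show ?thesis using c by (simp add: field_simps)
qed

lemma Cauchy_Schwarz_integral_sq:
 assumes f: "sqint M f" and g: "sqint M g"
 shows "(LINT x|M. f x * g x)^2 <= (LINT x|M. (f x)^2) * (LINT x|M. (g x)^2)"
proof (rule nonneg_quadratic_discr)
 fix t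
 have "0 <= (LINT x|M. (f x + t * g x)^2)" by simp
 also have "... = (LINT x|M. (f x)^2) + 2 * t * (LINT x|M. f x * g x) + t^2 * (LINT x|M. (g x)^2)"
  unfolding integral_sq_add[OF f sqint_cmult[OF g]]
  by (simp add: power_mult_distrib mult.left_commute[of _ t])
 finally show "0 <= (LINT x|M. (f x)^2) + 2 * t * (LINT x|M. f x * g x) + t^2 * (LINT x|M. (g x)^2)" .
qed simp

lemma Cauchy_Schwarz_integral:
 assumes f: "sqint M f" and g: "sqint M g"
 shows "\<bar>LINT x|M. f x * g x\<bar> <= sqrt (LINT x|M. (f x)^2) * sqrt (LINT x|M. (g x)^2)"
 using real_sqrt_le_mono[OF Cauchy_Schwarz_integral_sq[OF f g]] by (simp add: real_sqrt_mult)

lemma sq_convergence_AE_subseq: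
 fixes f :: "nat => 'a => real"
 assumes f: "!!n. sqint M (%x. f n x - g x)"
  and lim: "(%n. LINT x|M. (f n x - g x)^2) ~> 0"
 shows "\<exists>r. strict_mono (r :: nat => nat) \<and> (AE x in M. (%n. f (r n) x) ~> g x)"
proof -
 have "\<exists>r. strict_mono (r :: nat => nat) \<and> (AE x in M. (%n. (f (r n) x - g x)^2) ~> 0)"
  by (rule tendsto_L1_AE_subseq) (use f lim in auto)
 then obtain r where r: "strict_mono (r :: nat => nat)"
  and ae: "AE x in M. (%n. (f (r n) x - g x)^2) ~> 0" by auto
 have "AE x in M. (%n. f (r n) x) ~> g x"
  using ae
 proof eventually_elim
  case (elim x)
  then have "(%n. sqrt ((f (r n) x - g x)^2)) ~> sqrt 0" by (rule tendsto_real_sqrt)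
  then have "(%n. f (r n) x - g x) ~> 0" by (simp add: tendsto_rabs_zero_iff)
  then show ?case by (simp add: LIM_zero_iff)
 qed
 with r show ?thesis by blast
qed

section \<open>Weights with bounded p-th moments\<close>

lemma ennreal_powr_top [simp]: "ennreal_powr \<infinity> p = \<infinity>" "ennreal_powr top p = top"
 by (auto simp: ennreal_powr_def)

lemma ennreal_powr_ennreal: "0 <= t ==> ennreal_powr (ennreal t) p = ennreal (t powr p)"
 by (simp add: ennreal_powr_def)

lemma measurable_ennreal_powr [measurable]:
 assumes [measurable]: "f : borel_measurable M"
 shows "(%x. ennreal_powr (f x) p) : borel_measurable M"
 unfolding ennreal_powr_def by measurable

text \<open>Cut at height T. Below it w <= T; above it w = w^(1-p) w^p with w^(1-p) <= T^(1-p).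
  Given a p-th moment of the weight, the second term is small for large T whatever the weight
  is.\<close>

lemma weight_split:
 fixes w :: ennreal
 assumes "p > 1" "T > 0" "0 <= v" "v <= C"
 shows "ennreal v * w <= ennreal T * ennreal v + ennreal (C * T powr (1 - p)) * ennreal_powr w p"
proof (cases w)
 case (real t)
 show ?thesis
 proof (cases "t <= T")
  case True
  have "ennreal v * w <= ennreal T * ennreal v"
   using real True assms by (simp add: ennreal_mult[symmetric] mult.commute mult_right_mono ennreal_leI)
  then show ?thesis by (simp add: add_increasing2)
 next
  case False
  then have t: "T < t" by simp
  have "t = t powr (1 - p) * t powr p" using t assms by (simp flip: powr_add)
  also have "... <= T powr (1 - p) * t powr p"
   using t assms by (intro mult_right_mono powr_mono2') auto
  finally have "v * t <= C * (T powr (1 - p) * t powr p)"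
   using assms t by (intro mult_mono) auto
  then have "ennreal v * w <= ennreal (C * T powr (1 - p)) * ennreal_powr w p"
   using real assms t by (simp add: ennreal_powr_ennreal ennreal_mult[symmetric] ennreal_leI mult.assoc)
  then show ?thesis by (simp add: add_increasing)
 qed
next
 case top
 show ?thesis
 proof (cases "v = 0")
  case False
  then have "0 < C * T powr (1 - p)" using assms by auto
  then show ?thesis using top assms by (simp add: ennreal_mult_top zero_less_mult_iff)
 qed simp
qed

text \<open>Moment bounds make unbounded, varying weights equi-integrable, so L1 convergence of
  uniformly bounded functions is enough. This is how (iii) enters.\<close>

lemma weighted_tendsto_zero:
 fixes W :: "'i => 'a => ennreal" and v :: "'i => 'a => real"
 assumes p: "p > 1" and [measurable]: "A : sets M" "!!i. W i : borel_measurable M" "!!i. v i : borel_measurable M"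
  and bd: "!!i. AE x in M. \<bar>v i x\<bar> <= C"
  and S: "eventually (%i. (set_nn_integral M A (%x. ennreal_powr (W i x) p)) <= ennreal S) F"
  and lim: "((%i. set_nn_integral M A (%x. ennreal \<bar>v i x\<bar>)) \<longlongrightarrow> 0) F"
 shows "((%i. set_nn_integral M A (%x. ennreal \<bar>v i x\<bar> * W i x)) \<longlongrightarrow> 0) F"
proof (rule order_tendstoI)
 fix e' :: ennreal assume "0 < e'"
 then obtain e where e: "0 < e" "ennreal e <= e'"
  by (metis ennreal_less_zero_iff ennreal_zero_less_one less_le_not_le linear top_greatest
    ennreal_cases ennreal_1 order_less_imp_le)
 define C' where "C' = max C 0 + 1"
 define S' where "S' = max S 0 + 1"
 have C': "C' > 0" and S': "S' > 0" by (auto simp: C'_def S'_def)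
 \<comment> \<open>Solves C' T^(1-p) S' = e/3; the L1 norm then has to fall below e/(3T).\<close>
 define T where "T = (e / (3 * C' * S')) powr (1 / (1 - p))"
 have T: "T > 0" using e C' S' by (simp add: T_def)
 have Tp: "C' * T powr (1 - p) * S' = e / 3"
  using e C' S' p by (simp add: T_def powr_powr field_simps)
 have "eventually (%i. (set_nn_integral M A (%x. ennreal \<bar>v i x\<bar>)) < ennreal (e / (3 * T))) F"
  using order_tendstoD(2)[OF lim, of "ennreal (e / (3 * T))"] e T by simp
 with S show "eventually (%i. (set_nn_integral M A (%x. ennreal \<bar>v i x\<bar> * W i x)) < e') F"
 proof eventually_elim
  case (elim i)
  have "(set_nn_integral M A (%x. ennreal \<bar>v i x\<bar> * W i x))
   <= (nn_integral M (%x. ennreal T * (ennreal \<bar>v i x\<bar> * ind A x)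
      + ennreal (C' * T powr (1 - p)) * (ennreal_powr (W i x) p * ind A x)))"
  proof (rule nn_integral_mono_AE, use bd[of i] in eventually_elim)
   case (elim x)
   then have "\<bar>v i x\<bar> <= C'" by (simp add: C'_def)
   from weight_split[OF p T _ this, of "W i x"]
   show ?case
    by (cases "x : A") (auto simp: mult.assoc)
  qed
  also have "... = ennreal T * (set_nn_integral M A (%x. ennreal \<bar>v i x\<bar>))
     + ennreal (C' * T powr (1 - p)) * (set_nn_integral M A (%x. ennreal_powr (W i x) p))"
   by (simp add: nn_integral_add nn_integral_cmult)
  also have "... <= ennreal T * ennreal (e / (3 * T)) + ennreal (C' * T powr (1 - p)) * ennreal S'"
   using elim by (intro add_mono mult_left_mono) (auto simp: S'_def intro: order_trans ennreal_leI)
  also have "... = ennreal (e / 3 + e / 3)"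
   using e T C' S' Tp by (simp add: ennreal_mult[symmetric] ennreal_plus[symmetric] del: ennreal_plus)
  also have "... < ennreal e" using e by (simp add: ennreal_less_iff)
  finally show ?case using e by order
 qed
qed simp

text \<open>Compactness is available along null sequences in (0,1] only, so the full limit is
  recovered by the subsequence principle, from a violating sequence with e n <= 1/(n+1).\<close>

lemma tendsto_at_right_subseqI:
 fixes \<Phi> :: "real => 'b::topological_space"
 assumes "!!e. range e \<subseteq> {0<..1} ==> e ~> 0 ==>
   \<exists>s. strict_mono (s :: nat => nat) \<and> (%k. \<Phi> (e (s k))) ~> L"
 shows "(\<Phi> \<longlongrightarrow> L) at0"
proof (rule topological_tendstoI, rule ccontr)
 fix U assume U: "open U" "L : U" and no: "\<not> eventually (%x. \<Phi> x : U) at0"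
 have "\<exists>x. 0 < x \<and> x <= 1 / real (Suc n) \<and> \<Phi> x \<notin> U" for n
 proof (rule ccontr)
  assume *: "\<not> ?thesis"
  have "eventually (%x. x : {0<..<1 / real (Suc n)}) at0"
   by (rule eventually_at_right_real) simp
  then have "eventually (%x. \<Phi> x : U) at0"
   by eventually_elim (use * in auto)
  with no show False by blast
 qed
 then obtain e where e: "!!n. 0 < e n \<and> e n <= 1 / real (Suc n) \<and> \<Phi> (e n) \<notin> U" by metis
 have "e ~> 0"
  by (rule tendsto_sandwich[OF _ _ tendsto_const LIMSEQ_Suc[OF lim_1_over_n]])
    (use e in \<open>auto intro!: always_eventually less_imp_le\<close>)
 moreover have "e n <= 1" for n
  using e[of n] by (smt (verit) divide_le_eq_1 of_nat_0_le_iff of_nat_Suc)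
 then have "range e \<subseteq> {0<..1}" using e by auto
 ultimately obtain s where s: "strict_mono (s :: nat => nat)" "(%k. \<Phi> (e (s k))) ~> L"
  using assms by blast
 from topological_tendstoD[OF s(2) U] have "eventually (%k. \<Phi> (e (s k)) : U) sequentially" .
 then show False using e by (auto simp: eventually_sequentially)
qed

section \<open>Smooth functions with compact support\<close>

text \<open>Lets an explicit derivative stand in for the chosen \<open>frechet_derivative\<close>;
  uniqueness of derivatives identifies the two.\<close>

lemma C_k_SucI:
 assumes "!!x. (f has_derivative f' x) (at x)" "!!v. C_k k (%x. f' x v)"
 shows "C_k (Suc k) f"
proof -
 have "f' x = frechet_derivative f (at x)" for x
  using frechet_derivative_at[OF assms(1)] .
 then show ?thesis using assms by (auto simp: differentiable_def)
qed

lemma C_k_SucE: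
 assumes "C_k (Suc k) f"
 obtains f' where "!!x. (f has_derivative f' x) (at x)" "!!v. C_k k (%x. f' x v)"
 using assms frechet_derivative_works[of f] by (intro that[of "%x. frechet_derivative f (at x)"]) auto

lemma C_k_continuous: "C_k k f ==> continuous_on UNIV f"
 by (cases k) (auto simp: continuous_on_eq_continuous_at dest: differentiable_imp_continuous_within)

lemma C_k_measurable: "C_k k f ==> f : Borel"
 by (rule borel_measurable_continuous_onI[OF C_k_continuous])

lemma C_k_SucD: "C_k (Suc k) f ==> C_k k f"
proof (induction k arbitrary: f)
 case 0
 then show ?case using C_k_continuous[of "Suc 0"] by simp
next
 case (Suc k)
 from Suc.prems obtain f' where "!!x. (f has_derivative f' x) (at x)" "!!v. C_k (Suc k) (%x. f' x v)"
  by (rule C_k_SucE) blast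
 with Suc.IH show ?case by (intro C_k_SucI[of f f']) auto
qed

lemma C_k_const [simp]: "C_k k (%x. c)"
proof (induction k arbitrary: c)
 case (Suc k)
 show ?case by (rule C_k_SucI[of _ "%x v. 0"]) (use Suc in \<open>auto intro: has_derivative_const\<close>)
qed auto

lemma C_k_add:
 assumes "C_k k f" "C_k k g"
 shows "C_k k (%x. f x + g x)"
 using assms
proof (induction k arbitrary: f g)
 case 0
 then show ?case by (auto intro!: continuous_intros)
next
 case (Suc k)
 from Suc.prems obtain f' g' where "!!x. (f has_derivative f' x) (at x)" "!!v. C_k k (%x. f' x v)"
  "!!x. (g has_derivative g' x) (at x)" "!!v. C_k k (%x. g' x v)"
  by (metis C_k_SucE)
 then show ?case
  by (intro C_k_SucI[of _ "%x v. f' x v + g' x v"]) (auto intro: has_derivative_add Suc.IH)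
qed

lemma C_k_mult:
 assumes "C_k k f" "C_k k g"
 shows "C_k k (%x. f x * g x)"
 using assms
proof (induction k arbitrary: f g)
 case 0
 then show ?case by (auto intro!: continuous_intros)
next
 case (Suc k)
 from Suc.prems obtain f' g' where d: "!!x. (f has_derivative f' x) (at x)" "!!v. C_k k (%x. f' x v)"
  "!!x. (g has_derivative g' x) (at x)" "!!v. C_k k (%x. g' x v)"
  by (metis C_k_SucE)
 show ?case
  by (rule C_k_SucI[of _ "%x v. f x * g' x v + f' x v * g x"])
   (intro has_derivative_mult C_k_add Suc.IH d C_k_SucD[OF Suc.prems(1)] C_k_SucD[OF Suc.prems(2)])+
qed

lemma C_k_cmult: "C_k k f ==> C_k k (%x. c * f x)"
 by (rule C_k_mult) simp_all

lemma C_k_diff: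
 assumes "C_k k f" "C_k k g"
 shows "C_k k (%x. f x - g x)"
 using C_k_add[OF assms(1) C_k_cmult[OF assms(2), of "-1"]] by simp

lemma C_k_inner_left: "C_k k (%x. x \<bullet> v)"
proof (cases k)
 case (Suc k)
 show ?thesis unfolding Suc
  by (rule C_k_SucI[of _ "%x w. w \<bullet> v"]) (auto intro!: derivative_eq_intros)
qed (auto intro!: continuous_intros)

text \<open>In finite dimension a closed support is compact iff it is bounded. Vanishing outside a
  ball is the form used from here on.\<close>

lemma Cc_iff: "f : Cc k \<longleftrightarrow> C_k k f \<and> (\<exists>R. \<forall>x. norm x > R \<longrightarrow> f x = 0)"
proof -
 have "compact (closure (support_on UNIV f)) \<longleftrightarrow> (\<exists>R. \<forall>x. norm x > R \<longrightarrow> f x = 0)"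
  unfolding compact_closure bounded_iff support_on_def by (auto simp: not_less[symmetric])
 then show ?thesis by (simp add: Cc_def)
qed

lemma Cc_support:
 assumes "f : Cc k"
 obtains R where "R > 0" "!!x. norm x > R ==> f x = 0"
proof -
 from assms obtain R where "!!x. norm x > R ==> f x = 0" by (auto simp: Cc_iff)
 then show ?thesis by (intro that[of "max R 1"]) auto
qed

lemma Cc_measurable: "f : Cc k ==> f : Borel"
 by (auto simp: Cc_iff intro: C_k_measurable)

lemma Cc_bounded:
 assumes "f : Cc k"
 obtains B where "B >= 0" "!!x. \<bar>f x\<bar> <= B"
proof -
 obtain R where R: "R > 0" "!!x. norm x > R ==> f x = 0" using Cc_support[OF assms] by metis
 have "compact (f ` cball 0 R)"
  using assms by (intro compact_continuous_image)
   (auto simp: Cc_iff intro: continuous_on_subset[OF C_k_continuous])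
 then have "bounded (f ` cball 0 R)" by (rule compact_imp_bounded)
 then obtain B where B: "!!y. y : f ` cball 0 R ==> norm y <= B" unfolding bounded_iff by blast
 have "\<bar>f x\<bar> <= max B 0" for x
 proof (cases "norm x <= R")
  case True
  then have "f x : f ` cball 0 R" by simp
  from B[OF this] show ?thesis by simp
 qed (use R in auto)
 then show ?thesis by (intro that[of "max B 0"]) auto
qed

lemma Cc_add:
 assumes "f : Cc k" "g : Cc k"
 shows "(%x. f x + g x) : Cc k"
proof -
 obtain R S where "!!x. norm x > R ==> f x = 0" "!!x. norm x > S ==> g x = 0"
  using assms by (auto simp: Cc_iff)
 then show ?thesis using assms
  by (auto simp: Cc_iff C_k_add intro!: exI[of _ "max R S"])
qed

lemma Cc_cmult: "f : Cc k ==> (%x. c * f x) : Cc k"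
 by (auto simp: Cc_iff C_k_cmult)

lemma Cc_zero: "(%x. 0) : Cc k"
 by (auto simp: Cc_iff)

lemma Cc_inf_Cc: "f : Cc_inf ==> f : Cc k"
 by (auto simp: Cc_inf_def)

lemma bounded_Borel_integrable:
 fixes f :: "'a::euclidean_space => real"
 assumes "f : Borel" "!!x. norm x > R ==> f x = 0" "!!x. \<bar>f x\<bar> <= B"
 shows "integrable lborel f"
proof -
 have "integrable lborel (%x. B * ind (cball 0 R :: 'a set) x)"
  by (intro integrable_mult_right integrable_real_indicator emeasure_bounded_finite) auto
 then show ?thesis
 proof (rule bint_bound)
  show "AE x in lborel. norm (f x) <= norm (B * ind (cball 0 R :: 'a set) x)"
  proof (rule AE_I2, goal_cases)
   case (1 x)
   show ?case
    using assms(2)[of x] assms(3)[of x] by (cases "norm x <= R") auto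
  qed
 qed (use assms in auto)
qed

lemma Cc_integrable: "f : Cc k ==> integrable lborel f"
proof -
 assume f: "f : Cc k"
 obtain R where R: "!!x. norm x > R ==> f x = 0" using Cc_support[OF f] by metis
 obtain B where B: "!!x. \<bar>f x\<bar> <= B" using Cc_bounded[OF f] by metis
 show ?thesis by (rule bounded_Borel_integrable[OF Cc_measurable[OF f] R B])
qed

lemma Cc_derivative:
 assumes "f : Cc (Suc k)"
 obtains f' where "!!x. (f has_derivative f' x) (at x)" "!!v. (%x. f' x v) : Cc k"
proof -
 have "C_k (Suc k) f" using assms by (simp add: Cc_iff del: C_k.simps)
 then obtain f' where f': "!!x. (f has_derivative f' x) (at x)" "!!v. C_k k (%x. f' x v)"
  by (rule C_k_SucE) blast
 obtain R where R: "!!x. norm x > R ==> f x = 0" using Cc_support[OF assms] by metis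
 have "f' x v = 0" if "norm x > R" for x v
 proof -
  have "open {x::'a. norm x > R}" by (intro open_Collect_less) (auto intro: continuous_intros)
  then have "(f has_derivative (%_. 0)) (at x)"
  proof (rule has_derivative_transform_within_open[rotated])
   show "x : {x. norm x > R}" using that by simp
   show "((%_. 0) has_derivative (%_. 0)) (at x)" by (rule has_derivative_const)
   show "!!x. x : {x. R < norm x} ==> 0 = f x" using R by simp
  qed    then have "f' x = (%_. 0)" using f'(1)[of x] has_derivative_unique by blast
  then show ?thesis by (rule fun_cong)
 qed
 then have "(%x. f' x v) : Cc k" for v using f'(2)[of v] unfolding Cc_iff by blast
 with f'(1) show ?thesis by (rule that)
qed

text \<open>The finitely many partial derivatives along the basis are bounded, and linearity in v
  makes the bound uniform over all directions.\<close>

lemma Cc_derivative_bounded: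
 assumes f: "f : Cc (Suc k)" and f': "!!x. (f has_derivative f' x) (at x)"
 obtains B where "B >= 0" "!!x v. \<bar>f' x v\<bar> <= B * norm v"
proof -
 obtain f'' where f'': "!!x. (f has_derivative f'' x) (at x)" "!!v. (%x. f'' x v) : Cc k"
  using Cc_derivative[OF f] by metis
 have eq: "f'' = f'" using f' f''(1) has_derivative_unique by blast
 have "\<exists>B. B >= 0 \<and> (\<forall>x. \<bar>f' x i\<bar> <= B)" for i
  using Cc_bounded[OF f''(2)[of i]] unfolding eq by metis
 then obtain B where B: "!!i. B i >= 0" "!!i x. \<bar>f' x i\<bar> <= B i" by metis
 show ?thesis
 proof (rule that)
  fix x v
  interpret bounded_linear "f' x" using f' by (rule has_derivative_bounded_linear)
  have "f' x v = f' x (\<Sum>i\<in>Basis. (v \<bullet> i) *\<^sub>R i)" by (simp add: euclidean_representation)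
  also have "... = (\<Sum>i\<in>Basis. (v \<bullet> i) * f' x i)" by (simp add: sum scaleR)
  also have "\<bar>...\<bar> <= (\<Sum>i\<in>Basis. \<bar>(v \<bullet> i) * f' x i\<bar>)" by (rule sum_abs)
  also have "... <= (\<Sum>i\<in>Basis. norm v * B i)"
   using B by (intro sum_mono) (auto simp: abs_mult Basis_le_norm intro!: mult_mono)
  finally show "\<bar>f' x v\<bar> <= (\<Sum>i\<in>Basis. B i) * norm v" by (simp add: sum_distrib_left mult.commute)
 qed (use B in \<open>auto intro: sum_nonneg\<close>)
qed

lemma Cc_Lipschitz:
 fixes f :: "'a::euclidean_space => real"
 assumes f: "f : Cc (Suc k)"
 obtains B where "B >= 0" "!!x y. \<bar>f x - f y\<bar> <= B * norm (x - y)"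
proof -
 obtain f' where f': "!!x. (f has_derivative f' x) (at x)" using Cc_derivative[OF f] by metis
 obtain B where B: "B >= 0" "!!x v. \<bar>f' x v\<bar> <= B * norm v" using Cc_derivative_bounded[OF f f'] by metis
 show ?thesis
 proof (rule that[OF B(1)])
  fix x y
  have "norm (f x - f y) <= B * norm (x - y)"
   using f' B by (intro differentiable_bound[of UNIV f f']) (auto intro!: onorm_le)
  then show "\<bar>f x - f y\<bar> <= B * norm (x - y)" by simp
 qed
qed

text \<open>The functions \<open>t \<mapsto> t\<^sup>-\<^sup>n exp (-1/t)\<close>, extended by zero, span a space closed under
 differentiation.\<close>

definition flat :: "nat => real => real" where
 "flat n t = (if t > 0 then inverse t ^ n * exp (- inverse t) else 0)"

lemma flat_nonneg: "flat n t >= 0" by (simp add: flat_def)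

lemma flat_derivative: "(flat n has_real_derivative flat (n + 2) t - real n * flat (n + 1) t) (at t)"
proof (cases t "0 :: real" rule: linorder_cases)
 case less
 have "((%_. 0) has_real_derivative 0) (at t)" by simp
 then have "(flat n has_real_derivative 0) (at t)"
 proof (rule has_field_derivative_transform_within[where d="-t"])
  fix x assume "dist x t < - t"
  then have "x - t < - t" unfolding dist_real_def by linarith
  then have "x <= 0" by linarith
  then show "0 = flat n x" by (simp add: flat_def)
 qed (use less in auto)
 then show ?thesis using less by (simp add: flat_def)
next
 case greater
 have "((%t. inverse t ^ n * exp (- inverse t)) has_real_derivative
   inverse t ^ n * (exp (- inverse t) * (inverse t)^2) - real n * inverse t ^ (n - 1) * (inverse t)^2 * exp (- inverse t)) (at t)"
  apply (rule derivative_eq_intros refl | use greater in simp; fail)+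
  using greater apply (simp add: power2_eq_square algebra_simps)
  done
 moreover have "inverse t ^ n * (exp (- inverse t) * (inverse t)^2) - real n * inverse t ^ (n - 1) * (inverse t)^2 * exp (- inverse t)
   = flat (n + 2) t - real n * flat (n + 1) t"
  using greater by (cases n) (auto simp: flat_def power2_eq_square)
 ultimately have "((%t. inverse t ^ n * exp (- inverse t)) has_real_derivative
   flat (n + 2) t - real n * flat (n + 1) t) (at t)" by simp
 then show ?thesis
 proof (rule has_field_derivative_transform_within[where d=t])
  fix x assume "dist x t < t"
  then have "t - x < t" unfolding dist_real_def by linarith
  then have "x > 0" by linarith
  then show "inverse x ^ n * exp (- inverse x) = flat n x" by (simp add: flat_def)
 qed (use greater in auto)
next
 case equal
 \<comment> \<open>Substituting h = 1/x turns the right difference quotient into x^(n+1) / exp x; on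
   the left it is identically 0.\<close>
 have "((%h. flat n h / h) \<longlongrightarrow> 0) at0"
 proof -
  have "((%x. x ^ Suc n / exp x) \<longlongrightarrow> (0::real)) at_top" by (rule tendsto_power_div_exp_0)
  moreover have "eventually (%x. x ^ Suc n / exp x = flat n (inverse x) / inverse x) at_top"
   using eventually_gt_at_top[of "0::real"] by eventually_elim (simp add: flat_def exp_minus field_simps)
  ultimately have "((%x. flat n (inverse x) / inverse x) \<longlongrightarrow> 0) at_top"
   by (rule Lim_transform_eventually)
  then show ?thesis by (simp add: filterlim_at_right_to_top)
 qed
 moreover have "((%h. flat n h / h) \<longlongrightarrow> 0) (at_left 0)"
 proof (rule Lim_transform_eventually)
  show "eventually (%h. 0 = flat n h / h) (at_left 0)"
   unfolding eventually_at_filter by (auto simp: flat_def)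
 qed simp
 ultimately have "((%h. flat n h / h) \<longlongrightarrow> 0) (at 0)" by (simp add: filterlim_split_at)
 then have "(flat n has_real_derivative 0) (at 0)" by (simp add: DERIV_def flat_def)
 then show ?thesis using equal by (simp add: flat_def)
qed

text \<open>The index n has to vary in the induction because differentiation raises it; the inner
  derivative -2 (x . v) only contributes a smooth factor.\<close>

lemma C_k_flat_radial: "C_k k (%x::'a::euclidean_space. flat n (r - x \<bullet> x))"
proof (induction k arbitrary: n)
 case 0
 have "continuous_on UNIV (flat n)"
  using flat_derivative by (intro DERIV_continuous_on) (auto intro: has_field_derivative_at_within)
 then show ?case by (auto intro!: continuous_intros continuous_on_compose2[of UNIV "flat n"])
next
 case (Suc k)
 show ?case
 proof (rule C_k_SucI)
  fix x :: 'a
  show "((%x. flat n (r - x \<bullet> x)) has_derivative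
   (%v. (flat (n + 2) (r - x \<bullet> x) - real n * flat (n + 1) (r - x \<bullet> x)) * (- 2 * (x \<bullet> v)))) (at x)"
   by (rule has_derivative_eq_rhs[OF has_derivative_compose[OF _ flat_derivative[unfolded has_field_derivative_def],
     of "%x. r - x \<bullet> x" "%v. - 2 * (x \<bullet> v)"]])
    (auto intro!: derivative_eq_intros simp: inner_commute fun_eq_iff)
 next
  fix v :: 'a
  have "C_k k (%x. x \<bullet> v)" by (rule C_k_inner_left)
  then show "C_k k (%x. (flat (n + 2) (r - x \<bullet> x) - real n * flat (n + 1) (r - x \<bullet> x)) * (- 2 * (x \<bullet> v)))"
   by (intro C_k_mult C_k_diff C_k_cmult Suc C_k_const)
 qed
qed

text \<open>The radial function flat 0 (d^2 - |x|^2), normalised. Its integral is positive because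
  it is positive on the open ball.\<close>

lemma mollifier_exists:
 fixes d :: real
 assumes "d > 0"
 obtains rh :: "'a::euclidean_space => real"
 where "rh : Cc_inf" "!!x. rh x >= 0" "!!x. norm x >= d ==> rh x = 0" "(LBINT x. rh x) = 1"
proof -
 define b :: "'a => real" where "b = (%x. flat 0 (d^2 - x \<bullet> x))"
 have b0: "b x = 0" if "norm x >= d" for x
 proof -
  have "d^2 <= (norm x)^2" using that assms by (intro power_mono) auto
  then show ?thesis by (simp add: b_def flat_def power2_norm_eq_inner)
 qed
 have bC: "b : Cc k" for k
  unfolding Cc_iff using b0 C_k_flat_radial[of k 0 "d^2"] by (auto simp: b_def intro!: exI[of _ d])
 have nn: "b x >= 0" for x by (simp add: b_def flat_nonneg)
 have int: "integrable lborel b" by (rule Cc_integrable[OF bC])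
 have "(LBINT x. b x) \<noteq> 0"
 proof
  assume "(LBINT x. b x) = 0"
  then have ae: "AE x in lborel. b x = 0"
   using integral_nonneg_eq_0_iff_AE[OF int] nn by auto
  have nz: "b x \<noteq> 0" if "x : ball (0::'a) d" for x
  proof -
   have "x \<bullet> x < d^2" using that by (simp add: power2_norm_eq_inner[symmetric] power_strict_mono)
   then show ?thesis by (simp add: b_def flat_def)
  qed
  from ae have "AE x in lborel. x \<notin> ball (0::'a) d" by eventually_elim (use nz in blast)
  then have "emeasure lborel (ball (0::'a) d) = 0"
   by (subst (asm) AE_iff_measurable[of "ball 0 d"]) auto
  then show False using content_ball_pos[OF assms, of "0::'a"] by (simp add: measure_def)
 qed
 moreover have "(LBINT x. b x) >= 0" using nn by simp
 ultimately have pos: "(LBINT x. b x) > 0" by simp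
 show ?thesis
 proof (rule that)
  show "(%x. inverse (LBINT x. b x) * b x) : Cc_inf"
   using Cc_cmult[OF bC] by (auto simp: Cc_inf_def)
 qed (use pos nn b0 in auto)
qed

section \<open>Convolution with a smooth function\<close>

definition conv :: "('a::euclidean_space => real) => ('a => real) => 'a => real" where
 "conv u rh x = (LBINT y. u y * rh (x - y))"

lemma conv_integrable:
 fixes u :: "'a::euclidean_space => real"
 assumes u: "integrable lborel u" and [measurable]: "rh : Borel" and B: "!!x. \<bar>rh x\<bar> <= B"
 shows "integrable lborel (%y. u y * rh (x - y))"
proof -
 have [measurable]: "u : Borel" using u by auto
 have "integrable lborel (%y. B * u y)" using u by simp
 then show ?thesis
 proof (rule bint_bound)
  have "B >= 0" using B[of 0] by simp
  then show "AE y in lborel. norm (u y * rh (x - y)) <= norm (B * u y)"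
   using B by (intro AE_I2) (simp add: abs_mult mult.commute[of B] mult_left_mono)
 qed simp
qed

lemma conv_continuous:
 fixes u :: "'a::euclidean_space => real"
 assumes u: "integrable lborel u" and rh: "continuous_on UNIV rh" and B: "!!x. \<bar>rh x\<bar> <= B"
 shows "continuous_on UNIV (conv u rh)"
proof (rule continuous_at_imp_continuous_on, rule ballI, unfold continuous_at_sequentially, intro allI impI)
 fix x :: 'a and X :: "nat => 'a" assume X: "X ~> x"
 have [measurable]: "rh : Borel" using rh by (rule borel_measurable_continuous_onI)
 have [measurable]: "u : Borel" using u by auto
 have "B >= 0" using B[of 0] by simp
 show "(conv u rh \<circ> X) ~> conv u rh x"
  unfolding conv_def o_def
 proof (rule integral_dominated_convergence[where w="%y. B * \<bar>u y\<bar>"])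
  show "AE y in lborel. (%n. u y * rh (X n - y)) ~> u y * rh (x - y)"
   using X rh by (intro AE_I2 tendsto_intros continuous_on_tendsto_compose[OF rh]) auto
  show "AE y in lborel. norm (u y * rh (X n - y)) <= B * \<bar>u y\<bar>" for n
   using B \<open>B >= 0\<close> by (intro AE_I2) (simp add: abs_mult mult.commute[of B] mult_left_mono)
 qed (use u in auto)
qed

text \<open>The derivative falls on \<open>rh\<close>, so u need only be integrable.
  Differentiability is a dominated convergence: by the Lipschitz bound the linearisation error of
  \<open>rh\<close> relative to the step is at most 2 B.\<close>

lemma conv_derivative:
 fixes u :: "'a::euclidean_space => real"
 assumes u: "integrable lborel u" and rh: "rh : Cc (Suc k)"
  and rh': "!!x. (rh has_derivative rh' x) (at x)" and rh'_Cc: "!!v. (%x. rh' x v) : Cc k"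
 shows "(conv u rh has_derivative (%v. conv u (%z. rh' z v) x)) (at x)"
proof -
 obtain B where B: "B >= 0" "!!x v. \<bar>rh' x v\<bar> <= B * norm v" using Cc_derivative_bounded[OF rh rh'] by metis
 have Lip: "\<bar>rh a - rh b\<bar> <= B * norm (a - b)" for a b
 proof -
  have "norm (rh a - rh b) <= B * norm (a - b)"
   using rh' B by (intro differentiable_bound[of UNIV rh rh']) (auto intro!: onorm_le)
  then show ?thesis by simp
 qed
 have [measurable]: "u : Borel" "rh : Borel" "(%x. rh' x v) : Borel" for v
  using u Cc_measurable[OF rh] Cc_measurable[OF rh'_Cc] by auto
 obtain B0 where B0: "!!x. \<bar>rh x\<bar> <= B0" using Cc_bounded[OF rh] by metis
 have i0: "integrable lborel (%y. u y * rh (z - y))" for z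
  by (rule conv_integrable[OF u _ B0]) simp
 have i1: "integrable lborel (%y. u y * rh' (x - y) v)" for v
  by (rule conv_integrable[OF u _ B(2)]) simp
 have lin: "bounded_linear (rh' z)" for z using rh' by (rule has_derivative_bounded_linear)
 have "linear (%v. conv u (%z. rh' z v) x)"
 proof (rule linearI)
  fix a b :: 'a and c :: real
  have add: "rh' z (a + b) = rh' z a + rh' z b" "rh' z (c *\<^sub>R a) = c * rh' z a" for z
   using linear_add[OF bounded_linear.linear[OF lin]] linear_scale[OF bounded_linear.linear[OF lin]] by auto
  show "conv u (%z. rh' z (a + b)) x = conv u (%z. rh' z a) x + conv u (%z. rh' z b) x"
   unfolding conv_def add using i1 by (simp add: distrib_left)
  show "conv u (%z. rh' z (c *\<^sub>R a)) x = c *\<^sub>R conv u (%z. rh' z a) x"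
   unfolding conv_def add by (simp add: mult.left_commute)
 qed
 then have bl: "bounded_linear (%v. conv u (%z. rh' z v) x)"
  by (simp add: linear_conv_bounded_linear)
 define q where "q h y = (rh (x + h - y) - rh (x - y) - rh' (x - y) h) / norm h" for h y
 have quot: "norm (conv u rh (x + h) - conv u rh x - conv u (%z. rh' z h) x) / norm h
   = \<bar>LBINT y. u y * q h y\<bar>" for h
 proof -
  have "conv u rh (x + h) - conv u rh x - conv u (%z. rh' z h) x
    = (LBINT y. u y * rh (x + h - y) - u y * rh (x - y) - u y * rh' (x - y) h)"
   unfolding conv_def using i0 i1 by simp
  moreover have "u y * q h y = (u y * rh (x + h - y) - u y * rh (x - y) - u y * rh' (x - y) h) / norm h" for y
   by (simp add: q_def right_diff_distrib)
  ultimately show ?thesis by (simp add: abs_divide)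
 qed
 have "(%h. \<bar>LBINT y. u y * q h y\<bar>) \<midarrow>0\<rightarrow> 0"
  unfolding tendsto_at_iff_sequentially
 proof (intro allI impI)
  fix X :: "nat => 'a" assume X0: "\<forall>i. X i : UNIV - {0}" and X: "X ~> 0"
  have "(%n. LBINT y. u y * q (X n) y) ~> integral\<^sup>L lborel (%_::'a. 0)"
  proof (rule integral_dominated_convergence[where w="%y. \<bar>u y\<bar> * (2 * B)"])
   show "AE y in lborel. (%n. u y * q (X n) y) ~> 0"
   proof (rule AE_I2)
    fix y
    have "(%h. norm (rh (x - y + h) - rh (x - y) - rh' (x - y) h) / norm h) \<midarrow>0\<rightarrow> 0"
     using rh'[of "x - y"] by (simp add: has_derivative_at)
    then have "((%h. norm (rh (x - y + h) - rh (x - y) - rh' (x - y) h) / norm h) \<circ> X) ~> 0"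
     using X0 X unfolding tendsto_at_iff_sequentially by blast
    then have "(%n. \<bar>q (X n) y\<bar>) ~> 0"
     by (simp add: q_def o_def algebra_simps abs_divide)
    then have "(%n. q (X n) y) ~> 0" by (simp add: tendsto_rabs_zero_iff)
    then show "(%n. u y * q (X n) y) ~> 0" by (rule tendsto_mult_right_zero)
   qed
   show "AE y in lborel. norm (u y * q (X n) y) <= \<bar>u y\<bar> * (2 * B)" for n
   proof (rule AE_I2, goal_cases)
    case (1 y)
    have nz: "norm (X n) > 0" using X0 by auto
    have "\<bar>rh (x + X n - y) - rh (x - y) - rh' (x - y) (X n)\<bar> <= 2 * B * norm (X n)"
     using Lip[of "x + X n - y" "x - y"] B(2)[of "x - y" "X n"] by simp
    then have "\<bar>q (X n) y\<bar> <= 2 * B" using nz by (simp add: q_def abs_divide divide_le_eq)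
    then show ?case by (auto simp: abs_mult intro: mult_left_mono)
   qed
   show "(%y. u y * q (X n) y) : borel_measurable lborel" for n
    unfolding q_def by measurable
  qed (use u in auto)
  then have "(%n. \<bar>LBINT y. u y * q (X n) y\<bar>) ~> 0" by (simp add: tendsto_rabs_zero)
  then show "((%h. \<bar>LBINT y. u y * q h y\<bar>) \<circ> X) ~> 0" by (simp add: o_def)
 qed
 then show ?thesis unfolding has_derivative_at using bl by (simp add: quot[unfolded real_norm_def])
qed

lemma C_k_conv:
 assumes u: "integrable lborel u" and rh: "rh : Cc k"
 shows "C_k k (conv u rh)"
 using rh
proof (induction k arbitrary: rh)
 case 0
 obtain B where "!!x. \<bar>rh x\<bar> <= B" using Cc_bounded[OF 0] by metis
 with u 0 show ?case by (auto simp: Cc_iff intro: conv_continuous)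
next
 case (Suc k)
 obtain rh' where rh': "!!x. (rh has_derivative rh' x) (at x)" "!!v. (%x. rh' x v) : Cc k"
  using Cc_derivative[OF Suc.prems] by metis
 show ?case by (rule C_k_SucI[OF conv_derivative[OF u Suc.prems rh'] Suc.IH[OF rh'(2)]])
qed

lemma conv_Cc_inf:
 assumes u: "integrable lborel u" "!!x. norm x > R ==> u x = 0" and rh: "rh : Cc_inf"
 shows "conv u rh : Cc_inf"
proof -
 obtain S where S: "!!x. norm x > S ==> rh x = 0" using Cc_support[OF Cc_inf_Cc[OF rh, of 0]] by metis
 have "conv u rh x = 0" if "norm x > R + S" for x
 proof -
  have "u y * rh (x - y) = 0" for y
  proof (cases "norm y > R")
   case False
   then have "norm (x - y) > S" using that norm_triangle_sub[of x y] by linarith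
   then show ?thesis using S by simp
  qed (simp add: u)
  then have "(%y. u y * rh (x - y)) = (%y. 0)" by (rule ext)
  then show ?thesis unfolding conv_def by simp
 qed
 then show ?thesis
  using C_k_conv[OF u(1) Cc_inf_Cc[OF rh]] by (auto simp: Cc_inf_def Cc_iff)
qed

section \<open>Jump forms and their resolvents\<close>

definition inc :: "('a => real) => 'a \<times> 'a => real" where
 "inc f p = f (fst p) - f (snd p)"

text \<open>The factor 1/2 and the removal of the diagonal go into the density. The form becomes the
  inner product of increments in L2 of this measure, and the facts about \<open>sqint\<close> apply
  to it.\<close>

definition jump_measure :: "('a::euclidean_space => 'a => real) => ('a \<times> 'a) measure" where
 "jump_measure J = density lborel2 (%p. ennreal (ind (- Id) p * J (fst p) (snd p) / 2))"

definition jump_kernel :: "('a::euclidean_space => 'a => real) => bool" where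
 "jump_kernel J \<longleftrightarrow> (%p. J (fst p) (snd p)) : Borel2 \<and> (\<forall>x y. 0 <= J x y)"

lemma jump_kernelD:
 assumes "jump_kernel J"
 shows "(%p. J (fst p) (snd p)) : Borel2" "0 <= J x y"
 using assms by (auto simp: jump_kernel_def)

lemma sets_lborel_pair [measurable_cong]:
 "sets ((lborel :: 'a::euclidean_space measure) \<Otimes>\<^sub>M (lborel :: 'b::euclidean_space measure)) = sets borel2"
 by (intro sets_pair_measure_cong) simp_all

lemma sets_jump_measure [measurable_cong]: "sets (jump_measure J) = sets borel2"
 by (simp add: jump_measure_def sets_lborel_pair)

lemma off_diagonal_measurable [measurable]:
 "- Id : sets ((borel :: 'a::euclidean_space measure) \<Otimes>\<^sub>M borel)"
proof -
 have "- (Id :: ('a \<times> 'a) set) = - {y. \<exists>x. y = (x, x)}" by auto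
 then have "open (- (Id :: ('a \<times> 'a) set))" using closed_diagonal[where 'a='a] by (simp add: open_closed)
 then show ?thesis unfolding borel_prod by (rule borel_open)
qed

lemma measurable_increment [measurable]:
 assumes [measurable]: "f : Borel"
 shows "inc f : Borel2"
 unfolding inc_def by measurable

lemma jump_energy_eq:
 assumes J: "jump_kernel J" and [measurable]: "f : Borel"
 shows "jump_energy J f = (nn_integral (jump_measure J) (%p. ennreal ((inc f p)^2)))"
proof -
 have [measurable]: "(%p. J (fst p) (snd p)) : Borel2" using J by (rule jump_kernelD)
 have "(nn_integral (jump_measure J) (%p. ennreal ((inc f p)^2)))
   = (nn_integral lborel2 (%p. ennreal (ind (- Id) p * J (fst p) (snd p) / 2) * ennreal ((inc f p)^2)))"
  unfolding jump_measure_def by (rule nn_integral_density) measurable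
 also have "... = (nn_integral lborel2 (%p. ennreal (1 / 2) * (ennreal ((f (fst p) - f (snd p))^2 * J (fst p) (snd p)) * ind (- Id) p)))"
 proof (rule nn_integral_cong, goal_cases)
  case (1 p)
  show ?case
   using jump_kernelD(2)[OF J]
   by (cases "p : Id") (auto simp: inc_def ennreal_mult'[symmetric] mult.commute simp del: ennreal_half)
 qed
 also have "... = ennreal (1 / 2) * (nn_integral lborel2 (%p. ennreal ((f (fst p) - f (snd p))^2 * J (fst p) (snd p)) * ind (- Id) p))"
  by (rule nn_integral_cmult) measurable
 finally show ?thesis by (simp add: jump_energy_def case_prod_unfold)
qed

lemma jump_form_eq:
 assumes J: "jump_kernel J" and [measurable]: "f : Borel" "g : Borel"
 shows "jump_form J f g = (LINT p|jump_measure J. inc f p * inc g p)"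
proof -
 have [measurable]: "(%p. J (fst p) (snd p)) : Borel2" using J by (rule jump_kernelD)
 have "(LINT p|jump_measure J. inc f p * inc g p)
   = (LINT p|lborel2. (ind (- Id) p * J (fst p) (snd p) / 2) *\<^sub>R (inc f p * inc g p))"
  unfolding jump_measure_def
 proof (rule integral_density)
  show "AE p in lborel \<Otimes>\<^sub>M lborel. 0 <= ind (- Id) p * J (fst p) (snd p) / 2"
   using jump_kernelD(2)[OF J] by (auto simp: indicator_def)
 qed measurable
 also have "... = (LINT p|lborel2. (1 / 2) * (ind (- Id) p *\<^sub>R (((f (fst p) - f (snd p)) * (g (fst p) - g (snd p)) * J (fst p) (snd p)))))"
  by (intro bint_cong) (auto simp: inc_def)
 also have "... = jump_form J f g"
  unfolding jump_form_def set_lebesgue_integral_def by (simp add: case_prod_unfold)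
 finally show ?thesis by simp
qed

lemma AE_fst_snd_lborel:
 assumes "AE x in (lborel :: 'a::euclidean_space measure). P x"
 shows "AE p in lborel \<Otimes>\<^sub>M lborel. P (fst p) \<and> P (snd p)"
proof -
 from assms obtain N where N: "{x. \<not> P x} \<subseteq> N" "N : null_sets lborel"
  by (auto elim!: AE_E3 simp: eventually_ae_filter)
 have "N \<times> UNIV : null_sets (lborel \<Otimes>\<^sub>M (lborel :: 'a measure))" "UNIV \<times> N : null_sets ((lborel :: 'a measure) \<Otimes>\<^sub>M lborel)"
  by (rule lborel.times_in_null_sets1[OF N(2)], simp) (rule lborel.times_in_null_sets2[OF _ N(2)], simp)
 then have "N \<times> UNIV \<union> UNIV \<times> N : null_sets lborel2" by auto
 then show ?thesis by (rule AE_I') (use N(1) in auto)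
qed

text \<open>The jump measure is absolutely continuous with respect to Lebesgue measure on pairs, so
  changing a function on a null set does not change its energy.\<close>

lemma AE_jump_measure:
 assumes J: "jump_kernel J" and "AE x in lborel. P x"
 shows "AE p in jump_measure J. P (fst p) \<and> P (snd p)"
proof -
 have [measurable]: "(%p. J (fst p) (snd p)) : Borel2" using J by (rule jump_kernelD)
 have "(%p. ennreal (ind (- Id) p * J (fst p) (snd p) / 2)) : borel_measurable lborel2"
  by measurable
 from AE_density[OF this] show ?thesis
  using AE_fst_snd_lborel[OF assms(2)] unfolding jump_measure_def by auto
qed

lemma fatou_sq:
 fixes f :: "nat => 'a => real"
 assumes [measurable]: "!!n. f n : borel_measurable M" "g : borel_measurable M" "h : borel_measurable M"
  and lim: "AE x in M. (%n. f n x) ~> g x"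
  and le: "eventually (%n. (nn_integral M (%x. ennreal ((h x - f n x)^2))) <= c) sequentially"
 shows "(nn_integral M (%x. ennreal ((h x - g x)^2))) <= c"
proof -
 have "(nn_integral M (%x. ennreal ((h x - g x)^2))) = (nn_integral M (%x. liminf (%n. ennreal ((h x - f n x)^2))))"
 proof (rule nn_integral_cong_AE, use lim in eventually_elim)
  case (elim x)
  then have "(%n. ennreal ((h x - f n x)^2)) ~> ennreal ((h x - g x)^2)"
   by (intro tendsto_intros tendsto_ennrealI)
  then show ?case
   by (intro lim_imp_Liminf[symmetric]) simp_all
 qed
 also have "... <= liminf (%n. nn_integral M (%x. ennreal ((h x - f n x)^2)))"
  by (rule nn_integral_liminf) measurable
 also have "... <= c" by (rule Liminf_le[OF sequentially_bot le])
 finally show ?thesis .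
qed

text \<open>Dominated convergence with majorants f n that move but converge in L2. It is applied to
  contractions of a sequence that converges in form norm.\<close>

lemma dominated_sq_convergence:
 fixes f h :: "nat => 'a => real"
 assumes f: "!!n. sqint M (f n)" and g: "sqint M g"
  and lim: "(%n. LINT x|M. (f n x - g x)^2) ~> 0"
  and [measurable]: "!!n. h n : borel_measurable M" "k : borel_measurable M"
  and h: "!!n x. \<bar>h n x\<bar> <= \<bar>f n x\<bar>" and k: "!!x. \<bar>k x\<bar> <= \<bar>g x\<bar>"
  and ae: "AE x in M. (%n. h n x) ~> k x"
 shows "(%n. LINT x|M. (h n x - k x)^2) ~> 0"
proof -
 have [measurable]: "!!n. f n : borel_measurable M" "g : borel_measurable M" using f g by auto
 have fg: "sqint M (%x. f n x - g x)" for n using f g by (rule sqint_diff)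
 have hi: "sqint M (h n)" for n by (rule sqint_bound[OF f]) (use h in auto)
 have ki: "sqint M k" by (rule sqint_bound[OF g]) (use k in auto)
 have hk: "sqint M (%x. h n x - k x)" for n using hi ki by (rule sqint_diff)
 have fgi: "integrable M (%x. (f n x - g x)^2)" for n using fg by (rule sqintD)
 have hki: "integrable M (%x. (h n x - k x)^2)" for n using hk by (rule sqintD)
 have gi: "integrable M (%x. (g x)^2)" using g by (rule sqintD)
 \<comment> \<open>The part of (h - k)^2 not paid for by 4 (f - g)^2. It has the fixed majorant 6
   g^2, since (s + 2 t)^2 <= 4 s^2 + 6 t^2.\<close>
 define b where "b n x = max 0 ((h n x - k x)^2 - 4 * (f n x - g x)^2)" for n x
 have [measurable]: "b n : borel_measurable M" for n unfolding b_def by measurable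
 have pt: "(h n x - k x)^2 <= 4 * (f n x - g x)^2 + 6 * (g x)^2" for n x
 proof -
  have "\<bar>h n x - k x\<bar> <= \<bar>f n x - g x\<bar> + 2 * \<bar>g x\<bar>" using h[of n x] k[of x] by linarith
  then have "(h n x - k x)^2 <= (\<bar>f n x - g x\<bar> + 2 * \<bar>g x\<bar>)^2" using abs_le_square_iff by fastforce
  also have "... <= 4 * (f n x - g x)^2 + 6 * (g x)^2"
  proof -
   have "(a + 2 * b)^2 <= 4 * a^2 + 6 * b^2" for a b :: real
   proof -
    have "0 <= 2 * (a - b)^2 + a^2" by simp
    then show ?thesis by (simp add: power2_eq_square algebra_simps)
   qed
   from this[of "\<bar>f n x - g x\<bar>" "\<bar>g x\<bar>"] show ?thesis by simp
  qed
  finally show ?thesis .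
 qed
 have b6: "\<bar>b n x\<bar> <= 6 * (g x)^2" for n x using pt[of n x] by (simp add: b_def)
 have bi: "integrable M (b n)" for n
  by (rule bint_bound[of _ "%x. 6 * (g x)^2"]) (use b6 gi in auto)
 have "(%n. LINT x|M. b n x) ~> (LINT x|M. 0)"
 proof (rule integral_dominated_convergence[where w="%x. 6 * (g x)^2"])
  show "AE x in M. (%n. b n x) ~> 0"
   using ae
  proof eventually_elim
   case (elim x)
   then have "(%n. (h n x - k x)^2) ~> (k x - k x)^2" by (intro tendsto_intros)
   then have z: "(%n. (h n x - k x)^2) ~> 0" by simp
   show ?case
    by (rule tendsto_sandwich[OF _ _ tendsto_const z]) (auto simp: b_def)
  qed
 qed (use b6 gi in auto)
 then have b0: "(%n. (LINT x|M. b n x) + 4 * (LINT x|M. (f n x - g x)^2)) ~> 0 + 4 * 0"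
  using lim by (intro tendsto_intros) simp
 have "(LINT x|M. (h n x - k x)^2) <= (LINT x|M. b n x) + 4 * (LINT x|M. (f n x - g x)^2)" for n
 proof -
  have "(LINT x|M. (h n x - k x)^2) <= (LINT x|M. b n x + 4 * (f n x - g x)^2)"
   using bi fgi hki by (intro integral_mono) (auto simp: b_def)
  also have "... = (LINT x|M. b n x) + 4 * (LINT x|M. (f n x - g x)^2)" using bi fgi by simp
  finally show ?thesis .
 qed
 then show ?thesis
  by (intro tendsto_sandwich[OF _ _ tendsto_const b0[simplified]]) auto
qed

text \<open>Serves the random forms and the limit form alike. Equal null sets let almost everywhere
  convergence for m pass to increments under the jump measure.\<close>

locale jump_space =
 fixes m :: "'a::euclidean_space measure" and J :: "'a => 'a => real"
 assumes sets_m [measurable_cong]: "sets m = sets borel"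
  and kernel: "jump_kernel J"
  and AE_m_iff: "!!P. (AE x in m. P x) \<longleftrightarrow> (AE x in lborel. P x)"
begin

lemma measurable_m: "borel_measurable m = Borel"
 by (rule measurable_cong_sets) (simp_all add: sets_m)

lemma measurable_jm: "borel_measurable (jump_measure J) = Borel2"
 by (rule measurable_cong_sets) (simp_all add: sets_jump_measure)

text \<open>The algebra of the form is developed on all functions of finite energy;
  \<open>dom\<close> below is the closure of C^1_c in this space and may be smaller.\<close>

definition fin :: "('a => real) => bool" where
 "fin f \<longleftrightarrow> f : Borel \<and> sqint (jump_measure J) (inc f) \<and> sqint m f"

definition Q :: "real => ('a => real) => ('a => real) => real" where
 "Q l f g = jump_form J f g + l * (LINT x|m. f x * g x)"

abbreviation (input) QQ :: "real => ('a => real) => real" where "QQ l f == Q l f f"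

lemma finD:
 assumes "fin f"
 shows "f : Borel" "sqint (jump_measure J) (inc f)" "sqint m f"
 using assms by (auto simp: fin_def)

lemma fin_lincomb:
 assumes f: "fin f" and g: "fin g"
 shows "fin (%x. f x + c * g x)"
proof -
 have "inc (%x. f x + c * g x) = (%p. inc f p + c * inc g p)"
  by (auto simp: inc_def algebra_simps)
 then show ?thesis using f g
  by (auto simp: fin_def intro!: sqint_add sqint_cmult)
qed

lemma fin_diff: "fin f ==> fin g ==> fin (%x. f x - g x)"
 using fin_lincomb[of f g "-1"] by simp

lemma fin_add: "fin f ==> fin g ==> fin (%x. f x + g x)"
 using fin_lincomb[of f g 1] by simp

lemma fin_zero: "fin (%x. 0)"
 by (auto simp: fin_def sqint_def inc_def)

lemma fin_cmult: "fin f ==> fin (%x. c * f x)"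
 using fin_lincomb[OF fin_zero, of f c] by simp

lemma fin_bound:
 assumes f: "fin f" and [measurable]: "g : Borel"
  and "!!x. \<bar>g x\<bar> <= \<bar>f x\<bar>" "!!p. \<bar>inc g p\<bar> <= \<bar>inc f p\<bar>"
 shows "fin g"
 unfolding fin_def
 by (intro conjI sqint_bound[OF finD(2)[OF f]] sqint_bound[OF finD(3)[OF f]])
  (use assms in auto)

lemma Q_eq:
 assumes "fin f" "fin g"
 shows "Q l f g = (LINT p|jump_measure J. inc f p * inc g p) + l * (LINT x|m. f x * g x)"
 using assms by (simp add: Q_def jump_form_eq[OF kernel] finD)

lemma Q_sym: "Q l f g = Q l g f"
 by (simp add: Q_def jump_form_def mult.commute mult.left_commute)

lemma Q_lincomb:
 assumes f: "fin f" and g: "fin g" and h: "fin h"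
 shows "Q l (%x. f x + c * g x) h = Q l f h + c * Q l g h"
proof -
 note i = sqint_mult[OF finD(2)[OF f] finD(2)[OF h]]
  sqint_mult[OF finD(2)[OF g] finD(2)[OF h]]
  sqint_mult[OF finD(3)[OF f] finD(3)[OF h]]
  sqint_mult[OF finD(3)[OF g] finD(3)[OF h]]
 have "(LINT p|jump_measure J. inc (%x. f x + c * g x) p * inc h p)
   = (LINT p|jump_measure J. inc f p * inc h p + c * (inc g p * inc h p))"
  by (simp add: inc_def algebra_simps)
 moreover have "(LINT x|m. (f x + c * g x) * h x) = (LINT x|m. f x * h x + c * (g x * h x))"
  by (simp add: algebra_simps)
 ultimately show ?thesis
  unfolding Q_eq[OF fin_lincomb[OF f g] h] Q_eq[OF f h] Q_eq[OF g h]
  using i by (simp add: algebra_simps)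
qed

lemma Q_diff_left:
 assumes "fin f" "fin g" "fin h"
 shows "Q l (%x. f x - g x) h = Q l f h - Q l g h"
 using Q_lincomb[OF assms, of l "-1"] by simp

lemma Q_expand:
 assumes f: "fin f" and g: "fin g"
 shows "QQ l (%x. f x + c * g x) = QQ l f + 2 * c * Q l f g + c^2 * QQ l g"
 using Q_lincomb[OF f g fin_lincomb[OF f g], of l c c] Q_lincomb[OF f g f, of l c] Q_lincomb[OF f g g, of l c]
 by (simp add: Q_sym[of l f "%x. f x + c * g x"] Q_sym[of l g "%x. f x + c * g x"] Q_sym[of l g f]
   power2_eq_square algebra_simps)

lemma Q_diag: "fin f ==> QQ l f = (LINT p|jump_measure J. (inc f p)^2) + l * (LINT x|m. (f x)^2)"
 by (simp add: Q_eq power2_eq_square)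

lemma Q_nonneg: "fin f ==> 0 <= l ==> 0 <= QQ l f"
 by (simp add: Q_diag)

lemma Q_parts:
 assumes "fin f" "0 <= l"
 shows "(LINT p|jump_measure J. (inc f p)^2) <= QQ l f" "l * (LINT x|m. (f x)^2) <= QQ l f"
 using assms by (simp_all add: Q_diag)

lemma Q_mono:
 assumes "fin f" "0 <= l" "l <= c * k" "1 <= c"
 shows "QQ l f <= c * QQ k f"
proof -
 have "(LINT p|jump_measure J. (inc f p)^2) <= c * (LINT p|jump_measure J. (inc f p)^2)"
  using mult_right_mono[of 1 c "LINT p|jump_measure J. (inc f p)^2"] assms by simp
 moreover have "l * (LINT x|m. (f x)^2) <= c * k * (LINT x|m. (f x)^2)"
  using assms by (intro mult_right_mono) auto
 ultimately show ?thesis using assms by (simp add: Q_diag distrib_left mult.assoc)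
qed

lemma Q_CS:
 assumes f: "fin f" and g: "fin g" and l: "0 <= l"
 shows "(Q l f g)^2 <= QQ l f * QQ l g"
proof (rule nonneg_quadratic_discr)
 fix t
 show "0 <= QQ l f + 2 * t * Q l f g + t^2 * QQ l g"
  using Q_nonneg[OF fin_lincomb[OF f g, of t] l] by (simp add: Q_expand[OF f g])
qed (use Q_nonneg[OF g l] in simp)

lemma Q_add_le:
 assumes f: "fin f" and g: "fin g" and l: "0 <= l"
 shows "QQ l (%x. f x + g x) <= 2 * QQ l f + 2 * QQ l g"
 using Q_expand[OF f g, of l 1] Q_expand[OF f g, of l "-1"] Q_nonneg[OF fin_lincomb[OF f g, of "-1"] l]
 by simp

lemma energy_eq:
 assumes "fin f"
 shows "jump_energy J f + (nn_integral m (%x. ennreal ((f x)^2))) = ennreal (QQ 1 f)"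
 using nn_integral_sq[OF finD(2)[OF assms]] nn_integral_sq[OF finD(3)[OF assms]] assms
 by (simp add: jump_energy_eq[OF kernel] finD(1) Q_diag ennreal_plus[symmetric] del: ennreal_plus)

lemma fin_iff:
 assumes "f : Borel"
 shows "fin f \<longleftrightarrow> jump_energy J f < \<infinity> \<and> (nn_integral m (%x. ennreal ((f x)^2))) < \<infinity>"
 using assms measurable_increment[OF assms]
 by (auto simp: fin_def sqint_iff_nn jump_energy_eq[OF kernel] measurable_m measurable_jm)

text \<open>Replaces the sequence and the extended real limit of \<open>form_domain\<close> by a
  real epsilon condition; \<open>form_domain_eq\<close> shows the two to be equal.\<close>

definition dom :: "('a => real) set" where
 "dom = {f. fin f \<and> (\<forall>e>0. \<exists>j. j : Cc 1 \<and> fin j \<and> QQ 1 (%x. j x - f x) < e)}"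

lemma form_domain_eq: "form_domain m J = dom"
proof (intro set_eqI iffI)
 fix f assume "f : form_domain m J"
 then obtain j where f: "f : Borel" "jump_energy J f < \<infinity>" "(nn_integral m (%x. ennreal ((f x)^2))) < \<infinity>"
  and j: "!!n::nat. j n : Cc 1"
  and lim: "(%n. jump_energy J (%x. j n x - f x) + (nn_integral m (%x. ennreal ((j n x - f x)^2)))) ~> 0"
  by (auto simp: form_domain_def)
 have ff: "fin f" using f by (simp add: fin_iff)
 have "\<exists>k. k : Cc 1 \<and> fin k \<and> QQ 1 (%x. k x - f x) < e" if e: "e > 0" for e
 proof -
  have "eventually (%n. jump_energy J (%x. j n x - f x) + (nn_integral m (%x. ennreal ((j n x - f x)^2))) < ennreal e) sequentially"
   using order_tendstoD(2)[OF lim] e by simp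
  then obtain n where n: "jump_energy J (%x. j n x - f x) + (nn_integral m (%x. ennreal ((j n x - f x)^2))) < ennreal e"
   by (auto simp: eventually_sequentially)
  have meas: "(%x. j n x - f x) : Borel"
   using Cc_measurable[OF j[of n]] f(1) by simp
  have lt: "jump_energy J (%x. j n x - f x) + (nn_integral m (%x. ennreal ((j n x - f x)^2))) < top"
   using n ennreal_less_top less_trans by blast
  then have fd: "fin (%x. j n x - f x)"
   by (subst fin_iff[OF meas]) (auto simp: less_top)
  have "fin (j n)" using fin_add[OF fd ff] by simp
  moreover have "QQ 1 (%x. j n x - f x) < e"
   using n Q_nonneg[OF fd, of 1] by (simp add: energy_eq[OF fd] ennreal_less_iff)
  ultimately show ?thesis using j by blast
 qed
 with ff show "f : dom" by (simp add: dom_def)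
next
 fix f assume "f : dom"
 then have ff: "fin f" and "\<forall>n::nat. \<exists>j. j : Cc 1 \<and> fin j \<and> QQ 1 (%x. j x - f x) < 1 / real (Suc n)"
  by (auto simp: dom_def)
 then obtain j where j: "!!n::nat. j n : Cc 1" "!!n. fin (j n)"
  "!!n. QQ 1 (%x. j n x - f x) < 1 / real (Suc n)"
  by metis
 have "(%n. QQ 1 (%x. j n x - f x)) ~> 0"
  by (rule tendsto_sandwich[OF _ _ tendsto_const LIMSEQ_Suc[OF lim_1_over_n]])
    (use j(3) Q_nonneg[OF fin_diff[OF j(2) ff], of 1] in \<open>auto intro!: always_eventually less_imp_le simp del: of_nat_Suc\<close>)
 then have "(%n. ennreal (QQ 1 (%x. j n x - f x))) ~> ennreal 0"
  by (rule tendsto_ennrealI)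
 then have "(%n. jump_energy J (%x. j n x - f x) + (nn_integral m (%x. ennreal ((j n x - f x)^2)))) ~> 0"
  by (simp add: energy_eq[OF fin_diff[OF j(2) ff]])
 moreover have "jump_energy J f < \<infinity>" "(nn_integral m (%x. ennreal ((f x)^2))) < \<infinity>"
  using ff fin_iff[OF finD(1)[OF ff]] by auto
 ultimately show "f : form_domain m J"
  using j(1) finD(1)[OF ff] by (auto simp: form_domain_def)
qed

lemma dom_fin: "f : dom ==> fin f" by (simp add: dom_def)

lemma dom_closed:
 assumes f: "fin f" and ex: "!!e. e > 0 ==> \<exists>g\<in>dom. QQ 1 (%x. g x - f x) < e"
 shows "f : dom"
proof -
 have "\<exists>j. j : Cc 1 \<and> fin j \<and> QQ 1 (%x. j x - f x) < e" if e: "e > 0" for e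
 proof -
  obtain g where g: "g : dom" "QQ 1 (%x. g x - f x) < e / 4" using ex[of "e / 4"] e by auto
  have "\<exists>j. j : Cc 1 \<and> fin j \<and> QQ 1 (%x. j x - g x) < e / 4"
   using g(1) e unfolding dom_def mem_Collect_eq by (meson divide_pos_pos zero_less_numeral)
  then obtain j where j: "j : Cc 1" "fin j" "QQ 1 (%x. j x - g x) < e / 4" by blast
  have "QQ 1 (%x. j x - f x) < e"
   using Q_add_le[OF fin_diff[OF j(2) dom_fin[OF g(1)]] fin_diff[OF dom_fin[OF g(1)] f], of 1] j(3) g(2)
   by simp
  with j show ?thesis by blast
 qed
 with f show ?thesis by (simp add: dom_def)
qed

lemma Cc_dom: "j : Cc 1 ==> fin j ==> j : dom"
 by (auto simp: dom_def intro!: exI[of _ j] simp: Q_diag[OF fin_zero] inc_def)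

lemma dom_lincomb:
 assumes f: "f : dom" and g: "g : dom"
 shows "(%x. f x + c * g x) : dom"
proof (rule dom_closed)
 show ff: "fin (%x. f x + c * g x)" using f g by (intro fin_lincomb dom_fin)
 fix e :: real assume e: "e > 0"
 \<comment> \<open>Makes 2 (e1 + c^2 e1) equal to e/2.\<close>
 define e1 where "e1 = e / (4 * (1 + c^2))"
 have e1: "e1 > 0" "e1 * (1 + c^2) = e / 4"
  using e by (auto simp: e1_def field_simps add_pos_nonneg add_nonneg_eq_0_iff)
 obtain j where j: "j : Cc 1" "fin j" "QQ 1 (%x. j x - f x) < e1"
  using f e1(1) unfolding dom_def by blast
 obtain k where k: "k : Cc 1" "fin k" "QQ 1 (%x. k x - g x) < e1"
  using g e1(1) unfolding dom_def by blast
 note d = fin_diff[OF j(2) dom_fin[OF f]] fin_diff[OF k(2) dom_fin[OF g]]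
 have "QQ 1 (%x. c * (k x - g x)) = c^2 * QQ 1 (%x. k x - g x)"
  using Q_expand[OF fin_zero d(2), of 1 c] Q_lincomb[OF fin_zero fin_zero d(2), of 1 1]
  by (simp add: Q_diag[OF fin_zero] inc_def)
 then have "QQ 1 (%x. c * (k x - g x)) <= c^2 * e1"
  using k(3) by (simp add: mult_left_mono)
 moreover have "QQ 1 (%x. (j x - f x) + c * (k x - g x))
   <= 2 * QQ 1 (%x. j x - f x) + 2 * QQ 1 (%x. c * (k x - g x))"
  by (rule Q_add_le[OF d(1) fin_cmult[OF d(2)]]) simp
 ultimately have "QQ 1 (%x. (j x - f x) + c * (k x - g x))
   <= 2 * (e1 * (1 + c^2))"
  using j(3) by (simp add: algebra_simps)
 also have "... < e" using e1(2) e by simp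
 finally have "QQ 1 (%x. (j x + c * k x) - (f x + c * g x)) < e"
  by (simp add: algebra_simps)
 moreover have "(%x. j x + c * k x) : dom"
  by (intro Cc_dom Cc_add Cc_cmult fin_lincomb j k)
 ultimately show "\<exists>h\<in>dom. QQ 1 (%x. h x - (f x + c * g x)) < e"
  by (intro bexI[of _ "%x. j x + c * k x"])
qed

lemma zero_dom: "(%x. 0) : dom"
 by (rule Cc_dom[OF Cc_zero fin_zero])

lemma dom_cmult: "f : dom ==> (%x. c * f x) : dom"
 using dom_lincomb[OF zero_dom, of f c] by simp

text \<open>Riesz-Fischer in the form norm: a fast subsequence converges almost everywhere, hence so
  do its increments for the jump measure, and Fatou turns this into convergence in norm.\<close>

lemma complete:
 assumes v: "!!n::nat. v n : dom"
  and Cauchy: "!!e. e > 0 ==> \<exists>N. \<forall>i\<ge>N. \<forall>j\<ge>N. QQ 1 (%x. v i x - v j x) < e"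
 shows "\<exists>u\<in>dom. (%n. QQ 1 (%x. v n x - u x)) ~> 0"
proof -
 have fv: "fin (v n)" for n using v by (rule dom_fin)
 have [measurable]: "v n : Borel" for n using fv by (rule finD)
 have vd: "fin (%x. v i x - v j x)" for i j by (intro fin_diff fv)
 \<comment> \<open>With rate 16^-k the integrals of 4^k (d k)^2 are at most 4^-k, hence summable;
   almost everywhere the terms then tend to 0, so |d k| <= 2^-k eventually.\<close>
 define small where "small k n \<longleftrightarrow> (\<forall>i\<ge>n. \<forall>j\<ge>n. QQ 1 (%x. v i x - v j x) < (1 / 16) ^ k)" for k n
 have "\<exists>r. \<forall>k. small k (r k) \<and> r k < r (Suc k)"
 proof (rule dependent_nat_choice)
  show "\<exists>n. small 0 n" unfolding small_def using Cauchy[of 1] by simp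
 next
  fix n k
  obtain N where "small (Suc k) N" unfolding small_def using Cauchy[of "(1 / 16) ^ Suc k"] by auto
  then have "small (Suc k) (max N (Suc n))" unfolding small_def by auto
  then show "\<exists>N. small (Suc k) N \<and> n < N" by (intro exI[of _ "max N (Suc n)"]) auto
 qed
 then obtain r where r: "!!k. small k (r k)" "!!k. r k < r (Suc k)" by blast
 have mono: "strict_mono r" using r(2) by (simp add: strict_mono_Suc_iff)
 define d where "d k x = v (r (Suc k)) x - v (r k) x" for k x
 have [measurable]: "d k : Borel" for k unfolding d_def by measurable
 have dQ: "(LINT x|m. (d k x)^2) <= (1 / 16) ^ k" for k
 proof -
  have "r k <= r (Suc k)" using r(2) less_imp_le by blast
  then have "QQ 1 (d k) < (1 / 16) ^ k" using r(1)[of k] unfolding small_def d_def by blast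
  then show ?thesis using Q_parts(2)[OF vd, of 1 "r (Suc k)" "r k"] unfolding d_def by linarith
 qed
 have dsq: "sqint m (d k)" for k unfolding d_def by (rule finD(3)[OF vd])
 have "(nn_integral m (%x. (\<Sum>k. ennreal (4 ^ k * (d k x)^2)))) = (\<Sum>k. nn_integral m (%x. ennreal (4 ^ k * (d k x)^2)))"
  by (rule nn_integral_suminf) measurable
 also have "... <= (\<Sum>k. ennreal ((1 / 4) ^ k))"
 proof (rule suminf_le)
  fix k
  have "(nn_integral m (%x. ennreal (4 ^ k * (d k x)^2))) = ennreal (LINT x|m. 4 ^ k * (d k x)^2)"
   by (rule nn_integral_eq_integral) (use sqintD(2)[OF dsq[of k]] in auto)
  also have "... <= ennreal (4 ^ k * (1 / 16) ^ k)"
   using dQ[of k] by (intro ennreal_leI) simp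
  also have "4 ^ k * (1 / 16) ^ k = ((1 / 4 :: real) ^ k)" by (simp add: power_mult_distrib[symmetric])
  finally show "(nn_integral m (%x. ennreal (4 ^ k * (d k x)^2))) <= ennreal ((1 / 4) ^ k)" .
 qed auto
 also have "... = ennreal (\<Sum>k. (1 / 4) ^ k)"
  by (rule suminf_ennreal2) (auto intro: summable_geometric)
 finally have "(nn_integral m (%x. (\<Sum>k. ennreal (4 ^ k * (d k x)^2)))) \<noteq> \<infinity>"
  by (metis ennreal_neq_top infinity_ennreal_def top.extremum_unique)
 then have "AE x in m. (\<Sum>k. ennreal (4 ^ k * (d k x)^2)) \<noteq> \<infinity>"
  by (intro nn_integral_noteq_infinite) measurable
 then have "AE x in m. convergent (%k. v (r k) x)"
 proof eventually_elim
  case fin: (elim x)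
  have "summable (%k. 4 ^ k * (d k x)^2)"
   by (rule summable_suminf_not_top) (use fin in auto)
  then have "(%k. 4 ^ k * (d k x)^2) ~> 0" by (rule summable_LIMSEQ_zero)
  then have "eventually (%k. 4 ^ k * (d k x)^2 < 1) sequentially" by (rule order_tendstoD(2)) simp
  then have "eventually (%k. norm (d k x) <= (1 / 2) ^ k) sequentially"
  proof eventually_elim
   case *: (elim k)
   have "(2 ^ k * \<bar>d k x\<bar>)^2 < 1^2"
    using * by (simp add: power_mult_distrib power_mult[symmetric] mult.commute[of k] power_mult)
   then have "2 ^ k * \<bar>d k x\<bar> < 1" by (rule power2_less_imp_less) simp
   then show ?case by (simp add: power_one_over field_simps)
  qed
  moreover have "summable (%k. (1 / 2 :: real) ^ k)" by (rule summable_geometric) simp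
  ultimately have "summable (%k. d k x)" by (rule summable_comparison_test_ev)
  then have "(%n. \<Sum>k<n. d k x) ~> (\<Sum>k. d k x)" by (rule summable_LIMSEQ)
  moreover have "(\<Sum>k<n. d k x) = v (r n) x - v (r 0) x" for n
   unfolding d_def by (rule sum_lessThan_telescope)
  ultimately have "(%n. (v (r n) x - v (r 0) x) + v (r 0) x) ~> (\<Sum>k. d k x) + v (r 0) x"
   by (intro tendsto_add) auto
  then show ?case by (auto simp: convergent_def)
 qed
 then have ae_m: "AE x in m. (%k. v (r k) x) ~> lim (%k. v (r k) x)"
  by eventually_elim (simp add: convergent_LIMSEQ_iff)
 define u where "u x = lim (%k. v (r k) x)" for x
 have um [measurable]: "u : Borel" unfolding u_def by (rule borel_measurable_lim_metric) measurable
 have ae: "AE x in m. (%k. v (r k) x) ~> u x" using ae_m unfolding u_def .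
 then have "AE p in jump_measure J. (%k. v (r k) (fst p)) ~> u (fst p) \<and> (%k. v (r k) (snd p)) ~> u (snd p)"
  by (intro AE_jump_measure[OF kernel]) (simp add: AE_m_iff)
 then have aeJ: "AE p in jump_measure J. (%k. inc (v (r k)) p) ~> inc u p"
  by eventually_elim (auto simp: inc_def intro: tendsto_diff)
 \<comment> \<open>Fatou runs along the subsequence in the second argument only, so every n >= N is
   covered. Energy and mass are each at most e, hence 2 e.\<close>
 have key: "fin (%x. v n x - u x) \<and> QQ 1 (%x. v n x - u x) <= 2 * e"
  if N: "\<forall>i\<ge>N. \<forall>j\<ge>N. QQ 1 (%x. v i x - v j x) < e" and n: "n >= N" for N n e
 proof -
  have rk: "r k >= N" if "k >= N" for k using that seq_suble[OF mono, of k] by simp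
  have "(nn_integral (jump_measure J) (%p. ennreal ((inc (v n) p - inc u p)^2))) <= ennreal e"
  proof (rule fatou_sq[OF _ _ _ aeJ])
   show "\<forall>\<^sub>F k in sequentially. (nn_integral (jump_measure J) (%p. ennreal ((inc (v n) p - inc (v (r k)) p)^2))) <= ennreal e"
    using eventually_ge_at_top[of N]
   proof eventually_elim
    case (elim k)
    then have lt: "QQ 1 (%x. v n x - v (r k) x) < e" using N n rk by blast
    have eq: "inc (v n) p - inc (v (r k)) p = inc (%x. v n x - v (r k) x) p" for p
     by (simp add: inc_def)
    show ?case
     unfolding eq nn_integral_sq[OF finD(2)[OF vd]]
     using lt Q_parts(1)[OF vd, of 1 n "r k"] by (intro ennreal_leI) simp
   qed
  qed measurable
  moreover have "inc (v n) p - inc u p = inc (%x. v n x - u x) p" for p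
   by (simp add: inc_def)
  ultimately have 1: "(nn_integral (jump_measure J) (%p. ennreal ((inc (%x. v n x - u x) p)^2))) <= ennreal e" by simp
  have 2: "(nn_integral m (%x. ennreal ((v n x - u x)^2))) <= ennreal e"
  proof (rule fatou_sq[OF _ _ _ ae])
   show "\<forall>\<^sub>F k in sequentially. (nn_integral m (%x. ennreal ((v n x - v (r k) x)^2))) <= ennreal e"
    using eventually_ge_at_top[of N]
   proof eventually_elim
    case (elim k)
    then have lt: "QQ 1 (%x. v n x - v (r k) x) < e" using N n rk by blast
    show ?case
     unfolding nn_integral_sq[OF finD(3)[OF vd]]
     using lt Q_parts(2)[OF vd, of 1 n "r k"] by (intro ennreal_leI) simp
   qed
  qed measurable
  have f: "fin (%x. v n x - u x)"
   unfolding fin_def sqint_iff_nn measurable_m measurable_jm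
   using 1 2 by (auto simp: measurable_increment intro: le_less_trans)
  have e: "e > 0" using N n Q_nonneg[OF vd, of 1 n n] by (meson le_less_trans zero_le_one)
  have "QQ 1 (%x. v n x - u x) <= 2 * e"
   using 1 2 e unfolding nn_integral_sq[OF finD(2)[OF f]] nn_integral_sq[OF finD(3)[OF f]] Q_diag[OF f]
   by simp
  with f show ?thesis by blast
 qed
 obtain N0 where "\<forall>i\<ge>N0. \<forall>j\<ge>N0. QQ 1 (%x. v i x - v j x) < 1" using Cauchy[of 1] by auto
 from key[OF this, of N0] have "fin (%x. v N0 x - u x)" by simp
 from fin_diff[OF fv[of N0] this] have fu: "fin u" by simp
 have conv: "(%n. QQ 1 (%x. v n x - u x)) ~> 0"
 proof (rule LIMSEQ_I)
  fix e :: real assume e: "e > 0"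
  obtain N where "\<forall>i\<ge>N. \<forall>j\<ge>N. QQ 1 (%x. v i x - v j x) < e / 3" using Cauchy[of "e / 3"] e by auto
  from key[OF this] have le: "QQ 1 (%x. v n x - u x) <= 2 * (e / 3)" if "n >= N" for n
   using that by blast
  have "norm (QQ 1 (%x. v n x - u x) - 0) < e" if "n >= N" for n
   using Q_nonneg[OF fin_diff[OF fv[of n] fu], of 1] e le[OF that] by simp
  then show "\<exists>N. \<forall>n\<ge>N. norm (QQ 1 (%x. v n x - u x) - 0) < e" by blast
 qed
 have "u : dom"
 proof (rule dom_closed[OF fu])
  fix e :: real assume "e > 0"
  with order_tendstoD(2)[OF conv this] obtain n where "QQ 1 (%x. v n x - u x) < e"
   by (auto simp: eventually_sequentially)
  with v show "\<exists>g\<in>dom. QQ 1 (%x. g x - u x) < e" by blast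
 qed
 with conv show ?thesis by blast
qed

text \<open>The resolvent is the minimiser of \<open>QQ l v - 2 \<integral> f v\<close>.\<close>

lemma resolvent_exists:
 assumes f: "sqint m f" and l: "l > 0"
 shows "\<exists>u. is_resolvent m J l f u"
proof -
 define F where "F g = (LINT x|m. f x * g x)" for g
 define I where "I v = QQ l v - 2 * F v" for v
 have fg: "integrable m (%x. f x * g x)" if "fin g" for g
  by (rule sqint_mult[OF f finD(3)[OF that]])
 have F_lin: "F (%x. g x + c * h x) = F g + c * F h" if "fin g" "fin h" for g h c
 proof -
  have "F (%x. g x + c * h x) = (LINT x|m. f x * g x + c * (f x * h x))"
   unfolding F_def by (simp add: algebra_simps)
  then show ?thesis using fg[OF that(1)] fg[OF that(2)] by (simp add: F_def)
 qed
 \<comment> \<open>Completing the square in v - f/l bounds the functional from below.\<close>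
 have lower: "- (LINT x|m. (f x)^2) / l <= I v" if v: "fin v" for v
 proof -
  have i: "integrable m (%x. (f x)^2)" "integrable m (%x. (v x)^2)" using f finD(3)[OF v] by (auto dest: sqintD)
  have "0 <= (LINT x|m. l * (v x - f x / l)^2)" using l by simp
  also have "... = (LINT x|m. l * (v x)^2 - 2 * (f x * v x) + (f x)^2 / l)"
   using l by (intro bint_cong) (auto simp: power2_eq_square field_simps)
  also have "... = l * (LINT x|m. (v x)^2) - 2 * F v + (LINT x|m. (f x)^2) / l"
   using i fg[OF v] by (simp add: F_def)
  finally show ?thesis using Q_parts(2)[OF v, of l] l by (simp add: I_def)
 qed
 define I0 where "I0 = (INF v\<in>dom. I v)"
 have bdd: "bdd_below (I ` dom)" using lower dom_fin by (intro bdd_belowI2) blast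
 have I0_le: "I0 <= I v" if "v : dom" for v unfolding I0_def by (rule cINF_lower[OF bdd that])
 have "\<exists>v\<in>dom. I v < I0 + 1 / real (Suc n)" for n
 proof -
  have "(INF v\<in>dom. I v) < I0 + 1 / real (Suc n)" by (simp add: I0_def)
  then show ?thesis by (subst (asm) cINF_less_iff[OF _ bdd]) (use zero_dom in auto)
 qed
 then obtain v where v: "!!n::nat. v n : dom" "!!n. I (v n) < I0 + 1 / real (Suc n)" by metis
 have fv: "fin (v n)" for n using v(1) by (rule dom_fin)
 \<comment> \<open>Parallelogram identity. The midpoint w is a competitor, so I w >= I0, and a
   minimising sequence is Cauchy.\<close>
 have par: "QQ l (%x. v i x - v j x) <= 2 / real (Suc i) + 2 / real (Suc j)" for i j
 proof -
  define w where "w x = v i x / 2 + (1 / 2) * v j x" for x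
  have e: "w = (%x. (1 / 2) * v i x + (1 / 2) * v j x)" by (simp add: w_def fun_eq_iff)
  have hi: "fin (%x. (1 / 2) * v i x)" by (rule fin_cmult[OF fv])
  have wd: "w : dom" unfolding e by (intro dom_lincomb dom_cmult v)
  have F_half: "F (%x. (1 / 2) * v i x) = (1 / 2) * F (v i)"
   unfolding F_def by simp
  have Fw: "F w = (F (v i) + F (v j)) / 2"
   unfolding e using F_lin[OF hi fv, of "1/2" j] F_half by simp
  have Qh: "Q l (%x. (1 / 2) * v i x) h = (1 / 2) * Q l (v i) h" if "fin h" for h
   using Q_lincomb[OF fin_zero fv[of i] that, of l "1/2"] Q_lincomb[OF fin_zero fin_zero that, of l 1] by simp
  have "QQ l w = QQ l (%x. (1 / 2) * v i x)
    + Q l (%x. (1 / 2) * v i x) (v j) + (1 / 4) * QQ l (v j)"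
   unfolding e Q_expand[OF hi fv] by (simp add: power2_eq_square)
  also have "QQ l (%x. (1 / 2) * v i x) = (1 / 4) * QQ l (v i)"
   using Qh[OF hi] Qh[OF fv[of i]] Q_sym[of l "v i" "%x. (1 / 2) * v i x"] by simp
  also have "Q l (%x. (1 / 2) * v i x) (v j) = (1 / 2) * Q l (v i) (v j)" by (rule Qh[OF fv])
  finally have Qw: "4 * QQ l w = QQ l (v i) + 2 * Q l (v i) (v j) + QQ l (v j)" by simp
  have Qd: "QQ l (%x. v i x - v j x) = QQ l (v i) - 2 * Q l (v i) (v j) + QQ l (v j)"
   using Q_expand[OF fv fv, of l i "-1" j] by simp
  have "QQ l (%x. v i x - v j x) = 2 * I (v i) + 2 * I (v j) - 4 * I w"
   unfolding I_def Qd using Qw Fw by simp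
  also have "... <= 2 / real (Suc i) + 2 / real (Suc j)"
   using v(2)[of i] v(2)[of j] I0_le[OF wd] by simp
  finally show ?thesis .
 qed
 \<comment> \<open>Compares the form norm with parameter 1 to the one with parameter l.\<close>
 define K where "K = max 1 (1 / l)"
 have K: "1 <= K" "1 <= K * l" using l by (auto simp: K_def max_def field_simps)
 have "\<exists>N. \<forall>i\<ge>N. \<forall>j\<ge>N. QQ 1 (%x. v i x - v j x) < e" if e: "e > 0" for e
 proof -
  have "0 < e / (5 * K)" using e K by simp
  then obtain N where N: "1 / real (Suc N) < e / (5 * K)" using reals_Archimedean[of "e / (5 * K)"] by (auto simp: inverse_eq_divide)
  have "QQ 1 (%x. v i x - v j x) < e" if ij: "i >= N" "j >= N" for i j
  proof -
   have "1 / real (Suc i) <= 1 / real (Suc N)" "1 / real (Suc j) <= 1 / real (Suc N)"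
    using ij by (auto intro!: divide_left_mono)
   then have "QQ l (%x. v i x - v j x) <= 4 * (e / (5 * K))"
    using par[of i j] N by simp
   then have "K * QQ l (%x. v i x - v j x) <= K * (4 * (e / (5 * K)))"
    using K by (intro mult_left_mono) auto
   also have "... < e" using K e by simp
   finally show ?thesis using Q_mono[OF fin_diff[OF fv fv], of 1 K l i j] K by simp
  qed
  then show ?thesis by blast
 qed
 from complete[OF v(1) this] obtain u where u: "u : dom"
  and conv: "(%n. QQ 1 (%x. v n x - u x)) ~> 0" by blast
 have fu: "fin u" using u by (rule dom_fin)
 have "is_resolvent m J l f u"
  unfolding is_resolvent_def form_domain_eq
 proof (intro conjI ballI u)
  fix g assume g: "g : dom"
  have fing: "fin g" using g by (rule dom_fin)
  \<comment> \<open>The line v n + t g stays in \<open>dom\<close>, where I >= I0 > I (v n) -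
    1/(n+1). The resulting quadratic in t is nonnegative, and its discriminant bounds the defect in
    the resolvent equation.\<close>
  have b: "(Q l (v n) g - F g)^2 <= 1 / real (Suc n) * QQ l g" for n
  proof (rule nonneg_quadratic_discr)
   fix t
   have "I (%x. v n x + t * g x) = I (v n) + 2 * t * (Q l (v n) g - F g) + t^2 * QQ l g"
    unfolding I_def Q_expand[OF fv fing] F_lin[OF fv fing] by (simp add: algebra_simps)
   moreover have "I0 <= I (%x. v n x + t * g x)" by (intro I0_le dom_lincomb v g)
   ultimately show "0 <= 1 / real (Suc n) + 2 * t * (Q l (v n) g - F g) + t^2 * QQ l g"
    using v(2)[of n] by simp
  qed (use Q_nonneg[OF fing] l in simp)
  have "(%n. 1 / real (Suc n) * QQ l g) ~> 0 * QQ l g"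
   by (intro tendsto_mult_right LIMSEQ_Suc[OF lim_1_over_n])
  then have z: "(%n. 1 / real (Suc n) * QQ l g) ~> 0" by simp
  have "(%n. (Q l (v n) g - F g)^2) ~> 0"
   by (rule tendsto_sandwich[OF _ _ tendsto_const z]) (use b in \<open>auto intro!: always_eventually simp del: of_nat_Suc\<close>)
  then have L1: "(%n. Q l (v n) g - F g) ~> 0" by simp
  have d: "(Q l (v n) g - Q l u g)^2 <= (max 1 l * QQ l g) * QQ 1 (%x. v n x - u x)" for n
  proof -
   note fd = fin_diff[OF fv[of n] fu]
   have "(Q l (%x. v n x - u x) g)^2 <= QQ l (%x. v n x - u x) * QQ l g"
    using Q_CS[OF fd fing, of l] l by simp
   also have "... <= (max 1 l * QQ 1 (%x. v n x - u x)) * QQ l g"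
    using Q_mono[OF fd, of l "max 1 l" 1] Q_nonneg[OF fing, of l] l by (intro mult_right_mono) auto
   finally show ?thesis using Q_diff_left[OF fv fu fing, of l n] by (simp add: mult_ac)
  qed
  have "(%n. (max 1 l * QQ l g) * QQ 1 (%x. v n x - u x)) ~> (max 1 l * QQ l g) * 0"
   by (intro tendsto_mult_left conv)
  then have z: "(%n. (max 1 l * QQ l g) * QQ 1 (%x. v n x - u x)) ~> 0" by simp
  have "(%n. (Q l (v n) g - Q l u g)^2) ~> 0"
   by (rule tendsto_sandwich[OF _ _ tendsto_const z]) (use d in auto)
  then have L2: "(%n. Q l (v n) g - Q l u g) ~> 0" by simp
  have "(%n. (Q l (v n) g - F g) - (Q l (v n) g - Q l u g)) ~> 0 - 0"
   by (intro tendsto_diff L1 L2)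
  then have "Q l u g = F g" by (simp add: LIMSEQ_const_iff)
  then show "jump_form J u g + l * (LINT x|m. u x * g x) = (LINT x|m. f x * g x)"
   by (simp add: Q_def F_def)
 qed
 then show ?thesis by blast
qed

lemma resolvent_is_resolvent:
 assumes "sqint m f" "l > 0"
 shows "is_resolvent m J l f (resolvent m J l f)"
 unfolding resolvent_def by (rule someI_ex[OF resolvent_exists[OF assms]])

lemma is_resolventD:
 assumes "is_resolvent m J l f u"
 shows "u : dom" "!!g. g : dom ==> Q l u g = (LINT x|m. f x * g x)"
 using assms by (auto simp: is_resolvent_def form_domain_eq Q_def)

text \<open>Contractions of a sequence converging in form norm converge in form norm as soon as they
  converge almost everywhere, with the sequence itself as moving majorant. The Markov property of
  the domain rests on this.\<close>

lemma dom_limit: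
 assumes g: "!!n::nat. g n : dom" and u: "fin u" and k [measurable]: "k : Borel"
  and f: "!!n. fin (f n)" and fu: "(%n. QQ 1 (%x. f n x - u x)) ~> 0"
  and le: "!!n x. \<bar>g n x\<bar> <= \<bar>f n x\<bar>" "!!n p. \<bar>inc (g n) p\<bar> <= \<bar>inc (f n) p\<bar>"
  and lek: "!!x. \<bar>k x\<bar> <= \<bar>u x\<bar>" "!!p. \<bar>inc k p\<bar> <= \<bar>inc u p\<bar>"
  and lim: "AE x in lborel. (%n. g n x) ~> k x"
 shows "k : dom"
proof -
 have fk: "fin k" by (rule fin_bound[OF u k lek])
 have fg: "fin (g n)" for n using g by (rule dom_fin)
 have [measurable]: "g n : Borel" for n using fg by (rule finD)
 have aeJ: "AE p in jump_measure J. (%n. inc (g n) p) ~> inc k p"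
  using AE_jump_measure[OF kernel lim] by eventually_elim (auto simp: inc_def intro: tendsto_diff)
 have aem: "AE x in m. (%n. g n x) ~> k x" using lim by (simp add: AE_m_iff)
 have d: "fin (%x. f n x - u x)" for n by (rule fin_diff[OF f u])
 have i: "inc (%x. f n x - u x) p = inc (f n) p - inc u p"
  "inc (%x. g n x - k x) p = inc (g n) p - inc k p" for n p by (auto simp: inc_def)
 have "(%n. LINT p|jump_measure J. (inc (f n) p - inc u p)^2) ~> 0"
  by (rule tendsto_sandwich[OF _ _ tendsto_const fu]) (use Q_parts(1)[OF d, of 1] in \<open>simp_all add: i\<close>)
 then have 1: "(%n. LINT p|jump_measure J. (inc (g n) p - inc k p)^2) ~> 0"
  by (rule dominated_sq_convergence[OF finD(2)[OF f] finD(2)[OF u] _ _ _ le(2) lek(2) aeJ]) measurable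
 have "(%n. LINT x|m. (f n x - u x)^2) ~> 0"
  by (rule tendsto_sandwich[OF _ _ tendsto_const fu]) (use Q_parts(2)[OF d, of 1] in simp_all)
 then have 2: "(%n. LINT x|m. (g n x - k x)^2) ~> 0"
  by (rule dominated_sq_convergence[OF finD(3)[OF f] finD(3)[OF u] _ _ _ le(1) lek(1) aem]) measurable
 have "(%n. QQ 1 (%x. g n x - k x)) ~> 0"
  unfolding Q_diag[OF fin_diff[OF fg fk]] i using tendsto_add[OF 1 2] by simp
 note conv = order_tendstoD(2)[OF this]
 show ?thesis
 proof (rule dom_closed[OF fk])
  fix e :: real assume "e > 0"
  from conv[OF this] obtain n where "QQ 1 (%x. g n x - k x) < e"
   by (auto simp: eventually_sequentially)
  with g show "\<exists>g\<in>dom. QQ 1 (%x. g x - k x) < e" by blast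
 qed
qed

text \<open>A C^1 contraction fixing 0 maps C^1_c into itself, and the approximants of u may be
  taken convergent almost everywhere.\<close>

lemma dom_contraction:
 assumes u: "u : dom" and T0: "T 0 = 0"
  and T: "!!s. (T has_real_derivative T' s) (at s)" "continuous_on UNIV T'" "!!s. \<bar>T' s\<bar> <= 1"
 shows "(%x. T (u x)) : dom"
proof -
 have Lip: "\<bar>T a - T b\<bar> <= \<bar>a - b\<bar>" for a b
 proof -
  have "norm (T a - T b) <= 1 * norm (a - b)"
   by (rule field_differentiable_bound[of UNIV T T']) (use T in auto)
  then show ?thesis by simp
 qed
 have Tc: "continuous_on UNIV T" using T(1) by (intro DERIV_continuous_on) (auto intro: has_field_derivative_at_within)
 then have [measurable]: "T : Borel" by (rule borel_measurable_continuous_onI)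
 have fu: "fin u" using u by (rule dom_fin)
 have [measurable]: "u : Borel" using fu by (rule finD)
 have TCc: "(%x. T (j x)) : Cc 1" if j: "j : Cc 1" for j :: "'a => real"
 proof -
  obtain j' where j': "!!x. (j has_derivative j' x) (at x)" "!!v. (%x. j' x v) : Cc 0"
   using Cc_derivative[of j 0] j by auto
  have "C_k (Suc 0) (%x. T (j x))"
  proof (rule C_k_SucI)
   fix x show "((%x. T (j x)) has_derivative (%v. T' (j x) * j' x v)) (at x)"
    by (rule has_derivative_compose[OF j'(1) T(1)[unfolded has_field_derivative_def]])
  next
   fix v
   have "continuous_on UNIV (%x. j' x v)" using j'(2)[of v] by (simp add: Cc_iff)
   moreover have "continuous_on UNIV j" using j C_k_continuous[of 1 j] unfolding Cc_iff by blast
   ultimately show "C_k 0 (%x. T' (j x) * j' x v)"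
    by (auto intro!: continuous_on_mult continuous_on_compose2[OF T(2)])
  qed
  moreover obtain R where "!!x. norm x > R ==> j x = 0" using Cc_support[OF j] by metis
  ultimately show ?thesis using T0 unfolding Cc_iff by (metis One_nat_def)
 qed
 have bd: "\<bar>T s\<bar> <= \<bar>s\<bar>" for s using Lip[of s 0] T0 by simp
 have bi: "\<bar>inc (%x. T (w x)) p\<bar> <= \<bar>inc w p\<bar>" for w :: "'a => real" and p
  using Lip by (simp add: inc_def)
 have "\<forall>n::nat. \<exists>j. j : Cc 1 \<and> fin j \<and> QQ 1 (%x. j x - u x) < 1 / real (Suc n)"
  using u by (auto simp: dom_def)
 then obtain j where j: "!!n::nat. j n : Cc 1" "!!n. fin (j n)"
  "!!n. QQ 1 (%x. j n x - u x) < 1 / real (Suc n)" by metis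
 have conv: "(%n. QQ 1 (%x. j n x - u x)) ~> 0"
  by (rule tendsto_sandwich[OF _ _ tendsto_const LIMSEQ_Suc[OF lim_1_over_n]])
    (use j(3) Q_nonneg[OF fin_diff[OF j(2) fu], of 1] in \<open>auto intro!: always_eventually less_imp_le simp del: of_nat_Suc\<close>)
 have "(%n. LINT x|m. (j n x - u x)^2) ~> 0"
  by (rule tendsto_sandwich[OF _ _ tendsto_const conv]) (use Q_parts(2)[OF fin_diff[OF j(2) fu], of 1] in simp_all)
 then obtain r where r: "strict_mono (r :: nat => nat)" "AE x in m. (%n. j (r n) x) ~> u x"
  using sq_convergence_AE_subseq[of m j u] finD(3)[OF fin_diff[OF j(2) fu]] by blast
 show ?thesis
 proof (rule dom_limit[of "%n x. T (j (r n) x)" u _ "%n. j (r n)"])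
  show "(%x. T (j (r n) x)) : dom" for n
  proof (rule Cc_dom[OF TCc[OF j(1)]])
   have [measurable]: "j (r n) : Borel" by (rule finD[OF j(2)])
   show "fin (%x. T (j (r n) x))" by (rule fin_bound[OF j(2)]) (use bd bi in auto)
  qed
  show "(%n. QQ 1 (%x. j (r n) x - u x)) ~> 0"
   using LIMSEQ_subseq_LIMSEQ[OF conv r(1)] by (simp add: o_def)
  show "AE x in lborel. (%n. T (j (r n) x)) ~> T (u x)"
   using r(2) unfolding AE_m_iff
   by eventually_elim (auto intro: continuous_on_tendsto_compose[OF Tc])
 qed (use fu j bd bi in auto)
qed

text \<open>The truncation used in the maximum principle has a corner at c, so it is reached through
  C^1 contractions.\<close>

lemma dom_excess:
 assumes u: "u : dom" and c: "c >= 0"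
 shows "(%x. max 0 (u x - c)) : dom"
proof -
 \<comment> \<open>Smooths (s + |s - c| - |c|) / 2, which is max 0 (s - c) for c >= 0; the last root
   makes T n 0 = 0.\<close>
 define T where "T n s = (s + sqrt ((s - c)^2 + (1 / real (Suc n))^2) - sqrt (c^2 + (1 / real (Suc n))^2)) / 2" for n s
 define T' where "T' n s = (1 + (s - c) / sqrt ((s - c)^2 + (1 / real (Suc n))^2)) / 2" for n s
 have pos: "(s - c)^2 + (1 / real (Suc n))^2 > 0" for s n by (intro add_nonneg_pos) auto
 have T: "(T n has_real_derivative T' n s) (at s)" for n s
 proof -
  have half: "inverse x / 2 * (2 * y) = y / x" for x y :: real by (simp add: field_simps)
  have "((%s. sqrt ((s - c)^2 + e)) has_real_derivative (s - c) / sqrt ((s - c)^2 + e)) (at s)"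
   if e: "(s - c)^2 + e > 0" for e
  proof -
   have "((%s. (s - c)^2 + e) has_real_derivative 2 * (s - c)) (at s)"
    by (auto intro!: derivative_eq_intros)
   show ?thesis
    by (rule DERIV_cong[OF DERIV_chain2[OF DERIV_real_sqrt[OF e] \<open>((%s. (s - c)^2 + e) has_real_derivative 2 * (s - c)) (at s)\<close>]])
     (rule half)
  qed
  note 1 = this[OF pos]
  show ?thesis unfolding T_def T'_def
   by (rule DERIV_cong[OF DERIV_cdivide[OF DERIV_diff[OF DERIV_add[OF DERIV_ident 1] DERIV_const]]]) simp
 qed
 have T'c: "continuous_on UNIV (T' n)" for n
  unfolding T'_def using pos by (intro continuous_intros) (auto simp: less_le)
 have T'b: "0 <= T' n s \<and> T' n s <= 1" for n s
 proof -
  have "\<bar>s - c\<bar> <= sqrt ((s - c)^2 + (1 / real (Suc n))^2)"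
   by (rule real_le_rsqrt) simp
  then have "\<bar>(s - c) / sqrt ((s - c)^2 + (1 / real (Suc n))^2)\<bar> <= 1"
   using pos[of s n] by (simp add: abs_divide divide_le_eq)
  moreover have "0 <= (1 + z) / 2 \<and> (1 + z) / 2 <= 1" if "\<bar>z\<bar> <= 1" for z :: real using that by auto
  ultimately show ?thesis unfolding T'_def by blast
 qed
 have T0: "T n 0 = 0" for n by (simp add: T_def)
 have Lip: "\<bar>T n a - T n b\<bar> <= \<bar>a - b\<bar>" for n a b
 proof -
  have "norm (T n a - T n b) <= 1 * norm (a - b)"
   by (rule field_differentiable_bound[of UNIV "T n" "T' n"]) (use T T'b in \<open>auto simp: abs_le_iff intro: order_trans[of _ 0]\<close>)
  then show ?thesis by simp
 qed
 have fu: "fin u" using u by (rule dom_fin)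
 have [measurable]: "u : Borel" using fu by (rule finD)
 show ?thesis
 proof (rule dom_limit[of "%n x. T n (u x)" u _ "%n. u"])
  show "(%x. T n (u x)) : dom" for n
  proof (rule dom_contraction[OF u T0 T T'c])
   show "\<bar>T' n s\<bar> <= 1" for s using T'b[of n s] by simp
  qed
  show "(%n. QQ 1 (%x. u x - u x)) ~> 0"
   by (simp add: Q_diag[OF fin_zero] inc_def)
  show "AE x in lborel. (%n. T n (u x)) ~> max 0 (u x - c)"
  proof (rule AE_I2)
   fix x
   have "(%n. T n (u x)) ~> (u x + sqrt ((u x - c)^2 + 0^2) - sqrt (c^2 + 0^2)) / 2"
    unfolding T_def by (intro tendsto_intros LIMSEQ_Suc[OF lim_1_over_n]) simp
   also have "(u x + sqrt ((u x - c)^2 + 0^2) - sqrt (c^2 + 0^2)) / 2 = max 0 (u x - c)"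
    using c by (simp add: max_def abs_if)
   finally show "(%n. T n (u x)) ~> max 0 (u x - c)" .
  qed
  show "\<bar>T n (u x)\<bar> <= \<bar>u x\<bar>" for n x using Lip[of n "u x" 0] T0 by simp
  show "\<bar>inc (%x. T n (u x)) p\<bar> <= \<bar>inc u p\<bar>" for n p using Lip by (simp add: inc_def)
  show "\<bar>inc (%x. max 0 (u x - c)) p\<bar> <= \<bar>inc u p\<bar>" for p
   by (simp add: inc_def)
  show "\<bar>max 0 (u x - c)\<bar> <= \<bar>u x\<bar>" for x using c by simp
 qed (use fu in auto)
qed

text \<open>Stampacchia's argument: test with g = max 0 (u - B/l). Increments of u and of its
  monotone truncation g never have opposite signs, so the energy term may be dropped, and g^2 has
  integral at most 0.\<close>

lemma resolvent_upper_bound: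
 assumes f: "sqint m f" and l: "l > 0" and u: "is_resolvent m J l f u" and B: "!!x. f x <= B" "B >= 0"
 shows "AE x in m. u x <= B / l"
proof -
 define g where "g x = max 0 (u x - B / l)" for x
 have ud: "u : dom" using u by (rule is_resolventD)
 have gd: "g : dom" unfolding g_def using ud B l by (intro dom_excess) auto
 have fu: "fin u" "fin g" using ud gd by (auto intro: dom_fin)
 have i: "integrable m (%x. u x * g x)" "integrable m (%x. f x * g x)" "integrable m (%x. (g x)^2)"
  using sqint_mult[OF finD(3)[OF fu(1)] finD(3)[OF fu(2)]]
   sqint_mult[OF f finD(3)[OF fu(2)]] finD(3)[OF fu(2)] by auto
 have "0 <= (LINT p|jump_measure J. inc u p * inc g p)"
 proof (rule bint_nonneg)
  fix p show "0 <= inc u p * inc g p"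
   by (auto simp: inc_def g_def max_def zero_le_mult_iff)
 qed
 then have "l * (LINT x|m. u x * g x) <= (LINT x|m. f x * g x)"
  using is_resolventD(2)[OF u gd] by (simp add: Q_eq[OF fu])
 moreover have "(LINT x|m. l * (g x)^2) <= (LINT x|m. l * (u x * g x) - f x * g x)"
 proof (rule integral_mono)
  fix x
  have "l * (g x)^2 = (l * u x - B) * g x" using l by (auto simp: g_def max_def power2_eq_square field_simps)
  also have "... <= (l * u x - f x) * g x" using B by (intro mult_right_mono) (auto simp: g_def)
  finally show "l * (g x)^2 <= l * (u x * g x) - f x * g x" by (simp add: algebra_simps)
 qed (use i in auto)
 ultimately have "l * (LINT x|m. (g x)^2) <= 0" using i by simp
 then have "(LINT x|m. (g x)^2) <= 0" using l by (simp add: mult_le_0_iff)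
 then have "(LINT x|m. (g x)^2) = 0" by (simp add: order_antisym)
 then have "AE x in m. (g x)^2 = 0" using integral_nonneg_eq_0_iff_AE[OF i(3)] by simp
 then show ?thesis by eventually_elim (auto simp: g_def max_def split: if_splits)
qed

lemma is_resolvent_uminus:
 assumes "is_resolvent m J l f u"
 shows "is_resolvent m J l (%x. - f x) (%x. - u x)"
proof -
 have u: "u : dom" using assms by (rule is_resolventD)
 have "Q l (%x. - u x) g = - Q l u g" if "g : dom" for g
  using Q_lincomb[OF fin_zero dom_fin[OF u] dom_fin[OF that], of l "-1"]
   Q_lincomb[OF fin_zero fin_zero dom_fin[OF that], of l 1] by simp
 then show ?thesis
  using assms dom_cmult[OF u, of "-1"] unfolding is_resolvent_def form_domain_eq
  by (auto simp: Q_def)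
qed

lemma resolvent_bound:
 assumes f: "sqint m f" and l: "l > 0" and u: "is_resolvent m J l f u" and B: "!!x. \<bar>f x\<bar> <= B"
 shows "AE x in m. \<bar>u x\<bar> <= B / l"
proof -
 have B0: "B >= 0" using B[of undefined] by linarith
 have "AE x in m. u x <= B / l" by (rule resolvent_upper_bound[OF f l u _ B0]) (use B abs_le_D1 in blast)
 moreover have "AE x in m. - u x <= B / l"
  by (rule resolvent_upper_bound[OF _ l is_resolvent_uminus[OF u] _ B0])
    (use sqint_cmult[OF f, of "-1"] B abs_le_D2 in auto)
 ultimately show ?thesis by eventually_elim simp
qed

end

section \<open>Translation-invariant kernels\<close>

lemma abs_le_imp_sq_le: "\<bar>a\<bar> <= b ==> a^2 <= (b::real)^2"
 by (metis abs_ge_zero power2_abs power_mono)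

lemma min_one_sq: "0 <= t ==> (min 1 t)^2 = min 1 ((t::real)^2)"
proof (cases "t <= 1")
 case False
 then have "1 <= t^2" using power_mono[of 1 t 2] by simp
 then show ?thesis using False by simp
qed (simp add: power_le_one)

lemma nn_integral_lborel_translate:
 fixes c :: "'a::euclidean_space"
 assumes [measurable]: "f : Borel"
 shows "(nnint (%x. f (c + x))) = (nnint (%x. f x))"
proof -
 have "(nnint (%x. f x)) = (nn_integral (distr lborel borel ((+) c)) (%x. f x))" by (simp add: lborel_distr_plus)
 also have "... = (nnint (%x. f (c + x)))" by (rule nn_integral_distr) measurable
 finally show ?thesis by simp
qed

lemma integrable_lborel_translate:
 fixes c :: "'a::euclidean_space" and f :: "'a => real"
 assumes f: "integrable lborel f"
 shows "integrable lborel (%x. f (c + x))" "(LBINT x. f (c + x)) = (LBINT x. f x)"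
proof -
 have [measurable]: "f : Borel" using f by auto
 have "integrable (distr lborel borel ((+) c)) f" using f by (simp add: lborel_distr_plus)
 then show "integrable lborel (%x. f (c + x))" by (subst (asm) integrable_distr_eq) simp_all
 have "(LBINT x. f x) = (LINT x|distr lborel borel ((+) c). f x)" by (simp add: lborel_distr_plus)
 also have "... = (LBINT x. f (c + x))" by (rule integral_distr) simp_all
 finally show "(LBINT x. f (c + x)) = (LBINT x. f x)" by simp
qed

lemma nn_integral_lborel_reflect:
 fixes c :: "'a::euclidean_space"
 assumes [measurable]: "f : Borel"
 shows "(nnint (%x. f (c - x))) = (nnint (%x. f x))"
proof -
 have e: "(lborel :: 'a measure) = distr lborel borel (%x. c - x)"
  using lborel_affine[of "-1" c] by (simp add: density_1)
 have "(nnint (%x. f x)) = (nn_integral (distr lborel borel (%x. c - x)) (%x. f x))" using e by simp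
 also have "... = (nnint (%x. f (c - x)))" by (rule nn_integral_distr) measurable
 finally show ?thesis by simp
qed

lemma integral_lborel_reflect:
 fixes c :: "'a::euclidean_space" and f :: "'a => real"
 assumes [measurable]: "f : Borel"
 shows "(LBINT x. f (c - x)) = (LBINT x. f x)"
proof -
 have e: "(lborel :: 'a measure) = distr lborel borel (%x. c - x)"
  using lborel_affine[of "-1" c] by (simp add: density_1)
 have "(LBINT x. f x) = (LINT x|distr lborel borel (%x. c - x). f x)" using e by simp
 also have "... = (LBINT x. f (c - x))" by (rule integral_distr) measurable
 finally show ?thesis by simp
qed

section \<open>Continuity of translations in L1\<close>

definition translation_continuous :: "('a::euclidean_space => real) => bool" where
 "translation_continuous u \<longleftrightarrow> (\<forall>h. h ~> 0 \<longrightarrow> (%n. LBINT x. \<bar>u (h n + x) - u x\<bar>) ~> 0)"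

lemma translation_continuous_approx:
 assumes u: "integrable lborel u"
  and ap: "!!e. e > 0 ==> \<exists>v. integrable lborel v \<and> translation_continuous v \<and> (LBINT x. \<bar>u x - v x\<bar>) < e"
 shows "translation_continuous u"
 unfolding translation_continuous_def
proof (intro allI impI LIMSEQ_I)
 fix h :: "nat => 'a" and e :: real assume h: "h ~> 0" and e: "e > 0"
 obtain v where v: "integrable lborel v" "translation_continuous v" "(LBINT x. \<bar>u x - v x\<bar>) < e / 3"
  using ap[of "e / 3"] e by auto
 have "(%n. LBINT x. \<bar>v (h n + x) - v x\<bar>) ~> 0" using v(2) h by (simp add: translation_continuous_def)
 from order_tendstoD(2)[OF this, of "e / 3"] e obtain N
  where N: "!!n. n >= N ==> (LBINT x. \<bar>v (h n + x) - v x\<bar>) < e / 3" by (auto simp: eventually_sequentially)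
 have "norm ((LBINT x. \<bar>u (h n + x) - u x\<bar>) - 0) < e" if n: "n >= N" for n
 proof -
  note iu = integrable_lborel_translate(1)[OF u, of "h n"] and iv = integrable_lborel_translate(1)[OF v(1), of "h n"]
  have d: "integrable lborel (%x. \<bar>u x - v x\<bar>)" using u v(1) by simp
  have "(LBINT x. \<bar>u (h n + x) - u x\<bar>)
   <= (LBINT x. \<bar>u (h n + x) - v (h n + x)\<bar> + \<bar>v (h n + x) - v x\<bar> + \<bar>u x - v x\<bar>)"
   using u v(1) iu iv by (intro integral_mono) auto
  also have "... = (LBINT x. \<bar>u (h n + x) - v (h n + x)\<bar>) + (LBINT x. \<bar>v (h n + x) - v x\<bar>) + (LBINT x. \<bar>u x - v x\<bar>)"
   using u v(1) iu iv by simp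
  also have "(LBINT x. \<bar>u (h n + x) - v (h n + x)\<bar>) = (LBINT x. \<bar>u x - v x\<bar>)"
   by (rule integrable_lborel_translate(2)[OF d])
  finally show ?thesis using v(3) N[OF n] by simp
 qed
 then show "\<exists>N. \<forall>n\<ge>N. norm ((LBINT x. \<bar>u (h n + x) - u x\<bar>) - 0) < e" by blast
qed

text \<open>Openness makes the loss max 0 (1_U(x) - 1_U(x + h)) tend to 0 pointwise, below the
  integrable 1_U. By translation invariance gain and loss have the same integral, so the L1 distance
  is twice the loss.\<close>

lemma translation_continuous_indicator_open:
 fixes U :: "'a::euclidean_space set"
 assumes U: "open U" "emeasure lborel U < \<infinity>"
 shows "translation_continuous (%x. ind U x :: real)"
 unfolding translation_continuous_def
proof (intro allI impI)
 fix h :: "nat => 'a" assume h: "h ~> 0"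
 have [measurable]: "U : sets borel" using U by simp
 let ?v = "%x. ind U x :: real"
 have i: "integrable lborel ?v" using U by (intro integrable_real_indicator) auto
 note it = integrable_lborel_translate[OF i]
 define w where "w n x = max 0 (?v x - ?v (h n + x))" for n x
 have wi: "integrable lborel (w n)" for n unfolding w_def using i it(1) by (intro integrable_max) auto
 have "(%n. LBINT x. w n x) ~> integral\<^sup>L lborel (%_::'a. 0)"
 proof (rule integral_dominated_convergence[where w="?v"])
  show "AE x in lborel. (%n. w n x) ~> 0"
  proof (rule AE_I2)
   fix x
   show "(%n. w n x) ~> 0"
   proof (cases "x : U")
    case True
    have "(%n. h n + x) ~> 0 + x" using h by (intro tendsto_intros)
    then have "eventually (%n. h n + x : U) sequentially" using True U(1) topological_tendstoD by fastforce
    then have "eventually (%n. w n x = 0) sequentially" by eventually_elim (simp add: w_def indicator_def)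
    then show ?thesis by (rule tendsto_eventually)
   next
    case False
    then have "w n x = 0" for n by (simp add: w_def indicator_def)
    then show ?thesis by simp
   qed
  qed
  show "AE x in lborel. norm (w n x) <= ?v x" for n
   by (rule AE_I2) (simp add: w_def indicator_def)
 qed (use i wi in auto)
 then have "(%n. 2 * (LBINT x. w n x)) ~> 2 * 0" by (intro tendsto_mult_left) simp
 moreover have "(LBINT x. \<bar>?v (h n + x) - ?v x\<bar>) = 2 * (LBINT x. w n x)" for n
 proof -
  have "(LBINT x. \<bar>?v (h n + x) - ?v x\<bar>) = (LBINT x. 2 * w n x + (?v (h n + x) - ?v x))"
   by (intro bint_cong) (auto simp: w_def split: split_indicator)
  also have "... = 2 * (LBINT x. w n x) + ((LBINT x. ?v (h n + x)) - (LBINT x. ?v x))"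
   using wi i it(1) by simp
  finally show ?thesis using it(2)[of "h n"] by linarith
 qed
 ultimately show "(%n. LBINT x. \<bar>?v (h n + x) - ?v x\<bar>) ~> 0" by simp
qed

text \<open>By outer regularity the indicator is L1 close to that of an open superset of finite
  measure.\<close>

lemma translation_continuous_indicator:
 fixes A :: "'a::euclidean_space set"
 assumes A: "A : sets borel" "emeasure lborel A < \<infinity>"
 shows "translation_continuous (%x. ind A x :: real)"
proof (rule translation_continuous_approx)
 show "integrable lborel (%x. ind A x :: real)" using A by (intro integrable_real_indicator) auto
 fix e :: real assume e: "e > 0"
 obtain U where U: "open U" "A \<subseteq> U" "emeasure lborel (U - A) < ennreal e"
  using outer_regular_lborel[OF A(1) e] by metis
 have Um: "U : sets borel" using U by simp
 have "emeasure lborel U = emeasure lborel A + emeasure lborel (U - A)"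
  using emeasure_Un[of A lborel "U - A"] U(2) A(1) Um plus_emeasure[of A lborel "U - A"]
  by (metis Diff_disjoint Diff_partition sets.Diff sets_lborel)
 also have "... < \<infinity>" using A(2) U(3) by (simp add: less_trans[OF U(3)])
 finally have fin: "emeasure lborel U < \<infinity>" .
 have "(LBINT x. \<bar>ind A x - ind U x :: real\<bar>) = (LBINT x. ind (U - A) x)"
  using U(2) by (intro bint_cong) (auto split: split_indicator)
 also have "... = measure lborel (U - A)" by simp
 also have "... < e" using U(3) e by (simp add: measure_def enn2real_less_iff less_trans[OF U(3)])
 finally show "\<exists>v. integrable lborel v \<and> translation_continuous v \<and> (LBINT x. \<bar>ind A x - v x\<bar>) < e"
  using translation_continuous_indicator_open[OF U(1) fin] Um fin
  by (intro exI[of _ "ind U"]) (auto intro: integrable_real_indicator)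
qed

lemma integrable_translation_continuous:
 assumes "integrable lborel u"
 shows "translation_continuous u"
 using assms
proof (induction rule: integrable_induct)
 case (base A c)
 have "(%n. LBINT x. \<bar>ind A (h n + x) *\<^sub>R c - ind A x *\<^sub>R c\<bar>) ~> 0" if h: "h ~> 0" for h
 proof -
  have "(%n. \<bar>c\<bar> * (LBINT x. \<bar>ind A (h n + x) - ind A x\<bar>)) ~> \<bar>c\<bar> * 0"
   using translation_continuous_indicator[of A] base h
   by (intro tendsto_mult_left) (simp add: translation_continuous_def)
  moreover have "\<bar>ind A (h n + x) *\<^sub>R c - ind A x *\<^sub>R c\<bar> = \<bar>c\<bar> * \<bar>ind A (h n + x) - ind A x\<bar>" for n x
   by (simp add: abs_mult[symmetric] algebra_simps)
  ultimately show ?thesis by simp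
 qed
 then show ?case by (simp add: translation_continuous_def)
next
 case (add f g)
 show ?case unfolding translation_continuous_def
 proof (intro allI impI)
  fix h :: "nat => 'a" assume h: "h ~> 0"
  note i = add.hyps integrable_lborel_translate(1)[OF add.hyps(1)] integrable_lborel_translate(1)[OF add.hyps(2)]
  have lim: "(%n. (LBINT x. \<bar>f (h n + x) - f x\<bar>) + (LBINT x. \<bar>g (h n + x) - g x\<bar>)) ~> 0"
   using tendsto_add[of "%n. LBINT x. \<bar>f (h n + x) - f x\<bar>" 0 _ "%n. LBINT x. \<bar>g (h n + x) - g x\<bar>" 0]
    add.IH h by (simp add: translation_continuous_def)
  have "(LBINT x. \<bar>f (h n + x) + g (h n + x) - (f x + g x)\<bar>)
   <= (LBINT x. \<bar>f (h n + x) - f x\<bar>) + (LBINT x. \<bar>g (h n + x) - g x\<bar>)" for n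
  proof -
   have "(LBINT x. \<bar>f (h n + x) + g (h n + x) - (f x + g x)\<bar>)
    <= (LBINT x. \<bar>f (h n + x) - f x\<bar> + \<bar>g (h n + x) - g x\<bar>)"
    using i by (intro integral_mono) auto
   then show ?thesis using i by simp
  qed
  then show "(%n. LBINT x. \<bar>f (h n + x) + g (h n + x) - (f x + g x)\<bar>) ~> 0"
   by (intro tendsto_sandwich[OF always_eventually always_eventually tendsto_const lim]) auto
 qed
next
 case (lim f s)
 show ?case
 proof (rule translation_continuous_approx[OF lim(4)])
  fix e :: real assume e: "e > 0"
  have "(%i. LBINT x. \<bar>f x - s i x\<bar>) ~> integral\<^sup>L lborel (%_::'a. 0)"
  proof (rule integral_dominated_convergence[where w="%x. 3 * \<bar>f x\<bar>"])
   show "AE x in lborel. (%i. \<bar>f x - s i x\<bar>) ~> 0"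
   proof (rule AE_I2)
    fix x
    have "(%i. \<bar>f x - s i x\<bar>) ~> \<bar>f x - f x\<bar>" using lim(2)[of x] by (intro tendsto_intros) simp
    then show "(%i. \<bar>f x - s i x\<bar>) ~> 0" by simp
   qed
   show "AE x in lborel. norm \<bar>f x - s i x\<bar> <= 3 * \<bar>f x\<bar>" for i
   proof (rule AE_I2, goal_cases)
    case (1 x)
    show ?case using lim(3)[of x i] by simp
   qed
  qed (use lim(1,4) in auto)
  then have "(%i. LBINT x. \<bar>f x - s i x\<bar>) ~> 0" by simp
  from order_tendstoD(2)[OF this e] obtain i where "(LBINT x. \<bar>f x - s i x\<bar>) < e"
   by (auto simp: eventually_sequentially)
  then show "\<exists>v. integrable lborel v \<and> translation_continuous v \<and> (LBINT x. \<bar>f x - v x\<bar>) < e"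
   using lim(1,5) by blast
 qed
qed

text \<open>For a bounded function the squared difference is at most 2 B times the absolute one, so
  L1 continuity suffices.\<close>

lemma translation_continuous_sq:
 fixes u :: "'a::euclidean_space => real"
 assumes u: "integrable lborel u" and B: "!!x. \<bar>u x\<bar> <= B" and h: "h ~> 0"
 shows "(%n. nnint (%x. ennreal ((u (h n + x) - u x)^2))) ~> 0"
proof -
 let ?A = "%n. ennreal (2 * B * (LBINT x. \<bar>u (h n + x) - u x\<bar>))"
 have "?A ~> ennreal (2 * B * 0)"
  using integrable_translation_continuous[OF u] h
  by (intro tendsto_ennrealI tendsto_mult_left) (simp add: translation_continuous_def)
 then have z: "?A ~> 0" by simp
 have le: "(nnint (%x. ennreal ((u (h n + x) - u x)^2))) <= ennreal (2 * B * (LBINT x. \<bar>u (h n + x) - u x\<bar>))" for n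
 proof -
  have "(nnint (%x. ennreal ((u (h n + x) - u x)^2))) <= (nnint (%x. ennreal (2 * B * \<bar>u (h n + x) - u x\<bar>)))"
  proof (intro nn_integral_mono ennreal_leI)
   fix x
   have "\<bar>u (h n + x) - u x\<bar> <= 2 * B" using B[of x] B[of "h n + x"] by linarith
   then have "\<bar>u (h n + x) - u x\<bar> * \<bar>u (h n + x) - u x\<bar> <= 2 * B * \<bar>u (h n + x) - u x\<bar>"
    by (intro mult_right_mono) auto
   then show "(u (h n + x) - u x)^2 <= 2 * B * \<bar>u (h n + x) - u x\<bar>" by (simp add: power2_eq_square)
  qed
  also have "... = ennreal (LBINT x. 2 * B * \<bar>u (h n + x) - u x\<bar>)"
   using u integrable_lborel_translate(1)[OF u] B[of 0]
   by (intro nn_integral_eq_integral) auto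
  finally show ?thesis by simp
 qed
 show ?thesis
  by (rule tendsto_sandwich[OF _ _ tendsto_const z]) (use le in auto)
qed

text \<open>Cauchy-Schwarz for sqrt \<open>rh\<close> and sqrt \<open>rh\<close> times g, where
  \<open>rh\<close> is a probability density.\<close>

lemma weighted_Jensen_sq:
 fixes rh g :: "'a => real"
 assumes rh: "integrable M rh" "!!t. 0 <= rh t" "(LINT t|M. rh t) = 1"
  and [measurable]: "g : borel_measurable M" and g: "!!t. \<bar>g t\<bar> <= B"
 shows "ennreal ((LINT t|M. rh t * g t)^2) <= (nn_integral M (%t. ennreal (rh t) * ennreal ((g t)^2)))"
proof -
 have [measurable]: "rh : borel_measurable M" using rh by auto
 have i: "integrable M (%t. rh t * (g t)^2)"
 proof (rule bint_bound[of _ "%t. B^2 * rh t"])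
  show "AE t in M. norm (rh t * (g t)^2) <= norm (B^2 * rh t)"
  proof (rule AE_I2, goal_cases)
   case (1 t)
   have "(g t)^2 <= B^2" using g[of t] by (rule abs_le_imp_sq_le)
   then show ?case
    using rh(2)[of t] by (simp add: abs_mult mult.commute[of "rh t"] mult_right_mono)
  qed
 qed (use rh in auto)
 have 1: "sqint M (%t. sqrt (rh t))" unfolding sqint_def using rh by simp
 have 2: "sqint M (%t. sqrt (rh t) * g t)" unfolding sqint_def using rh(2) i by (simp add: power_mult_distrib)
 have "(LINT t|M. sqrt (rh t) * (sqrt (rh t) * g t))^2 <= (LINT t|M. (sqrt (rh t))^2) * (LINT t|M. (sqrt (rh t) * g t)^2)"
  by (rule Cauchy_Schwarz_integral_sq[OF 1 2])
 then have "(LINT t|M. rh t * g t)^2 <= (LINT t|M. rh t * (g t)^2)"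
  using rh by (simp add: power_mult_distrib mult.assoc[symmetric])
 then have "ennreal ((LINT t|M. rh t * g t)^2) <= ennreal (LINT t|M. rh t * (g t)^2)" by (rule ennreal_leI)
 also have "... = (nn_integral M (%t. ennreal (rh t * (g t)^2)))"
  using i rh(2) by (intro nn_integral_eq_integral[symmetric]) auto
 also have "... = (nn_integral M (%t. ennreal (rh t) * ennreal ((g t)^2)))"
  using rh(2) by (simp add: ennreal_mult)
 finally show ?thesis .
qed

section \<open>Levy kernels and density of smooth functions\<close>

locale levy_kernel =
 fixes nu :: "'a::euclidean_space => real"
 assumes nu_measurable [measurable]: "nu : Borel"
  and nu_nonneg: "!!z. 0 <= nu z"
  and nu_levy: "(nnint (%z. ennreal (min 1 ((norm z)^2) * nu z))) < \<infinity>"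
begin

sublocale jump_space lborel "%x y. nu (x - y)"
 by standard (auto simp: jump_kernel_def nu_nonneg)

text \<open>Density of the jump vectors, carrying the factor 1/2 of
  \<open>jump_measure\<close>.\<close>

definition w :: "'a => ennreal" where "w z = ennreal (ind (- {0}) z * nu z / 2)"

lemma w_measurable [measurable]: "w : Borel"
 unfolding w_def by measurable

text \<open>Fubini after the substitution x = y + z, which separates the jump vector from the
  starting point.\<close>

lemma jump_measure_nn_integral:
 assumes [measurable]: "G : Borel2"
 shows "(nn_integral (jump_measure (%x y. nu (x - y))) (%p. G p)) = (nnint (%z. w z * (nnint (%y. G (y + z, y)))))"
proof -
 have "(nn_integral (jump_measure (%x y. nu (x - y))) (%p. G p))
  = (nn_integral lborel2 (%p. ennreal (ind (- Id) p * nu (fst p - snd p) / 2) * G p))"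
  unfolding jump_measure_def by (rule nn_integral_density) measurable
 also have "... = (nn_integral lborel2 (%p. w (fst p - snd p) * G p))"
  by (intro nn_integral_cong) (auto simp: w_def indicator_def)
 also have "... = (nnint (%y. nnint (%x. w (x - y) * G (x, y))))"
  by (subst lborel_pair.nn_integral_snd[symmetric]) (auto simp: case_prod_unfold)
 also have "... = (nnint (%y. nnint (%z. w z * G (y + z, y))))"
 proof (rule nn_integral_cong, goal_cases)
  case (1 y)
  show ?case
   using nn_integral_lborel_translate[of "%x. w (x - y) * G (x, y)" y] by simp
 qed
 also have "... = (nnint (%z. nnint (%y. w z * G (y + z, y))))"
  by (rule lborel_pair.Fubini') measurable
 also have "... = (nnint (%z. w z * (nnint (%y. G (y + z, y)))))"
  by (intro nn_integral_cong nn_integral_cmult) measurable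
 finally show ?thesis .
qed

lemma w_levy: "(nnint (%z. w z * ennreal (min 1 ((norm z)^2)))) < \<infinity>"
proof -
 have "(nnint (%z. w z * ennreal (min 1 ((norm z)^2)))) <= (nnint (%z. ennreal (min 1 ((norm z)^2) * nu z)))"
 proof (rule nn_integral_mono, goal_cases)
  case (1 z)
  show ?case
   using nu_nonneg[of z] by (auto simp: w_def ennreal_mult'[symmetric] indicator_def mult.commute intro!: ennreal_leI mult_left_mono)
 qed
 with nu_levy show ?thesis by (simp add: le_less_trans)
qed

lemma energy_levy:
 assumes [measurable]: "f : Borel"
 shows "jump_energy (%x y. nu (x - y)) f = (nnint (%z. w z * (nnint (%y. ennreal ((f (y + z) - f y)^2)))))"
 unfolding jump_energy_eq[OF kernel assms]
 by (subst jump_measure_nn_integral) (simp_all add: inc_def)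

lemma Cc_fin:
 assumes j: "j : Cc (Suc k)"
 shows "fin j"
proof -
 obtain R where R: "R > 0" "!!x. norm x > R ==> j x = 0" using Cc_support[OF j] by metis
 obtain B where B: "B >= 0" "!!x. \<bar>j x\<bar> <= B" using Cc_bounded[OF j] by metis
 obtain L where L: "L >= 0" "!!x y. \<bar>j x - j y\<bar> <= L * norm (x - y)" using Cc_Lipschitz[OF j] by metis
 have [measurable]: "j : Borel" using j by (rule Cc_measurable)
 \<comment> \<open>Squared increments are at most c min(1, |z|^2), by the Lipschitz bound for short
   jumps and by boundedness for long ones, and they vanish unless an endpoint lies in the
   ball.\<close>
 define c where "c = (max (2 * B) L)^2"
 have inner: "(nnint (%y. ennreal ((j (y + z) - j y)^2)))
   <= ennreal (2 * c * measure lborel (cball (0::'a) R)) * ennreal (min 1 ((norm z)^2))" for z :: 'a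
 proof -
  have pt: "ennreal ((j (y + z) - j y)^2)
   <= ennreal (c * min 1 ((norm z)^2)) * (ind (cball 0 R) (z + y) + ind (cball 0 R) y)" for y
  proof -
   have "\<bar>j (y + z) - j y\<bar> <= max (2 * B) L * min 1 (norm z)"
   proof (cases "norm z <= 1")
    case True
    have "\<bar>j (y + z) - j y\<bar> <= L * norm z" using L(2)[of "y + z" y] by simp
    also have "... <= max (2 * B) L * norm z" by (intro mult_right_mono) auto
    finally show ?thesis using True by simp
   next
    case False
    have "\<bar>j (y + z) - j y\<bar> <= 2 * B" using B(2)[of "y + z"] B(2)[of y] by linarith
    then show ?thesis using False by simp
   qed
   then have "(j (y + z) - j y)^2 <= (max (2 * B) L * min 1 (norm z))^2"
    by (rule abs_le_imp_sq_le)
   also have "... = c * min 1 ((norm z)^2)"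
    by (simp add: c_def power_mult_distrib min_one_sq)
   finally have le: "(j (y + z) - j y)^2 <= c * min 1 ((norm z)^2)" .
   have c0: "0 <= c * min 1 ((norm z)^2)" by (simp add: c_def)
   show ?thesis
   proof (cases "norm (z + y) <= R \<or> norm y <= R")
    case True
    then have "(1::ennreal) <= ind (cball 0 R) (z + y) + ind (cball 0 R) y"
     by (auto simp: indicator_def)
    from mult_left_mono[OF this, of "ennreal (c * min 1 ((norm z)^2))"]
    show ?thesis using ennreal_leI[OF le] by (auto intro: order_trans)
   next
    case False
    then show ?thesis using R(2)[of "y + z"] R(2)[of y] by (simp add: add.commute)
   qed
  qed
  have "(nnint (%y. ennreal ((j (y + z) - j y)^2)))
   <= (nnint (%y. ennreal (c * min 1 ((norm z)^2)) * (ind (cball 0 R) (z + y) + ind (cball 0 R) y)))"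
   by (rule nn_integral_mono) (rule pt)
  also have "... = ennreal (c * min 1 ((norm z)^2)) *
    ((nnint (%y. ind (cball 0 R) (z + y))) + (nnint (%y. ind (cball 0 R) (y::'a))))"
  proof -
   have [measurable]: "(%y. ind (cball 0 R) (z + y) :: ennreal) : Borel"
    by (rule measurable_compose[of "%y. z + y" borel borel "ind (cball 0 R)"])
     (auto intro!: borel_measurable_indicator borel_closed)
   have [measurable]: "(ind (cball (0::'a) R) :: 'a => ennreal) : Borel"
    by (intro borel_measurable_indicator borel_closed closed_cball)
   show ?thesis by (subst nn_integral_cmult, measurable) (subst nn_integral_add, auto)
  qed
  also have "(nnint (%y. ind (cball 0 R) (z + y))) = (nnint (%y. ind (cball 0 R) (y::'a)))"
   by (rule nn_integral_lborel_translate) (intro borel_measurable_indicator borel_closed closed_cball)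
  also have "(nnint (%y. ind (cball 0 R) (y::'a))) = ennreal (measure lborel (cball (0::'a) R))"
  proof -
   have "emeasure lborel (cball (0::'a) R) \<noteq> top"
    using emeasure_bounded_finite[of "cball (0::'a) R"] by (simp add: less_top)
   then have "emeasure lborel (cball (0::'a) R) = ennreal (measure lborel (cball (0::'a) R))"
    by (rule emeasure_eq_ennreal_measure)
   then show ?thesis by simp
  qed
  also have "ennreal (c * min 1 ((norm z)^2)) * (ennreal (measure lborel (cball (0::'a) R)) + ennreal (measure lborel (cball (0::'a) R)))
   = ennreal (2 * c * measure lborel (cball (0::'a) R)) * ennreal (min 1 ((norm z)^2))"
   by (simp add: c_def ennreal_mult[symmetric] ennreal_plus[symmetric] mult_ac del: ennreal_plus)
  finally show ?thesis .
 qed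
 have "jump_energy (%x y. nu (x - y)) j
   <= (nnint (%z. ennreal (2 * c * measure lborel (cball (0::'a) R)) * (w z * ennreal (min 1 ((norm z)^2)))))"
  unfolding energy_levy[OF Cc_measurable[OF j]]
  by (rule nn_integral_mono) (use mult_left_mono[OF inner] in \<open>auto simp: mult_ac\<close>)
 also have "... < \<infinity>"
  using w_levy by (simp add: nn_integral_cmult ennreal_mult_less_top)
 finally have 1: "jump_energy (%x y. nu (x - y)) j < \<infinity>" .
 have "integrable lborel (%x. (j x)^2)"
 proof (rule bounded_Borel_integrable)
  show "\<bar>(j x)^2\<bar> <= B^2" for x using abs_le_imp_sq_le[OF B(2)[of x]] by simp
 qed (use R in auto)
 then have "(nnint (%x. ennreal ((j x)^2))) < \<infinity>" by (simp add: integrable_iff_bounded)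
 with 1 show ?thesis by (simp add: fin_iff[OF Cc_measurable[OF j]])
qed

lemma Cc_inf_dom: "j : Cc_inf ==> j : dom"
 using Cc_dom[OF Cc_inf_Cc[of j 1]] Cc_fin[of j 0] Cc_inf_Cc[of j "Suc 0"] by simp

text \<open>Besides a factor on the increments of u, cutting off produces u(y) times an increment of
  the cutoff. Its square is at most u(y)^2 min(1, |x - y|^2), which is integrable by the Levy
  condition, so dominated convergence applies.\<close>

lemma cutoff_approx:
 assumes u: "fin u" and e: "e > 0"
 obtains v R where "fin v" "!!x. norm x > R ==> v x = 0" "!!x. \<bar>v x\<bar> <= \<bar>u x\<bar>"
  "QQ 1 (%x. v x - u x) < e"
proof -
 have [measurable]: "u : Borel" using u by (rule finD)
 \<comment> \<open>Equals 1 up to radius n + 1 and 0 from radius 2 (n + 1) on, with Lipschitz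
   constant at most 1.\<close>
 define cut where "cut n x = max 0 (min 1 (2 - norm x / real (Suc n)))" for n and x :: 'a
 have cut01: "0 <= cut n x" "cut n x <= 1" for n x by (auto simp: cut_def)
 have [measurable]: "cut n : Borel" for n unfolding cut_def by measurable
 have cutL: "\<bar>cut n x - cut n y\<bar> <= norm (x - y)" for n x y
 proof -
  have "\<bar>norm x / real (Suc n) - norm y / real (Suc n)\<bar> = \<bar>norm x - norm y\<bar> / real (Suc n)"
   by (simp add: diff_divide_distrib[symmetric] del: of_nat_Suc)
  also have "... <= \<bar>norm x - norm y\<bar> / 1" by (intro divide_left_mono) auto
  also have "... <= norm (x - y)" using norm_triangle_ineq3[of x y] by simp
  finally have "\<bar>norm x / real (Suc n) - norm y / real (Suc n)\<bar> <= norm (x - y)" .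
  moreover have "\<bar>max 0 (min 1 (2 - a)) - max 0 (min 1 (2 - b))\<bar> <= \<bar>a - b\<bar>" for a b :: real
   by (auto simp: max_def min_def)
  ultimately show ?thesis unfolding cut_def by (rule order_trans[rotated])
 qed
 have cutlim: "(%n. cut n x) ~> 1" for x
 proof (rule tendsto_eventually)
  obtain N :: nat where N: "norm x <= real N" using real_arch_simple by blast
  show "eventually (%n. cut n x = 1) sequentially"
   using eventually_ge_at_top[of N]
  proof eventually_elim
   case (elim n)
   then have "norm x / real (Suc n) <= 1" using N by (simp add: divide_le_eq)
   then show ?case by (simp add: cut_def)
  qed
 qed
 define v where "v n x = u x * cut n x" for n x
 have [measurable]: "v n : Borel" for n unfolding v_def by measurable
 have d: "v n x - u x = u x * (cut n x - 1)" for n x by (simp add: v_def algebra_simps)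
 have vle: "\<bar>v n x\<bar> <= \<bar>u x\<bar>" for n x
  using cut01[of n x] by (simp add: v_def abs_mult mult_left_le)
 let ?J = "jump_measure (%x y. nu (x - y))"
 define b where "b p = 2 * (inc u p)^2 + 2 * ((u (snd p))^2 * min 1 ((norm (fst p - snd p))^2))" for p
 have bound: "(inc (%x. v n x - u x) p)^2 <= b p" for n p
 proof -
  obtain x y where p: "p = (x, y)" by (cases p)
  have e: "inc (%x. v n x - u x) p = (cut n x - 1) * (u x - u y) + u y * (cut n x - cut n y)"
   by (simp add: p inc_def d algebra_simps)
  have 1: "((cut n x - 1) * (u x - u y))^2 <= (u x - u y)^2"
  proof -
   have "(cut n x - 1)^2 <= 1" using cut01[of n x] by (simp add: abs_square_le_1)
   then show ?thesis by (simp add: power_mult_distrib mult_left_le_one_le)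
  qed
  have "\<bar>cut n x - cut n y\<bar> <= min 1 (norm (x - y))" using cutL[of n x y] cut01[of n x] cut01[of n y] by auto
  then have "(cut n x - cut n y)^2 <= (min 1 (norm (x - y)))^2"
   by (rule abs_le_imp_sq_le)
  also have "... = min 1 ((norm (x - y))^2)" by (rule min_one_sq) simp
  finally have 2: "(u y * (cut n x - cut n y))^2 <= (u y)^2 * min 1 ((norm (x - y))^2)"
   by (simp add: power_mult_distrib mult_left_mono)
  have "(a + b)^2 <= 2 * a^2 + 2 * b^2" for a b :: real
   using sum_squares_bound[of a b] by (simp add: power2_sum)
  then have "(inc (%x. v n x - u x) p)^2 <= 2 * ((cut n x - 1) * (u x - u y))^2 + 2 * (u y * (cut n x - cut n y))^2"
   unfolding e .
  then show ?thesis using 1 2 by (simp add: b_def p inc_def)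
 qed
 have tail: "integrable ?J (%p. (u (snd p))^2 * min 1 ((norm (fst p - snd p))^2))"
 proof (subst integrable_iff_bounded, intro conjI)
  have "(nn_integral ?J (%p. ennreal (norm ((u (snd p))^2 * min 1 ((norm (fst p - snd p))^2)))))
   = (nnint (%z. w z * (nnint (%y. ennreal ((u y)^2 * min 1 ((norm z)^2))))))"
   by (subst jump_measure_nn_integral) simp_all
  also have "... = (nnint (%z. (nnint (%y. ennreal ((u y)^2))) * (w z * ennreal (min 1 ((norm z)^2)))))"
   by (intro nn_integral_cong) (simp add: ennreal_mult nn_integral_multc mult_ac)
  also have "... = (nnint (%y. ennreal ((u y)^2))) * (nnint (%z. w z * ennreal (min 1 ((norm z)^2))))"
   by (rule nn_integral_cmult) measurable
  also have "... < \<infinity>" using w_levy finD(3)[OF u] by (simp add: sqint_iff_nn ennreal_mult_less_top)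
  finally show "(nn_integral ?J (%p. ennreal (norm ((u (snd p))^2 * min 1 ((norm (fst p - snd p))^2))))) < \<infinity>" .
 qed measurable
 have bi: "integrable ?J b" unfolding b_def using tail finD(2)[OF u] by (auto dest: sqintD)
 have fd: "fin (%x. v n x - u x)" for n
 proof -
  have "integrable ?J (%p. (inc (%x. v n x - u x) p)^2)"
  proof (rule bint_bound[OF bi])
   show "AE p in ?J. norm ((inc (%x. v n x - u x) p)^2) <= norm (b p)"
   proof (rule AE_I2, goal_cases)
    case (1 p)
    show ?case
     using order_trans[OF bound abs_ge_self, of n p] by simp
   qed
  qed measurable
  moreover have "sqint lborel (%x. v n x - u x)"
   by (rule sqint_bound[OF finD(3)[OF u]]) (use cut01 in \<open>auto simp: d abs_mult intro!: mult_left_le\<close>)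
  ultimately show ?thesis by (auto simp: fin_def sqint_def)
 qed
 have "(%n. LINT p|?J. (inc (%x. v n x - u x) p)^2) ~> integral\<^sup>L ?J (%_. 0)"
 proof (rule integral_dominated_convergence[where w=b])
  show "AE p in ?J. (%n. (inc (%x. v n x - u x) p)^2) ~> 0"
  proof (rule AE_I2, goal_cases)
   case (1 p)
   have "(%n. (u (fst p) * (cut n (fst p) - 1) - u (snd p) * (cut n (snd p) - 1))^2)
     ~> (u (fst p) * (1 - 1) - u (snd p) * (1 - 1))^2"
    by (intro tendsto_intros cutlim)
   then show ?case by (simp add: inc_def d)
  qed
 qed (use bi bound in auto)
 moreover have "(%n. LBINT x. (v n x - u x)^2) ~> integral\<^sup>L lborel (%_::'a. 0)"
 proof (rule integral_dominated_convergence[where w="%x. (u x)^2"])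
  show "AE x in lborel. (%n. (v n x - u x)^2) ~> 0"
  proof (rule AE_I2)
   fix x
   have "(%n. (u x * (cut n x - 1))^2) ~> (u x * (1 - 1))^2" by (intro tendsto_intros cutlim)
   then show "(%n. (v n x - u x)^2) ~> 0" by (simp add: d)
  qed
  show "AE x in lborel. norm ((v n x - u x)^2) <= (u x)^2" for n
  proof (rule AE_I2)
   fix x
   have "(cut n x - 1)^2 <= 1" using cut01[of n x] by (simp add: abs_square_le_1)
   then show "norm ((v n x - u x)^2) <= (u x)^2" by (simp add: d power_mult_distrib mult_left_le)
  qed
 qed (use finD(3)[OF u] in \<open>auto dest: sqintD\<close>)
 ultimately have "(%n. QQ 1 (%x. v n x - u x)) ~> 0"
  unfolding Q_diag[OF fd] using tendsto_add by fastforce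
 from order_tendstoD(2)[OF this e] obtain n where n: "QQ 1 (%x. v n x - u x) < e"
  by (auto simp: eventually_sequentially)
 show ?thesis
 proof (rule that[OF _ _ vle n])
  show "fin (v n)" using fin_add[OF fd[of n] u] by simp
  show "v n x = 0" if "norm x > 2 * real (Suc n)" for x
   using that by (simp add: v_def cut_def field_simps)
 qed
qed

text \<open>Jensen moves the square inside the convolution, so the error in form norm is at most an
  average of translation errors H t over the support of the mollifier, and H is small near
  0.\<close>

lemma mollify_approx:
 assumes v: "fin v" "!!x. norm x > R ==> v x = 0" and B: "!!x. \<bar>v x\<bar> <= B" and e: "e > 0"
 obtains j where "j : Cc_inf" "fin j" "QQ 1 (%x. j x - v x) <= e"
proof -
 have [measurable]: "v : Borel" using v(1) by (rule finD)
 have vi: "integrable lborel v" by (rule bounded_Borel_integrable[OF _ v(2) B]) simp_all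
 have B0: "B >= 0" using B[of 0] by linarith
 define F where "F z y = v (y + z) - v y" for z y
 have [measurable]: "(%p. F (f p) (g p)) : borel_measurable N" if "f : borel_measurable N" "g : borel_measurable N" for f g and N :: "'b measure"
  using that unfolding F_def by measurable
 have Fi: "integrable lborel (F z)" for z
  unfolding F_def using vi integrable_lborel_translate(1)[OF vi, of z] by (auto simp: add.commute)
 have FB: "\<bar>F z y\<bar> <= 2 * B" for z y using B[of y] B[of "y + z"] unfolding F_def by linarith
 define G where "G t z = (nnint (%y. ennreal ((F z (y - t) - F z y)^2)))" for t z
 define G0 where "G0 t = (nnint (%y. ennreal ((v (y - t) - v y)^2)))" for t
 have [measurable]: "G0 : Borel" unfolding G0_def by measurable
 have Gm [measurable]: "(%p. G (f p) (g p)) : borel_measurable N" if "f : borel_measurable N" "g : borel_measurable N" for f g and N :: "'b measure"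
  using that unfolding G_def F_def by measurable
 \<comment> \<open>The squared form norm of v(. - t) - v: G t z collects its increments along z, and
   G0 t is the L2 part.\<close>
 define H where "H t = (nnint (%z. w z * G t z)) + G0 t" for t
 have [measurable]: "H : Borel" unfolding H_def by measurable
 have en: "(nnint (%z. w z * (nnint (%y. ennreal ((F z y)^2))))) < \<infinity>"
  using v(1) fin_iff[of v] unfolding energy_levy[OF finD(1)[OF v(1)]] F_def by simp
 \<comment> \<open>For fixed z this is L2 continuity of translations of the increment F z; four
   times the energy density of v dominates.\<close>
 have Hlim: "(%n. H (t n)) ~> 0" if t: "t ~> 0" for t
 proof -
  have t': "(%n. - t n) ~> 0" using tendsto_minus[OF t] by simp
  have 0: "(%n. G0 (t n)) ~> 0"
   using translation_continuous_sq[OF vi B t'] by (simp add: G0_def)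
  have "(%n. nnint (%z. w z * G (t n) z)) ~> (nn_integral (lborel::'a measure) (%z. 0))"
  proof (rule nn_integral_dominated_convergence[where w="%z. 4 * (w z * (nnint (%y. ennreal ((F z y)^2))))"])
   show "AE z in lborel. (%n. w z * G (t n) z) ~> 0"
   proof (rule AE_I2)
    fix z :: 'a
    have "(%n. G (t n) z) ~> 0"
     using translation_continuous_sq[OF Fi FB t'] by (simp add: G_def)
    then have "(%n. w z * G (t n) z) ~> w z * 0"
     by (intro ennreal_tendsto_cmult) (auto simp: w_def)
    then show "(%n. w z * G (t n) z) ~> 0" by simp
   qed
   show "AE z in lborel. w z * G (t n) z <= 4 * (w z * (nnint (%y. ennreal ((F z y)^2))))" for n
   proof (rule AE_I2, goal_cases)
    case (1 z)
    have "G (t n) z <= (nnint (%y. 2 * ennreal ((F z (- t n + y))^2) + 2 * ennreal ((F z y)^2)))"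
     unfolding G_def
    proof (rule nn_integral_mono, goal_cases)
     case (1 y)
     have "(F z (y - t n) - F z y)^2 <= 2 * (F z (- t n + y))^2 + 2 * (F z y)^2"
      using sum_squares_bound[of "F z (- t n + y)" "- F z y"] by (simp add: power2_diff)
     then have "ennreal ((F z (y - t n) - F z y)^2) <= ennreal (2 * (F z (- t n + y))^2 + 2 * (F z y)^2)"
      by (rule ennreal_leI)
     then show ?case
      by (simp add: ennreal_mult)
    qed
    also have "... = 2 * (nnint (%y. ennreal ((F z (- t n + y))^2))) + 2 * (nnint (%y. ennreal ((F z y)^2)))"
     by (simp add: nn_integral_add nn_integral_cmult)
    also have "(nnint (%y. ennreal ((F z (- t n + y))^2))) = (nnint (%y. ennreal ((F z y)^2)))"
     by (rule nn_integral_lborel_translate) measurable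
    finally have "G (t n) z <= 4 * (nnint (%y. ennreal ((F z y)^2)))"
     by (simp add: distrib_right[symmetric])
    then show ?case
     by (metis mult.left_commute mult_left_mono zero_le)
   qed
   show "(nnint (%z. 4 * (w z * (nnint (%y. ennreal ((F z y)^2)))))) < \<infinity>"
    using en by (simp add: nn_integral_cmult ennreal_mult_less_top)
  qed measurable
  then have "(%n. (nnint (%z. w z * G (t n) z)) + G0 (t n)) ~> 0 + 0"
   by (intro tendsto_add 0) simp
  then show ?thesis by (simp add: H_def)
 qed
 have "eventually (%t. H t < ennreal e) (nhds 0)"
 proof -
  have "eventually (%t. H t < ennreal e) (inf (nhds 0) (principal UNIV))"
  proof (rule sequentially_imp_eventually_nhds_within, intro allI impI, elim conjE)
   fix t :: "nat => 'a" assume "t ~> 0"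
   from order_tendstoD(2)[OF Hlim[OF this]] e show "\<forall>\<^sub>F n in sequentially. H (t n) < ennreal e" by simp
  qed
  then show ?thesis by simp
 qed
 then obtain d where d: "d > 0" "!!t. norm t < d ==> H t < ennreal e"
  by (auto simp: eventually_nhds_metric dist_norm)
 obtain rh :: "'a => real" where rh: "rh : Cc_inf" "!!x. rh x >= 0" "!!x. norm x >= d ==> rh x = 0" "(LBINT x. rh x) = 1"
  using mollifier_exists[OF d(1)] by metis
 have rhi: "integrable lborel rh" using Cc_integrable[OF Cc_inf_Cc[OF rh(1), of 0]] .
 have [measurable]: "rh : Borel" using rhi by auto
 define j where "j = conv v rh"
 have jC: "j : Cc_inf" unfolding j_def by (rule conv_Cc_inf[OF vi v(2) rh(1)])
 have [measurable]: "j : Borel" using Cc_measurable[OF Cc_inf_Cc[OF jC, of 0]] .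
 have vsi: "integrable lborel (%t. rh t * v (x - t))" for x
 proof (rule bint_bound[of _ "%t. B * rh t"])
  show "AE t in lborel. norm (rh t * v (x - t)) <= norm (B * rh t)"
   using B B0 rh(2) by (intro AE_I2) (simp add: abs_mult mult.commute[of "rh _"] mult_right_mono)
 qed (use rhi in auto)
 have jeq: "j x = (LBINT t. rh t * v (x - t))" for x
  unfolding j_def conv_def
  using integral_lborel_reflect[of "%y. v y * rh (x - y)" x] by (simp add: mult.commute)
 \<comment> \<open>Since \<open>rh\<close> has integral 1, the error is an average of translation
   differences.\<close>
 have d0: "j x - v x = (LBINT t. rh t * (v (x - t) - v x))" for x
 proof -
  have "(LBINT t. rh t * (v (x - t) - v x)) = (LBINT t. rh t * v (x - t) - v x * rh t)"
   by (simp add: algebra_simps)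
  also have "... = j x - v x" using vsi[of x] rhi rh(4) by (simp add: jeq)
  finally show ?thesis by simp
 qed
 have d1: "(j (y + z) - v (y + z)) - (j y - v y) = (LBINT t. rh t * (F z (y - t) - F z y))" for y z
 proof -
  have "(LBINT t. rh t * (F z (y - t) - F z y))
    = (LBINT t. (rh t * v (y + z - t) - rh t * v (y - t)) - (v (y + z) - v y) * rh t)"
   by (simp add: F_def algebra_simps)
  also have "... = (j (y + z) - j y) - (v (y + z) - v y)" using vsi rhi rh(4) by (simp add: jeq)
  finally show ?thesis by simp
 qed
 let ?A = "nnint (%x. ennreal ((j x - v x)^2))"
 let ?D = "nnint (%t. ennreal (rh t) * G0 t)"
 have J0: "?A <= ?D"
 proof -
  have "?A <= (nnint (%x. nnint (%t. ennreal (rh t) * ennreal ((v (x - t) - v x)^2))))"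
   unfolding d0
  proof (rule nn_integral_mono, rule weighted_Jensen_sq[OF rhi rh(2) rh(4)])
   fix x t show "\<bar>v (x - t) - v x\<bar> <= 2 * B" using B[of "x - t"] B[of x] by linarith
  qed measurable
  also have "... = (nnint (%t. nnint (%x. ennreal (rh t) * ennreal ((v (x - t) - v x)^2))))"
   by (rule lborel_pair.Fubini') measurable
  also have "... = ?D"
   unfolding G0_def by (intro nn_integral_cong nn_integral_cmult) measurable
  finally show ?thesis .
 qed
 let ?B = "nnint (%t. ennreal (rh t) * (nnint (%z. w z * G t z)))"
 let ?C = "nnint (%z. w z * (nnint (%y. ennreal (((j (y + z) - v (y + z)) - (j y - v y))^2))))"
 have J1: "?C
   <= ?B"
 proof -
  have in1: "(nnint (%y. ennreal (((j (y + z) - v (y + z)) - (j y - v y))^2))) <= (nnint (%t. ennreal (rh t) * G t z))" for z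
  proof -
   have "(nnint (%y. ennreal (((j (y + z) - v (y + z)) - (j y - v y))^2)))
    <= (nnint (%y. nnint (%t. ennreal (rh t) * ennreal ((F z (y - t) - F z y)^2))))"
    unfolding d1
   proof (rule nn_integral_mono, rule weighted_Jensen_sq[OF rhi rh(2) rh(4)])
    fix y t show "\<bar>F z (y - t) - F z y\<bar> <= 4 * B" using FB[of z "y - t"] FB[of z y] by linarith
   qed measurable
   also have "... = (nnint (%t. nnint (%y. ennreal (rh t) * ennreal ((F z (y - t) - F z y)^2))))"
    by (rule lborel_pair.Fubini') measurable
   also have "... = (nnint (%t. ennreal (rh t) * G t z))"
    unfolding G_def by (intro nn_integral_cong nn_integral_cmult) measurable
   finally show ?thesis .
  qed
  have "?C
    <= (nnint (%z. nnint (%t. w z * (ennreal (rh t) * G t z))))"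
  proof (rule nn_integral_mono, goal_cases)
   case (1 z)
   have "w z * (nnint (%t. ennreal (rh t) * G t z)) = (nnint (%t. w z * (ennreal (rh t) * G t z)))"
    by (rule nn_integral_cmult[symmetric]) measurable
   with mult_left_mono[OF in1[of z], of "w z"]
   show ?case
    by simp
  qed
  also have "... = (nnint (%t. nnint (%z. w z * (ennreal (rh t) * G t z))))"
   by (rule lborel_pair.Fubini') measurable
  also have "... = ?B"
  proof (rule nn_integral_cong, goal_cases)
   case (1 t)
   show ?case
    by (subst nn_integral_cmult[symmetric]) (auto simp: mult_ac)
  qed
  finally show ?thesis .
 qed
 have meas: "(%x. j x - v x) : Borel" by measurable
 have "jump_energy (%x y. nu (x - y)) (%x. j x - v x) + ?A
   <= ?B + ?D"
  unfolding energy_levy[OF meas] by (rule add_mono[OF J1 J0])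
 also have "... = (nnint (%t. ennreal (rh t) * H t))"
  unfolding H_def distrib_left by (rule nn_integral_add[symmetric]) measurable
 also have "... <= (nnint (%t. ennreal e * ennreal (rh t)))"
 proof (rule nn_integral_mono, goal_cases)
  case (1 t)
  show ?case
  proof (cases "norm t < d")
   case True
   then show ?thesis using d(2)[OF True] by (simp add: mult.commute[of "ennreal e"] mult_left_mono less_imp_le)
  next
   case False
   then show ?thesis using rh(3)[of t] by simp
  qed
 qed
 also have "... = ennreal e * ennreal (LBINT t. rh t)"
  using rh(2) rhi by (simp add: nn_integral_cmult nn_integral_eq_integral)
 finally have le: "jump_energy (%x y. nu (x - y)) (%x. j x - v x) + ?A <= ennreal e"
  by (simp add: rh(4))
 have fd: "fin (%x. j x - v x)"
 proof -
  have "jump_energy (%x y. nu (x - y)) (%x. j x - v x) + ?A < top"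
   using le_less_trans[OF le ennreal_less_top] .
  then show ?thesis by (simp add: fin_iff[OF meas] less_top)
 qed
 show ?thesis
 proof (rule that[OF jC])
  show "fin j" using fin_add[OF fd v(1)] by simp
  show "QQ 1 (%x. j x - v x) <= e"
   using le e by (simp add: energy_eq[OF fd])
 qed
qed

text \<open>Cut off, then mollify. Boundedness enters through the L2 continuity of
  translations.\<close>

lemma Cc_inf_dense:
 assumes u: "fin u" and B: "!!x. \<bar>u x\<bar> <= B" and e: "e > 0"
 obtains j where "j : Cc_inf" "fin j" "QQ 1 (%x. j x - u x) < e"
proof -
 obtain v R where v: "fin v" "!!x. norm x > R ==> v x = 0" "!!x. \<bar>v x\<bar> <= \<bar>u x\<bar>"
  "QQ 1 (%x. v x - u x) < e / 4"
  using cutoff_approx[OF u, of "e / 4"] e by auto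
 have "\<bar>v x\<bar> <= B" for x using v(3)[of x] B[of x] by simp
 then obtain j where j: "j : Cc_inf" "fin j" "QQ 1 (%x. j x - v x) <= e / 4"
  using mollify_approx[OF v(1,2), of R B "e / 4"] e by auto
 have "QQ 1 (%x. j x - u x) < e"
  using Q_add_le[OF fin_diff[OF j(2) v(1)] fin_diff[OF v(1) u], of 1] j(3) v(4) by simp
 with j show ?thesis by (intro that)
qed

lemma bounded_fin_dom:
 assumes u: "fin u" and B: "!!x. \<bar>u x\<bar> <= B"
 shows "u : dom"
proof (rule dom_closed[OF u])
 fix e :: real assume "e > 0"
 from Cc_inf_dense[OF u B this] obtain j where "j : Cc_inf" "QQ 1 (%x. j x - u x) < e" by metis
 with Cc_inf_dom show "\<exists>g\<in>dom. QQ 1 (%x. g x - u x) < e" by blast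
qed

end

section \<open>Full domain of the limit form, barriers and comparison\<close>

context levy_kernel
begin

text \<open>For a translation-invariant kernel the closure of C^1_c is the whole space of finite
  energy. Comparison arguments may then test with functions such as max 0 (u - W), of which finite
  energy is all that is known.\<close>

lemma fin_dom:
 assumes u: "fin u"
 shows "u : dom"
proof (rule dom_limit[of "%n x. max (- real n) (min (real n) (u x))" u _ "%n. u"])
 have [measurable]: "u : Borel" using u by (rule finD)
 have le: "\<bar>max (- real n) (min (real n) (u x))\<bar> <= \<bar>u x\<bar>" for n x by auto
 have inc: "\<bar>inc (%x. max (- real n) (min (real n) (u x))) p\<bar> <= \<bar>inc u p\<bar>" for n p
  unfolding inc_def by linarith
 show "(%x. max (- real n) (min (real n) (u x))) : dom" for n
 proof (rule bounded_fin_dom)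
  show "fin (%x. max (- real n) (min (real n) (u x)))" by (rule fin_bound[OF u _ le inc]) simp
  show "\<bar>max (- real n) (min (real n) (u x))\<bar> <= real n" for x by auto
 qed
 show "(%n. QQ 1 (%x. u x - u x)) ~> 0"
  by (simp add: Q_diag[OF fin_zero] inc_def)
 show "AE x in lborel. (%n. max (- real n) (min (real n) (u x))) ~> u x"
 proof (rule AE_I2, rule tendsto_eventually)
  fix x
  obtain N :: nat where N: "\<bar>u x\<bar> <= real N" using real_arch_simple by blast
  show "eventually (%n. max (- real n) (min (real n) (u x)) = u x) sequentially"
   using eventually_ge_at_top[of N]
  proof eventually_elim
   case (elim n)
   then have "\<bar>u x\<bar> <= real n" using N by linarith
   then show ?case by linarith
  qed
 qed
 show "\<bar>max (- real n) (min (real n) (u x))\<bar> <= \<bar>u x\<bar>" for n x by (rule le)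
 show "\<bar>inc (%x. max (- real n) (min (real n) (u x))) p\<bar> <= \<bar>inc u p\<bar>" for n p by (rule inc)
qed (use u in \<open>auto dest: finD\<close>)

text \<open>Jumps longer than 1/(n+1) have finite total mass, so that each of the four products in
  an expanded product of increments is integrable by itself.\<close>

definition far :: "nat => 'a => ennreal" where
 "far n z = w z * ind {z. 1 / real (Suc n) < norm z} z"

lemma far_measurable [measurable]: "far n : Borel"
 unfolding far_def by measurable

lemma far_finite: "(nnint (%z. far n z)) < \<infinity>"
proof -
 have pt: "far n z <= ennreal ((real (Suc n))^2) * (w z * ennreal (min 1 ((norm z)^2)))" for z
 proof (cases "1 / real (Suc n) < norm z")
  case True
  then have "1 <= real (Suc n) * norm z" by (simp add: field_simps del: of_nat_Suc)
  then have "1 <= (real (Suc n))^2 * (norm z)^2" using power_mono[of 1 "real (Suc n) * norm z" 2]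
   by (simp add: power_mult_distrib del: of_nat_Suc)
  moreover have "1 <= (real (Suc n))^2" by simp
  ultimately have "1 <= (real (Suc n))^2 * min 1 ((norm z)^2)"
   by (auto simp: min_def simp del: of_nat_Suc)
  then have "1 <= ennreal ((real (Suc n))^2) * ennreal (min 1 ((norm z)^2))"
   by (simp add: ennreal_mult[symmetric] del: of_nat_Suc)
  from mult_left_mono[OF this, of "w z"] show ?thesis using True
   by (simp add: far_def mult_ac del: of_nat_Suc)
 qed (simp add: far_def)
 have "(nnint (%z. far n z)) <= (nnint (%z. ennreal ((real (Suc n))^2) * (w z * ennreal (min 1 ((norm z)^2)))))"
  by (rule nn_integral_mono) (rule pt)
 also have "... < \<infinity>" using w_levy by (simp add: nn_integral_cmult ennreal_mult_less_top del: of_nat_Suc)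
 finally show ?thesis .
qed

text \<open>Expanding \<open>(W x - W y) (g x - g y)\<close> away from the diagonal and shifting the variable in two
 of the four products turns the form into an integral of \<open>g\<close> against second differences of \<open>W\<close>.\<close>

lemma far_form:
 assumes W: "sqint lborel W" "!!x. 0 <= W x" and g: "sqint lborel g" "!!x. 0 <= g x"
  and c: "!!x. (nnint (%z. w z * ennreal \<bar>W (x + z) + W (x - z) - 2 * W x\<bar>)) <= ennreal (c * W x)" "0 <= c"
 defines "A n \<equiv> {p. 1 / real (Suc n) < norm (fst p - snd p)}"
 shows "integrable (jump_measure (%x y. nu (x - y))) (%p. ind (A n) p * (inc W p * inc g p))"
  and "\<bar>LINT p|jump_measure (%x y. nu (x - y)). ind (A n) p * (inc W p * inc g p)\<bar>
      <= c * (LBINT x. W x * g x)"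
proof -
 let ?J = "jump_measure (%x y. nu (x - y))"
 have [measurable]: "W : Borel" "g : Borel"
  using sqintD(1)[OF W(1)] sqintD(1)[OF g(1)] by simp_all
 have [measurable]: "A n : sets borel2"
 proof -
  have "{p : space borel2. 1 / real (Suc n) < norm (fst p - snd (p :: 'a \<times> 'a))} : sets borel2"
   by measurable
  then show ?thesis by (simp add: A_def space_pair_measure)
 qed
 have nn: "(nn_integral ?J (%p. ennreal (ind (A n) p * G p))) = (nnint (%z. far n z * (nnint (%y. ennreal (G (y + z, y))))))"
  if [measurable]: "G : Borel2" for G
 proof -
  have "(nn_integral ?J (%p. ennreal (ind (A n) p * G p)))
    = (nnint (%z. w z * (nnint (%y. ennreal (ind (A n) (y + z, y) * G (y + z, y))))))"
   by (rule jump_measure_nn_integral) measurable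
  also have "... = (nnint (%z. far n z * (nnint (%y. ennreal (G (y + z, y))))))"
   by (intro nn_integral_cong) (auto simp: far_def A_def indicator_def)
  finally show ?thesis .
 qed
 have Wg: "integrable lborel (%x. W x * g x)" by (rule sqint_mult[OF W(1) g(1)])
 define S where "S = (LBINT x. W x * g x)"
 have S0: "0 <= S" unfolding S_def using W(2) g(2) by simp
 have S: "(nnint (%x. ennreal (W x * g x))) = ennreal S"
  unfolding S_def using Wg W(2) g(2) by (intro nn_integral_eq_integral) auto
 obtain T where T: "(nnint (%z. far n z)) = ennreal T" "0 <= T"
  using far_finite[of n] by (cases "nnint (%z. far n z)") auto
 define P where "P G = (nn_integral ?J (%p. ennreal (ind (A n) p * G p)))" for G :: "'a \<times> 'a => real"
 let ?G1 = "%p. W (fst p) * g (fst p)" and ?G2 = "%p. W (snd p) * g (snd p)"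
 let ?G3 = "%p. W (fst p) * g (snd p)" and ?G4 = "%p. W (snd p) * g (fst p)"
 have P2: "P ?G2 = ennreal (T * S)"
  unfolding P_def by (subst nn) (simp_all add: S nn_integral_multc T S0 ennreal_mult)
 have P1: "P ?G1 = ennreal (T * S)"
 proof -
  have "(nnint (%y. ennreal (W (y + z) * g (y + z)))) = ennreal S" for z
   using nn_integral_lborel_translate[of "%y. ennreal (W y * g y)" z] S by (simp add: add.commute)
  then show ?thesis unfolding P_def by (subst nn) (simp_all add: nn_integral_multc T S0 ennreal_mult)
 qed
 have P3: "P ?G3 = (nnint (%y. nnint (%z. far n z * ennreal (W (y + z) * g y))))"
 proof -
  have "P ?G3 = (nnint (%z. nnint (%y. far n z * ennreal (W (y + z) * g y))))"
   unfolding P_def by (subst nn) (simp_all add: nn_integral_cmult)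
  also have "... = (nnint (%y. nnint (%z. far n z * ennreal (W (y + z) * g y))))"
   by (rule lborel_pair.Fubini') measurable
  finally show ?thesis .
 qed
 have P4: "P ?G4 = (nnint (%y. nnint (%z. far n z * ennreal (W (y - z) * g y))))"
 proof -
  have "P ?G4 = (nnint (%z. far n z * (nnint (%y. ennreal (W y * g (y + z))))))"
   unfolding P_def by (subst nn) simp_all
  also have "... = (nnint (%z. far n z * (nnint (%y. ennreal (W (y - z) * g y)))))"
  proof (rule nn_integral_cong, goal_cases)
   case (1 z)
   have "(nnint (%y. ennreal (W (y - z) * g y))) = (nnint (%y. ennreal (W y * g (y + z))))"
    using nn_integral_lborel_translate[of "%y. ennreal (W (y - z) * g y)" z] by (simp add: add.commute)
   then show ?case
    by simp
  qed
  also have "... = (nnint (%z. nnint (%y. far n z * ennreal (W (y - z) * g y))))"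
   by (simp add: nn_integral_cmult)
  also have "... = (nnint (%y. nnint (%z. far n z * ennreal (W (y - z) * g y))))"
   by (rule lborel_pair.Fubini') measurable
  finally show ?thesis .
 qed
 define D2 where "D2 y z = \<bar>W (y + z) + W (y - z) - 2 * W y\<bar>" for y z
 have [measurable]: "(%z. D2 y z) : Borel" for y unfolding D2_def by measurable
 have D2': "(nnint (%z. far n z * ennreal (D2 y z * g y))) <= ennreal (c * (W y * g y))" for y
 proof -
  have "(nnint (%z. far n z * ennreal (D2 y z * g y))) <= (nnint (%z. (w z * ennreal (D2 y z)) * ennreal (g y)))"
   using g(2)[of y] by (intro nn_integral_mono) (auto simp: far_def indicator_def ennreal_mult D2_def mult.assoc)
  also have "... = (nnint (%z. w z * ennreal (D2 y z))) * ennreal (g y)" by (rule nn_integral_multc) measurable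
  also have "... <= ennreal (c * W y) * ennreal (g y)" using c(1)[of y] unfolding D2_def by (rule mult_right_mono) simp
  also have "... = ennreal (c * (W y * g y))" using c(2) W(2)[of y] g(2)[of y] by (simp add: ennreal_mult[symmetric] mult_ac)
  finally show ?thesis .
 qed
 let ?B = "nnint (%y. nnint (%z. far n z * ennreal ((W (y + z) + W (y - z)) * g y)))"
 have P34: "P ?G3 + P ?G4 = ?B"
 proof -
  have "P ?G3 + P ?G4 = (nnint (%y. (nnint (%z. far n z * ennreal (W (y + z) * g y))) + (nnint (%z. far n z * ennreal (W (y - z) * g y)))))"
   unfolding P3 P4 by (rule nn_integral_add[symmetric]) measurable
  also have "... = (nnint (%y. nnint (%z. far n z * ennreal (W (y + z) * g y) + far n z * ennreal (W (y - z) * g y))))"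
   by (intro nn_integral_cong nn_integral_add[symmetric]) measurable
  also have "... = ?B"
   using W(2) g(2) by (intro nn_integral_cong) (simp add: distrib_left[symmetric] distrib_right ennreal_plus[symmetric] del: ennreal_plus)
  finally show ?thesis .
 qed
 have mid: "(nnint (%y. nnint (%z. far n z * ennreal (2 * (W y * g y))))) = ennreal (2 * T * S)"
 proof -
  have "(nnint (%y. nnint (%z. far n z * ennreal (2 * (W y * g y))))) = (nnint (%y. ennreal (2 * T) * ennreal (W y * g y)))"
   using W(2) g(2) T by (intro nn_integral_cong) (simp add: nn_integral_multc ennreal_mult[symmetric] mult_ac)
  also have "... = ennreal (2 * T * S)" using T S0 by (simp add: nn_integral_cmult S ennreal_mult)
  finally show ?thesis .
 qed
 let ?A = "%y. nnint (%z. far n z * ennreal (D2 y z * g y))"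
 have dd: "(nnint ?A) <= ennreal (c * S)"
 proof -
  have "(nnint ?A) <= (nnint (%y. ennreal c * ennreal (W y * g y)))"
   using D2' c(2) W(2) g(2) by (intro nn_integral_mono) (simp add: ennreal_mult[symmetric])
  also have "... = ennreal (c * S)" using c(2) S0 by (simp add: nn_integral_cmult S ennreal_mult)
  finally show ?thesis .
 qed
 have [measurable]: "(%p. D2 (fst p) (snd p)) : Borel2" unfolding D2_def by measurable
 have [measurable]: "?A : Borel"
  unfolding D2_def by measurable
 \<comment> \<open>The cross terms are bounded from above and from below separately, because
   nonnegative integrals cannot be subtracted before they are known to be finite.\<close>
 have up: "P ?G3 + P ?G4 <= ennreal (2 * T * S) + ennreal (c * S)"
 proof -
  have "P ?G3 + P ?G4 <= (nnint (%y. (nnint (%z. far n z * ennreal (2 * (W y * g y)))) + (nnint (%z. far n z * ennreal (D2 y z * g y)))))"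
   unfolding P34
  proof (rule nn_integral_mono, goal_cases)
   case (1 y)
   have "(nnint (%z. far n z * ennreal ((W (y + z) + W (y - z)) * g y)))
     <= (nnint (%z. far n z * ennreal (2 * (W y * g y)) + far n z * ennreal (D2 y z * g y)))"
   proof (rule nn_integral_mono, goal_cases)
    case (1 z)
    have "(W (y + z) + W (y - z)) * g y <= (2 * W y + D2 y z) * g y"
     using g(2) by (intro mult_right_mono) (auto simp: D2_def)
    then have "ennreal ((W (y + z) + W (y - z)) * g y) <= ennreal (2 * (W y * g y) + D2 y z * g y)"
     by (intro ennreal_leI) (simp add: algebra_simps)
    also have "... = ennreal (2 * (W y * g y)) + ennreal (D2 y z * g y)"
     using W(2) g(2) by (intro ennreal_plus) (auto simp: D2_def)
    finally show ?case
     unfolding distrib_left[symmetric] by (rule mult_left_mono) simp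
   qed
   also have "... = (nnint (%z. far n z * ennreal (2 * (W y * g y)))) + (nnint (%z. far n z * ennreal (D2 y z * g y)))"
    by (rule nn_integral_add) measurable
   finally show ?case .
  qed
  also have "... = (nnint (%y. (nnint (%z. far n z * ennreal (2 * (W y * g y))))))
    + (nnint ?A)"
   by (rule nn_integral_add) measurable
  also have "... <= ennreal (2 * T * S) + ennreal (c * S)" unfolding mid by (rule add_left_mono[OF dd])
  finally show ?thesis .
 qed
 have down: "ennreal (2 * T * S) <= P ?G3 + P ?G4 + ennreal (c * S)"
 proof -
  have "ennreal (2 * T * S) <= (nnint (%y. (nnint (%z. far n z * ennreal ((W (y + z) + W (y - z)) * g y))) + (nnint (%z. far n z * ennreal (D2 y z * g y)))))"
   unfolding mid[symmetric]
  proof (rule nn_integral_mono, goal_cases)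
   case (1 y)
   have "(nnint (%z. far n z * ennreal (2 * (W y * g y))))
     <= (nnint (%z. far n z * ennreal ((W (y + z) + W (y - z)) * g y) + far n z * ennreal (D2 y z * g y)))"
   proof (rule nn_integral_mono, goal_cases)
    case (1 z)
    have "(2 * W y) * g y <= (W (y + z) + W (y - z) + D2 y z) * g y"
     using g(2) by (intro mult_right_mono) (auto simp: D2_def)
    then have "ennreal (2 * (W y * g y)) <= ennreal ((W (y + z) + W (y - z)) * g y + D2 y z * g y)"
     by (intro ennreal_leI) (simp add: algebra_simps)
    also have "... = ennreal ((W (y + z) + W (y - z)) * g y) + ennreal (D2 y z * g y)"
     using W(2) g(2) by (intro ennreal_plus) (auto simp: D2_def)
    finally show ?case
     unfolding distrib_left[symmetric] by (rule mult_left_mono) simp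
   qed
   also have "... = (nnint (%z. far n z * ennreal ((W (y + z) + W (y - z)) * g y))) + (nnint (%z. far n z * ennreal (D2 y z * g y)))"
    by (rule nn_integral_add) measurable
   finally show ?case .
  qed
  also have "... = P ?G3 + P ?G4 + (nnint ?A)"
   unfolding P34 by (rule nn_integral_add) measurable
  also have "... <= P ?G3 + P ?G4 + ennreal (c * S)" by (rule add_left_mono[OF dd])
  finally show ?thesis .
 qed
 have "P ?G3 + P ?G4 < top"
 proof -
  have "ennreal (2 * T * S) + ennreal (c * S) < top" by (simp add: less_top[symmetric])
  with up show ?thesis by (rule le_less_trans)
 qed
 then have fin34: "P ?G3 < top" "P ?G4 < top" by (auto simp: less_top[symmetric])
 have int: "integrable ?J (%p. ind (A n) p * G p)"
  if "P G < top" "G : Borel2" "!!p. 0 <= G p" for G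
 proof (subst integrable_iff_bounded, intro conjI)
  have [measurable]: "G : Borel2" by fact
  show "(%p. ind (A n) p * G p) : borel_measurable ?J" by measurable
  show "(nn_integral ?J (%p. ennreal (norm (ind (A n) p * G p)))) < \<infinity>"
   using that(1,3) unfolding P_def by (simp add: abs_mult)
 qed
 have val: "(LINT p|?J. ind (A n) p * G p) = enn2real (P G)"
  if "G : Borel2" "!!p. 0 <= G p" for G
  unfolding P_def using that by (intro integral_eq_nn_integral) (auto simp: indicator_def)
 have i1: "integrable ?J (%p. ind (A n) p * ?G1 p)" by (rule int) (use P1 W(2) g(2) in auto)
 have i2: "integrable ?J (%p. ind (A n) p * ?G2 p)" by (rule int) (use P2 W(2) g(2) in auto)
 have i3: "integrable ?J (%p. ind (A n) p * ?G3 p)" by (rule int) (use fin34 W(2) g(2) in auto)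
 have i4: "integrable ?J (%p. ind (A n) p * ?G4 p)" by (rule int) (use fin34 W(2) g(2) in auto)
 have e: "ind (A n) p * (inc W p * inc g p)
  = ind (A n) p * ?G1 p + ind (A n) p * ?G2 p - ind (A n) p * ?G3 p - ind (A n) p * ?G4 p" for p
  by (simp add: inc_def algebra_simps)
 show "integrable ?J (%p. ind (A n) p * (inc W p * inc g p))"
  unfolding e using i1 i2 i3 i4 by simp
 obtain a where a: "P ?G3 = ennreal a" "0 <= a" using fin34(1) by (cases "P ?G3") auto
 obtain b where b: "P ?G4 = ennreal b" "0 <= b" using fin34(2) by (cases "P ?G4") auto
 have "(LINT p|?J. ind (A n) p * (inc W p * inc g p))
   = (LINT p|?J. ind (A n) p * ?G1 p) + (LINT p|?J. ind (A n) p * ?G2 p) - (LINT p|?J. ind (A n) p * ?G3 p) - (LINT p|?J. ind (A n) p * ?G4 p)"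
  unfolding e using i1 i2 i3 i4 by simp
 also have "... = T * S + T * S - a - b"
  using W(2) g(2) T S0 by (subst (1 2 3 4) val) (auto simp: P1 P2 a b)
 finally have eq: "(LINT p|?J. ind (A n) p * (inc W p * inc g p)) = T * S + T * S - a - b" .
 have "a + b <= 2 * T * S + c * S"
  using up a b T S0 c(2) by (simp add: ennreal_plus[symmetric] del: ennreal_plus)
 moreover have "2 * T * S <= a + b + c * S"
  using down a b T S0 c(2) by (simp add: ennreal_plus[symmetric] del: ennreal_plus)
 ultimately show "\<bar>LINT p|?J. ind (A n) p * (inc W p * inc g p)\<bar> <= c * (LBINT x. W x * g x)"
  unfolding eq S_def[symmetric] by linarith
qed

text \<open>Let n tend to infinity in \<open>far_form\<close>. The choice g = W first gives, by
  Fatou, finite energy of W; only then is the product of increments with a general g integrable and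
  dominated convergence available.\<close>

lemma barrier_form:
 assumes W: "sqint lborel W" "!!x. 0 <= W x"
  and c: "!!x. (nnint (%z. w z * ennreal \<bar>W (x + z) + W (x - z) - 2 * W x\<bar>)) <= ennreal (c * W x)" "0 <= c"
 shows "fin W" and "!!g. fin g ==> (!!x. 0 <= g x) ==> - c * (LBINT x. W x * g x) <= Q 0 W g"
proof -
 let ?J = "jump_measure (%x y. nu (x - y))"
 define A where "A n = {p :: 'a \<times> 'a. 1 / real (Suc n) < norm (fst p - snd p)}" for n
 have [measurable]: "W : Borel" using sqintD(1)[OF W(1)] by simp
 have Am [measurable]: "A n : sets borel2" for n
 proof -
  have "{p : space borel2. 1 / real (Suc n) < norm (fst p - snd (p :: 'a \<times> 'a))} : sets borel2"
   by measurable
  then show ?thesis by (simp add: A_def space_pair_measure)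
 qed
 have lim: "(%n. ind (A n) p * h) ~> h" if "fst p \<noteq> snd p" for p and h :: real
 proof (rule tendsto_eventually)
  have "0 < norm (fst p - snd p)" using that by simp
  then obtain N where N: "1 / real (Suc N) < norm (fst p - snd p)"
   using reals_Archimedean[of "norm (fst p - snd p)"] by (auto simp: inverse_eq_divide)
  show "eventually (%n. ind (A n) p * h = h) sequentially"
   using eventually_ge_at_top[of N]
  proof eventually_elim
   case (elim n)
   then have "1 / real (Suc n) <= 1 / real (Suc N)" by (intro divide_left_mono) auto
   then show ?case using N by (simp add: A_def)
  qed
 qed
 have lim': "(%n. ind (A n) p * (inc f p * inc g p)) ~> inc f p * inc g p" for p f g
 proof (cases "fst p = snd p")
  case True
  then show ?thesis by (simp add: inc_def)
 qed (rule lim)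
 note ff = far_form[OF W W c, folded A_def]
 let ?A = "c * (LBINT x. W x * W x)"
 have WW: "(nn_integral ?J (%p. ennreal ((inc W p)^2))) <= ennreal ?A"
 proof -
  have "(nn_integral ?J (%p. ennreal ((inc W p)^2))) = (nn_integral ?J (%p. liminf (%n. ennreal (ind (A n) p * (inc W p * inc W p)))))"
  proof (rule nn_integral_cong, goal_cases)
   case (1 p)
   have "(%n. ennreal (ind (A n) p * (inc W p * inc W p))) ~> ennreal (inc W p * inc W p)"
    by (intro tendsto_ennrealI lim')
   from lim_imp_Liminf[OF sequentially_bot this]
   show ?case
    by (simp add: power2_eq_square)
  qed
  also have "... <= liminf (%n. nn_integral ?J (%p. ennreal (ind (A n) p * (inc W p * inc W p))))"
   by (rule nn_integral_liminf) measurable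
  also have "... <= ennreal ?A"
  proof (rule Liminf_le[OF sequentially_bot always_eventually], rule allI)
   fix n
   have "(nn_integral ?J (%p. ennreal (ind (A n) p * (inc W p * inc W p))))
    = ennreal (LINT p|?J. ind (A n) p * (inc W p * inc W p))"
    by (rule nn_integral_eq_integral[OF ff(1)]) auto
   also have "... <= ennreal ?A"
    using ff(2)[of n] by (intro ennreal_leI) simp
   finally show "(nn_integral ?J (%p. ennreal (ind (A n) p * (inc W p * inc W p)))) <= ennreal ?A" .
  qed
  finally show ?thesis .
 qed
 show fW: "fin W"
  unfolding fin_def using W(1) le_less_trans[OF WW ennreal_less_top]
  by (auto simp: sqint_iff_nn measurable_jm measurable_increment)
 fix g assume g: "fin g" "!!x. 0 <= g x"
 have [measurable]: "g : Borel" using g(1) by (rule finD)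
 note fg = far_form[OF W finD(3)[OF g(1)] g(2) c, folded A_def]
 have i: "integrable ?J (%p. inc W p * inc g p)"
  by (rule sqint_mult[OF finD(2)[OF fW] finD(2)[OF g(1)]])
 have "(%n. LINT p|?J. ind (A n) p * (inc W p * inc g p)) ~> (LINT p|?J. inc W p * inc g p)"
 proof (rule integral_dominated_convergence[where w="%p. \<bar>inc W p * inc g p\<bar>"])
  show "AE p in ?J. norm (ind (A n) p * (inc W p * inc g p)) <= \<bar>inc W p * inc g p\<bar>" for n
   by (rule AE_I2) (auto simp: indicator_def)
  show "AE p in ?J. (%n. ind (A n) p * (inc W p * inc g p)) ~> inc W p * inc g p"
   by (rule AE_I2) (rule lim')
 qed (use i in auto)
 moreover have "- c * (LBINT x. W x * g x) <= (LINT p|?J. ind (A n) p * (inc W p * inc g p))" for n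
  using fg(2)[of n] by linarith
 ultimately have "- c * (LBINT x. W x * g x) <= (LINT p|?J. inc W p * inc g p)"
  by (intro LIMSEQ_le_const) auto
 then show "- c * (LBINT x. W x * g x) <= Q 0 W g" by (simp add: Q_eq[OF fW g(1)])
qed

text \<open>Comparison principle. By \<open>barrier_form\<close> and the bound on f, W is a
  supersolution of the resolvent equation; testing with max 0 (u - W) shows that this function
  vanishes.\<close>

lemma resolvent_barrier:
 assumes f: "sqint lborel f" and l: "l > 0" and u: "is_resolvent lborel (%x y. nu (x - y)) l f u"
  and W: "sqint lborel W" "!!x. 0 <= W x"
  and c: "!!x. (nnint (%z. w z * ennreal \<bar>W (x + z) + W (x - z) - 2 * W x\<bar>)) <= ennreal (c * W x)" "0 <= c"
  and fW: "!!x. f x <= (l - c) * W x"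
 shows "AE x in lborel. u x <= W x"
proof -
 have finW: "fin W" by (rule barrier_form(1)[OF W c])
 have fu: "fin u" using is_resolventD(1)[OF u] by (rule dom_fin)
 note d = fin_diff[OF fu finW]
 define g where "g x = max 0 (u x - W x)" for x
 have [measurable]: "u : Borel" "W : Borel"
  using fu finW by (auto dest: finD)
 have fg: "fin g" unfolding g_def
  by (rule fin_bound[OF d]) (auto simp: inc_def)
 have gd: "g : dom" by (rule fin_dom[OF fg])
 have g0: "0 <= g x" for x by (simp add: g_def)
 have i: "integrable lborel (%x. f x * g x)" "integrable lborel (%x. W x * g x)"
  "integrable lborel (%x. (u x - W x) * g x)" "integrable lborel (%x. (g x)^2)"
  using sqint_mult[OF f finD(3)[OF fg]] sqint_mult[OF W(1) finD(3)[OF fg]]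
   sqint_mult[OF finD(3)[OF d] finD(3)[OF fg]] sqintD(2)[OF finD(3)[OF fg]] by auto
 have "(LBINT x. f x * g x) <= (LBINT x. (l - c) * (W x * g x))"
 proof (rule integral_mono[OF i(1)])
  show "integrable lborel (%x. (l - c) * (W x * g x))" using i(2) by simp
  show "f x * g x <= (l - c) * (W x * g x)" for x
   using mult_right_mono[OF fW[of x] g0[of x]] by (simp add: mult.assoc)
 qed
 also have "... = (l - c) * (LBINT x. W x * g x)" using i by simp
 also have "... <= Q l W g"
  using barrier_form(2)[OF W c fg g0] by (simp add: Q_def algebra_simps)
 finally have "Q l u g <= Q l W g" using is_resolventD(2)[OF u gd] by simp
 then have le: "Q l (%x. u x - W x) g <= 0" by (simp add: Q_diff_left[OF fu finW fg])
 have "0 <= (LINT p|jump_measure (%x y. nu (x - y)). inc (%x. u x - W x) p * inc g p)"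
 proof (rule bint_nonneg)
  fix p
  have "0 <= (a - b) * (max 0 a - max 0 b)" for a b :: real by (auto simp: max_def zero_le_mult_iff)
  then show "0 <= inc (%x. u x - W x) p * inc g p" by (simp add: inc_def g_def)
 qed
 then have "l * (LBINT x. (u x - W x) * g x) <= 0" using le by (simp add: Q_eq[OF d fg])
 moreover have "(u x - W x) * g x = (g x)^2" for x by (simp add: g_def max_def power2_eq_square)
 ultimately have "(LBINT x. (g x)^2) <= 0" using l by (simp add: mult_le_0_iff)
 then have "(LBINT x. (g x)^2) = 0" by (simp add: order_antisym)
 then have "AE x in lborel. (g x)^2 = 0" using integral_nonneg_eq_0_iff_AE[OF i(4)] by simp
 then show ?thesis by eventually_elim (auto simp: g_def max_def split: if_splits)
qed

end

section \<open>Decay of the limit resolvent\<close>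

lemma two_powr_power: "(2 powr t) ^ n = 2 powr (t * real n)"
 using powr_realpow[of "2 powr t" n] by (simp add: powr_powr)

lemma half_power: "(1 / 2 :: real) ^ n = 2 powr (- real n)"
proof -
 have "2 powr (- real n) = inverse ((2::real) ^ n)" unfolding powr_minus by (subst powr_realpow) simp_all
 then show ?thesis by (simp add: power_divide inverse_eq_divide)
qed

lemma exists_dyadic_scale:
 fixes r :: real
 assumes "2 ^ m < r"
 obtains k where "2 ^ (m + k) < r" "r <= 2 ^ (m + k + 1)"
proof -
 have ex: "\<exists>n. r <= 2 ^ n" using real_arch_pow[of 2 r] less_imp_le by auto
 define n where "n = (LEAST n. r <= 2 ^ n)"
 have n: "r <= 2 ^ n" unfolding n_def by (rule LeastI_ex[OF ex])
 have "m < n"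
 proof (rule ccontr)
  assume "\<not> m < n"
  then have "(2::real) ^ n <= 2 ^ m" by (intro power_increasing) auto
  with n assms show False by simp
 qed
 then obtain k where k: "n = m + k + 1" using less_imp_add_positive[of m n] by (metis Suc_eq_plus1 add.assoc less_iff_Suc_add add_Suc_right)
 have "\<not> r <= 2 ^ (m + k)" using not_less_Least[of "m + k" "%n. r <= 2 ^ n"] k by (simp add: n_def)
 then show ?thesis using n k by (intro that[of k]) auto
qed

lemma ennreal_le_suminf: "f k <= (\<Sum>k. f k :: ennreal)"
 using sum_le_suminf[of f "{k}"] by (simp add: summableI)

lemma dyadic_outer:
 fixes z :: "'a::euclidean_space"
 assumes "2 ^ m < norm z" and a: "0 <= a"
 shows "ennreal (norm z powr - a) <= (\<Sum>k. ennreal ((2 ^ (m + k)) powr - a) * ind (cball 0 (2 ^ (m + k + 1))) z)"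
proof -
 obtain k where k: "2 ^ (m + k) < norm z" "norm z <= 2 ^ (m + k + 1)" by (rule exists_dyadic_scale[OF assms(1)])
 have "norm z powr - a <= (2 ^ (m + k)) powr - a"
  using k(1) a by (intro powr_mono2') auto
 then have "ennreal (norm z powr - a) <= ennreal ((2 ^ (m + k)) powr - a) * ind (cball 0 (2 ^ (m + k + 1))) z"
  using k(2) by (simp add: ennreal_leI)
 also have "... <= (\<Sum>k. ennreal ((2 ^ (m + k)) powr - a) * ind (cball 0 (2 ^ (m + k + 1))) z)"
  by (rule ennreal_le_suminf)
 finally show ?thesis .
qed

text \<open>Dyadic shells: on the k-th one the power is at most (2^(m+k))^-a while the mass grows
  like 2^(k b), a geometric series since b < a. The measure is general because both Lebesgue measure
  and the random measures are fed in.\<close>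

lemma nn_integral_outer_powr:
 fixes M :: "'a::euclidean_space measure"
 assumes [measurable_cong]: "sets M = sets borel" and a: "0 <= a" "b < a"
  and M: "!!k. emeasure M (cball 0 (2 ^ (m + k + 1))) <= ennreal (V * (2 ^ (m + k + 1)) powr b)" and V: "0 <= V"
 shows "(set_nn_integral M {z. 2 ^ m < norm z} (%z. ennreal (norm z powr - a)))
  <= ennreal (V * 2 powr b * (2 ^ m) powr (b - a) / (1 - 2 powr (b - a)))"
proof -
 have q: "2 powr (b - a) < (1::real)" using a powr_less_mono[of "b - a" 0 2] by simp
 have cb [measurable]: "cball (0::'a) r : sets M" for r by (simp add: assms(1))
 let ?A = "V * 2 powr b * (2 ^ m) powr (b - a)"
 have "(set_nn_integral M {z. 2 ^ m < norm z} (%z. ennreal (norm z powr - a)))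
   <= (nn_integral M (%z. (\<Sum>k. ennreal ((2 ^ (m + k)) powr - a) * ind (cball 0 (2 ^ (m + k + 1))) z)))"
 proof (rule nn_integral_mono, goal_cases)
  case (1 z)
  show ?case
  proof (cases "2 ^ m < norm z")
   case True
   with dyadic_outer[OF True a(1)] show ?thesis by simp
  qed simp
 qed
 also have "... = (\<Sum>k. nn_integral M (%z. ennreal ((2 ^ (m + k)) powr - a) * ind (cball 0 (2 ^ (m + k + 1))) z))"
  by (rule nn_integral_suminf) measurable
 also have "... <= (\<Sum>k. ennreal (?A * (2 powr (b - a)) ^ k))"
 proof (rule suminf_le)
  fix k
  have "(nn_integral M (%z. ennreal ((2 ^ (m + k)) powr - a) * ind (cball 0 (2 ^ (m + k + 1))) z))
   = ennreal ((2 ^ (m + k)) powr - a) * emeasure M (cball 0 (2 ^ (m + k + 1)))"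
   by (rule nn_integral_cmult_indicator[OF cb])
  also have "... <= ennreal ((2 ^ (m + k)) powr - a) * ennreal (V * (2 ^ (m + k + 1)) powr b)"
   by (rule mult_left_mono[OF M]) simp
  also have "... = ennreal ((2 ^ (m + k)) powr - a * (V * (2 ^ (m + k + 1)) powr b))"
   using V by (simp add: ennreal_mult[symmetric])
  also have "(2 ^ (m + k)) powr - a * (V * (2 ^ (m + k + 1)) powr b) = ?A * (2 powr (b - a)) ^ k"
  proof -
   have p: "(2 :: real) ^ n = 2 powr real n" for n by (simp add: powr_realpow)
   have "(2 ^ (m + k)) powr - a * (2 ^ (m + k + 1)) powr b = 2 powr (real (m + k) * - a + real (m + k + 1) * b)"
    unfolding p powr_powr by (simp only: powr_add)
   also have "real (m + k) * - a + real (m + k + 1) * b = b + real m * (b - a) + (b - a) * real k"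
    by (simp add: algebra_simps)
   also have "2 powr (b + real m * (b - a) + (b - a) * real k) = 2 powr b * (2 ^ m) powr (b - a) * (2 powr (b - a)) ^ k"
    unfolding p powr_powr two_powr_power by (simp only: powr_add)
   finally show ?thesis by (simp add: mult_ac)
  qed
  finally show "(nn_integral M (%z. ennreal ((2 ^ (m + k)) powr - a) * ind (cball 0 (2 ^ (m + k + 1))) z))
    <= ennreal (?A * (2 powr (b - a)) ^ k)" .
 qed auto
 also have "... = ennreal (\<Sum>k. ?A * (2 powr (b - a)) ^ k)"
  using q V by (intro suminf_ennreal2 summable_mult summable_geometric) auto
 also have "(\<Sum>k. ?A * (2 powr (b - a)) ^ k) = V * 2 powr b * (2 ^ m) powr (b - a) / (1 - 2 powr (b - a))"
  using q by (subst suminf_mult) (auto simp: suminf_geometric summable_geometric)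
 finally show ?thesis .
qed

lemma emeasure_cball_powr:
 fixes c :: "'a::euclidean_space"
 assumes "0 < r"
 shows "emeasure lborel (cball c r) = ennreal (unit_ball_vol (real DIM('a)) * r powr real DIM('a))"
 unfolding powr_realpow[OF assms] using assms emeasure_cball[of r c] by simp

text \<open>Both ends are dyadic series, with ratio 2^(al-2) towards the origin and 2^-al at
  infinity.\<close>

lemma stable_levy_integral:
 assumes a: "0 < al" "al < 2"
 shows "(nn_integral (lborel :: 'a::euclidean_space measure) (%z. ennreal (min 1 ((norm z)^2) * norm z powr - (real DIM('a) + al)))) < \<infinity>"
proof -
 let ?d = "real DIM('a)" and ?u = "unit_ball_vol (real DIM('a))"
 define B :: "'a => ennreal" where "B z = (\<Sum>k. ennreal (2 powr (?d + al) * (2 powr (?d + al - 2)) ^ k) * ind (cball 0 ((1 / 2) ^ k)) z)" for z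
 have u0: "0 <= ?u" by simp
 have inner: "ennreal (min 1 ((norm z)^2) * norm z powr - (?d + al)) <= B z" if z: "norm z <= 1" "z \<noteq> 0" for z :: 'a
 proof -
  have "2 ^ 0 < 2 / norm z" using z by (simp add: field_simps)
  \<comment> \<open>Applied to 2 / |z| the index counts shells inward from the unit sphere; k = 0
    leaves only |z| = 1.\<close>
  then obtain k where k: "2 ^ (0 + k) < 2 / norm z" "2 / norm z <= 2 ^ (0 + k + 1)" by (rule exists_dyadic_scale)
  have n0: "0 < norm z" using z by simp
  show ?thesis
  proof (cases k)
   case 0
   then have "norm z = 1" using k z n0 by (simp add: divide_le_eq)
   then have "ennreal (min 1 ((norm z)^2) * norm z powr - (?d + al)) <= ennreal (2 powr (?d + al) * (2 powr (?d + al - 2)) ^ 0) * ind (cball 0 ((1 / 2) ^ 0)) z"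
    using a powr_mono[of 0 "?d + al" 2] by (simp add: ennreal_leI del: powr_mono)
   also have "... <= B z" unfolding B_def by (rule ennreal_le_suminf)
   finally show ?thesis .
  next
   case (Suc j)
   have lt: "norm z < (1 / 2) ^ j" and ge: "(1 / 2) ^ (j + 1) <= norm z"
    using k n0 Suc by (auto simp: field_simps power_one_over)
   have "min 1 ((norm z)^2) <= ((1 / 2) ^ j)^2" using lt by (intro min.coboundedI2 power_mono) auto
   moreover have "norm z powr - (?d + al) <= ((1 / 2) ^ (j + 1)) powr - (?d + al)"
    using ge a by (intro powr_mono2') auto
   ultimately have "min 1 ((norm z)^2) * norm z powr - (?d + al) <= ((1 / 2) ^ j)^2 * ((1 / 2) ^ (j + 1)) powr - (?d + al)"
    by (intro mult_mono) auto
   also have "... = 2 powr (?d + al) * (2 powr (?d + al - 2)) ^ j"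
   proof -
    have "((1 / 2) ^ j)^2 * ((1 / 2) ^ (j + 1)) powr - (?d + al) = 2 powr (- real (2 * j)) * 2 powr (- real (j + 1) * - (?d + al))"
    proof -
     have "((1 / 2 :: real) ^ j)^2 = (1 / 2) ^ (2 * j)" by (simp add: power_mult[symmetric] mult.commute)
     then show ?thesis by (simp only: half_power powr_powr)
    qed
    also have "... = 2 powr (?d + al) * 2 powr ((?d + al - 2) * real j)"
     by (simp add: powr_add[symmetric] algebra_simps)
    also have "2 powr ((?d + al - 2) * real j) = (2 powr (?d + al - 2)) ^ j"
     by (rule two_powr_power[symmetric])
    finally show ?thesis .
   qed
   finally have "ennreal (min 1 ((norm z)^2) * norm z powr - (?d + al))
     <= ennreal (2 powr (?d + al) * (2 powr (?d + al - 2)) ^ j) * ind (cball 0 ((1 / 2) ^ j)) z"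
    using lt by (simp add: ennreal_leI)
   also have "... <= B z" unfolding B_def by (rule ennreal_le_suminf)
   finally show ?thesis .
  qed
 qed
 have cbm: "(%z::'a. c * ind (cball 0 r) z) : Borel" for c :: ennreal and r
  by (intro borel_measurable_times_ennreal borel_measurable_const borel_measurable_indicator borel_closed closed_cball)
 have [measurable]: "B : Borel"
  unfolding B_def by (rule borel_measurable_suminf_order) (rule cbm)
 have "(nnint (%z. B z)) = (\<Sum>k. nnint (%z. ennreal (2 powr (?d + al) * (2 powr (?d + al - 2)) ^ k) * ind (cball (0::'a) ((1 / 2) ^ k)) z))"
  unfolding B_def by (rule nn_integral_suminf) (use cbm in simp)
 also have "... = (\<Sum>k. ennreal ((2 powr (?d + al) * ?u) * (2 powr (al - 2)) ^ k))"
 proof (intro arg_cong[where f=suminf] ext)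
  fix k :: nat
  have "(nnint (%z. ennreal (2 powr (?d + al) * (2 powr (?d + al - 2)) ^ k) * ind (cball (0::'a) ((1 / 2) ^ k)) z))
   = ennreal (2 powr (?d + al) * (2 powr (?d + al - 2)) ^ k) * emeasure lborel (cball (0::'a) ((1 / 2) ^ k))"
   by (rule nn_integral_cmult_indicator) simp
  also have "emeasure lborel (cball (0::'a) ((1 / 2) ^ k)) = ennreal (?u * ((1 / 2) ^ k) powr ?d)"
   by (rule emeasure_cball_powr) simp
  also have "ennreal (2 powr (?d + al) * (2 powr (?d + al - 2)) ^ k) * ennreal (?u * ((1 / 2) ^ k) powr ?d)
   = ennreal ((2 powr (?d + al) * (2 powr (?d + al - 2)) ^ k) * (?u * ((1 / 2) ^ k) powr ?d))"
   by (rule ennreal_mult[symmetric]) (use u0 in \<open>auto intro!: mult_nonneg_nonneg\<close>)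
  also have "((1 / 2 :: real) ^ k) powr ?d = 2 powr (- ?d * real k)"
   unfolding half_power powr_powr by (simp add: mult.commute)
  also have "(2 powr (?d + al) * (2 powr (?d + al - 2)) ^ k) * (?u * 2 powr (- ?d * real k)) = (2 powr (?d + al) * ?u) * (2 powr (al - 2)) ^ k"
  proof -
   have e: "(2 powr (?d + al - 2)) ^ k * 2 powr (- ?d * real k) = (2 powr (al - 2)) ^ k"
    unfolding two_powr_power
    by (simp only: powr_add[symmetric]) (rule arg_cong[where f="%t. 2 powr t"], simp add: algebra_simps)
   have "(p * x) * (u * y) = (p * u) * (x * y)" for p x u y :: real by (simp only: mult_ac)
   then show ?thesis unfolding e[symmetric] .
  qed
  finally show "(nnint (%z. ennreal (2 powr (?d + al) * (2 powr (?d + al - 2)) ^ k) * ind (cball (0::'a) ((1 / 2) ^ k)) z))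
   = ennreal ((2 powr (?d + al) * ?u) * (2 powr (al - 2)) ^ k)" .
 qed
 also have "... = ennreal (\<Sum>k. (2 powr (?d + al) * ?u) * (2 powr (al - 2)) ^ k)"
 proof (rule suminf_ennreal2)
  have "2 powr (al - 2) < (1::real)" using a powr_less_mono[of "al - 2" 0 2] by simp
  then show "summable (%k. (2 powr (?d + al) * ?u) * (2 powr (al - 2)) ^ k)"
   by (intro summable_mult summable_geometric) simp
  show "0 <= (2 powr (?d + al) * ?u) * (2 powr (al - 2)) ^ k" for k
   by (intro mult_nonneg_nonneg zero_le_power powr_ge_zero u0)
 qed
 finally have Bfin: "(nnint (%z. B z)) < \<infinity>" by simp
 have outer: "(set_nnint {z::'a. 2 ^ 0 < norm z} (%z. ennreal (norm z powr - (?d + al))))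
  <= ennreal (?u * 2 powr ?d * (2 ^ 0) powr (?d - (?d + al)) / (1 - 2 powr (?d - (?d + al))))"
 proof (rule nn_integral_outer_powr)
  show "emeasure lborel (cball (0::'a) (2 ^ (0 + k + 1))) <= ennreal (?u * (2 ^ (0 + k + 1)) powr ?d)" for k
   by (subst emeasure_cball_powr) simp_all
  show "0 <= ?d + al" "?d < ?d + al" using a by simp_all
  show "0 <= ?u" by (rule u0)
  show "sets (lborel :: 'a measure) = sets borel" by (rule sets_lborel)
 qed
 have Ofin: "(set_nnint {z::'a. 1 < norm z} (%z. ennreal (norm z powr - (?d + al)))) < \<infinity>"
  using le_less_trans[OF outer ennreal_less_top] by simp
 have "(nn_integral (lborel :: 'a measure) (%z. ennreal (min 1 ((norm z)^2) * norm z powr - (?d + al))))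
   <= (nnint (%z. B z + ennreal (norm z powr - (?d + al)) * ind {z. 1 < norm z} z))"
 proof (rule nn_integral_mono, goal_cases)
  case (1 z)
  show ?case
  proof (cases "z = 0")
   case False
   show ?thesis
   proof (cases "norm z <= 1")
    case True
    then show ?thesis using inner[OF True False] by (simp add: add_increasing2)
   next
    case out: False
    have "min 1 ((norm z)^2) * norm z powr - (?d + al) <= norm z powr - (?d + al)"
     by (intro mult_left_le_one_le) auto
    then have "ennreal (min 1 ((norm z)^2) * norm z powr - (?d + al)) <= ennreal (norm z powr - (?d + al))" by (rule ennreal_leI)
    then show ?thesis using out by (simp add: add_increasing)
   qed
  next
   case True
   show ?thesis unfolding True norm_zero power_zero_numeral by (simp only: powr_0 mult_zero_right ennreal_0 zero_le)
  qed
 qed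
 also have "... = (nnint (%z. B z)) + (set_nnint {z::'a. 1 < norm z} (%z. ennreal (norm z powr - (?d + al))))"
  by (rule nn_integral_add) measurable
 also have "... < \<infinity>" using Bfin Ofin by simp
 finally show ?thesis .
qed

text \<open>A smooth stand-in for |x|^-be. It serves as barrier with be = d + alpha, the decay rate
  of the bound on the jump density.\<close>

definition bump :: "real => 'a::euclidean_space => real" where
 "bump be x = (1 + x \<bullet> x) powr (- be / 2)"

lemma bump_pos: "0 < bump be x" "0 <= bump be x"
proof -
 have "0 < 1 + x \<bullet> x" by (simp add: add_pos_nonneg)
 then show "0 < bump be x" "0 <= bump be x" by (auto simp: bump_def)
qed

lemma bump_le_one: "0 <= be ==> bump be x <= 1"
 unfolding bump_def using powr_mono2'[of "- be / 2" 1 "1 + x \<bullet> x"] by (simp add: add_pos_nonneg)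

lemma bump_le_powr:
 assumes "0 <= be" "x \<noteq> 0"
 shows "bump be x <= norm x powr - be"
proof -
 have "bump be x <= (norm x ^ 2) powr (- be / 2)"
  unfolding bump_def using assms by (intro powr_mono2') (auto simp: power2_norm_eq_inner)
 also have "(norm x ^ 2) powr (- be / 2) = norm x powr - be"
 proof -
  have "norm x ^ 2 = norm x powr 2" using assms by simp
  then show ?thesis by (simp only: powr_powr) simp
 qed
 finally show ?thesis .
qed

lemma bump_measurable [measurable]: "bump be : Borel"
 unfolding bump_def by measurable

text \<open>Along a line the function \<open>(1 + \<bar>x\<bar>^2)\<^sup>-\<^sup>g\<close> has second derivative of the size
 \<open>(1 + \<bar>x\<bar>^2)\<^sup>-\<^sup>g\<close> times the squared length of the direction.\<close>

lemma bump_second_difference_near: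
 fixes x z :: "'a::euclidean_space"
 assumes b: "0 <= be" and near: "4 * (z \<bullet> z) <= 1 + x \<bullet> x"
 shows "\<bar>bump be (x + z) + bump be (x - z) - 2 * bump be x\<bar>
  <= (2 * 4 powr (be / 2) * (be * (be + 3) + 1) + 2) * min 1 ((norm z)^2) * bump be x"
proof -
 define g where "g = be / 2"
 have g0: "0 <= g" using b by (simp add: g_def)
 define q where "q t = 1 + (x + t *\<^sub>R z) \<bullet> (x + t *\<^sub>R z)" for t
 define q' where "q' t = 2 * ((x + t *\<^sub>R z) \<bullet> z)" for t
 define h where "h t = q t powr - g" for t
 define h' where "h' t = - g * (q t powr (- g - 1) * q' t)" for t
 define h'' where "h'' t = - g * ((- g - 1) * q t powr (- g - 2) * q' t * q' t + q t powr (- g - 1) * (2 * (z \<bullet> z)))" for t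
 have q1: "1 <= q t" for t by (simp add: q_def)
 have q0: "0 < q t" for t using q1[of t] by linarith
 have dq: "(q has_real_derivative q' t) (at t)" for t
  unfolding q_def q'_def inner_add_left inner_add_right inner_scaleR_left inner_scaleR_right
  by (auto intro!: derivative_eq_intros simp: inner_commute algebra_simps)
 have dq': "(q' has_real_derivative 2 * (z \<bullet> z)) (at t)" for t
  unfolding q'_def inner_add_left inner_scaleR_left
  by (auto intro!: derivative_eq_intros)
 have dh: "(h has_real_derivative h' t) (at t)" for t
  unfolding h_def h'_def
  by (rule DERIV_cong[OF DERIV_fun_powr[OF dq q0]]) simp
 have dh': "(h' has_real_derivative h'' t) (at t)" for t
 proof -
  have "((%t. q t powr (- g - 1)) has_real_derivative (- g - 1) * q t powr (- g - 1 - of_nat 1) * q' t) (at t)"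
   by (rule DERIV_fun_powr[OF dq q0])
  from DERIV_cmult[OF DERIV_mult[OF this dq'], of "- g"]
  show ?thesis unfolding h'_def h''_def by (rule DERIV_cong) (simp add: algebra_simps)
 qed
 \<comment> \<open>The square |x + 2 t z|^2 >= 0 bounds t (x . z) from below; with 4 |z|^2 <= 1 +
   |x|^2 at least a quarter of 1 + |x|^2 is left.\<close>
 have qlow: "(1 + x \<bullet> x) / 4 <= q t" if t: "\<bar>t\<bar> <= 1" for t
 proof -
  have "0 <= (x + (2 * t) *\<^sub>R z) \<bullet> (x + (2 * t) *\<^sub>R z)" by simp
  then have 1: "0 <= x \<bullet> x + 4 * (t * (x \<bullet> z)) + 4 * (t^2 * (z \<bullet> z))"
   by (simp add: inner_add_left inner_add_right inner_commute power2_eq_square algebra_simps)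
  have "t^2 * (z \<bullet> z) <= 1 * (z \<bullet> z)" using t by (intro mult_right_mono) (auto simp: abs_square_le_1)
  then have 2: "4 * (t^2 * (z \<bullet> z)) <= 1 + x \<bullet> x" using near by simp
  have "q t = 1 + x \<bullet> x + 2 * (t * (x \<bullet> z)) + t^2 * (z \<bullet> z)"
   by (simp add: q_def inner_add_left inner_add_right inner_commute power2_eq_square algebra_simps)
  moreover have "(1 + X) / 4 <= Y" if "0 <= X + 4 * T + 4 * c" "4 * c <= 1 + X" "Y = 1 + X + 2 * T + c" "0 <= X" for X T c Y :: real
   using that by (simp add: field_simps)
  ultimately show ?thesis using 1 2 inner_ge_zero[of x] by blast
 qed
 have hle: "h t <= 4 powr g * bump be x" if t: "\<bar>t\<bar> <= 1" for t
 proof -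
  have p: "0 < 1 + x \<bullet> x" by (simp add: add_pos_nonneg)
  have "h t <= ((1 + x \<bullet> x) / 4) powr - g"
   unfolding h_def using qlow[OF t] g0 p by (intro powr_mono2') auto
  also have "... = 4 powr g * bump be x"
   using p by (simp add: bump_def g_def powr_divide powr_minus field_simps)
  finally show ?thesis .
 qed
 \<comment> \<open>Sum of the two contributions to h'': 4 g (g + 1) from (q')^2 <= 4 q |z|^2, and 2
   g from q''.\<close>
 define C where "C = g * (4 * g + 6)"
 have h''b: "\<bar>h'' t\<bar> <= C * (z \<bullet> z) * (4 powr g * bump be x)" if t: "\<bar>t\<bar> <= 1" for t
 proof -
  have "(q' t)^2 = 4 * ((x + t *\<^sub>R z) \<bullet> z)^2" by (simp add: q'_def power_mult_distrib)
  also have "... <= 4 * (((x + t *\<^sub>R z) \<bullet> (x + t *\<^sub>R z)) * (z \<bullet> z))" using Cauchy_Schwarz_ineq by simp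
  also have "... <= 4 * (q t * (z \<bullet> z))" by (intro mult_left_mono mult_right_mono) (auto simp: q_def)
  finally have q'b: "(q' t)^2 <= 4 * (q t * (z \<bullet> z))" .
  have e2: "q t powr (- g - 2) * q t = q t powr (- g - 1)"
  proof -
   have "q t powr (- g - 2) * q t = q t powr (- g - 2) * q t powr 1" using q0[of t] by simp
   also have "... = q t powr (- g - 2 + 1)" by (rule powr_add[symmetric])
   also have "- g - 2 + 1 = - g - 1" by simp
   finally show ?thesis .
  qed
  have "\<bar>h'' t\<bar> = g * \<bar>(- g - 1) * (q t powr (- g - 2) * (q' t)^2) + q t powr (- g - 1) * (2 * (z \<bullet> z))\<bar>"
   using g0 by (simp add: h''_def abs_mult power2_eq_square mult.assoc)
  also have "... <= g * ((g + 1) * (q t powr (- g - 2) * (q' t)^2) + q t powr (- g - 1) * (2 * (z \<bullet> z)))"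
  proof (intro mult_left_mono g0)
   have "0 <= q t powr (- g - 2) * (q' t)^2" "0 <= q t powr (- g - 1) * (2 * (z \<bullet> z))" by auto
   then show "\<bar>(- g - 1) * (q t powr (- g - 2) * (q' t)^2) + q t powr (- g - 1) * (2 * (z \<bullet> z))\<bar>
    <= (g + 1) * (q t powr (- g - 2) * (q' t)^2) + q t powr (- g - 1) * (2 * (z \<bullet> z))"
    using g0 by (intro order_trans[OF abs_triangle_ineq]) (auto simp: abs_mult add.commute[of 1])
  qed
  also have "... <= g * ((g + 1) * (q t powr (- g - 2) * (4 * (q t * (z \<bullet> z)))) + q t powr (- g - 1) * (2 * (z \<bullet> z)))"
   using q'b g0 by (intro mult_left_mono add_mono) auto
  also have "q t powr (- g - 2) * (4 * (q t * (z \<bullet> z))) = 4 * (q t powr (- g - 1) * (z \<bullet> z))"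
   using e2 by (metis mult.assoc mult.left_commute)
  also have "g * ((g + 1) * (4 * (q t powr (- g - 1) * (z \<bullet> z))) + q t powr (- g - 1) * (2 * (z \<bullet> z))) = C * (z \<bullet> z) * q t powr (- g - 1)"
   by (simp add: C_def algebra_simps)
  also have "... <= C * (z \<bullet> z) * (4 powr g * bump be x)"
  proof (rule mult_left_mono)
   have "q t powr (- g - 1) <= h t" unfolding h_def using q1[of t] by (intro powr_mono) auto
   then show "q t powr (- g - 1) <= 4 powr g * bump be x" using hle[OF t] by linarith
  qed (use g0 in \<open>simp add: C_def\<close>)
  finally show ?thesis .
 qed
 define D where "D = \<bar>bump be (x + z) + bump be (x - z) - 2 * bump be x\<bar>"
 have hv: "h 1 = bump be (x + z)" "h (-1) = bump be (x - z)" "h 0 = bump be x"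
  by (simp_all add: h_def q_def g_def bump_def)
 \<comment> \<open>The mean value theorem twice: for h t + h (-t) on [0, 1], then for h' on
   [-t, t].\<close>
 have "\<exists>t. 0 < t \<and> t < 1 \<and> (h 1 + h (-1)) - (h 0 + h (-0)) = (1 - 0) * (h' t - h' (- t))"
 proof (rule MVT2)
  fix t :: real
  have "((%t. h (- t)) has_real_derivative h' (- t) * (-1)) (at t)"
   by (rule DERIV_chain2[OF dh]) (auto intro!: derivative_eq_intros)
  from DERIV_add[OF dh this] show "((%t. h t + h (- t)) has_real_derivative h' t - h' (- t)) (at t)" by simp
 qed simp
 then obtain t where t: "0 < t" "t < 1" "h 1 + h (-1) - 2 * h 0 = h' t - h' (- t)" by auto
 have "\<exists>s. - t < s \<and> s < t \<and> h' t - h' (- t) = (t - - t) * h'' s"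
  by (rule MVT2) (use t dh' in auto)
 then obtain s where s: "- t < s" "s < t" "h' t - h' (- t) = 2 * t * h'' s" by auto
 have "D = \<bar>2 * t * h'' s\<bar>" using t(3) s(3) hv by (simp add: D_def)
 also have "... = 2 * t * \<bar>h'' s\<bar>" using t by (simp add: abs_mult)
 also have "... <= 2 * 1 * \<bar>h'' s\<bar>" using t by (intro mult_right_mono mult_left_mono) auto
 also have "... <= 2 * (C * (z \<bullet> z) * (4 powr g * bump be x))" using h''b[of s] s t by simp
 finally have D1: "D <= 2 * C * 4 powr g * (norm z)^2 * bump be x"
  by (simp add: power2_norm_eq_inner mult_ac)
 \<comment> \<open>For |z| > 1 only the sizes of the three values are used.\<close>
 have D2: "D <= (2 * 4 powr g + 2) * bump be x"
  using hle[of 1] hle[of "-1"] hv bump_pos(2)[of be x] bump_pos(2)[of be "x + z"] bump_pos(2)[of be "x - z"]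
  by (simp add: D_def algebra_simps)
 have Ce: "C = be * (be + 3)" by (simp add: C_def g_def algebra_simps)
 have C0: "0 <= C" using g0 by (simp add: C_def)
 let ?B = "2 * 4 powr (be / 2) * (be * (be + 3) + 1) + 2"
 have p4: "0 <= 4 powr g" by simp
 have B1: "2 * C * 4 powr g <= ?B" "2 * 4 powr g + 2 <= ?B"
  unfolding Ce[symmetric] g_def[symmetric] using C0 by (auto simp: algebra_simps)
 have "D <= ?B * min 1 ((norm z)^2) * bump be x"
 proof (cases "(norm z)^2 <= 1")
  case True
  have "2 * C * 4 powr g * (norm z)^2 * bump be x <= ?B * (norm z)^2 * bump be x"
   using B1(1) bump_pos(2) by (intro mult_right_mono) auto
  then show ?thesis using True D1 by (simp add: min_def)
 next
  case False
  have "(2 * 4 powr g + 2) * bump be x <= ?B * bump be x"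
   by (rule mult_right_mono[OF B1(2) bump_pos(2)])
  then show ?thesis using False D2 by simp
 qed
 then show ?thesis by (simp add: D_def)
qed

text \<open>Two regimes. If |z|^2 is at most a quarter of 1 + |x|^2, the second derivative estimate
  applies. Otherwise the kernel |z|^-be is itself at most 2^be times the bump at x, and the
  translated bumps are integrable in z. Either way the bump at x factors out.\<close>

lemma bump_second_difference:
 fixes x z :: "'a::euclidean_space"
 assumes b: "0 <= be" and z: "z \<noteq> 0"
 shows "\<bar>bump be (x + z) + bump be (x - z) - 2 * bump be x\<bar> * norm z powr - be
  <= bump be x * ((2 * 4 powr (be / 2) * (be * (be + 3) + 1) + 10) * (min 1 ((norm z)^2) * norm z powr - be)
    + 2 powr be * (bump be (x + z) + bump be (x - z)))"
 (is "?D * ?n <= ?b * (?B * (?m * ?n) + ?P * ?s)")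
proof (cases "4 * (z \<bullet> z) <= 1 + x \<bullet> x")
 case True
 have "?D <= (2 * 4 powr (be / 2) * (be * (be + 3) + 1) + 2) * ?m * ?b"
  by (rule bump_second_difference_near[OF b True])
 also have "... <= ?B * ?m * ?b"
  by (intro mult_right_mono) (auto simp: bump_pos)
 finally have "?D * ?n <= ?B * ?m * ?b * ?n" by (intro mult_right_mono) auto
 moreover have "0 <= ?b * (?P * ?s)" using bump_pos(2) by (intro mult_nonneg_nonneg add_nonneg_nonneg) auto
 ultimately show ?thesis by (simp add: algebra_simps)
next
 case False
 then have far: "(1 + x \<bullet> x) / 4 <= (norm z)^2" by (simp add: power2_norm_eq_inner)
 have p: "0 < 1 + x \<bullet> x" by (simp add: add_pos_nonneg)
 have n0: "0 < norm z" using z by simp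
 have "(norm z)^2 = norm z powr 2" using n0 by simp
 then have "?n = ((norm z)^2) powr (- be / 2)" by (simp only: powr_powr) simp
 also have "... <= ((1 + x \<bullet> x) / 4) powr (- be / 2)" using far p b by (intro powr_mono2') auto
 also have "... = 4 powr (be / 2) * ?b" using p by (simp add: bump_def powr_divide powr_minus field_simps)
 also have "4 powr (be / 2) = (2 powr 2) powr (be / 2)" by simp
 also have "... = ?P" by (simp only: powr_powr) simp
 finally have nle: "?n <= ?P * ?b" .
 have "1 / 4 <= (1 + x \<bullet> x) / 4" by simp
 with far have "1 / 4 <= (norm z)^2" by (rule order_trans[rotated])
 then have q: "1 / 4 <= ?m" by simp
 have s0: "0 <= ?s" by (intro add_nonneg_nonneg bump_pos(2))
 have "\<bar>s - 2 * b\<bar> <= s + 2 * b" if "0 <= s" "0 <= b" for s b :: real using that by auto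
 from this[OF s0 bump_pos(2)] have "?D <= ?s + 2 * ?b" .
 then have "?D * ?n <= (?s + 2 * ?b) * ?n" by (rule mult_right_mono) simp
 also have "... = ?s * ?n + 2 * ?b * ?n" by (rule distrib_right)
 also have "?s * ?n <= ?s * (?P * ?b)" by (rule mult_left_mono[OF nle s0])
 \<comment> \<open>Here |z|^2 >= 1/4, so the summand 10 in the constant absorbs this term: 10/4 >=
   2.\<close>
 also have "2 * ?b * ?n <= ?b * (?B * (?m * ?n))"
 proof -
  have "0 <= 2 * 4 powr (be / 2) * (be * (be + 3) + 1)" using b by (intro mult_nonneg_nonneg add_nonneg_nonneg) auto
  moreover have "2 <= (c + 10) * t" if "0 <= c" "1 / 4 <= t" for c t :: real
   using mult_mono[of 10 "c + 10" "1 / 4" t] that by simp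
  ultimately have "2 <= ?B * ?m" using q by blast
  then have "2 * (?b * ?n) <= (?B * ?m) * (?b * ?n)"
   by (rule mult_right_mono) (simp add: bump_pos(2))
  then show ?thesis by (simp only: mult_ac)
 qed
 finally show ?thesis by (simp only: distrib_left mult_ac add_ac)
qed

lemma nn_integral_lborel_scale:
 fixes f :: "'a::euclidean_space => ennreal"
 assumes [measurable]: "f : Borel" and R: "R > 0"
 shows "(nnint (%x. f x)) = ennreal (R ^ DIM('a)) * (nnint (%x. f (R *\<^sub>R x)))"
proof -
 have "(nnint (%x. f x)) = (nn_integral (density (distr lborel borel (%x. 0 + R *\<^sub>R x)) (%_. ennreal (\<bar>R\<bar> ^ DIM('a)))) (%x. f x))"
  using lborel_affine[of R "0::'a"] R by simp
 also have "... = (nn_integral (distr lborel borel (%x. 0 + R *\<^sub>R x)) (%x. ennreal (\<bar>R\<bar> ^ DIM('a)) * f x))"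
  by (rule nn_integral_density) measurable
 also have "... = (nnint (%x. ennreal (\<bar>R\<bar> ^ DIM('a)) * f (0 + R *\<^sub>R x)))"
  by (rule nn_integral_distr) measurable
 also have "... = ennreal (\<bar>R\<bar> ^ DIM('a)) * (nnint (%x. f (0 + R *\<^sub>R x)))"
  by (rule nn_integral_cmult) measurable
 finally show ?thesis using R by simp
qed

lemma bump_integral:
 assumes a: "0 < al" "al < 2"
 shows "(nn_integral (lborel :: 'a::euclidean_space measure) (%x. ennreal (bump (real DIM('a) + al) x))) < \<infinity>"
proof -
 let ?be = "real DIM('a) + al"
 have b: "0 <= ?be" using a by simp
 have cb: "(ind (cball (0::'a) 1) :: 'a => ennreal) : Borel"
  by (intro borel_measurable_indicator borel_closed closed_cball)
 have "(nn_integral (lborel :: 'a measure) (%x. ennreal (bump ?be x)))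
  <= (nnint (%x. ind (cball (0::'a) 1) x + ennreal (min 1 ((norm x)^2) * norm x powr - ?be)))"
 proof (rule nn_integral_mono, goal_cases)
  case (1 x)
  show ?case
  proof (cases "norm x <= 1")
   case True
   have "ennreal (bump ?be x) <= ennreal 1" by (rule ennreal_leI[OF bump_le_one[OF b]])
   then show ?thesis using True by (simp add: add_increasing2)
  next
   case False
   then have "1 <= (norm x)^2" using power_mono[of 1 "norm x" 2] by simp
   then have "min 1 ((norm x)^2) = 1" by simp
   moreover have "bump ?be x <= norm x powr - ?be" by (rule bump_le_powr[OF b]) (use False in auto)
   ultimately show ?thesis using False by (simp only: mult_1) (simp add: add_increasing ennreal_leI)
  qed
 qed
 also have "... = (nnint (%x. ind (cball (0::'a) 1) x)) + (nn_integral (lborel :: 'a measure) (%x. ennreal (min 1 ((norm x)^2) * norm x powr - ?be)))"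
  by (rule nn_integral_add) (use cb in simp, measurable)
 also have "(nnint (%x. ind (cball (0::'a) 1) x)) = emeasure lborel (cball (0::'a) 1)"
  by (rule nn_integral_indicator) simp
 also have "emeasure lborel (cball (0::'a) 1) + (nn_integral (lborel :: 'a measure) (%x. ennreal (min 1 ((norm x)^2) * norm x powr - ?be))) < \<infinity>"
  using stable_levy_integral[OF a, where 'a='a] emeasure_bounded_finite[of "cball (0::'a) 1"] by (simp only: ennreal_add_less_top infinity_ennreal_def bounded_cball)
 finally show ?thesis .
qed

lemma bump_scaled_le:
 assumes "1 <= R" "0 <= be"
 shows "bump be (x /\<^sub>R R) <= R powr be * bump be x"
proof -
 have p: "0 < 1 + x \<bullet> x" by (simp add: add_pos_nonneg)
 have R2: "1 <= R^2" "0 < R^2" using assms(1) power_mono[of 1 R 2] by auto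
 have "(1 + x \<bullet> x) / R^2 <= 1 + (x /\<^sub>R R) \<bullet> (x /\<^sub>R R)"
 proof -
  have "(x /\<^sub>R R) \<bullet> (x /\<^sub>R R) = (x \<bullet> x) / R^2" by (simp add: power2_eq_square divide_inverse)
  moreover have "(1 + x \<bullet> x) / R^2 = 1 / R^2 + (x \<bullet> x) / R^2" by (rule add_divide_distrib)
  moreover have "1 / R^2 <= 1" using R2 by simp
  ultimately show ?thesis by simp
 qed
 then have "bump be (x /\<^sub>R R) <= ((1 + x \<bullet> x) / R^2) powr (- be / 2)"
  unfolding bump_def by (rule powr_mono2'[rotated 2]) (use p R2 assms in auto)
 also have "... = bump be x * inverse ((R^2) powr (- be / 2))"
 proof -
  have "((1 + x \<bullet> x) / R^2) powr (- be / 2) = (1 + x \<bullet> x) powr (- be / 2) / (R^2) powr (- be / 2)"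
   by (rule powr_divide)
  then show ?thesis unfolding bump_def by (simp only: divide_inverse[of "_ powr _"])
 qed
 also have "inverse ((R^2) powr (- be / 2)) = (R^2) powr (be / 2)" by (simp only: powr_minus[symmetric] minus_divide_left minus_minus)
 also have "R^2 = R powr 2" using assms(1) by simp
 also have "(R powr 2) powr (be / 2) = R powr be" by (simp only: powr_powr) simp
 finally show ?thesis by (simp only: mult.commute)
qed

section \<open>Kernels bounded by a stable kernel\<close>

locale stable_like = levy_kernel nu for nu :: "'a::euclidean_space => real" +
 fixes al C :: real
 assumes alpha: "0 < al" "al < 2"
  and nu_le: "!!z. z \<noteq> 0 ==> nu z <= C * norm z powr - (real DIM('a) + al)"
  and C_nonneg: "0 <= C"
begin

definition be :: real where "be = real DIM('a) + al"

lemma beta_nonneg: "0 <= be"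
 using alpha by (simp add: be_def)

lemma w_le: "w z <= ennreal (C * norm z powr - be)"
proof (cases "z = 0")
 case False
 have "nu z / 2 <= nu z" using nu_nonneg[of z] by simp
 also have "... <= C * norm z powr - be" using nu_le[OF False] by (simp only: be_def)
 finally show ?thesis using False by (simp add: w_def ennreal_leI)
qed (simp add: w_def)

text \<open>Dilating z by R produces R^d R^-be = R^-al, so stretching the barrier makes the constant
  in its inequality as small as desired.\<close>

lemma scaled_second_difference:
 obtains A where "0 <= A"
  "!!R x. 0 < R ==> (nnint (%z. w z * ennreal \<bar>bump be ((x + z) /\<^sub>R R) + bump be ((x - z) /\<^sub>R R) - 2 * bump be (x /\<^sub>R R)\<bar>))
    <= ennreal (A * R powr - al * bump be (x /\<^sub>R R))"
proof -
 define b :: "'a => real" where "b = bump be"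
 have b0: "0 <= b x" for x unfolding b_def by (rule bump_pos)
 have [measurable]: "b : Borel" unfolding b_def by (rule bump_measurable)
 define B where "B = 2 * 4 powr (be / 2) * (be * (be + 3) + 1) + 10"
 have B0: "0 <= B" unfolding B_def using beta_nonneg by (intro mult_nonneg_nonneg add_nonneg_nonneg) auto
 define P where "P = (2::real) powr be"
 have P0: "0 <= P" unfolding P_def by simp
 define k :: "'a => real" where "k z = min 1 ((norm z)^2) * norm z powr - be" for z
 have k0: "0 <= k z" for z by (simp add: k_def)
 have [measurable]: "k : Borel" unfolding k_def by measurable
 obtain I1 where I1: "(nnint (%z. ennreal (k z))) = ennreal I1" "0 <= I1"
  using stable_levy_integral[OF alpha, where 'a='a] unfolding k_def be_def
  by (cases "nn_integral (lborel :: 'a measure) (%z. ennreal (min 1 ((norm z)^2) * norm z powr - (real DIM('a) + al)))") auto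
 obtain I2 where I2: "(nnint (%z. ennreal (b z))) = ennreal I2" "0 <= I2"
  using bump_integral[OF alpha, where 'a='a] unfolding b_def be_def
  by (cases "nn_integral (lborel :: 'a measure) (%z. ennreal (bump (real DIM('a) + al) z))") auto
 \<comment> \<open>B times the Levy integral of |z|^-be, plus 2^be times the integrals of the two
   translated bumps.\<close>
 define A0 where "A0 = B * I1 + P * (I2 + I2)"
 have A0: "0 <= A0" unfolding A0_def using B0 I1 I2 P0 by (intro add_nonneg_nonneg mult_nonneg_nonneg) auto
 define D2 where "D2 y z = \<bar>b (y + z) + b (y - z) - 2 * b y\<bar>" for y z
 have [measurable]: "(%z. D2 y z) : Borel" for y unfolding D2_def by measurable
 have unit: "(nnint (%z. ennreal (norm z powr - be * D2 y z))) <= ennreal (A0 * b y)" for y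
 proof -
  have "(nnint (%z. ennreal (norm z powr - be * D2 y z)))
   <= (nnint (%z. ennreal (b y) * (ennreal B * ennreal (k z) + ennreal P * (ennreal (b (y + z)) + ennreal (b (y - z))))))"
  proof (rule nn_integral_mono, goal_cases)
   case (1 z)
   have "norm z powr - be * D2 y z <= b y * (B * k z + P * (b (y + z) + b (y - z)))"
   proof (cases "z = 0")
    case True
    have "0 <= b y * (B * k z + P * (b (y + z) + b (y - z)))"
     by (intro mult_nonneg_nonneg add_nonneg_nonneg b0 B0 P0 k0)
    then show ?thesis using True by (simp add: D2_def)
   next
    case False
    have "D2 y z * norm z powr - be <= b y * (B * k z + P * (b (y + z) + b (y - z)))"
     unfolding D2_def b_def B_def k_def P_def by (rule bump_second_difference[OF beta_nonneg False])
    then show ?thesis by (simp only: mult.commute)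
   qed
   then have "ennreal (norm z powr - be * D2 y z) <= ennreal (b y * (B * k z + P * (b (y + z) + b (y - z))))"
    by (rule ennreal_leI)
   also have "... = ennreal (b y) * (ennreal B * ennreal (k z) + ennreal P * (ennreal (b (y + z)) + ennreal (b (y - z))))"
    by (simp only: ennreal_mult ennreal_plus b0 B0 P0 k0 add_nonneg_nonneg mult_nonneg_nonneg)
   finally show ?case .
  qed
  also have "... = ennreal (b y) * (ennreal B * (nnint (%z. ennreal (k z)))
    + ennreal P * ((nnint (%z. ennreal (b (y + z)))) + (nnint (%z. ennreal (b (y - z))))))"
   by (simp add: nn_integral_cmult nn_integral_add)
  also have "(nnint (%z. ennreal (b (y + z)))) = ennreal I2"
   unfolding I2(1)[symmetric] by (rule nn_integral_lborel_translate) measurable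
  also have "(nnint (%z. ennreal (b (y - z)))) = ennreal I2"
   unfolding I2(1)[symmetric] by (rule nn_integral_lborel_reflect) measurable
  also have "ennreal (b y) * (ennreal B * (nnint (%z. ennreal (k z))) + ennreal P * (ennreal I2 + ennreal I2)) = ennreal (b y * A0)"
   unfolding I1(1) A0_def
   by (simp only: ennreal_mult ennreal_plus b0 B0 P0 I1(2) I2(2) add_nonneg_nonneg mult_nonneg_nonneg)
  finally show ?thesis by (simp only: mult.commute)
 qed
 show ?thesis
 proof (rule that)
  show "0 <= C * A0" using C_nonneg A0 by simp
  fix R :: real and x :: 'a assume R: "0 < R"
  let ?f = "%z. ennreal (C * norm z powr - be * D2 (x /\<^sub>R R) (z /\<^sub>R R))"
  have fm: "?f : Borel" unfolding D2_def by measurable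
  have e: "bump be ((x + z) /\<^sub>R R) + bump be ((x - z) /\<^sub>R R) - 2 * bump be (x /\<^sub>R R)
    = b (x /\<^sub>R R + z /\<^sub>R R) + b (x /\<^sub>R R - z /\<^sub>R R) - 2 * b (x /\<^sub>R R)" for z
   by (simp add: b_def scaleR_add_right scaleR_diff_right)
  have "(nnint (%z. w z * ennreal \<bar>bump be ((x + z) /\<^sub>R R) + bump be ((x - z) /\<^sub>R R) - 2 * bump be (x /\<^sub>R R)\<bar>))
   <= (nnint (%z. ?f z))"
  proof (rule nn_integral_mono, goal_cases)
   case (1 z)
   have "w z * ennreal (D2 (x /\<^sub>R R) (z /\<^sub>R R)) <= ennreal (C * norm z powr - be) * ennreal (D2 (x /\<^sub>R R) (z /\<^sub>R R))"
    by (rule mult_right_mono[OF w_le]) simp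
   also have "... = ?f z" using C_nonneg by (simp add: ennreal_mult D2_def)
   finally show ?case
    unfolding e D2_def .
  qed
  also have "... = ennreal (R ^ DIM('a)) * (nnint (%z. ?f (R *\<^sub>R z)))"
   by (rule nn_integral_lborel_scale[OF fm R])
  also have "(nnint (%z. ?f (R *\<^sub>R z))) = (nnint (%z. ennreal (C * R powr - be) * ennreal (norm z powr - be * D2 (x /\<^sub>R R) z)))"
  proof (rule nn_integral_cong, goal_cases)
   case (1 z)
   have "norm (R *\<^sub>R z) powr - be = R powr - be * norm z powr - be" using R by (simp add: powr_mult)
   moreover have "(R *\<^sub>R z) /\<^sub>R R = z" using R by simp
   ultimately have "?f (R *\<^sub>R z) = ennreal ((C * R powr - be) * (norm z powr - be * D2 (x /\<^sub>R R) z))"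
    by (simp only: mult_ac)
   also have "... = ennreal (C * R powr - be) * ennreal (norm z powr - be * D2 (x /\<^sub>R R) z)"
    by (rule ennreal_mult) (use C_nonneg in \<open>auto simp: D2_def\<close>)
   finally show ?case .
  qed
  also have "... = ennreal (C * R powr - be) * (nnint (%z. ennreal (norm z powr - be * D2 (x /\<^sub>R R) z)))"
   by (rule nn_integral_cmult) measurable
  also have "ennreal (R ^ DIM('a)) * (ennreal (C * R powr - be) * (nnint (%z. ennreal (norm z powr - be * D2 (x /\<^sub>R R) z))))
    <= ennreal (R ^ DIM('a)) * (ennreal (C * R powr - be) * ennreal (A0 * b (x /\<^sub>R R)))"
   by (intro mult_left_mono unit) auto
  also have "... = ennreal (R ^ DIM('a) * (C * R powr - be * (A0 * b (x /\<^sub>R R))))"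
   using R C_nonneg A0 b0[of "x /\<^sub>R R"] by (simp add: ennreal_mult)
  also have "R ^ DIM('a) * (C * R powr - be * (A0 * b (x /\<^sub>R R))) = C * A0 * R powr - al * bump be (x /\<^sub>R R)"
  proof -
   have "R ^ DIM('a) * R powr - be = R powr (real DIM('a) + - be)"
    unfolding powr_add using R by (simp add: powr_realpow)
   also have "real DIM('a) + - be = - al" by (simp add: be_def)
   finally have r: "R ^ DIM('a) * R powr - be = R powr - al" .
   have "r1 * (c * r2 * (a * t)) = c * a * (r1 * r2) * t" for r1 r2 c a t :: real by (simp only: mult_ac)
   then show ?thesis unfolding r[symmetric] b_def .
  qed
  finally show "(nnint (%z. w z * ennreal \<bar>bump be ((x + z) /\<^sub>R R) + bump be ((x - z) /\<^sub>R R) - 2 * bump be (x /\<^sub>R R)\<bar>))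
    <= ennreal (C * A0 * R powr - al * bump be (x /\<^sub>R R))" .
 qed
qed

lemma bump_sqint: "sqint lborel (bump be :: 'a => real)"
proof -
 have "(nn_integral (lborel :: 'a measure) (%x. ennreal ((bump be x)^2))) <= (nn_integral (lborel :: 'a measure) (%x. ennreal (bump be x)))"
 proof (intro nn_integral_mono ennreal_leI)
  fix x :: 'a
  show "(bump be x)^2 <= bump be x"
   unfolding power2_eq_square by (rule mult_left_le_one_le[OF bump_pos(2) bump_pos(2) bump_le_one[OF beta_nonneg]])
 qed
 also have "... < \<infinity>" unfolding be_def by (rule bump_integral[OF alpha])
 finally show ?thesis by (simp add: sqint_iff_nn)
qed

text \<open>A multiple of a sufficiently stretched bump is a supersolution: the stretching makes c
  <= l/2, and the multiple makes the remaining l/2 of it exceed f on the support of f.\<close>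

lemma resolvent_decay_upper:
 assumes f: "sqint lborel f" and l: "l > 0" and u: "is_resolvent lborel (%x y. nu (x - y)) l f u"
  and F: "!!x. f x <= F" "0 <= F" and S: "!!x. norm x > S ==> f x = 0" "0 <= S"
 obtains D where "0 <= D" "AE x in lborel. u x <= D * bump be x"
proof -
 obtain A where A: "0 <= A" "!!R x. 0 < R ==>
   (nnint (%z. w z * ennreal \<bar>bump be ((x + z) /\<^sub>R R) + bump be ((x - z) /\<^sub>R R) - 2 * bump be (x /\<^sub>R R)\<bar>))
    <= ennreal (A * R powr - al * bump be (x /\<^sub>R R))"
  using scaled_second_difference by blast
 \<comment> \<open>Makes A R^-al at most l/2; the lower bound 1 is for
   \<open>bump_scaled_le\<close>.\<close>
 define R where "R = max 1 ((2 * A / l) powr (1 / al))"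
 have R1: "1 <= R" by (simp add: R_def)
 define c where "c = A * R powr - al"
 have c0: "0 <= c" using A by (simp add: c_def)
 have cl: "c <= l / 2"
 proof -
  have nn: "0 <= 2 * A / l" using A l by simp
  have "2 * A / l = (2 * A / l) powr 1" by (rule powr_one[OF nn, symmetric])
  also have "... = ((2 * A / l) powr (1 / al)) powr al" unfolding powr_powr using alpha by simp
  also have "... <= R powr al" using alpha by (intro powr_mono2) (auto simp: R_def)
  finally have le: "2 * A / l <= R powr al" .
  have Rp: "0 < R powr al" using R1 by simp
  have "2 * A <= R powr al * l" using le l by (simp add: pos_divide_le_eq)
  then have "2 * A / R powr al <= l" using Rp by (simp add: pos_divide_le_eq mult.commute)
  moreover have "R powr - al = 1 / R powr al" by (rule powr_minus_divide)
  ultimately show ?thesis unfolding c_def by (simp add: mult.commute)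
 qed
 \<comment> \<open>Lower bound of the stretched bump on the ball of radius S that carries f. With M
   = 2 F / (l m0) one gets l/2 times W at least F there.\<close>
 define m0 where "m0 = (1 + S^2) powr (- be / 2)"
 have Sp: "0 < 1 + S^2" by (simp add: add_pos_nonneg)
 have m0: "0 < m0" using Sp by (simp add: m0_def)
 define M where "M = 2 * F / (l * m0)"
 have M0: "0 <= M" using F(2) l m0 by (simp add: M_def)
 define W where "W x = M * bump be (x /\<^sub>R R)" for x :: 'a
 have W0: "0 <= W x" for x unfolding W_def by (intro mult_nonneg_nonneg M0 bump_pos)
 have WD: "W x <= M * R powr be * bump be x" for x
  unfolding W_def using mult_left_mono[OF bump_scaled_le[OF R1 beta_nonneg] M0] by (simp only: mult.assoc)
 have [measurable]: "W : Borel"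
  unfolding W_def using measurable_compose[OF _ bump_measurable, of "%x. x /\<^sub>R R" borel] by simp
 have Wsq: "sqint lborel W"
 proof (rule sqint_bound[OF sqint_cmult[OF bump_sqint, of "M * R powr be"]])
  show "AE x in lborel. \<bar>W x\<bar> <= \<bar>M * R powr be * bump be x\<bar>"
  proof (rule AE_I2, goal_cases)
   case (1 x)
   have "\<bar>W x\<bar> = W x" using W0 by simp
   also have "... <= \<bar>M * R powr be * bump be x\<bar>" by (rule order_trans[OF WD abs_ge_self])
   finally show ?case .
  qed
 qed simp
 have "AE x in lborel. u x <= W x"
 proof (rule resolvent_barrier[OF f l u Wsq W0 _ c0])
  fix x :: 'a
  let ?D = "%z. bump be ((x + z) /\<^sub>R R) + bump be ((x - z) /\<^sub>R R) - 2 * bump be (x /\<^sub>R R)"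
  have "\<bar>W (x + z) + W (x - z) - 2 * W x\<bar> = M * \<bar>?D z\<bar>" for z
  proof -
   have "W (x + z) + W (x - z) - 2 * W x = M * ?D z" unfolding W_def by (simp only: right_diff_distrib distrib_left mult_ac)
   then show ?thesis using M0 by (simp add: abs_mult)
  qed
  then have "(nnint (%z. w z * ennreal \<bar>W (x + z) + W (x - z) - 2 * W x\<bar>)) = (nnint (%z. ennreal M * (w z * ennreal \<bar>?D z\<bar>)))"
   using M0 by (simp add: ennreal_mult mult_ac)
  also have "... = ennreal M * (nnint (%z. w z * ennreal \<bar>?D z\<bar>))"
  proof (rule nn_integral_cmult)
   have [measurable]: "(%z. bump be (g z /\<^sub>R R)) : Borel" if "g : Borel" for g :: "'a => 'a"
    by (rule measurable_compose[OF _ bump_measurable]) (use that in measurable)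
   show "(%z. w z * ennreal \<bar>?D z\<bar>) : borel_measurable lborel" by measurable
  qed
  also have "... <= ennreal M * ennreal (c * bump be (x /\<^sub>R R))"
   unfolding c_def by (rule mult_left_mono[OF A(2)]) (use R1 in auto)
  also have "... = ennreal (c * W x)"
   unfolding W_def using M0 c0 bump_pos(2)[of be "x /\<^sub>R R"] by (simp add: ennreal_mult[symmetric] mult.left_commute)
  finally show "(nnint (%z. w z * ennreal \<bar>W (x + z) + W (x - z) - 2 * W x\<bar>)) <= ennreal (c * W x)" .
 next
  fix x
  show "f x <= (l - c) * W x"
  proof (cases "norm x <= S")
   case True
   have "norm (x /\<^sub>R R) <= S"
   proof -
    have "norm (x /\<^sub>R R) = norm x / R" using R1 by (simp add: divide_inverse mult.commute)
    also have "... <= norm x / 1" using R1 by (intro divide_left_mono) auto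
    finally show ?thesis using True by simp
   qed
   then have "(x /\<^sub>R R) \<bullet> (x /\<^sub>R R) <= S^2"
    unfolding power2_norm_eq_inner[symmetric] by (intro power_mono) auto
   then have "m0 <= bump be (x /\<^sub>R R)"
    unfolding m0_def bump_def using beta_nonneg
    by (intro powr_mono2') (auto simp del: inner_scaleR_left inner_scaleR_right intro!: add_pos_nonneg)
   then have "M * m0 <= W x" unfolding W_def by (rule mult_left_mono[OF _ M0])
   then have "l / 2 * (M * m0) <= (l - c) * W x" using cl l M0 m0 by (intro mult_mono) auto
   moreover have "l / 2 * (M * m0) = F" using l m0 by (simp add: M_def)
   ultimately show ?thesis using F(1)[of x] by linarith
  next
   case False
   have "0 <= (l - c) * W x" using cl l by (intro mult_nonneg_nonneg W0) auto
   then show ?thesis using S(1)[of x] False by simp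
  qed
 qed
 then have "AE x in lborel. u x <= (M * R powr be) * bump be x"
  by eventually_elim (use WD in \<open>blast intro: order_trans\<close>)
 then show ?thesis using M0 by (intro that) auto
qed

lemma resolvent_decay:
 assumes f: "sqint lborel f" and l: "l > 0" and u: "is_resolvent lborel (%x y. nu (x - y)) l f u"
  and F: "!!x. \<bar>f x\<bar> <= F" and S: "!!x. norm x > S ==> f x = 0"
 obtains D where "0 <= D" "AE x in lborel. \<bar>u x\<bar> <= D * bump be x"
proof -
 have F0: "0 <= F" using F[of undefined] by linarith
 have S': "norm x > max S 0 ==> f x = 0" for x using S by simp
 obtain D1 where D1: "0 <= D1" "AE x in lborel. u x <= D1 * bump be x"
  by (rule resolvent_decay_upper[OF f l u _ F0, of "max S 0"]) (use F abs_le_D1 S' in auto)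
 have f': "sqint lborel (%x. - f x)" using sqint_cmult[OF f, of "-1"] by simp
 obtain D2 where D2: "0 <= D2" "AE x in lborel. - u x <= D2 * bump be x"
  by (rule resolvent_decay_upper[OF f' l is_resolvent_uminus[OF u] _ F0, of "max S 0"]) (use F abs_le_D2 S' in auto)
 have "AE x in lborel. \<bar>u x\<bar> <= (D1 + D2) * bump be x"
  using D1(2) D2(2)
 proof eventually_elim
  case (elim x)
  note * = elim(1-2)
  have "0 <= D1 * bump be x" "0 <= D2 * bump be x" by (intro mult_nonneg_nonneg D1(1) D2(1) bump_pos(2))+
  with * show ?case unfolding distrib_right by linarith
 qed
 then show ?thesis using D1 D2 by (intro that[of "D1 + D2"]) auto
qed

end

section \<open>The ergodic theorem\<close>

lemma cball_measurable [measurable]: "cball (c :: 'c::euclidean_space) r : sets borel"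
 by (intro borel_closed closed_cball)

lemma ball_measurable [measurable]: "ball (c :: 'c::euclidean_space) r : sets borel"
 by (intro borel_open open_ball)

lemma inverse_ennreal_cancel:
 assumes q: "0 < q"
 shows "inverse (ennreal q) * (ennreal q * a) = a"
proof -
 have "inverse (ennreal q) * ennreal q = ennreal (inverse q * q)"
  using q by (simp only: inverse_ennreal ennreal_mult less_imp_le inverse_nonnegative_iff_nonnegative)
 also have "... = 1" using q by simp
 finally show ?thesis by (simp add: mult.assoc[symmetric])
qed

context ergodic_environment
begin

lemma tau_joint_measurable [measurable (raw)]:
 assumes [measurable]: "f : N \<rightarrow>\<^sub>M borel" "g : N \<rightarrow>\<^sub>M M"
 shows "(%p. \<tau> (f p) (g p)) : N \<rightarrow>\<^sub>M M"
proof -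
 have "(%p. (f p, g p)) : N \<rightarrow>\<^sub>M borel \<Otimes>\<^sub>M M" by measurable
 from measurable_compose[OF this tau_measurable] show ?thesis by simp
qed

lemma tau_measurable_fixed [measurable]: "\<tau> x : M \<rightarrow>\<^sub>M M"
 by measurable

lemma tau_space: "w : space M ==> \<tau> x w : space M"
 by (rule measurable_space[OF tau_measurable_fixed])

lemma tau_inverse: "w : space M ==> \<tau> (- x) (\<tau> x w) = w" "w : space M ==> \<tau> x (\<tau> (- x) w) = w"
 by (simp_all add: tau_add tau_zero)

text \<open>Invariance is assumed for images. The image under -x is the preimage under x, as these
  maps are inverse to each other on the sample space.\<close>

lemma distr_tau: "distr M M (\<tau> x) = M"
proof (rule measure_eqI)
 fix A assume A: "A : sets (distr M M (\<tau> x))"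
 then have A': "A : sets M" by simp
 have sub: "A \<subseteq> space M" using A' by (rule sets.sets_into_space)
 have "\<tau> x -` A \<inter> space M = \<tau> (- x) ` A"
 proof (intro set_eqI iffI)
  fix w assume "w : \<tau> x -` A \<inter> space M"
  then have "\<tau> x w : A" "w = \<tau> (- x) (\<tau> x w)" by (auto simp: tau_inverse)
  then show "w : \<tau> (- x) ` A" by (intro image_eqI[of _ _ "\<tau> x w"])
 next
  fix w assume "w : \<tau> (- x) ` A"
  then obtain y where "y : A" "w = \<tau> (- x) y" by blast
  then show "w : \<tau> x -` A \<inter> space M" using sub by (auto simp: tau_inverse tau_space)
 qed
 then have "emeasure (distr M M (\<tau> x)) A = emeasure M (\<tau> (- x) ` A)"
  using A' by (simp add: emeasure_distr)
 moreover have "\<tau> (- x) ` A : sets M"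
  using measurable_sets[OF tau_measurable_fixed A', of x] \<open>\<tau> x -` A \<inter> space M = \<tau> (- x) ` A\<close> by simp
 ultimately show "emeasure (distr M M (\<tau> x)) A = emeasure M A"
  using tau_preserving[OF A', of "- x"] by (simp add: emeasure_eq_measure)
qed simp

lemma nn_integral_tau:
 assumes [measurable]: "f : borel_measurable M"
 shows "(nn_integral M (%w. f (\<tau> x w))) = (nn_integral M (%w. f w))"
 using nn_integral_distr[of "\<tau> x" M M f] by (simp add: distr_tau)

lemma integral_tau:
 fixes f :: "'w => real"
 assumes [measurable]: "f : borel_measurable M"
 shows "(LINT w|M. f (\<tau> x w)) = (LINT w|M. f w)"
 using integral_distr[of "\<tau> x" M M f] by (simp add: distr_tau)

section \<open>Maximal inequality along the orbits\<close>

abbreviation (input) tr :: "real => 'a => 'w => 'w" where "tr r x == \<tau> (r *\<^sub>R x)"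

text \<open>The orbit is stretched so that the domain stays the unit ball. This is the average over
  the ball of radius r times the volume of the unit ball.\<close>

definition ball_avg :: "('w => real) => real => 'w => ennreal" where
 "ball_avg G r w = (set_nnint (cball 0 1) (%x. ennreal (G (tr r x w))))"

lemma ball_avg_unscaled:
 assumes [measurable]: "G : borel_measurable M" and r: "r > 0" and w: "w : space M"
 shows "(set_nnint (cball 0 r) (%y. ennreal (G (\<tau> y w)))) = ennreal (r ^ DIM('a)) * ball_avg G r w"
proof -
 have [measurable]: "(%y. \<tau> y w) : borel \<rightarrow>\<^sub>M M" using w by measurable
 let ?A = "nnint (%x. ennreal (G (tr r x w)) * ind (cball 0 r) (r *\<^sub>R x))"
 have "(set_nnint (cball 0 r) (%y. ennreal (G (\<tau> y w))))
  = ennreal (r ^ DIM('a)) * ?A"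
  by (rule nn_integral_lborel_scale[OF _ r]) measurable
 also have "?A = ball_avg G r w"
  unfolding ball_avg_def
 proof (rule nn_integral_cong, goal_cases)
  case (1 x)
  have "norm (r *\<^sub>R x) <= r \<longleftrightarrow> norm x <= 1" using r by simp
  then show ?case
   by (simp add: indicator_def)
 qed
 finally show ?thesis .
qed

text \<open>Transference: the Vitali covering lemma, applied along the orbits, gives the weak type
 bound for the maximal function of the action.\<close>

lemma orbit_covering:
 fixes g :: "'a => real" and N :: nat
 assumes [measurable]: "g : Borel" and g: "!!x. 0 <= g x" and t: "t > 0"
  and S: "S : sets borel" "!!x. x : S ==> norm x <= real N"
   "!!x. x : S ==> \<exists>n\<in>{1..N}. ennreal (t * real n ^ DIM('a)) < (set_nnint (cball x (real n)) (%y. ennreal (g y)))"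
 shows "ennreal t * emeasure lborel S <= ennreal (unit_ball_vol (real DIM('a)) * 5 ^ DIM('a)) * (set_nnint (cball 0 (2 * real N)) (%y. ennreal (g y)))"
proof -
 define V where "V = unit_ball_vol (real DIM('a))"
 have V0: "0 <= V" by (simp add: V_def)
 \<comment> \<open>Balls, as pairs of centre and radius, on which the integral of g exceeds t times
   the d-th power of the radius. The radii are at most N, as Vitali's lemma requires.\<close>
 define K where "K = {(x, n). x : S \<and> n : {1..N} \<and> ennreal (t * real n ^ DIM('a)) < (set_nnint (cball x (real n)) (%y. ennreal (g y)))}"
 have sub: "S \<subseteq> (\<Union>i\<in>K. cball (fst i) (real (snd i)))"
 proof
  fix x assume x: "x : S"
  then obtain n where "(x, n) : K" using S(3)[OF x] by (auto simp: K_def)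
  then show "x : (\<Union>i\<in>K. cball (fst i) (real (snd i)))" by force
 qed
 have rad: "0 < real (snd i) \<and> real (snd i) <= real N" if "i : K" for i
  using that by (auto simp: K_def)
 obtain C where C: "countable C" "C \<subseteq> K"
   "pairwise (%i j. disjnt (cball (fst i) (real (snd i))) (cball (fst j) (real (snd j)))) C"
   "S \<subseteq> (\<Union>i\<in>C. cball (fst i) (5 * real (snd i)))"
  by (rule Vitali_covering_lemma_cballs[OF sub rad])
 let ?D = "density lborel (%y. ennreal (g y))"
 have disj: "disjoint_family_on (%i. cball (fst i) (real (snd i))) C"
  using C(3) by (auto simp: disjoint_family_on_def pairwise_def disjnt_def)
 have vol: "ennreal t * emeasure lborel (cball (fst i) (5 * real (snd i))) <= ennreal (V * 5 ^ DIM('a)) * emeasure ?D (cball (fst i) (real (snd i)))"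
  if i: "i : C" for i
 proof -
  obtain x n where xn: "i = (x, n)" by (cases i)
  have n: "n >= 1" and gt: "ennreal (t * real n ^ DIM('a)) < (set_nnint (cball x (real n)) (%y. ennreal (g y)))"
   using i C(2) by (auto simp: K_def xn)
  have "ennreal t * emeasure lborel (cball x (5 * real n)) = ennreal t * ennreal (V * (5 * real n) ^ DIM('a))"
   unfolding V_def by (subst emeasure_cball) auto
  also have "... = ennreal (V * 5 ^ DIM('a)) * ennreal (t * real n ^ DIM('a))"
   using t V0 by (simp add: ennreal_mult[symmetric] power_mult_distrib mult_ac)
  also have "... <= ennreal (V * 5 ^ DIM('a)) * (set_nnint (cball x (real n)) (%y. ennreal (g y)))"
   using gt by (intro mult_left_mono) auto
  also have "(set_nnint (cball x (real n)) (%y. ennreal (g y))) = emeasure ?D (cball x (real n))"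
   by (subst emeasure_density) auto
  finally show ?thesis by (simp add: xn)
 qed
 let ?A = "\<Union>i\<in>C. cball (fst i) (real (snd i))"
 have "ennreal t * emeasure lborel S = (nnint (%x. ennreal t * ind S x))"
  using S(1) by (simp add: nn_integral_cmult_indicator)
 also have "... <= (nnint (%x. (nn_integral (count_space C) (%i. ennreal t * ind (cball (fst i) (5 * real (snd i))) x))))"
 proof (rule nn_integral_mono, goal_cases)
  case (1 x)
  show ?case
  proof (cases "x : S")
   case True
   then obtain i where i: "i : C" "x : cball (fst i) (5 * real (snd i))" using C(4) by blast
   then have "ennreal t * ind S x = ennreal t * ind (cball (fst i) (5 * real (snd i))) x" using True by simp
   also have "... <= (nn_integral (count_space C) (%i. ennreal t * ind (cball (fst i) (5 * real (snd i))) x))"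
    by (rule nn_integral_ge_point[OF i(1)])
   finally show ?thesis .
  qed simp
 qed
 also have "... = (nn_integral (count_space C) (%i. (nnint (%x. ennreal t * ind (cball (fst i) (5 * real (snd i))) x))))"
  by (rule nn_integral_count_space_nn_integral[OF C(1)])
   (intro borel_measurable_times_ennreal borel_measurable_const borel_measurable_indicator, simp)
 also have "... = (nn_integral (count_space C) (%i. ennreal t * emeasure lborel (cball (fst i) (5 * real (snd i)))))"
  by (intro nn_integral_cong nn_integral_cmult_indicator) simp
 also have "... <= (nn_integral (count_space C) (%i. ennreal (V * 5 ^ DIM('a)) * emeasure ?D (cball (fst i) (real (snd i)))))"
  by (rule nn_integral_mono) (use vol in simp)
 also have "... = ennreal (V * 5 ^ DIM('a)) * (nn_integral (count_space C) (%i. emeasure ?D (cball (fst i) (real (snd i)))))"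
  by (rule nn_integral_cmult) simp
 also have "(nn_integral (count_space C) (%i. emeasure ?D (cball (fst i) (real (snd i))))) = emeasure ?D ?A"
  by (rule emeasure_UN_countable[symmetric]) (use C(1) disj in auto)
 also have "ennreal (V * 5 ^ DIM('a)) * emeasure ?D ?A
  <= ennreal (V * 5 ^ DIM('a)) * emeasure ?D (cball 0 (2 * real N))"
 proof (intro mult_left_mono emeasure_mono)
  show "?A \<subseteq> cball 0 (2 * real N)"
  proof (rule UN_least)
   fix i assume i: "i : C"
   then have "fst i : S" "real (snd i) <= real N" using C(2) rad by (auto simp: K_def)
   then have "norm (fst i) + real (snd i) <= 2 * real N" using S(2) by fastforce
   then show "cball (fst i) (real (snd i)) \<subseteq> cball 0 (2 * real N)"
    by (intro cball_subset_cball_iff[THEN iffD2]) (simp add: dist_norm)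
  qed
 qed auto
 also have "emeasure ?D (cball 0 (2 * real N)) = (set_nnint (cball 0 (2 * real N)) (%y. ennreal (g y)))"
  by (subst emeasure_density) auto
 finally show ?thesis by (simp add: V_def)
qed

text \<open>5^d from Vitali's lemma, 2^d from passing from orbit pieces of radius N to radius 2 N,
  and the volume of the unit ball.\<close>

definition max_const :: real where
 "max_const = 10 ^ DIM('a)* unit_ball_vol (real DIM('a))"

text \<open>Integrate the orbit estimate over the sample space. By invariance each orbit integral
  over a ball becomes the volume of the ball times an expectation, so N^d cancels and the constant
  does not depend on N.\<close>

lemma maximal_inequality_finite:
 assumes [measurable]: "G : borel_measurable M" and G: "!!w. 0 <= G w" and t: "t > 0"
 shows "ennreal t * emeasure M {w\<in>space M. \<exists>n\<in>{1..N}. ennreal t < ball_avg G (real n) w}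
  <= ennreal max_const * (nn_integral M (%w. ennreal (G w)))"
proof (cases "N = 0")
 case True
 then show ?thesis by simp
next
 case False
 interpret LM: pair_sigma_finite lborel M ..
 define V where "V = unit_ball_vol (real DIM('a))"
 have V0: "0 < V" by (simp add: V_def)
 have N0: "0 < real N" using False by simp
 define E where "E = {w\<in>space M. \<exists>n\<in>{1..N}. ennreal (t * real n ^ DIM('a)) < (set_nnint (cball 0 (real n)) (%y. ennreal (G (\<tau> y w))))}"
 have [measurable]: "E : sets M" unfolding E_def by measurable
 have Eeq: "{w\<in>space M. \<exists>n\<in>{1..N}. ennreal t < ball_avg G (real n) w} = E"
 proof -
  have "ennreal t < ball_avg G (real n) w \<longleftrightarrow> ennreal (t * real n ^ DIM('a)) < (set_nnint (cball 0 (real n)) (%y. ennreal (G (\<tau> y w))))"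
   if "w : space M" "n : {1..N}" for w n
  proof -
   have n: "0 < real n" using that by simp
   have np: "0 < real n ^ DIM('a)" using n by simp
   show ?thesis
    unfolding ball_avg_unscaled[OF assms(1) n that(1)]
    using t np by (cases "ball_avg G (real n) w")
     (auto simp: ennreal_mult[symmetric] ennreal_less_iff mult.commute[of t] ennreal_mult_top less_top[symmetric])
  qed
  then show ?thesis unfolding E_def by blast
 qed
 have orbit: "ennreal t * (set_nnint (cball 0 (real N)) (%x. ind E (\<tau> x w)))
   <= ennreal (V * 5 ^ DIM('a)) * (set_nnint (cball 0 (2 * real N)) (%y. ennreal (G (\<tau> y w))))" if w: "w : space M" for w
 proof -
  have [measurable]: "(%y. \<tau> y w) : borel \<rightarrow>\<^sub>M M" using w by measurable
  \<comment> \<open>Positions x within radius N at which the orbit of w lies in E. A ball average at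
    such a point of the orbit is an average of g over a ball around x.\<close>
  define S where "S = {x. norm x <= real N \<and> \<tau> x w : E}"
  have Sm: "S : sets borel"
  proof -
   have "{x : space borel. norm x <= real N \<and> \<tau> x w : E} : sets borel" by measurable
   then show ?thesis by (simp add: S_def)
  qed
  have "ennreal t * emeasure lborel S <= ennreal (V * 5 ^ DIM('a)) * (set_nnint (cball 0 (2 * real N)) (%y. ennreal (G (\<tau> y w))))"
   unfolding V_def
  proof (rule orbit_covering[OF _ _ t Sm])
   fix x assume x: "x : S"
   show "norm x <= real N" using x by (simp add: S_def)
   have "\<tau> x w : E" using x by (simp add: S_def)
   then obtain n where n: "n : {1..N}" "ennreal (t * real n ^ DIM('a)) < (set_nnint (cball 0 (real n)) (%y. ennreal (G (\<tau> y (\<tau> x w)))))"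
    by (auto simp: E_def)
   have "(set_nnint (cball x (real n)) (%y. ennreal (G (\<tau> y w))))
    = (nnint (%y. ennreal (G (\<tau> (x + y) w)) * ind (cball x (real n)) (x + y)))"
    by (rule nn_integral_lborel_translate[symmetric]) measurable
   also have "... = (set_nnint (cball 0 (real n)) (%y. ennreal (G (\<tau> y (\<tau> x w)))))"
    using w by (intro nn_integral_cong) (auto simp: tau_add add.commute indicator_def dist_norm)
   finally show "\<exists>n\<in>{1..N}. ennreal (t * real n ^ DIM('a)) < (set_nnint (cball x (real n)) (%y. ennreal (G (\<tau> y w))))"
    using n by (intro bexI[of _ n]) auto
  qed (use G in auto)
  moreover have "(set_nnint (cball 0 (real N)) (%x. ind E (\<tau> x w))) = emeasure lborel S"
  proof -
   have "(set_nnint (cball 0 (real N)) (%x. ind E (\<tau> x w))) = (nnint (%x. ind S x))"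
    by (intro nn_integral_cong) (auto simp: S_def indicator_def)
   then show ?thesis using Sm by simp
  qed
  ultimately show ?thesis by simp
 qed
 have cb: "emeasure lborel (cball (0::'a) r) = ennreal (V * r ^ DIM('a))" if "0 <= r" for r
  unfolding V_def using that by (rule emeasure_cball)
 have swap: "(nn_integral M (%w. (set_nnint (cball 0 r) (%x. h (\<tau> x w))))) = ennreal (V * r ^ DIM('a)) * (nn_integral M (%w. h w))"
  if [measurable]: "h : borel_measurable M" and r: "0 <= r" for h :: "'w => ennreal" and r
 proof -
  have "(nn_integral M (%w. (set_nnint (cball 0 r) (%x. h (\<tau> x w))))) = (nnint (%x. (nn_integral M (%w. h (\<tau> x w) * ind (cball 0 r) x))))"
   by (rule LM.Fubini') measurable
  also have "... = (nnint (%x. (nn_integral M (%w. h w)) * ind (cball (0::'a) r) x))"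
   by (intro nn_integral_cong) (simp add: nn_integral_multc nn_integral_tau)
  also have "... = (nn_integral M (%w. h w)) * emeasure lborel (cball (0::'a) r)"
   by (rule nn_integral_cmult_indicator) simp
  finally show ?thesis by (simp add: cb[OF r] mult.commute)
 qed
 let ?A = "nn_integral M (%w. ennreal (G w))"
 let ?B = "V * (2 * real N) ^ DIM('a)"
 let ?C = "nn_integral M (%w. (set_nnint (cball 0 (2 * real N)) (%y. ennreal (G (\<tau> y w)))))"
 have "ennreal t * (ennreal (V * real N ^ DIM('a)) * emeasure M E) = ennreal t * (nn_integral M (%w. (set_nnint (cball 0 (real N)) (%x. ind E (\<tau> x w)))))"
  by (subst swap) simp_all
 also have "... = (nn_integral M (%w. ennreal t * (set_nnint (cball 0 (real N)) (%x. ind E (\<tau> x w)))))"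
  by (rule nn_integral_cmult[symmetric]) measurable
 also have "... <= (nn_integral M (%w. ennreal (V * 5 ^ DIM('a)) * (set_nnint (cball 0 (2 * real N)) (%y. ennreal (G (\<tau> y w))))))"
  by (rule nn_integral_mono) (rule orbit)
 also have "... = ennreal (V * 5 ^ DIM('a)) * ?C"
  by (rule nn_integral_cmult) measurable
 also have "?C = ennreal ?B * ?A"
  by (rule swap) auto
 finally have le: "ennreal t * (ennreal (V * real N ^ DIM('a)) * emeasure M E)
  <= ennreal (V * 5 ^ DIM('a)) * (ennreal ?B * ?A)" .
 define q where "q = V * real N ^ DIM('a)"
 have q: "0 < q" using V0 N0 by (simp add: q_def)
 have e1: "ennreal t * (ennreal q * emeasure M E) = ennreal q * (ennreal t * emeasure M E)" by (simp only: mult_ac)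
 have e2: "ennreal (V * 5 ^ DIM('a)) * (ennreal ?B * ?A)
  = ennreal q * (ennreal max_const * ?A)"
 proof -
  have "V * 5 ^ DIM('a) * ?B = q * max_const"
  proof -
   have "(10::real) ^ DIM('a) = 5 ^ DIM('a) * 2 ^ DIM('a)" by (simp add: power_mult_distrib[symmetric])
   then show ?thesis by (simp add: q_def max_const_def V_def[symmetric] power_mult_distrib)
  qed
  then have "ennreal (V * 5 ^ DIM('a)) * ennreal ?B = ennreal q * ennreal max_const"
   using V0 q by (simp add: ennreal_mult[symmetric] max_const_def)
  then show ?thesis by (simp only: mult.assoc[symmetric])
 qed
 have "ennreal q * (ennreal t * emeasure M E) <= ennreal q * (ennreal max_const * ?A)"
  using le unfolding e2 q_def[symmetric] e1 .
 then have "inverse (ennreal q) * (ennreal q * (ennreal t * emeasure M E)) <= inverse (ennreal q) * (ennreal q * (ennreal max_const * ?A))"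
  by (rule mult_left_mono) simp
 then show ?thesis unfolding Eeq inverse_ennreal_cancel[OF q] .
qed

text \<open>Integer radii make the exceptional set an increasing union of measurable sets; real
  radii return in \<open>ball_integral_le_maximal\<close>.\<close>

lemma maximal_inequality:
 assumes [measurable]: "G : borel_measurable M" and G: "!!w. 0 <= G w" and t: "t > 0"
 shows "ennreal t * emeasure M {w\<in>space M. \<exists>n\<ge>1. ennreal t < ball_avg G (real n) w}
  <= ennreal max_const * (nn_integral M (%w. ennreal (G w)))"
proof -
 define E where "E N = {w\<in>space M. \<exists>n\<in>{1..N}. ennreal t < ball_avg G (real n) w}" for N
 have E: "E N : sets M" for N unfolding E_def ball_avg_def by measurable
 have "{w\<in>space M. \<exists>n\<ge>1. ennreal t < ball_avg G (real n) w} = (\<Union>N. E N)" unfolding E_def by fastforce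
 moreover have "emeasure M (\<Union>N. E N) = (SUP N. emeasure M (E N))"
 proof (rule SUP_emeasure_incseq[symmetric])
  show "range E \<subseteq> sets M" using E by blast
  show "incseq E" unfolding incseq_def E_def by force
 qed
 moreover have "ennreal t * (SUP N. emeasure M (E N)) = (SUP N. ennreal t * emeasure M (E N))"
  by (rule SUP_mult_left_ennreal)
 moreover have "(SUP N. ennreal t * emeasure M (E N)) <= ennreal max_const * (nn_integral M (%w. ennreal (G w)))"
  by (rule SUP_least) (unfold E_def, rule maximal_inequality_finite[OF assms(1) G t])
 ultimately show ?thesis by simp
qed

lemma ball_integral_le_maximal:
 assumes [measurable]: "G : borel_measurable M" and w: "w : space M" and K: "!!n. n >= 1 ==> ball_avg G (real n) w <= K"
  and L: "L >= 1" and r: "r >= 1"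
 shows "(set_nnint (cball 0 L) (%x. ennreal (G (tr r x w)))) <= ennreal ((2 * L) ^ DIM('a)) * K"
proof -
 have [measurable]: "(%y. \<tau> y w) : borel \<rightarrow>\<^sub>M M" using w by measurable
 have rp: "0 < r" "0 < r * L" using r L by (auto intro: mult_pos_pos)
 have rL1: "1 <= r * L" using mult_mono[of 1 r 1 L] r L by simp
 \<comment> \<open>Rounding up at most doubles the radius, because r L >= 1.\<close>
 define n where "n = nat \<lceil>r * L\<rceil>"
 have n: "r * L <= real n" "real n <= 2 * (r * L)" "n >= 1"
  using rL1 unfolding n_def by linarith+
 let ?A = "set_nnint (cball 0 L) (%x. ennreal (G (tr r x w)))"
 have "ennreal (r ^ DIM('a)) * ?A
   = (set_nnint (cball 0 (r * L)) (%y. ennreal (G (\<tau> y w))))"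
 proof -
  let ?B = "nnint (%x. ennreal (G (tr r x w)) * ind (cball 0 (r * L)) (r *\<^sub>R x))"
  have "(set_nnint (cball 0 (r * L)) (%y. ennreal (G (\<tau> y w))))
   = ennreal (r ^ DIM('a)) * ?B"
   by (rule nn_integral_lborel_scale[OF _ rp(1)]) measurable
  also have "?B = ?A"
   using rp by (intro nn_integral_cong) (simp add: indicator_def)
  finally show ?thesis by simp
 qed
 also have "... <= (set_nnint (cball 0 (real n)) (%y. ennreal (G (\<tau> y w))))"
  using n(1) by (intro nn_integral_mono) (auto simp: indicator_def)
 also have "... = ennreal (real n ^ DIM('a)) * ball_avg G (real n) w"
  by (rule ball_avg_unscaled[OF assms(1) _ w]) (use n in simp)
 also have "... <= ennreal ((2 * (r * L)) ^ DIM('a)) * K"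
  using n K by (intro mult_mono ennreal_leI power_mono) auto
 also have "... = ennreal (r ^ DIM('a)) * (ennreal ((2 * L) ^ DIM('a)) * K)"
 proof -
  have "(2 * (r * L)) ^ DIM('a) = r ^ DIM('a) * (2 * L) ^ DIM('a)" by (simp add: power_mult_distrib)
  moreover have "ennreal (r ^ DIM('a) * (2 * L) ^ DIM('a)) = ennreal (r ^ DIM('a)) * ennreal ((2 * L) ^ DIM('a))"
   using rp L by (intro ennreal_mult) auto
  ultimately show ?thesis by (simp only: mult.assoc)
 qed
 finally have le: "ennreal (r ^ DIM('a)) * ?A
   <= ennreal (r ^ DIM('a)) * (ennreal ((2 * L) ^ DIM('a)) * K)" .
 have q: "0 < r ^ DIM('a)" using rp by simp
 from mult_left_mono[OF le, of "inverse (ennreal (r ^ DIM('a)))"] show ?thesis unfolding inverse_ennreal_cancel[OF q] by simp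
qed

text \<open>The maximal function is finite almost surely, since its level sets have probability of
  order 1/k. The constant so obtained is uniform in the scale r and in the radius L.\<close>

lemma ball_integral_bounded_AE:
 assumes G: "integrable M G" "!!w. 0 <= G w"
 shows "AE w in M. \<exists>K\<ge>0. \<forall>r\<ge>1. \<forall>L\<ge>1. (set_nnint (cball 0 L) (%x. ennreal (G (tr r x w)))) <= ennreal (K * L ^ DIM('a))"
proof -
 have [measurable]: "G : borel_measurable M" using G(1) by auto
 define E where "E k = {w\<in>space M. \<exists>n\<ge>1. ennreal (real (Suc k)) < ball_avg G (real n) w}" for k :: nat
 have E: "E k : sets M" for k unfolding E_def ball_avg_def by measurable
 define m where "m = (LINT w|M. G w)"
 have m: "(nn_integral M (%w. ennreal (G w))) = ennreal m" "0 <= m"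
  unfolding m_def using G by (auto intro!: nn_integral_eq_integral)
 have c0: "0 <= max_const" by (simp add: max_const_def)
 have bound: "real (Suc k) * measure M (E k) <= max_const * m" for k
 proof -
  have "ennreal (real (Suc k)) * emeasure M (E k) <= ennreal max_const * ennreal m"
   unfolding E_def m(1)[symmetric] by (rule maximal_inequality) (use G in auto)
  then have "ennreal (real (Suc k) * measure M (E k)) <= ennreal (max_const * m)"
   using c0 m(2) by (simp add: emeasure_eq_measure ennreal_mult[symmetric] del: of_nat_Suc)
  then show ?thesis using c0 m(2) by (subst (asm) ennreal_le_iff) auto
 qed
 have "measure M (\<Inter>k. E k) <= 0"
 proof (rule ccontr)
  assume "\<not> ?thesis"
  then have p: "0 < measure M (\<Inter>k. E k)" by simp
  obtain k :: nat where k: "max_const * m < real k * measure M (\<Inter>k. E k)"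
   using reals_Archimedean3[OF p] by blast
  have "measure M (\<Inter>k. E k) <= measure M (E k)" by (rule finite_measure_mono) (auto simp: E)
  then have "real k * measure M (\<Inter>k. E k) <= real (Suc k) * measure M (E k)" by (intro mult_mono) auto
  with bound[of k] k show False by linarith
 qed
 then have "emeasure M (\<Inter>k. E k) = 0" by (simp add: emeasure_eq_measure measure_nonneg order_antisym)
 then have "(\<Inter>k. E k) : null_sets M" using E by (intro null_setsI) auto
 then have "AE w in M. w \<notin> (\<Inter>k. E k)" by (rule AE_not_in)
 with AE_space show ?thesis
 proof eventually_elim
  case (elim w)
  note w = elim(1)
  from elim obtain k where "w \<notin> E k" by blast
  then have K: "ball_avg G (real n) w <= ennreal (real (Suc k))" if "n >= 1" for n
   using w that by (auto simp: E_def not_less)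
  show ?case
  proof (intro exI[of _ "2 ^ DIM('a) * real (Suc k)"] conjI allI impI)
   fix r L :: real assume r: "r >= 1" and L: "L >= 1"
   have "(set_nnint (cball 0 L) (%x. ennreal (G (tr r x w)))) <= ennreal ((2 * L) ^ DIM('a)) * ennreal (real (Suc k))"
    by (rule ball_integral_le_maximal[OF _ w K L r]) simp_all
   also have "... = ennreal (2 ^ DIM('a) * real (Suc k) * L ^ DIM('a))"
    using L by (simp add: ennreal_mult[symmetric] power_mult_distrib mult_ac del: of_nat_Suc)
   finally show "(set_nnint (cball 0 L) (%x. ennreal (G (tr r x w)))) <= ennreal (2 ^ DIM('a) * real (Suc k) * L ^ DIM('a))" .
  qed simp
 qed
qed

section \<open>Mean and pointwise ergodic theorem\<close>

lemma bounded_integrable: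
 fixes g :: "'w => real"
 assumes "g : borel_measurable M" "!!w. \<bar>g w\<bar> <= B"
 shows "integrable M g"
 by (rule integrable_const_bound[of _ B]) (use assms in auto)

lemma integral_abs_le_sqrt:
 assumes f: "sqint M f"
 shows "(LINT w|M. \<bar>f w\<bar>) <= sqrt (LINT w|M. (f w)^2)"
proof -
 have 1: "sqint M (%w. \<bar>f w\<bar>)" using f by (auto simp: sqint_def)
 have 2: "sqint M (%w. 1)" by (simp add: sqint_def)
 show ?thesis using Cauchy_Schwarz_integral[OF 1 2] by (simp add: prob_space)
qed

text \<open>Invariance holds only almost surely for each h, whereas ergodicity concerns sets that
  are invariant pointwise. The set of points whose orbit meets {G > c} in a Lebesgue null set of
  positions is strictly invariant, and Fubini identifies it with {G <= c} up to a null set.\<close>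

lemma invariant_AE_const:
 fixes G :: "'w => real"
 assumes [measurable]: "G : borel_measurable M" and B: "!!w. \<bar>G w\<bar> <= B"
  and inv: "!!h. AE w in M. G (\<tau> h w) = G w"
 shows "AE w in M. G w = (LINT w|M. G w)"
proof -
 interpret LM: pair_sigma_finite lborel M ..
 define c where "c = (LINT w|M. G w)"
 have Gi: "integrable M G" by (rule bounded_integrable[OF _ B]) simp
 have "AE h in lborel. AE w in M. G (\<tau> h w) = G w" using inv by simp
 then have orb: "AE w in M. AE h in lborel. G (\<tau> h w) = G w"
  by (subst (asm) LM.AE_commute) measurable
 define A where "A = {w\<in>space M. (nn_integral (lborel :: 'a measure) (%x. ind {w\<in>space M. c < G w} (\<tau> x w))) = 0}"
 have Am: "A : sets M" unfolding A_def by measurable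
 have tauA: "\<tau> h w : A" if "w : A" for h w
 proof -
  have w: "w : space M" using that by (simp add: A_def)
  have [measurable]: "(%y. \<tau> y w) : borel \<rightarrow>\<^sub>M M" using w by measurable
  have "(nn_integral (lborel :: 'a measure) (%x. ind {w\<in>space M. c < G w} (\<tau> x (\<tau> h w))))
   = (nnint (%x. ind {w\<in>space M. c < G w} (\<tau> (h + x) w)))"
   using w by (intro nn_integral_cong) (simp add: tau_add add.commute)
  also have "... = (nnint (%x. ind {w\<in>space M. c < G w} (\<tau> x w)))"
   by (rule nn_integral_lborel_translate) measurable
  finally show ?thesis using that w by (simp add: A_def tau_space)
 qed
 have "\<tau> h ` A = A" for h
 proof
  show "\<tau> h ` A \<subseteq> A" by (rule image_subsetI) (rule tauA)
  show "A \<subseteq> \<tau> h ` A"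
  proof
   fix w assume a: "w : A"
   then have "w = \<tau> h (\<tau> (- h) w)" by (simp add: A_def tau_inverse)
   then show "w : \<tau> h ` A" by (rule image_eqI) (rule tauA[OF a])
  qed
 qed
 then have zero_one: "measure M A : {0, 1}" by (intro tau_ergodic[OF Am] allI)
 have A_iff: "AE w in M. w : A \<longleftrightarrow> G w <= c"
  using orb AE_space
 proof eventually_elim
  case (elim w)
  note o = elim(1) and w = elim(2)
  have "(nn_integral (lborel :: 'a measure) (%x. ind {w\<in>space M. c < G w} (\<tau> x w))) = (nn_integral (lborel :: 'a measure) (%x. (if c < G w then 1 else 0)))"
  proof (rule nn_integral_cong_AE, use o in eventually_elim)
   case (elim x)
   then show ?case
    using tau_space[OF w, of x] by (simp add: indicator_def)
  qed
  then have "w : A \<longleftrightarrow> (nn_integral (lborel :: 'a measure) (%x. (if c < G w then 1 else 0))) = 0"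
   using w by (simp add: A_def)
  then show ?case by (cases "c < G w") simp_all
 qed
 \<comment> \<open>Otherwise G > c almost surely, although c is the mean of G.\<close>
 have "measure M A = 1"
 proof (rule ccontr)
  assume "measure M A \<noteq> 1"
  then have "measure M A = 0" using zero_one by blast
  then have "A : null_sets M" using Am by (auto simp: emeasure_eq_measure)
  then have "AE w in M. w \<notin> A" by (rule AE_not_in)
  with A_iff have lt: "AE w in M. c < G w" by eventually_elim auto
  have "(LINT w|M. G w - c) = 0" using Gi by (simp add: c_def prob_space)
  moreover have "AE w in M. 0 <= G w - c" using lt by eventually_elim simp
  moreover have "integrable M (%w. G w - c)" using Gi by simp
  ultimately have "AE w in M. G w - c = 0" using integral_nonneg_eq_0_iff_AE by blast
  with lt have "AE w in M. False" by eventually_elim simp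
  then show False by (simp add: AE_False)
 qed
 then have "AE w in M. w : A" using prob_eq_1[OF Am] by simp
 with A_iff have le: "AE w in M. 0 <= c - G w" by eventually_elim auto
 have "(LINT w|M. c - G w) = 0" using Gi by (simp add: c_def prob_space)
 moreover have "integrable M (%w. c - G w)" using Gi by simp
 ultimately have "AE w in M. c - G w = 0" using integral_nonneg_eq_0_iff_AE le by blast
 then show ?thesis unfolding c_def[symmetric] by eventually_elim simp
qed

definition orbit_avg :: "'a set => real => ('w => real) => 'w => real" where
 "orbit_avg Q r f w = (LBINT x. ind Q x * f (tr r x w))"

lemma orbit_measurable:
 fixes f :: "'w => real"
 assumes [measurable]: "f : borel_measurable M" and w: "w : space M"
 shows "(%x. f (tr r x w)) : Borel"
proof -
 have [measurable]: "(%y. \<tau> y w) : borel \<rightarrow>\<^sub>M M" using w by measurable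
 show ?thesis by measurable
qed

lemma orbit_avg_integrable:
 fixes f :: "'w => real"
 assumes f: "f : borel_measurable M" "!!w. \<bar>f w\<bar> <= B" and w: "w : space M"
  and Q: "Q : sets borel" "Q \<subseteq> cball 0 L"
 shows "integrable lborel (%x. ind Q x * f (tr r x w))"
proof (rule bounded_Borel_integrable)
 show "(%x. ind Q x * f (tr r x w)) : Borel"
  using orbit_measurable[OF f(1) w] Q(1) by simp
 show "ind Q x * f (tr r x w) = 0" if "norm x > L" for x using Q(2) that by (auto simp: indicator_def)
 show "\<bar>ind Q x * f (tr r x w)\<bar> <= B" for x
  using f(2)[of "\<tau> (r *\<^sub>R x) w"] by (auto simp: indicator_def)
qed

text \<open>Averaging a coboundary amounts to translating Q by a vector of length |h|/r, and the
  indicator of Q is L1 close to its small translates.\<close>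

lemma orbit_avg_shift:
 fixes f :: "'w => real"
 assumes f [measurable]: "f : borel_measurable M" and B: "!!w. \<bar>f w\<bar> <= B" and w: "w : space M"
  and Q: "Q : sets borel" "Q \<subseteq> cball 0 L"
 shows "((%r. orbit_avg Q r (%w. f (\<tau> h w) - f w) w) \<longlongrightarrow> 0) at_top"
proof (rule tendsto_at_topI_sequentially)
 fix X :: "nat => real" assume X: "filterlim X at_top sequentially"
 have B0: "0 <= B" using B[of undefined] by linarith
 have Qi: "integrable lborel (%x. ind Q x :: real)"
 proof (rule integrable_real_indicator)
  have "bounded Q" using Q(2) bounded_cball bounded_subset by blast
  then show "emeasure lborel Q < \<infinity>" by (rule emeasure_bounded_finite)
 qed (use Q in simp)
 \<comment> \<open>Chosen so that X n (x - c n) = h + X n x: the shift of the observable becomes a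
   translation of x.\<close>
 define c where "c n = - (inverse (X n) *\<^sub>R h)" for n
 have "(%n. inverse (X n)) ~> 0" by (rule tendsto_inverse_0_at_top[OF X])
 then have "(%n. - (inverse (X n) *\<^sub>R h)) ~> - (0 *\<^sub>R h)" by (intro tendsto_intros)
 then have c0: "c ~> 0" unfolding c_def by simp
 have "(%n. B * (LBINT x. \<bar>ind Q (c n + x) - ind Q x\<bar>)) ~> B * 0"
  using integrable_translation_continuous[OF Qi] c0 by (intro tendsto_mult_left) (simp add: translation_continuous_def)
 then have lim: "(%n. B * (LBINT x. \<bar>ind Q (c n + x) - ind Q x\<bar>)) ~> 0" by simp
 let ?A = "%w. f (\<tau> h w) - f w"
 have "eventually (%n. norm (orbit_avg Q (X n) ?A w) <= B * (LBINT x. \<bar>ind Q (c n + x) - ind Q x\<bar>)) sequentially"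
  using filterlim_at_top_dense[THEN iffD1, OF X, rule_format, of 0]
 proof eventually_elim
  case Xn: (elim n)
  define k where "k x = f (tr (X n) x w)" for x
  have [measurable]: "k : Borel" unfolding k_def by (rule orbit_measurable[OF f w])
  have kB: "\<bar>k x\<bar> <= B" for x by (simp add: k_def B)
  have sh: "f (\<tau> h (tr (X n) x w)) = k (x - c n)" for x
  proof -
   have "X n *\<^sub>R (x - c n) = h + X n *\<^sub>R x" using Xn by (simp add: c_def scaleR_add_right)
   then show ?thesis using w by (simp add: k_def tau_add)
  qed
  have i0: "integrable lborel (%x. ind Q x * k x)"
   unfolding k_def by (rule orbit_avg_integrable[OF f B w Q])
  have ib: "integrable lborel (%x. ind Q (c n + x) * k x)"
  proof (rule bint_bound[of _ "%x. B * ind Q (c n + x)"])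
   show "integrable lborel (%x. B * ind Q (c n + x))" using integrable_lborel_translate(1)[OF Qi] by simp
   have [measurable]: "(%x. ind Q (c n + x) :: real) : Borel"
    using borel_measurable_integrable[OF integrable_lborel_translate(1)[OF Qi, of "c n"]] by simp
   show "(%x. ind Q (c n + x) * k x) : borel_measurable lborel" by measurable
   show "AE x in lborel. norm (ind Q (c n + x) * k x) <= norm (B * ind Q (c n + x))"
    using kB B0 by (intro AE_I2) (auto simp: indicator_def)
  qed
  have tr: "(LBINT x. ind Q x * k (x - c n)) = (LBINT x. ind Q (c n + x) * k x)"
   and itr: "integrable lborel (%x. ind Q x * k (x - c n))"
  proof -
   have "(%x. ind Q (c n + (- c n + x)) * k (- c n + x)) = (%x. ind Q x * k (x - c n))" by (simp add: fun_eq_iff)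
   then show "(LBINT x. ind Q x * k (x - c n)) = (LBINT x. ind Q (c n + x) * k x)"
    "integrable lborel (%x. ind Q x * k (x - c n))"
    using integrable_lborel_translate[OF ib, of "- c n"] by simp_all
  qed
  have "orbit_avg Q (X n) ?A w = (LBINT x. ind Q x * k (x - c n) - ind Q x * k x)"
   unfolding orbit_avg_def using sh by (simp add: k_def right_diff_distrib)
  also have "... = (LBINT x. ind Q (c n + x) * k x) - (LBINT x. ind Q x * k x)"
   using itr i0 by (simp add: tr)
  also have "... = (LBINT x. ind Q (c n + x) * k x - ind Q x * k x)" using ib i0 by simp
  finally have "norm (orbit_avg Q (X n) ?A w) = norm (LBINT x. ind Q (c n + x) * k x - ind Q x * k x)" by simp
  also have "... <= (LBINT x. norm (ind Q (c n + x) * k x - ind Q x * k x))"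
   by (rule integral_norm_bound)
  also have "... <= (LBINT x. B * \<bar>ind Q (c n + x) - ind Q x\<bar>)"
  proof (rule integral_mono)
   show "integrable lborel (%x. norm (ind Q (c n + x) * k x - ind Q x * k x))" using ib i0 by simp
   show "integrable lborel (%x. B * \<bar>ind Q (c n + x) - ind Q x\<bar>)"
    using Qi integrable_lborel_translate(1)[OF Qi] by simp
   show "norm (ind Q (c n + x) * k x - ind Q x * k x) <= B * \<bar>ind Q (c n + x) - ind Q x\<bar>" for x
    using kB[of x] B0 by (simp add: left_diff_distrib[symmetric] abs_mult mult.commute[of B] mult_left_mono)
  qed
  finally show ?case
   by simp
 qed
 then show "(%n. orbit_avg Q (X n) ?A w) ~> 0"
  using lim by (rule Lim_null_comparison)
qed

text \<open>The averages agree at every point of the sample space, so replacing F by a member of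
  this class adds no exceptional set.\<close>

definition equiv_obs :: "'a set => ('w => real) => real => ('w => real) set" where
 "equiv_obs Q F B = {g. g : borel_measurable M \<and> (\<forall>w. \<bar>g w\<bar> <= B) \<and> (LINT w|M. g w) = (LINT w|M. F w) \<and>
   (\<forall>w\<in>space M. ((%r. orbit_avg Q r (%w. g w - F w) w) \<longlongrightarrow> 0) at_top)}"

text \<open>Observables with the same asymptotic averages as \<open>F\<close> form a convex set that is invariant under
 the action; an almost minimiser of the second moment in it is almost invariant, hence by ergodicity
 almost constant.\<close>

lemma mean_ergodic:
 assumes F [measurable]: "F : borel_measurable M" and B: "!!o1. \<bar>F o1\<bar> <= B"
  and Q: "Q : sets borel" "Q \<subseteq> cball 0 L" and d: "d > 0"
 shows "\<exists>g\<in>equiv_obs Q F B. (LINT o1|M. \<bar>g o1 - (LINT o1|M. F o1)\<bar>) < d"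
proof -
 define P where "P = equiv_obs Q F B"
 define c where "c = (LINT o1|M. F o1)"
 have B0: "0 <= B" using B[of undefined] by linarith
 have PD: "g : borel_measurable M" "\<bar>g o1\<bar> <= B" "(LINT o1|M. g o1) = c"
  "o1 : space M ==> ((%r. orbit_avg Q r (%o1. g o1 - F o1) o1) \<longlongrightarrow> 0) at_top" if "g : P" for g o1
  using that by (auto simp: P_def equiv_obs_def c_def)
 have Fi: "integrable lborel (%x. ind Q x * F (tr r x o1))" if "o1 : space M" for r o1
  by (rule orbit_avg_integrable[OF F B that Q])
 have gi: "integrable lborel (%x. ind Q x * g (tr r x o1))" if "o1 : space M" "g : P" for r o1 g
  by (rule orbit_avg_integrable[OF PD(1)[OF that(2)] PD(2)[OF that(2)] that(1) Q])
 have FP: "F : P" unfolding P_def equiv_obs_def using B by (auto simp: orbit_avg_def)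
 have mid: "(%o1. (g o1 + h o1) / 2) : P" if g: "g : P" and h: "h : P" for g h
  unfolding P_def equiv_obs_def
 proof (intro CollectI conjI allI ballI)
  have [measurable]: "g : borel_measurable M" "h : borel_measurable M" using g h by (auto dest: PD)
  show "(%o1. (g o1 + h o1) / 2) : borel_measurable M" by measurable
  show "\<bar>(g o1 + h o1) / 2\<bar> <= B" for o1 using PD(2)[OF g, of o1] PD(2)[OF h, of o1] by (simp add: abs_le_iff)
  have "integrable M g" "integrable M h"
   using bounded_integrable[OF PD(1)[OF g] PD(2)[OF g]] bounded_integrable[OF PD(1)[OF h] PD(2)[OF h]] by auto
  then show "(LINT o1|M. (g o1 + h o1) / 2) = (LINT o1|M. F o1)" using PD(3)[OF g] PD(3)[OF h] by (simp add: c_def)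
  fix o1 assume o1: "o1 : space M"
  have "orbit_avg Q r (%o1. (g o1 + h o1) / 2 - F o1) o1
   = (1 / 2) * orbit_avg Q r (%o1. g o1 - F o1) o1 + (1 / 2) * orbit_avg Q r (%o1. h o1 - F o1) o1" for r
  proof -
   have "orbit_avg Q r (%o1. (g o1 + h o1) / 2 - F o1) o1
    = (LBINT x. (1 / 2) * (ind Q x * g (tr r x o1) - ind Q x * F (tr r x o1))
      + (1 / 2) * (ind Q x * h (tr r x o1) - ind Q x * F (tr r x o1)))"
    unfolding orbit_avg_def by (intro bint_cong) (auto simp: indicator_def field_simps)
   also have "... = (1 / 2) * (LBINT x. ind Q x * g (tr r x o1) - ind Q x * F (tr r x o1))
     + (1 / 2) * (LBINT x. ind Q x * h (tr r x o1) - ind Q x * F (tr r x o1))"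
    using gi[OF o1 g] gi[OF o1 h] Fi[OF o1] by simp
   finally show ?thesis unfolding orbit_avg_def by (simp only: right_diff_distrib)
  qed
  then show "((%r. orbit_avg Q r (%o1. (g o1 + h o1) / 2 - F o1) o1) \<longlongrightarrow> 0) at_top"
   using tendsto_add[OF tendsto_mult_left[OF PD(4)[OF g o1], of "1/2"] tendsto_mult_left[OF PD(4)[OF h o1], of "1/2"]] by simp
 qed
 have shift: "(%o1. g (\<tau> t o1)) : P" if g: "g : P" for g t
  unfolding P_def equiv_obs_def
 proof (intro CollectI conjI allI ballI)
  have gm [measurable]: "g : borel_measurable M" using g by (rule PD)
  show gtm: "(%o1. g (\<tau> t o1)) : borel_measurable M" by measurable
  show "\<bar>g (\<tau> t o1)\<bar> <= B" for o1 by (rule PD(2)[OF g])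
  show "(LINT o1|M. g (\<tau> t o1)) = (LINT o1|M. F o1)" using PD(3)[OF g] by (simp add: integral_tau c_def)
  fix o1 assume o1: "o1 : space M"
  have it: "integrable lborel (%x. ind Q x * g (\<tau> t (tr r x o1)))" for r
   by (rule orbit_avg_integrable[OF gtm PD(2)[OF g] o1 Q])
  have "orbit_avg Q r (%o1. g (\<tau> t o1) - F o1) o1 = orbit_avg Q r (%o1. g (\<tau> t o1) - g o1) o1 + orbit_avg Q r (%o1. g o1 - F o1) o1" for r
   unfolding orbit_avg_def right_diff_distrib using it gi[OF o1 g] Fi[OF o1] by simp
  then show "((%r. orbit_avg Q r (%o1. g (\<tau> t o1) - F o1) o1) \<longlongrightarrow> 0) at_top"
   using tendsto_add[OF orbit_avg_shift[OF gm PD(2)[OF g] o1 Q, of t] PD(4)[OF g o1]] by simp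
 qed
 define N where "N g = (LINT o1|M. (g o1)^2)" for g :: "'w => real"
 have sq: "sqint M g" if "g : borel_measurable M" "!!o1. \<bar>g o1\<bar> <= K" for g K
  unfolding sqint_def
  by (intro conjI that bounded_integrable[of _ "K^2"]) (use that abs_le_imp_sq_le in auto)
 have sqP: "sqint M g" if "g : P" for g by (rule sq[OF PD(1)[OF that] PD(2)[OF that]])
 have bdd: "bdd_below (N ` P)" by (rule bdd_belowI2[of _ 0]) (simp add: N_def)
 define a where "a = (INF g\<in>P. N g)"
 have a_le: "a <= N g" if "g : P" for g unfolding a_def by (rule cINF_lower[OF bdd that])
 have "\<exists>g\<in>P. N g < a + 1 / real (Suc n)" for n
 proof -
  have "(INF g\<in>P. N g) < a + 1 / real (Suc n)" by (simp add: a_def)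
  then show ?thesis by (subst (asm) cINF_less_iff[OF _ bdd]) (use FP in auto)
 qed
 then obtain g where g: "!!n::nat. g n : P" "!!n. N (g n) < a + 1 / real (Suc n)" by metis
 have [measurable]: "g n : borel_measurable M" for n by (rule PD[OF g(1)])
 \<comment> \<open>Midpoints stay in P, so their second moment is at least a.\<close>
 have par: "(LINT o1|M. (u o1 - v o1)^2) <= 2 * N u + 2 * N v - 4 * a" if u: "u : P" and v: "v : P" for u v
 proof -
  have i: "integrable M (%o1. (u o1)^2)" "integrable M (%o1. (v o1)^2)" "integrable M (%o1. ((u o1 + v o1) / 2)^2)"
   using sqP[OF u] sqP[OF v] sqP[OF mid[OF u v]] by (auto dest: sqintD)
  have "(LINT o1|M. (u o1 - v o1)^2) = (LINT o1|M. 2 * (u o1)^2 + 2 * (v o1)^2 - 4 * ((u o1 + v o1) / 2)^2)"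
   by (intro bint_cong) (auto simp: power2_eq_square algebra_simps)
  also have "... = 2 * N u + 2 * N v - 4 * N (%o1. (u o1 + v o1) / 2)" using i by (simp add: N_def)
  finally show ?thesis using a_le[OF mid[OF u v]] by simp
 qed
 have L1: "(LINT o1|M. \<bar>u o1 - v o1\<bar>) <= sqrt (2 * N u + 2 * N v - 4 * a)" if u: "u : P" and v: "v : P" for u v
  using integral_abs_le_sqrt[OF sqint_diff[OF sqP[OF u] sqP[OF v]]] real_sqrt_le_mono[OF par[OF u v]] by linarith
 have cauchy: "\<exists>n0. \<forall>i\<ge>n0. \<forall>j\<ge>n0. (LINT o1|M. norm (g i o1 - g j o1)) < e" if e: "e > 0" for e
 proof -
  have "0 < e^2 / 4" using e by simp
  then obtain n0 where n0: "1 / real (Suc n0) < e^2 / 4" using reals_Archimedean[of "e^2 / 4"] by (auto simp: inverse_eq_divide)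
  have "(LINT o1|M. norm (g i o1 - g j o1)) < e" if "i >= n0" "j >= n0" for i j
  proof -
   have "1 / real (Suc i) <= 1 / real (Suc n0)" "1 / real (Suc j) <= 1 / real (Suc n0)"
    using that by (auto intro!: divide_left_mono)
   then have "2 * N (g i) + 2 * N (g j) - 4 * a < e^2" using g(2)[of i] g(2)[of j] n0 by linarith
   then have "sqrt (2 * N (g i) + 2 * N (g j) - 4 * a) < sqrt (e^2)" by (rule real_sqrt_less_mono)
   then show ?thesis using L1[OF g(1) g(1), of i j] e by simp
  qed
  then show ?thesis by blast
 qed
 obtain r where r: "strict_mono (r :: nat => nat)" "AE o1 in M. Cauchy (%i. g (r i) o1)"
  by (rule cauchy_L1_AE_cauchy_subseq[of M g]) (use bounded_integrable[OF PD(1)[OF g(1)] PD(2)[OF g(1)]] cauchy in auto)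
 \<comment> \<open>Clamping keeps the bound B even where the subsequence diverges.\<close>
 define G where "G o1 = max (- B) (min B (lim (%i. g (r i) o1)))" for o1
 have Gm [measurable]: "G : borel_measurable M"
 proof -
  have "(%o1. lim (%i. g (r i) o1)) : borel_measurable M" by (rule borel_measurable_lim_metric) measurable
  then show ?thesis unfolding G_def by measurable
 qed
 have GB: "\<bar>G o1\<bar> <= B" for o1 using B0 by (auto simp: G_def)
 have conv: "AE o1 in M. (%i. g (r i) o1) ~> G o1"
  using r(2)
 proof eventually_elim
  case (elim o1)
  then have l: "(%i. g (r i) o1) ~> lim (%i. g (r i) o1)" by (simp add: Cauchy_convergent_iff convergent_LIMSEQ_iff)
  have "(%i. max (- B) (min B (g (r i) o1))) ~> G o1" unfolding G_def by (intro tendsto_intros l)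
  moreover have "max (- B) (min B (g (r i) o1)) = g (r i) o1" for i using PD(2)[OF g(1), of "r i" o1] by linarith
  ultimately show ?case by simp
 qed
 define s where "s i = (LINT o1|M. \<bar>g (r i) o1 - G o1\<bar>)" for i
 have "(%i. LINT o1|M. \<bar>g (r i) o1 - G o1\<bar>) ~> (LINT o1|M. 0)"
 proof (rule integral_dominated_convergence[where w="%_. 2 * B"])
  show "AE o1 in M. (%i. \<bar>g (r i) o1 - G o1\<bar>) ~> 0"
   using conv
  proof eventually_elim
   case (elim o1)
   then have "(%i. \<bar>g (r i) o1 - G o1\<bar>) ~> \<bar>G o1 - G o1\<bar>" by (intro tendsto_intros)
   then show ?case by simp
  qed
  show "AE o1 in M. norm \<bar>g (r i) o1 - G o1\<bar> <= 2 * B" for i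
  proof (rule AE_I2, goal_cases)
   case (1 o1)
   show ?case using PD(2)[OF g(1), of "r i" o1] GB[of o1] by simp
  qed
 qed auto
 then have s0: "s ~> 0" by (simp add: s_def[abs_def])
 have gint: "integrable M (g n)" for n by (rule bounded_integrable[OF PD(1)[OF g(1)] PD(2)[OF g(1)]])
 have Gint: "integrable M G" by (rule bounded_integrable[OF Gm GB])
 \<comment> \<open>A member of P and its shift have equal second moments, so near the minimum the
   parallelogram bound makes them L1 close; G inherits exact invariance in the limit.\<close>
 have inv: "AE o1 in M. G (\<tau> t o1) = G o1" for t
 proof -
  have gti: "integrable M (%o1. g n (\<tau> t o1))" for n by (rule bounded_integrable[OF PD(1)[OF shift[OF g(1)]] PD(2)[OF g(1)]])
  have Gti: "integrable M (%o1. G (\<tau> t o1))" by (rule bounded_integrable[OF _ GB]) measurable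
  have bound: "(LINT o1|M. \<bar>G (\<tau> t o1) - G o1\<bar>) <= 2 * s i + sqrt (4 / real (Suc (r i)))" for i
  proof -
   have "(LINT o1|M. \<bar>G (\<tau> t o1) - G o1\<bar>) <= (LINT o1|M. \<bar>g (r i) (\<tau> t o1) - G (\<tau> t o1)\<bar> + \<bar>g (r i) o1 - g (r i) (\<tau> t o1)\<bar> + \<bar>g (r i) o1 - G o1\<bar>)"
    using gint Gint gti Gti by (intro integral_mono) auto
   also have "... = (LINT o1|M. \<bar>g (r i) (\<tau> t o1) - G (\<tau> t o1)\<bar>) + (LINT o1|M. \<bar>g (r i) o1 - g (r i) (\<tau> t o1)\<bar>) + s i"
    unfolding s_def using gint Gint gti Gti by simp
   also have "(LINT o1|M. \<bar>g (r i) (\<tau> t o1) - G (\<tau> t o1)\<bar>) = s i"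
    unfolding s_def by (rule integral_tau[of "%o1. \<bar>g (r i) o1 - G o1\<bar>"]) measurable
   also have "(LINT o1|M. \<bar>g (r i) o1 - g (r i) (\<tau> t o1)\<bar>) <= sqrt (4 / real (Suc (r i)))"
   proof -
    have "N (%o1. g (r i) (\<tau> t o1)) = N (g (r i))" unfolding N_def by (rule integral_tau[of "%o1. (g (r i) o1)^2"]) measurable
    then have "2 * N (g (r i)) + 2 * N (%o1. g (r i) (\<tau> t o1)) - 4 * a <= 4 / real (Suc (r i))"
     using g(2)[of "r i"] by simp
    then show ?thesis using L1[OF g(1) shift[OF g(1)], of "r i" "r i" t] real_sqrt_le_mono by (meson order_trans)
   qed
   finally show ?thesis by simp
  qed
  have "(%i. 1 / real (Suc (r i))) ~> 0"
   using LIMSEQ_subseq_LIMSEQ[OF LIMSEQ_Suc[OF lim_1_over_n] r(1)] by (simp add: o_def)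
  then have "(%i. 2 * s i + sqrt (4 * (1 / real (Suc (r i))))) ~> 2 * 0 + sqrt (4 * 0)" by (intro tendsto_intros s0)
  then have "(%i. 2 * s i + sqrt (4 / real (Suc (r i)))) ~> 0" by simp
  then have "(LINT o1|M. \<bar>G (\<tau> t o1) - G o1\<bar>) <= 0" by (rule LIMSEQ_le_const) (use bound in blast)
  then have "(LINT o1|M. \<bar>G (\<tau> t o1) - G o1\<bar>) = 0" by (simp add: order_antisym)
  then have "AE o1 in M. \<bar>G (\<tau> t o1) - G o1\<bar> = 0"
   by (subst (asm) integral_nonneg_eq_0_iff_AE) (use Gti Gint in simp_all)
  then show ?thesis by eventually_elim simp
 qed
 have "(LINT o1|M. G o1) = c"
 proof -
  have "\<bar>c - (LINT o1|M. G o1)\<bar> <= s i" for i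
  proof -
   have "c - (LINT o1|M. G o1) = (LINT o1|M. g (r i) o1 - G o1)" using gint Gint PD(3)[OF g(1)] by simp
   then show ?thesis unfolding s_def using integral_abs_bound[of M "%o1. g (r i) o1 - G o1"] by simp
  qed
  then have "\<bar>c - (LINT o1|M. G o1)\<bar> <= 0" by (intro LIMSEQ_le_const[OF s0]) blast
  then show ?thesis by simp
 qed
 with invariant_AE_const[OF Gm GB inv] have Gc: "AE o1 in M. G o1 = c" by simp
 obtain i where i: "s i < d" using order_tendstoD(2)[OF s0 d] by (auto simp: eventually_sequentially)
 have "(LINT o1|M. \<bar>g (r i) o1 - c\<bar>) = s i" unfolding s_def
  by (rule integral_cong_AE) (measurable, use Gc in eventually_elim, simp)
 with i g(1) show ?thesis unfolding P_def c_def by (intro bexI[of _ "g (r i)"]) auto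
qed

text \<open>Exceptional sets of measure at most 1/(n+1) intersect in a null set.\<close>

lemma AE_by_small_sets:
 assumes "!!d. d > 0 ==> \<exists>E\<in>sets M. measure M E <= d \<and> (\<forall>w\<in>space M - E. P w)"
 shows "AE w in M. P w"
proof -
 have "\<exists>E\<in>sets M. measure M E <= 1 / real (Suc n) \<and> (\<forall>w\<in>space M - E. P w)" for n by (rule assms) simp
 then obtain E where E: "!!n. E n : sets M" "!!n. measure M (E n) <= 1 / real (Suc n)"
  "!!n w. w : space M - E n ==> P w" by metis
 have "measure M (\<Inter>n. E n) <= 1 / real (Suc k)" for k
 proof -
  have "measure M (\<Inter>n. E n) <= measure M (E k)" by (rule finite_measure_mono) (auto simp: E)
  with E(2)[of k] show ?thesis by linarith
 qed
 then have "measure M (\<Inter>n. E n) <= 0" by (intro LIMSEQ_le_const[OF LIMSEQ_Suc[OF lim_1_over_n]]) blast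
 then have "emeasure M (\<Inter>n. E n) = 0" by (simp add: emeasure_eq_measure measure_nonneg order_antisym)
 then have "(\<Inter>n. E n) : null_sets M" using E(1) by (intro null_setsI) auto
 then have "AE w in M. w \<notin> (\<Inter>n. E n)" by (rule AE_not_in)
 with AE_space show ?thesis
 proof eventually_elim
  case (elim w)
  then obtain n where "w : space M - E n" by blast
  then show ?case by (rule E(3))
 qed
qed

lemma truncation_L1:
 fixes F :: "'w => real"
 assumes F: "integrable M F" and d: "d > 0"
 obtains n :: nat where "(LINT o1|M. \<bar>F o1 - max (- real n) (min (real n) (F o1))\<bar>) < d"
proof -
 have [measurable]: "F : borel_measurable M" using F by auto
 let ?A = "%n. LINT o1|M. \<bar>F o1 - max (- real n) (min (real n) (F o1))\<bar>"
 have "?A ~> (LINT o1|M. 0)"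
 proof (rule integral_dominated_convergence[where w="%o1. \<bar>F o1\<bar>"])
  show "AE o1 in M. (%n. \<bar>F o1 - max (- real n) (min (real n) (F o1))\<bar>) ~> 0"
  proof (rule AE_I2, goal_cases)
   case (1 o1)
   obtain N :: nat where N: "\<bar>F o1\<bar> <= real N" using real_arch_simple by blast
   show ?case
   proof (rule tendsto_eventually, rule eventually_sequentiallyI[of N], goal_cases)
    case (1 n)
    then have "\<bar>F o1\<bar> <= real n" using N by linarith
    then show ?case by linarith
   qed
  qed
  show "AE o1 in M. norm \<bar>F o1 - max (- real n) (min (real n) (F o1))\<bar> <= \<bar>F o1\<bar>" for n
   by (rule AE_I2) (unfold real_norm_def, linarith)
 qed (use F in auto)
 then have "?A ~> 0" by simp
 from order_tendstoD(2)[OF this d] that show thesis by (auto simp: eventually_sequentially)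
qed

text \<open>Banach's principle. F is replaced by a bounded truncation F1, and F1 by a nearly
  constant g with the same asymptotic averages at every point. The total error D is L1 small, so the
  maximal inequality keeps its averages below s at all scales r >= 1 outside a set of probability at
  most d.\<close>

lemma ergodic_average_step:
 fixes F :: "'w => real"
 assumes F: "integrable M F" and Q: "Q : sets borel" "Q \<subseteq> cball 0 L" and L: "L >= 1" and t: "t > 0"
 shows "AE w in M. eventually (%r. \<bar>orbit_avg Q r F w - measure lborel Q * (LINT w|M. F w)\<bar> <= t) at_top"
proof (rule AE_by_small_sets)
 fix d :: real assume d: "d > 0"
 have Fm [measurable]: "F : borel_measurable M" using F by auto
 define c where "c = (LINT w|M. F w)"
 \<comment> \<open>q is the volume factor of \<open>ball_integral_le_maximal\<close>, and q s = t/2.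
   The number u is such that a D of mean at most 3 u has an exceptional set of measure at most
   d.\<close>
 define q where "q = (2 * L) ^ DIM('a)"
 have q: "0 < q" unfolding q_def using L by simp
 define s where "s = t / (2 * q)"
 have s: "0 < s" using t q by (simp add: s_def)
 have mc: "0 <= max_const" by (simp add: max_const_def)
 define u where "u = d * s / (3 * (max_const + 1))"
 have u: "0 < u" using d s mc by (simp add: u_def)
 have um: "max_const * (3 * u) <= d * s"
 proof -
  have "(max_const + 1) * (3 * u) = d * s"
  proof -
   have "3 * (max_const + 1) \<noteq> 0" using mc by (simp add: add_nonneg_eq_0_iff)
   moreover have "(max_const + 1) * (3 * u) = 3 * (max_const + 1) * u" by simp
   moreover have "z * (x / z) = x" if "z \<noteq> 0" for x z :: real using that by simp
   ultimately show ?thesis unfolding u_def by metis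
  qed
  moreover have "max_const * (3 * u) <= (max_const + 1) * (3 * u)" using u by (intro mult_right_mono) auto
  ultimately show ?thesis by linarith
 qed
 obtain N :: nat where N: "(LINT w|M. \<bar>F w - max (- real N) (min (real N) (F w))\<bar>) < u"
  by (rule truncation_L1[OF F u])
 define F1 where "F1 w = max (- real N) (min (real N) (F w))" for w
 have F1m [measurable]: "F1 : borel_measurable M" unfolding F1_def by measurable
 have F1B: "\<bar>F1 w\<bar> <= real N" for w unfolding F1_def by linarith
 have F1i: "integrable M F1" by (rule bounded_integrable[OF F1m F1B])
 define c1 where "c1 = (LINT w|M. F1 w)"
 obtain g where g: "g : equiv_obs Q F1 (real N)" "(LINT w|M. \<bar>g w - c1\<bar>) < u"
  using mean_ergodic[OF F1m F1B Q u] unfolding c1_def by blast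
 have gm [measurable]: "g : borel_measurable M" and gB: "!!w. \<bar>g w\<bar> <= real N"
  and glim: "!!w. w : space M ==> ((%r. orbit_avg Q r (%w. g w - F1 w) w) \<longlongrightarrow> 0) at_top"
  using g(1) by (auto simp: equiv_obs_def)
 have gi: "integrable M g" by (rule bounded_integrable[OF gm gB])
 have cc: "\<bar>c1 - c\<bar> <= (LINT w|M. \<bar>F w - F1 w\<bar>)"
 proof -
  have "c - c1 = (LINT w|M. F w - F1 w)" using F F1i by (simp add: c_def c1_def)
  then show ?thesis using integral_abs_bound[of M "%w. F w - F1 w"] abs_minus_commute[of c1 c] by simp
 qed
 \<comment> \<open>Bounds (F - c) + (g - F1), regrouped as (F - F1) + (g - c1) + (c1 - c); the
   averages of g - F1 tend to 0 at every point.\<close>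
 define D where "D w = \<bar>F w - F1 w\<bar> + \<bar>g w - c1\<bar> + \<bar>c1 - c\<bar>" for w
 have Dm [measurable]: "D : borel_measurable M" unfolding D_def by measurable
 have D0: "0 <= D w" for w by (simp add: D_def)
 have Di: "integrable M D" unfolding D_def[abs_def] using F F1i gi by simp
 have DI: "(LINT w|M. D w) <= 3 * u"
 proof -
  have "(LINT w|M. D w) = (LINT w|M. \<bar>F w - F1 w\<bar>) + (LINT w|M. \<bar>g w - c1\<bar>) + \<bar>c1 - c\<bar>"
   unfolding D_def using F F1i gi by (simp add: prob_space)
  then show ?thesis using N g(2) cc unfolding F1_def[symmetric] by linarith
 qed
 define E where "E = {w\<in>space M. \<exists>n\<ge>1. ennreal s < ball_avg D (real n) w}"
 have E: "E : sets M" unfolding E_def ball_avg_def by measurable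
 have mE: "measure M E <= d"
 proof -
  have "ennreal s * emeasure M E <= ennreal max_const * (nn_integral M (%w. ennreal (D w)))"
   unfolding E_def by (rule maximal_inequality[OF Dm D0 s])
  also have "(nn_integral M (%w. ennreal (D w))) = ennreal (LINT w|M. D w)"
   by (rule nn_integral_eq_integral[OF Di]) (simp add: D0)
  finally have "ennreal (s * measure M E) <= ennreal (max_const * (LINT w|M. D w))"
   using s mc D0 by (simp add: emeasure_eq_measure ennreal_mult bint_nonneg)
  then have "s * measure M E <= max_const * (LINT w|M. D w)"
   using mc D0 by (subst (asm) ennreal_le_iff) (auto intro!: mult_nonneg_nonneg bint_nonneg)
  also have "... <= max_const * (3 * u)" using DI mc by (rule mult_left_mono)
  also have "... <= s * d" using um by (simp only: mult.commute)
  finally show ?thesis using s by (simp only: mult_le_cancel_left_pos)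
 qed
 show "\<exists>E\<in>sets M. measure M E <= d \<and> (\<forall>w\<in>space M - E. eventually (%r. \<bar>orbit_avg Q r F w - measure lborel Q * (LINT w|M. F w)\<bar> <= t) at_top)"
 proof (intro bexI[OF _ E] conjI ballI mE)
  fix w assume "w : space M - E"
  then have w: "w : space M" and K: "!!n. n >= 1 ==> ball_avg D (real n) w <= ennreal s"
   by (auto simp: E_def not_less)
  have "eventually (%r. \<bar>orbit_avg Q r (%w. g w - F1 w) w\<bar> < t / 2) at_top"
   using tendstoD[OF glim[OF w], of "t / 2"] t by simp
  with eventually_ge_at_top[of 1]
  show "eventually (%r. \<bar>orbit_avg Q r F w - measure lborel Q * (LINT w|M. F w)\<bar> <= t) at_top"
  proof eventually_elim
   case (elim r)
   note r = elim(1) and small = elim(2)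
   have [measurable]: "(%x. F (tr r x w)) : Borel" "(%x. D (tr r x w)) : Borel"
    by (rule orbit_measurable[OF Fm w], rule orbit_measurable[OF Dm w])
   have [measurable]: "Q : sets borel" by (rule Q)
   define k where "k x = ind Q x * D (tr r x w)" for x
   have k0: "0 <= k x" for x by (simp add: k_def D0)
   have "(nnint (%x. ennreal (k x))) <= (set_nnint (cball 0 L) (%x. ennreal (D (tr r x w))))"
    unfolding k_def using Q(2) by (intro nn_integral_mono) (auto simp: indicator_def)
   also have "... <= ennreal q * ennreal s"
    unfolding q_def by (rule ball_integral_le_maximal[OF Dm w K L r])
   also have "... = ennreal (t / 2)" using q s by (simp add: ennreal_mult[symmetric] s_def)
   finally have kn: "(nnint (%x. ennreal (k x))) <= ennreal (t / 2)" .
   have ki: "integrable lborel k"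
    by (rule integrableI_nonneg) (use kn k0 in \<open>auto simp: k_def[abs_def] less_top[symmetric] top_unique\<close>)
   have kI: "(LBINT x. k x) <= t / 2"
    using kn nn_integral_eq_integral[OF ki] k0 t by (simp add: ennreal_le_iff)
   have F1int: "integrable lborel (%x. ind Q x * F1 (tr r x w))" by (rule orbit_avg_integrable[OF F1m F1B w Q])
   have gint: "integrable lborel (%x. ind Q x * g (tr r x w))" by (rule orbit_avg_integrable[OF gm gB w Q])
   have Fint: "integrable lborel (%x. ind Q x * F (tr r x w))"
   proof (rule bint_bound[of _ "%x. \<bar>ind Q x * F1 (tr r x w)\<bar> + k x"])
    show "integrable lborel (%x. \<bar>ind Q x * F1 (tr r x w)\<bar> + k x)" using F1int ki by simp
    show "AE x in lborel. norm (ind Q x * F (tr r x w)) <= norm (\<bar>ind Q x * F1 (tr r x w)\<bar> + k x)"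
     by (rule AE_I2) (simp add: k_def indicator_def D_def, linarith)
   qed measurable
   have Qi: "integrable lborel (%x. ind Q x :: real)"
   proof (rule integrable_real_indicator)
    have "bounded Q" using Q(2) bounded_cball bounded_subset by blast
    then show "emeasure lborel Q < \<infinity>" by (rule emeasure_bounded_finite)
   qed simp
   have "orbit_avg Q r F w - measure lborel Q * c + orbit_avg Q r (%w. g w - F1 w) w
    = (LBINT x. (ind Q x * F (tr r x w) - ind Q x * c)
      + (ind Q x * g (tr r x w) - ind Q x * F1 (tr r x w)))"
    unfolding orbit_avg_def right_diff_distrib using F1int gint Fint Qi by simp
   also have "\<bar>...\<bar> <= (LBINT x. k x)"
   proof (rule order_trans[OF integral_abs_bound integral_mono])
    show "\<bar>(ind Q x * F (tr r x w) - ind Q x * c)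
      + (ind Q x * g (tr r x w) - ind Q x * F1 (tr r x w))\<bar> <= k x" for x
     by (simp add: k_def indicator_def D_def, linarith)
   qed (use F1int gint Fint Qi ki in auto)
   finally show ?case
    using kI small unfolding c_def[symmetric] by linarith
  qed
 qed
qed

text \<open>Stated for bounded Borel sets rather than balls, because the weights will be tested on a
  generator of the Borel sets.\<close>

lemma ergodic_average:
 fixes F :: "'w => real"
 assumes F: "integrable M F" and Q: "Q : sets borel" "Q \<subseteq> cball 0 L" and L: "L >= 1"
 shows "AE w in M. ((%r. orbit_avg Q r F w) \<longlongrightarrow> measure lborel Q * (LINT w|M. F w)) at_top"
proof -
 have "AE w in M. \<forall>n. eventually (%r. \<bar>orbit_avg Q r F w - measure lborel Q * (LINT w|M. F w)\<bar> <= 1 / real (Suc n)) at_top"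
  unfolding AE_all_countable by (intro allI ergodic_average_step[OF F Q L]) simp
 then show ?thesis
 proof eventually_elim
  case ev: (elim w)
  show ?case
  proof (rule tendstoI, goal_cases)
   case (1 e)
   then obtain n where n: "1 / real (Suc n) < e" using reals_Archimedean[of e] by (auto simp: inverse_eq_divide)
   from ev[rule_format, of n] show ?case
    by eventually_elim (use n in \<open>simp add: dist_real_def\<close>)
  qed
 qed
qed

end

lemma powr_neg_small:
 fixes A :: real
 assumes p: "1 < p" and e: "e > 0"
 obtains T where "0 < T" "A * T powr (1 - p) < e"
proof -
 have "((%T. T powr (1 - p)) \<longlongrightarrow> 0) at_top"
  by (rule tendsto_neg_powr[OF _ filterlim_ident]) (use p in simp)
 from tendsto_mult_left[OF this, of A] have "((%T. A * T powr (1 - p)) \<longlongrightarrow> 0) at_top" by simp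
 then have "eventually (%T. A * T powr (1 - p) < e) at_top" using e by (rule order_tendstoD(2))
 then have "eventually (%T. 0 < T \<and> A * T powr (1 - p) < e) at_top"
  using eventually_gt_at_top[of 0] by eventually_elim simp
 from eventually_happens[OF this] that show thesis by auto
qed

section \<open>Convergence of the random weights\<close>

definition bsupp :: "real => real => ('a::euclidean_space => real) => bool" where
 "bsupp C L v \<longleftrightarrow> v : Borel \<and> (\<forall>x. \<bar>v x\<bar> <= C) \<and> (\<forall>x. norm x > L \<longrightarrow> v x = 0)"

lemma bsuppD:
 assumes "bsupp C L v"
 shows "v : Borel" "\<bar>v x\<bar> <= C" "norm x > L ==> v x = 0"
 using assms by (auto simp: bsupp_def)

lemma bsupp_integrable: "bsupp C L v ==> integrable lborel v"
 by (rule bounded_Borel_integrable[of v L C]) (auto dest: bsuppD)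

lemma bsupp_diff:
 assumes "bsupp C L v" "bsupp D L w"
 shows "bsupp (C + D) L (%x. v x - w x)"
 unfolding bsupp_def
proof (intro conjI allI impI)
 show "(%x. v x - w x) : Borel"
  by (intro borel_measurable_diff bsuppD(1)[OF assms(1)] bsuppD(1)[OF assms(2)])
 show "\<bar>v x - w x\<bar> <= C + D" for x using bsuppD(2)[OF assms(1), of x] bsuppD(2)[OF assms(2), of x] by linarith
 show "v x - w x = 0" if "norm x > L" for x using bsuppD(3)[OF assms(1) that] bsuppD(3)[OF assms(2) that] by simp
qed

lemma bsupp_mono:
 "bsupp C L v ==> C <= C' ==> L <= L' ==> bsupp C' L' v"
 unfolding bsupp_def by (meson order_trans order_le_less_trans)

lemma bsupp_indicator:
 "A : sets borel ==> bsupp 1 L (%x. ind (A \<inter> cball 0 L) x)"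
 unfolding bsupp_def
 by (intro conjI allI impI borel_measurable_indicator sets.Int cball_measurable) (auto simp: indicator_def)

lemma bsupp_mult:
 assumes v: "bsupp C L v" and w: "w : Borel" "!!x. \<bar>w x\<bar> <= D"
 shows "bsupp (C * D) L (%x. v x * w x)"
 unfolding bsupp_def
proof (intro conjI allI impI)
 show "(%x. v x * w x) : Borel"
  by (intro borel_measurable_times bsuppD(1)[OF v] w(1))
 show "\<bar>v x * w x\<bar> <= C * D" for x
  unfolding abs_mult using bsuppD(2)[OF v, of x] w(2)[of x] by (intro mult_mono) auto
 show "v x * w x = 0" if "norm x > L" for x using bsuppD(3)[OF v that] by simp
qed

text \<open>Everything that one typical realisation of the random measures has to provide. Mass and
  moment bounds are uniform in the scale; convergence is asked only on a generator stable under
  intersections, which the ergodic theorem can deliver outside a single null set.\<close>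

locale weight_family =
 fixes rh :: "real => 'a::euclidean_space => real" and p K :: real
 assumes rho_measurable [measurable]: "!!a. rh a : Borel"
  and rho_nonneg: "!!a x. 0 <= rh a x"
  and p: "1 < p" and K_nonneg: "0 <= K"
  and rho_mass: "!!a L. a : {0<..1} ==> 1 <= L ==> (set_nnint (cball 0 L) (%x. ennreal (rh a x))) <= ennreal (K * L ^ DIM('a))"
  and rho_moment: "!!a L. a : {0<..1} ==> 1 <= L ==> (set_nnint (cball 0 L) (%x. ennreal (rh a x powr p))) <= ennreal (K * L ^ DIM('a))"
  and rho_generator: "\<exists>G. Int_stable G \<and> UNIV : G \<and> sets (borel :: 'a measure) = sigma_sets UNIV G \<and>
   (\<forall>A\<in>G. \<forall>n::nat. ((%a. LBINT x. ind (A \<inter> cball 0 (real n)) x * rh a x) \<longlongrightarrow> measure lborel (A \<inter> cball 0 (real n))) at0)"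
begin

lemma rho_integrable:
 assumes v: "bsupp C L v" and a: "a : {0<..1}"
 shows "integrable lborel (%x. v x * rh a x)"
proof -
 have [measurable]: "v : Borel" using v by (rule bsuppD)
 have C: "0 <= C" using bsuppD(2)[OF v, of 0] by linarith
 define L' where "L' = max 1 L"
 have L': "1 <= L'" by (simp add: L'_def)
 have "(nnint (%x. ennreal (norm (v x * rh a x)))) <= (nnint (%x. ennreal C * (ennreal (rh a x) * ind (cball 0 L') x)))"
 proof (rule nn_integral_mono, goal_cases)
  case (1 x)
  show ?case
  proof (cases "norm x > L'")
   case True
   then have "v x = 0" using bsuppD(3)[OF v, of x] by (simp add: L'_def)
   then show ?thesis by simp
  next
   case False
   have "norm (v x * rh a x) <= C * rh a x"
    using bsuppD(2)[OF v, of x] rho_nonneg[of a x] by (simp add: abs_mult mult_right_mono)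
   then have "ennreal (norm (v x * rh a x)) <= ennreal C * ennreal (rh a x)"
    using C rho_nonneg[of a x] by (simp add: ennreal_mult[symmetric] ennreal_leI)
   then show ?thesis using False by (simp add: not_less)
  qed
 qed
 also have "... = ennreal C * (set_nnint (cball 0 L') (%x. ennreal (rh a x)))" by (rule nn_integral_cmult) measurable
 also have "... <= ennreal C * ennreal (K * L' ^ DIM('a))" by (intro mult_left_mono rho_mass a L') simp
 also have "... < \<infinity>" by (simp add: ennreal_mult_less_top)
 finally show ?thesis by (intro integrableI_bounded) auto
qed

text \<open>Equi-integrability of the weights: with C and L fixed, choose T large first and then the
  L1 norm of v small.\<close>

lemma rho_uniform:
 assumes v: "bsupp C L v" and a: "a : {0<..1}" and L: "1 <= L" and T: "0 < T"
 shows "\<bar>LBINT x. v x * rh a x\<bar> <= T * (LBINT x. \<bar>v x\<bar>) + C * T powr (1 - p) * (K * L ^ DIM('a))"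
proof -
 have [measurable]: "v : Borel" using v by (rule bsuppD)
 have C: "0 <= C" using bsuppD(2)[OF v, of 0] by linarith
 have vi: "integrable lborel (%x. \<bar>v x\<bar>)" using bsupp_integrable[OF v] by simp
 have Kp: "0 <= K * L ^ DIM('a)" using K_nonneg L by simp
 let ?A = "LBINT x. \<bar>v x\<bar>"
 have "(nnint (%x. ennreal (\<bar>v x\<bar> * rh a x)))
  <= (nnint (%x. ennreal T * ennreal \<bar>v x\<bar> + ennreal (C * T powr (1 - p)) * (ennreal (rh a x powr p) * ind (cball 0 L) x)))"
 proof (rule nn_integral_mono, goal_cases)
  case (1 x)
  show ?case
  proof (cases "norm x > L")
   case True
   then show ?thesis using bsuppD(3)[OF v, of x] by simp
  next
   case False
   have "ennreal \<bar>v x\<bar> * ennreal (rh a x) <= ennreal T * ennreal \<bar>v x\<bar> + ennreal (C * T powr (1 - p)) * ennreal_powr (ennreal (rh a x)) p"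
    by (rule weight_split[OF p T abs_ge_zero bsuppD(2)[OF v]])
   then show ?thesis using False by (simp add: ennreal_mult rho_nonneg ennreal_powr_ennreal not_less)
  qed
 qed
 also have "... = ennreal T * (nnint (%x. ennreal \<bar>v x\<bar>)) + ennreal (C * T powr (1 - p)) * (set_nnint (cball 0 L) (%x. ennreal (rh a x powr p)))"
  by (subst nn_integral_add) (simp_all add: nn_integral_cmult)
 also have "... <= ennreal T * ennreal ?A + ennreal (C * T powr (1 - p)) * ennreal (K * L ^ DIM('a))"
  by (intro add_mono mult_left_mono rho_moment[OF a L]) (simp_all add: nn_integral_eq_integral[OF vi])
 also have "... = ennreal (T * ?A + C * T powr (1 - p) * (K * L ^ DIM('a)))"
 proof -
  have I: "0 <= ?A" by simp
  have c: "0 <= C * T powr (1 - p)" using C by simp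
  have "ennreal (T * ?A) = ennreal T * ennreal ?A"
   using less_imp_le[OF T] I by (rule ennreal_mult)
  moreover have "ennreal (C * T powr (1 - p) * (K * L ^ DIM('a))) = ennreal (C * T powr (1 - p)) * ennreal (K * L ^ DIM('a))"
   using c Kp by (rule ennreal_mult)
  moreover have "ennreal (T * ?A + C * T powr (1 - p) * (K * L ^ DIM('a)))
   = ennreal (T * ?A) + ennreal (C * T powr (1 - p) * (K * L ^ DIM('a)))"
   by (rule ennreal_plus) (rule mult_nonneg_nonneg[OF less_imp_le[OF T] I], rule mult_nonneg_nonneg[OF c Kp])
  ultimately show ?thesis by simp
 qed
 finally have le: "(nnint (%x. ennreal (\<bar>v x\<bar> * rh a x))) <= ennreal (T * ?A + C * T powr (1 - p) * (K * L ^ DIM('a)))" .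
 have nn: "0 <= T * ?A + C * T powr (1 - p) * (K * L ^ DIM('a))"
 proof (rule add_nonneg_nonneg)
  show "0 <= T * ?A" using T by simp
  show "0 <= C * T powr (1 - p) * (K * L ^ DIM('a))" by (rule mult_nonneg_nonneg[OF _ Kp]) (use C in simp)
 qed
 have abs: "\<bar>v x * rh a x\<bar> = \<bar>v x\<bar> * rh a x" for x using rho_nonneg[of a x] by (simp add: abs_mult)
 have i: "integrable lborel (%x. \<bar>v x\<bar> * rh a x)"
  using rho_integrable[OF v a] unfolding abs[symmetric] by (rule integrable_abs)
 have "\<bar>LBINT x. v x * rh a x\<bar> <= (LBINT x. \<bar>v x\<bar> * rh a x)"
  using integral_abs_bound[of lborel "%x. v x * rh a x"] by (simp only: abs)
 also have "... <= T * ?A + C * T powr (1 - p) * (K * L ^ DIM('a))"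
 proof -
  have "(nnint (%x. ennreal (\<bar>v x\<bar> * rh a x))) = ennreal (LBINT x. \<bar>v x\<bar> * rh a x)"
   by (rule nn_integral_eq_integral[OF i]) (simp add: rho_nonneg)
  then show ?thesis using le by (simp only: ennreal_le_iff[OF nn])
 qed
 finally show ?thesis .
qed

text \<open>Weak convergence of the weights to the constant 1, tested on v.\<close>

definition homogenized :: "('a => real) => bool" where
 "homogenized v \<longleftrightarrow> ((%a. LBINT x. v x * rh a x) \<longlongrightarrow> (LBINT x. v x)) at0"

lemma eventually_unit: "eventually (%a. a : {0<..1}) at0"
 by (rule eventually_at_rightI[of 0 1]) auto

text \<open>The height T is fixed first, from the moment term alone, and the index i afterwards; the
  factor T + 1 also pays for the difference of the limits.\<close>

lemma homogenized_closed:
 assumes v: "!!i::nat. bsupp C L (v i)" and w: "bsupp C L w"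
  and lim: "(%i. LBINT x. \<bar>v i x - w x\<bar>) ~> 0" and hom: "!!i. homogenized (v i)"
 shows "homogenized w"
 unfolding homogenized_def
proof (rule tendstoI, goal_cases)
 case e: (1 e)
 define L' where "L' = max 1 L"
 have L': "1 <= L'" by (simp add: L'_def)
 define A where "A = (C + C) * (K * L' ^ DIM('a))"
 obtain T where T: "0 < T" "A * T powr (1 - p) < e / 4"
  by (rule powr_neg_small[OF p, of "e / 4"]) (use e in simp_all)
 have "(%i. (T + 1) * (LBINT x. \<bar>v i x - w x\<bar>)) ~> 0" using tendsto_mult_left[OF lim, of "T + 1"] by simp
 then have "eventually (%i. (T + 1) * (LBINT x. \<bar>v i x - w x\<bar>) < e / 4) sequentially"
  by (rule order_tendstoD(2)) (use e in simp)
 then obtain i where i: "(T + 1) * (LBINT x. \<bar>v i x - w x\<bar>) < e / 4" by (auto simp: eventually_sequentially)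
 have d: "bsupp (C + C) L' (%x. v i x - w x)"
  by (rule bsupp_mono[OF bsupp_diff[OF v w]]) (auto simp: L'_def)
 have "eventually (%a. dist (LBINT x. v i x * rh a x) (LBINT x. v i x) < e / 4) at0"
  using hom[of i] e unfolding homogenized_def by (intro tendstoD) auto
 with eventually_unit show ?case
 proof eventually_elim
  case (elim a)
  note a = elim(1) and c = elim(2)
  have "(LBINT x. (v i x - w x) * rh a x) = (LBINT x. v i x * rh a x) - (LBINT x. w x * rh a x)"
   using rho_integrable[OF v a] rho_integrable[OF w a] by (simp add: left_diff_distrib)
  moreover have "\<bar>LBINT x. (v i x - w x) * rh a x\<bar> <= T * (LBINT x. \<bar>v i x - w x\<bar>) + (C + C) * T powr (1 - p) * (K * L' ^ DIM('a))"
   by (rule rho_uniform[OF d a L' T(1)])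
  moreover have "(C + C) * T powr (1 - p) * (K * L' ^ DIM('a)) = A * T powr (1 - p)" by (simp add: A_def)
  moreover have "(T + 1) * (LBINT x. \<bar>v i x - w x\<bar>) = T * (LBINT x. \<bar>v i x - w x\<bar>) + (LBINT x. \<bar>v i x - w x\<bar>)"
   by (simp add: distrib_right)
  moreover have "\<bar>(LBINT x. v i x) - (LBINT x. w x)\<bar> <= (LBINT x. \<bar>v i x - w x\<bar>)"
  proof -
   have "(LBINT x. v i x) - (LBINT x. w x) = (LBINT x. v i x - w x)"
    using bsupp_integrable[OF v] bsupp_integrable[OF w] by simp
   then show ?thesis using integral_abs_bound[of lborel "%x. v i x - w x"] by simp
  qed
  moreover have "0 <= (LBINT x. \<bar>v i x - w x\<bar>)" by simp
  ultimately show ?case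
   using T(2) i c e unfolding dist_real_def by linarith
 qed
qed

lemma homogenized_closed_pointwise:
 assumes v: "!!i::nat. bsupp C L (v i)" and lim: "!!x. (%i. v i x) ~> w x" and hom: "!!i. homogenized (v i)"
 shows "homogenized w"
proof -
 have [measurable]: "v i : Borel" for i by (rule bsuppD(1)[OF v])
 have wm [measurable]: "w : Borel" by (rule borel_measurable_LIMSEQ_real[OF lim]) simp
 have wC: "\<bar>w x\<bar> <= C" for x
  by (rule LIMSEQ_le_const2[OF tendsto_rabs[OF lim]]) (use bsuppD(2)[OF v] in blast)
 have w0: "w x = 0" if "norm x > L" for x
  by (rule LIMSEQ_unique[OF lim]) (simp add: bsuppD(3)[OF v that])
 have w: "bsupp C L w" unfolding bsupp_def using wm wC w0 by blast
 have "(%i. LBINT x. \<bar>v i x - w x\<bar>) ~> (LINT x|(lborel :: 'a measure). 0)"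
 proof (rule integral_dominated_convergence[where w="%x. 2 * C * ind (cball 0 L) x"])
  show "AE x in lborel. (%i. \<bar>v i x - w x\<bar>) ~> 0"
  proof (rule AE_I2)
   fix x
   have "(%i. \<bar>v i x - w x\<bar>) ~> \<bar>w x - w x\<bar>" by (intro tendsto_intros lim)
   then show "(%i. \<bar>v i x - w x\<bar>) ~> 0" by simp
  qed
  show "AE x in lborel. norm \<bar>v i x - w x\<bar> <= 2 * C * ind (cball 0 L) x" for i
  proof (rule AE_I2, goal_cases)
   case (1 x)
   show ?case
    using bsuppD(2)[OF v, of i x] wC[of x] bsuppD(3)[OF v, of x i] w0[of x]
    by (cases "norm x > L") (auto simp: indicator_def)
  qed
  show "integrable lborel (%x. 2 * C * ind (cball (0::'a) L) x)"
   by (intro integrable_mult_right integrable_real_indicator emeasure_bounded_finite) auto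
 qed auto
 then have "(%i. LBINT x. \<bar>v i x - w x\<bar>) ~> 0" by simp
 from homogenized_closed[OF v w this hom] show ?thesis .
qed

lemma homogenized_zero: "homogenized (%x. 0)" by (simp add: homogenized_def)

lemma homogenized_lincomb:
 assumes v: "bsupp C L v" "homogenized v" and w: "bsupp D M w" "homogenized w"
 shows "homogenized (%x. v x + c * w x)"
proof -
 have "((%a. (LBINT x. v x * rh a x) + c * (LBINT x. w x * rh a x)) \<longlongrightarrow> (LBINT x. v x) + c * (LBINT x. w x)) at0"
  using v(2) w(2) unfolding homogenized_def by (intro tendsto_intros)
 moreover have "eventually (%a. (LBINT x. v x * rh a x) + c * (LBINT x. w x * rh a x) = (LBINT x. (v x + c * w x) * rh a x)) at0"
  using eventually_unit
 proof eventually_elim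
  case a: (elim a)
  have "(LBINT x. (v x + c * w x) * rh a x) = (LBINT x. v x * rh a x + c * (w x * rh a x))"
   by (intro bint_cong) (auto simp: algebra_simps)
  then show ?case
   using rho_integrable[OF v(1) a] rho_integrable[OF w(1) a] by simp
 qed
 moreover have "(LBINT x. v x + c * w x) = (LBINT x. v x) + c * (LBINT x. w x)"
  using bsupp_integrable[OF v(1)] bsupp_integrable[OF w(1)] by simp
 ultimately show ?thesis unfolding homogenized_def by (simp add: Lim_transform_eventually)
qed

text \<open>Pi-lambda argument. Intersecting with a fixed ball keeps complements integrable and puts
  countable unions within reach of \<open>homogenized_closed_pointwise\<close>.\<close>

lemma homogenized_indicator:
 assumes A: "A : sets borel"
 shows "homogenized (%x. ind (A \<inter> cball 0 (real n)) x)"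
proof -
 obtain G where G: "Int_stable G" "UNIV : G" "sets (borel :: 'a measure) = sigma_sets UNIV G"
  "!!A n. A : G ==> ((%a. LBINT x. ind (A \<inter> cball 0 (real n)) x * rh a x) \<longlongrightarrow> measure lborel (A \<inter> cball 0 (real n))) at0"
  using rho_generator by blast
 have base: "homogenized (%x. ind (A \<inter> cball 0 (real n)) x)" if "A : G" for A
  using G(4)[OF that, of n] by (simp add: homogenized_def)
 have "A : sigma_sets UNIV G" using A G(3) by simp
 from G(1) subset_UNIV[of G, folded Pow_UNIV] this show ?thesis
 proof (induction rule: sigma_sets_induct_disjoint)
  case (basic A)
  then show ?case by (rule base)
 next
  case empty
  then show ?case by (simp add: homogenized_zero)
 next
  case (compl A)
  then have A: "A : sets borel" using G(3) by simp
  have "homogenized (%x. ind (UNIV \<inter> cball 0 (real n)) x + (- 1) * ind (A \<inter> cball 0 (real n)) x)"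
   by (rule homogenized_lincomb[OF bsupp_indicator[of _ "real n"] base[OF G(2)] bsupp_indicator[of _ "real n"] compl(2)]) (use A in auto)
  moreover have "(%x. ind (UNIV \<inter> cball 0 (real n)) x + (- 1) * ind (A \<inter> cball 0 (real n)) x :: real) = (%x. ind ((UNIV - A) \<inter> cball 0 (real n)) x)"
   by (auto simp: indicator_def fun_eq_iff)
  ultimately show ?case by simp
 next
  case (union A)
  have A: "A i : sets borel" for i using union(2) G(3) by auto
  have part: "homogenized (%x. ind ((\<Union>i<k. A i) \<inter> cball 0 (real n)) x)" for k
  proof (induction k)
   case 0
   then show ?case by (simp add: homogenized_zero)
  next
   case (Suc k)
   have "homogenized (%x. ind ((\<Union>i<k. A i) \<inter> cball 0 (real n)) x + 1 * ind (A k \<inter> cball 0 (real n)) x)"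
    by (rule homogenized_lincomb[OF bsupp_indicator[of _ "real n"] Suc bsupp_indicator[of _ "real n"] union(3)]) (use A in auto)
   moreover have "(%x. ind ((\<Union>i<k. A i) \<inter> cball 0 (real n)) x + 1 * ind (A k \<inter> cball 0 (real n)) x :: real) = (%x. ind ((\<Union>i<Suc k. A i) \<inter> cball 0 (real n)) x)"
   proof
    fix x
    have "x \<notin> A i" if "x : A k" "i < k" for i
     using disjoint_family_onD[OF union(1), of k i] that by auto
    then have "x \<notin> A k \<or> x \<notin> (\<Union>i<k. A i)" by blast
    moreover have "(\<Union>i<Suc k. A i) = A k \<union> (\<Union>i<k. A i)" by (simp add: lessThan_Suc)
    ultimately show "ind ((\<Union>i<k. A i) \<inter> cball 0 (real n)) x + 1 * ind (A k \<inter> cball 0 (real n)) x = (ind ((\<Union>i<Suc k. A i) \<inter> cball 0 (real n)) x :: real)"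
     by (simp only: indicator_def Int_iff Un_iff) (simp split: if_splits)
   qed
   ultimately show ?case by simp
  qed
  show ?case
  proof (rule homogenized_closed_pointwise[OF _ _ part])
   show "bsupp 1 (real n) (%x. ind ((\<Union>i<k. A i) \<inter> cball 0 (real n)) x)" for k
    by (rule bsupp_indicator) (use A in auto)
   show "(%k. ind ((\<Union>i<k. A i) \<inter> cball 0 (real n)) x) ~> (ind ((\<Union>i. A i) \<inter> cball 0 (real n)) x :: real)" for x
   proof (cases "\<exists>i. x : A i")
    case True
    then obtain i where i: "x : A i" by blast
    show ?thesis
    proof (rule tendsto_eventually, rule eventually_sequentiallyI[of "Suc i"], goal_cases)
     case (1 k)
     then have "x : (\<Union>i<k. A i)" using i by auto
     then show ?case
      using i by (auto simp: indicator_def)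
    qed
   next
    case False
    then show ?thesis by simp
   qed
  qed
 qed
qed

lemma homogenized_sum:
 assumes "finite Y" "!!y. y : Y ==> A y : sets borel"
 shows "homogenized (%x. \<Sum>y\<in>Y. c y * ind (A y \<inter> cball 0 (real n)) x)"
  and "\<exists>C. bsupp C (real n) (%x. \<Sum>y\<in>Y. c y * ind (A y \<inter> cball 0 (real n)) x)"
proof -
 have "homogenized (%x. \<Sum>y\<in>Y. c y * ind (A y \<inter> cball 0 (real n)) x)
  \<and> (\<exists>C. bsupp C (real n) (%x. \<Sum>y\<in>Y. c y * ind (A y \<inter> cball 0 (real n)) x))"
  using assms
 proof (induction Y rule: finite_induct)
  case empty
  then show ?case by (auto simp: homogenized_zero bsupp_def)
 next
  case (insert z Y)
  let ?s = "%x. \<Sum>y\<in>Y. c y * ind (A y \<inter> cball 0 (real n)) x"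
  obtain C where C: "bsupp C (real n) ?s" and h: "homogenized ?s" using insert by auto
  have Az: "A z : sets borel" using insert by simp
  let ?A = "A z \<inter> cball 0 (real n)"
  have eq: "(%x. \<Sum>y\<in>insert z Y. c y * ind (A y \<inter> cball 0 (real n)) x) = (%x. ?s x + c z * ind ?A x)"
   by (rule ext, subst sum.insert[OF insert(1,2)], rule add.commute)
  have "bsupp (C + \<bar>c z\<bar>) (real n) (%x. ?s x + c z * ind ?A x)"
   unfolding bsupp_def
  proof (intro conjI allI impI)
   show "(%x. ?s x + c z * ind ?A x) : Borel"
    using bsuppD(1)[OF C] Az by measurable
   show "\<bar>?s x + c z * ind ?A x\<bar> <= C + \<bar>c z\<bar>" for x
    using bsuppD(2)[OF C, of x] by (auto simp: indicator_def)
   show "?s x + c z * ind ?A x = 0" if "norm x > real n" for x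
    using bsuppD(3)[OF C that] that by (simp add: indicator_def)
  qed
  moreover have "homogenized (%x. ?s x + c z * ind ?A x)"
   by (rule homogenized_lincomb[OF C h bsupp_indicator[OF Az] homogenized_indicator[OF Az]])
  ultimately show ?case unfolding eq by blast
 qed
 then show "homogenized (%x. \<Sum>y\<in>Y. c y * ind (A y \<inter> cball 0 (real n)) x)"
  "\<exists>C. bsupp C (real n) (%x. \<Sum>y\<in>Y. c y * ind (A y \<inter> cball 0 (real n)) x)" by auto
qed

text \<open>Simple functions approximating v stay below 2 |v|, which preserves both the bound and
  the support.\<close>

lemma weak_convergence:
 assumes v: "bsupp C L v"
 shows "homogenized v"
proof -
 have vm [measurable]: "v : Borel" by (rule bsuppD(1)[OF v])
 obtain n :: nat where n: "L <= real n" using real_arch_simple by blast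
 obtain F where F: "!!i. simple_function borel (F i)" "!!x. (%i. F i x) ~> v x" "!!i x. dist (F i x) 0 <= 2 * dist (v x) 0"
  using borel_measurable_implies_sequence_metric[OF vm, of 0] by auto
 have Fb: "bsupp (2 * C) (real n) (F i)" for i
  unfolding bsupp_def
 proof (intro conjI allI impI)
  show "F i : Borel" by (rule borel_measurable_simple_function[OF F(1)])
  show "\<bar>F i x\<bar> <= 2 * C" for x using F(3)[of i x] bsuppD(2)[OF v, of x] by simp
  show "F i x = 0" if "norm x > real n" for x using F(3)[of i x] bsuppD(3)[OF v, of x] that n by simp
 qed
 have "homogenized (F i)" for i
 proof -
  have "F i x = (\<Sum>y\<in>range (F i). y * ind ((F i -` {y}) \<inter> cball 0 (real n)) x)" for x
  proof (cases "norm x > real n")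
   case True
   then show ?thesis using bsuppD(3)[OF Fb True, of i] by (simp add: indicator_def)
  next
   case False
   have "(\<Sum>y\<in>range (F i). y * ind ((F i -` {y}) \<inter> cball 0 (real n)) x) = (\<Sum>y\<in>range (F i). if y = F i x then y else 0)"
    using False by (intro sum.cong) (auto simp: indicator_def)
   also have "... = F i x" using simple_functionD(1)[OF F(1)[of i]] by simp
   finally show ?thesis by simp
  qed
  moreover have "homogenized (%x. \<Sum>y\<in>range (F i). y * ind ((F i -` {y}) \<inter> cball 0 (real n)) x)"
   by (rule homogenized_sum) (use simple_functionD[OF F(1)[of i]] in auto)
  ultimately show ?thesis by (metis (no_types, lifting) ext)
 qed
 from homogenized_closed_pointwise[OF Fb F(2) this] show ?thesis .
qed

text \<open>The tested function may vary too: by \<open>rho_uniform\<close> an L1 small perturbation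
  is negligible uniformly in the weights.\<close>

lemma weak_convergence_variable:
 assumes e: "range e \<subseteq> {0<..1}" "e ~> 0"
  and v: "!!n::nat. bsupp C L (v n)" and w: "bsupp C L w"
  and lim: "(%n. LBINT x. \<bar>v n x - w x\<bar>) ~> 0"
 shows "(%n. LBINT x. v n x * rh (e n) x) ~> (LBINT x. w x)"
proof -
 have en: "e n : {0<..1}" for n using e(1) by blast
 have fe: "filterlim e at0 sequentially"
  by (rule tendsto_imp_filterlim_at_right[OF e(2)]) (use en in auto)
 have hw: "(%n. LBINT x. w x * rh (e n) x) ~> (LBINT x. w x)"
  using filterlim_compose[OF weak_convergence[OF w, unfolded homogenized_def] fe] .
 define L' where "L' = max 1 L"
 have L': "1 <= L'" by (simp add: L'_def)
 define A where "A = (C + C) * (K * L' ^ DIM('a))"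
 have d: "bsupp (C + C) L' (%x. v n x - w x)" for n
  by (rule bsupp_mono[OF bsupp_diff[OF v w]]) (auto simp: L'_def)
 have "(%n. LBINT x. (v n x - w x) * rh (e n) x) ~> 0"
 proof (rule tendstoI, goal_cases)
  case t: (1 t)
  obtain T where T: "0 < T" "A * T powr (1 - p) < t / 2"
   by (rule powr_neg_small[OF p, of "t / 2"]) (use t in simp_all)
  have "(%n. T * (LBINT x. \<bar>v n x - w x\<bar>)) ~> 0" using tendsto_mult_left[OF lim, of T] by simp
  then have "eventually (%n. T * (LBINT x. \<bar>v n x - w x\<bar>) < t / 2) sequentially"
   by (rule order_tendstoD(2)) (use t in simp)
  then show ?case
  proof eventually_elim
   case n: (elim n)
   have "(C + C) * T powr (1 - p) * (K * L' ^ DIM('a)) = A * T powr (1 - p)" by (simp add: A_def)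
   with rho_uniform[OF d en[of n] L' T(1), of n] n T(2)
   show ?case unfolding dist_real_def by linarith
  qed
 qed
 from tendsto_add[OF this hw] show ?thesis
  using rho_integrable[OF v en] rho_integrable[OF w en] by (simp add: left_diff_distrib)
qed

text \<open>The square of w decays at rate 2 be > d, while balls of radius L carry mass at most K
  L^d, so the dyadic tail series is small uniformly in s. This is what the pointwise decay of the
  limit resolvent is for.\<close>

lemma rho_tail:
 assumes b: "real DIM('a) < 2 * be" and D: "0 <= D" and w: "AE x in lborel. \<bar>w x\<bar> <= D * bump be x"
  and wm [measurable]: "w : Borel" and t: "t > 0"
 obtains m :: nat where "!!s. s : {0<..1} ==> (set_nnint {x. 2 ^ m < norm x} (%x. ennreal ((w x)^2 * rh s x))) <= ennreal t"
proof -
 have be: "0 <= be" using b by (simp add: less_imp_le order_less_le_trans[OF _ order.refl])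
 define a where "a = 2 * be"
 define d where "d = real DIM('a)"
 \<comment> \<open>c 2^((d-a) m) is the dyadic bound of the tail beyond radius 2^m.\<close>
 define c where "c = D^2 * (K * 2 powr d / (1 - 2 powr (d - a)))"
 have "(%m. c * (2 powr (d - a)) ^ m) ~> c * 0"
 proof (intro tendsto_mult_left LIMSEQ_realpow_zero)
  show "2 powr (d - a) < 1" using b by (simp add: a_def d_def powr_less_one)
 qed simp
 then have "eventually (%m. c * (2 powr (d - a)) ^ m < t) sequentially"
  using t by (intro order_tendstoD(2)) simp_all
 then obtain m where m: "c * (2 powr (d - a)) ^ m < t" by (auto simp: eventually_sequentially)
 show thesis
 proof (rule that[of m])
  fix s :: real assume s: "s : {0<..1}"
  have sm [measurable_cong]: "sets (density lborel (%x. ennreal (rh s x))) = sets borel" by simp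
  have "(set_nnint {x. 2 ^ m < norm x} (%x. ennreal ((w x)^2 * rh s x)))
   <= (nnint (%x. ennreal (D^2) * (ennreal (rh s x) * (ennreal (norm x powr - a) * ind {x. 2 ^ m < norm x} x))))"
  proof (rule nn_integral_mono_AE, use w in eventually_elim)
   case wx: (elim x)
   show ?case
   proof (cases "2 ^ m < norm x")
    case True
    then have x: "x \<noteq> 0" by (auto simp: not_less)
    have "\<bar>w x\<bar> <= D * norm x powr - be"
     using wx mult_left_mono[OF bump_le_powr[OF be x] D] by linarith
    then have "(w x)^2 <= (D * norm x powr - be)^2" by (rule abs_le_imp_sq_le)
    also have "... = D^2 * norm x powr - a"
    proof -
     have "norm x powr - a = norm x powr - be * norm x powr - be"
      unfolding powr_add[symmetric] a_def by simp
     then show ?thesis unfolding power2_eq_square by simp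
    qed
    finally have "(w x)^2 * rh s x <= D^2 * (rh s x * norm x powr - a)"
     using mult_right_mono[OF _ rho_nonneg[of s x], of "(w x)^2" "D^2 * norm x powr - a"] by (simp only: mult_ac)
    then have "ennreal ((w x)^2 * rh s x) <= ennreal (D^2 * (rh s x * norm x powr - a))" by (rule ennreal_leI)
    then show ?thesis using True rho_nonneg[of s x] by (simp add: ennreal_mult)
   qed simp
  qed
  also have "... = ennreal (D^2) * (set_nn_integral (density lborel (%x. ennreal (rh s x))) {x. 2 ^ m < norm x} (%x. ennreal (norm x powr - a)))"
   by (subst nn_integral_density) (simp_all add: nn_integral_cmult)
  also have "... <= ennreal (D^2) * ennreal (K * 2 powr d * (2 ^ m) powr (d - a) / (1 - 2 powr (d - a)))"
  proof (intro mult_left_mono nn_integral_outer_powr[OF sm])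
   show "0 <= a" using be by (simp add: a_def)
   show "d < a" using b by (simp add: a_def d_def)
   show "0 <= K" by (rule K_nonneg)
   fix k
   have one: "(1::real) <= 2 ^ (m + k + 1)" by (rule one_le_power) simp
   have "emeasure (density lborel (%x. ennreal (rh s x))) (cball 0 (2 ^ (m + k + 1))) = (set_nnint (cball 0 (2 ^ (m + k + 1))) (%x. ennreal (rh s x)))"
    by (subst emeasure_density) auto
   also have "... <= ennreal (K * (2 ^ (m + k + 1)) ^ DIM('a))" by (rule rho_mass[OF s one])
   also have "(2 ^ (m + k + 1)) ^ DIM('a) = ((2 ^ (m + k + 1)) powr d :: real)"
    unfolding d_def by (rule powr_realpow[symmetric]) simp
   finally show "emeasure (density lborel (%x. ennreal (rh s x))) (cball 0 (2 ^ (m + k + 1))) <= ennreal (K * (2 ^ (m + k + 1)) powr d)" .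
  qed simp
  also have "... = ennreal (c * (2 powr (d - a)) ^ m)"
  proof -
   have "(2 ^ m) powr (d - a) = (2 powr (d - a)) ^ m"
    unfolding two_powr_power by (simp add: powr_powr mult.commute flip: powr_realpow)
   then show ?thesis unfolding c_def by (simp add: ennreal_mult'[symmetric] mult.assoc)
  qed
  also have "... <= ennreal t" using m by (intro ennreal_leI) simp
  finally show "(set_nnint {x. 2 ^ m < norm x} (%x. ennreal ((w x)^2 * rh s x))) <= ennreal t" .
 qed
qed

end

text \<open>Finite intersections of a countable base, the empty one giving \<open>UNIV\<close>.
  Countability lets one null set serve the whole generator; stability under intersection is for the
  pi-lambda argument.\<close>

lemma countable_Int_stable_generator:
 obtains G :: "'a::second_countable_topology set set"
 where "countable G" "Int_stable G" "UNIV : G" "G \<subseteq> sets borel" "sets borel = sigma_sets UNIV G"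
proof -
 obtain B :: "'a set set" where B: "countable B" "topological_basis B" using ex_countable_basis by blast
 define G where "G = (%F. \<Inter>F) ` {F. finite F \<and> F \<subseteq> B}"
 have "countable G" unfolding G_def by (intro countable_image countable_Collect_finite_subset B)
 moreover have "Int_stable G"
 proof (rule Int_stableI)
  fix X Y assume "X : G" "Y : G"
  then obtain E F where "finite E" "E \<subseteq> B" "X = \<Inter>E" "finite F" "F \<subseteq> B" "Y = \<Inter>F" unfolding G_def by blast
  then have "X \<inter> Y = \<Inter>(E \<union> F)" "finite (E \<union> F)" "E \<union> F \<subseteq> B" by auto
  then show "X \<inter> Y : G" unfolding G_def by blast
 qed
 moreover have "UNIV : G" unfolding G_def by (rule image_eqI[of _ _ "{}"]) auto
 moreover have sub: "G \<subseteq> sets borel"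
 proof
  fix X assume "X : G"
  then obtain F where F: "finite F" "F \<subseteq> B" "X = \<Inter>F" unfolding G_def by blast
  have "open X" unfolding F(3) using F(1,2) B(2) by (intro open_Inter) (auto dest: topological_basis_open)
  then show "X : sets borel" by (rule borel_open)
 qed
 moreover have "sets borel = sigma_sets UNIV G"
 proof
  have "X : sigma_sets UNIV G" if "X : B" for X
  proof (rule sigma_sets.Basic)
   show "X : G" unfolding G_def using that by (intro image_eqI[of _ _ "{X}"]) auto
  qed
  then have "sigma_sets UNIV B \<subseteq> sigma_sets UNIV G" by (intro sigma_sets_mono) blast
  then show "sets borel \<subseteq> sigma_sets UNIV G" by (simp add: borel_eq_countable_basis[OF B])
  show "sigma_sets UNIV G \<subseteq> sets borel" using sets.sigma_sets_subset[OF sub] by simp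
 qed
 ultimately show thesis by (rule that)
qed

section \<open>Almost sure behaviour of the random weights\<close>

context random_coefficients
begin

text \<open>With a = 1/r, limits at scale 0 are ergodic averages at infinity over the sets of a
  countable generator. The maximal inequality, used for mu and for its p-th power, gives the uniform
  bounds.\<close>

lemma weights_AE:
 assumes p: "1 < p" and moment: "integrable M (%w. \<mu> w powr p)"
 shows "AE w in M. \<exists>K. weight_family (%a x. \<mu> (\<tau> (x /\<^sub>R a) w)) p K"
proof -
 have mm [measurable]: "\<mu> : borel_measurable M" by (rule mu_measurable)
 obtain G :: "'a set set" where G: "countable G" "Int_stable G" "UNIV : G" "G \<subseteq> sets borel" "sets borel = sigma_sets UNIV G"
  by (rule countable_Int_stable_generator)
 have "AE w in M. ((%r. orbit_avg (A \<inter> cball 0 (real n)) r \<mu> w) \<longlongrightarrow> measure lborel (A \<inter> cball 0 (real n)) * (LINT w|M. \<mu> w)) at_top"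
  if "A : G" for A and n :: nat
 proof (rule ergodic_average[OF mu_integrable])
  show "A \<inter> cball 0 (real n) : sets borel" using that G(4) by (intro sets.Int cball_measurable) blast
  show "A \<inter> cball 0 (real n) \<subseteq> cball 0 (max 1 (real n))" by auto
 qed simp
 then have avg: "AE w in M. \<forall>A\<in>G. \<forall>n::nat. ((%r. orbit_avg (A \<inter> cball 0 (real n)) r \<mu> w) \<longlongrightarrow> measure lborel (A \<inter> cball 0 (real n))) at_top"
  using G(1) by (simp add: AE_ball_countable AE_all_countable mu_mean)
 \<comment> \<open>Absolute values are taken because mu is nonnegative on the sample space only,
   while the maximal bound asks for functions that are nonnegative everywhere.\<close>
 have i1: "integrable M (%w. \<bar>\<mu> w\<bar>)" using mu_integrable by simp
 have i2: "integrable M (%w. \<bar>\<mu> w\<bar> powr p)"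
  by (rule Bochner_Integration.integrable_cong[THEN iffD1, OF refl _ moment]) (simp add: mu_nonneg)
 have b1: "AE w in M. \<exists>K\<ge>0. \<forall>r\<ge>1. \<forall>L\<ge>1. (set_nnint (cball (0::'a) L) (%x. ennreal \<bar>\<mu> (tr r x w)\<bar>)) <= ennreal (K * L ^ DIM('a))"
  by (rule ball_integral_bounded_AE[OF i1]) simp
 have b2: "AE w in M. \<exists>K\<ge>0. \<forall>r\<ge>1. \<forall>L\<ge>1. (set_nnint (cball (0::'a) L) (%x. ennreal (\<bar>\<mu> (tr r x w)\<bar> powr p))) <= ennreal (K * L ^ DIM('a))"
  by (rule ball_integral_bounded_AE[OF i2]) simp
 from avg b1 b2 AE_space show ?thesis
 proof eventually_elim
  case (elim w)
  note avg = elim(1) and w = elim(4)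
  from elim obtain K1 K2 where K1: "0 <= K1" "!!r L. 1 <= r ==> 1 <= L ==> (set_nnint (cball (0::'a) L) (%x. ennreal \<bar>\<mu> (tr r x w)\<bar>)) <= ennreal (K1 * L ^ DIM('a))"
   and K2: "0 <= K2" "!!r L. 1 <= r ==> 1 <= L ==> (set_nnint (cball (0::'a) L) (%x. ennreal (\<bar>\<mu> (tr r x w)\<bar> powr p))) <= ennreal (K2 * L ^ DIM('a))"
   by blast
  have nn: "0 <= \<mu> (\<tau> y w)" for y by (rule mu_nonneg[OF tau_space[OF w]])
  have inv1: "1 <= inverse a" if "a : {0<..1}" for a :: real using that by (simp add: one_le_inverse)
  show ?case
  proof (intro exI[of _ "max K1 K2"] weight_family.intro p)
   show "(%x. \<mu> (\<tau> (x /\<^sub>R a) w)) : Borel" for a by (rule orbit_measurable[OF mm w])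
   show "0 <= \<mu> (\<tau> (x /\<^sub>R a) w)" for a x by (rule nn)
   show "0 <= max K1 K2" using K1(1) by simp
   fix a L :: real assume a: "a : {0<..1}" and L: "1 <= L"
   have Lp: "0 <= L ^ DIM('a)" using L by simp
   have m: "ennreal (K1 * L ^ DIM('a)) <= ennreal (max K1 K2 * L ^ DIM('a))" "ennreal (K2 * L ^ DIM('a)) <= ennreal (max K1 K2 * L ^ DIM('a))"
    by (intro ennreal_leI mult_right_mono Lp; simp)+
   show "(set_nnint (cball 0 L) (%x. ennreal (\<mu> (\<tau> (x /\<^sub>R a) w)))) <= ennreal (max K1 K2 * L ^ DIM('a))"
    using order_trans[OF K1(2)[OF inv1[OF a] L] m(1)] by (simp only: abs_of_nonneg[OF nn])
   show "(set_nnint (cball 0 L) (%x. ennreal (\<mu> (\<tau> (x /\<^sub>R a) w) powr p))) <= ennreal (max K1 K2 * L ^ DIM('a))"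
    using order_trans[OF K2(2)[OF inv1[OF a] L] m(2)] by (simp only: abs_of_nonneg[OF nn])
  next
   have "((%a. LBINT x. ind (A \<inter> cball 0 (real n)) x * \<mu> (\<tau> (x /\<^sub>R a) w)) \<longlongrightarrow> measure lborel (A \<inter> cball 0 (real n))) at0"
    if "A : G" for A n
    using filterlim_compose[OF avg[rule_format, OF that, of n] filterlim_inverse_at_top_right] unfolding orbit_avg_def .
   then show "\<exists>G. Int_stable G \<and> UNIV : G \<and> sets (borel :: 'a measure) = sigma_sets UNIV G \<and>
    (\<forall>A\<in>G. \<forall>n::nat. ((%a. LBINT x. ind (A \<inter> cball 0 (real n)) x * \<mu> (\<tau> (x /\<^sub>R a) w)) \<longlongrightarrow> measure lborel (A \<inter> cball 0 (real n))) at0)"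
    using G by blast
  qed
 qed
qed

end

section \<open>Bounded versions and integrals over bands\<close>

context jump_space
begin

lemma Q_AE_zero:
 assumes d: "fin d" and z: "AE x in lborel. d x = 0"
 shows "QQ l d = 0"
proof -
 have "AE p in jump_measure J. (inc d p)^2 = 0"
  using AE_jump_measure[OF kernel z] by eventually_elim (simp add: inc_def)
 then have "(LINT p|jump_measure J. (inc d p)^2) = 0" by (rule integral_eq_zero_AE)
 moreover have "AE x in m. (d x)^2 = 0" unfolding AE_m_iff using z by eventually_elim simp
 then have "(LINT x|m. (d x)^2) = 0" by (rule integral_eq_zero_AE)
 ultimately show ?thesis by (simp add: Q_diag[OF d])
qed

text \<open>\<open>resolvent\<close> picks an arbitrary representative, bounded only almost
  everywhere. Clamping alters it on a null set, hence changes neither the form nor membership in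
  \<open>dom\<close>.\<close>

lemma resolvent_bounded_version:
 assumes f: "sqint m f" and l: "l > 0" and u: "is_resolvent m J l f u" and B: "!!x. \<bar>f x\<bar> <= B"
 obtains v where "is_resolvent m J l f v" "!!x. \<bar>v x\<bar> <= B / l" "AE x in lborel. v x = u x"
proof -
 have b: "0 <= B / l" using B[of undefined] l by (intro divide_nonneg_pos) linarith+
 define v where "v x = max (- (B / l)) (min (B / l) (u x))" for x
 have ud: "u : dom" by (rule is_resolventD(1)[OF u])
 have uf: "fin u" by (rule dom_fin[OF ud])
 have [measurable]: "u : Borel" by (rule finD(1)[OF uf])
 have vm: "v : Borel" unfolding v_def by measurable
 have vf: "fin v"
 proof (rule fin_bound[OF uf vm])
  show "\<bar>v x\<bar> <= \<bar>u x\<bar>" for x using b unfolding v_def by linarith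
  show "\<bar>inc v q\<bar> <= \<bar>inc u q\<bar>" for q unfolding v_def inc_def by linarith
 qed
 have eq: "AE x in lborel. v x = u x"
  using resolvent_bound[OF f l u B, unfolded AE_m_iff] by eventually_elim (simp add: v_def abs_le_iff max_def min_def)
 have z: "AE x in lborel. u x - v x = 0" using eq by eventually_elim simp
 have Q0: "QQ k (%x. u x - v x) = 0" for k by (rule Q_AE_zero[OF fin_diff[OF uf vf] z])
 have vd: "v : dom"
 proof (rule dom_closed[OF vf])
  fix e :: real assume "e > 0"
  then show "\<exists>g\<in>dom. QQ 1 (%x. g x - v x) < e" by (intro bexI[OF _ ud]) (simp only: Q0)
 qed
 have "is_resolvent m J l f v"
  unfolding is_resolvent_def form_domain_eq
 proof (intro conjI ballI vd)
  fix g assume g: "g : dom"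
  have "(Q l (%x. u x - v x) g)^2 <= QQ l (%x. u x - v x) * QQ l g"
   by (rule Q_CS[OF fin_diff[OF uf vf] dom_fin[OF g]]) (use l in simp)
  then have "Q l (%x. u x - v x) g = 0" by (simp add: Q0)
  then have "Q l v g = Q l u g" by (simp add: Q_diff_left[OF uf vf dom_fin[OF g]])
  then show "jump_form J v g + l * (LINT x|m. v x * g x) = (LINT x|m. f x * g x)"
   using is_resolventD(2)[OF u g] by (simp add: Q_def)
 qed
 moreover have "\<bar>v x\<bar> <= B / l" for x using b unfolding v_def by linarith
 ultimately show thesis using eq that by blast
qed

end

definition band :: "real => ('a::euclidean_space \<times> 'a) set" where
 "band y = {q. y < norm (fst q - snd q) \<and> norm (fst q - snd q) < 1 / y}"

lemma band_measurable [measurable]: "band y : sets ((borel :: 'a::euclidean_space measure) \<Otimes>\<^sub>M borel)"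
proof -
 have "{q : space ((borel :: 'a measure) \<Otimes>\<^sub>M borel). y < norm (fst q - snd q) \<and> norm (fst q - snd q) < 1 / y} : sets borel2"
  by measurable
 then show ?thesis by (simp add: band_def space_pair_measure)
qed

lemma jump_measure_integral:
 assumes J: "jump_kernel J" and [measurable]: "G : Borel2"
 shows "(LINT q|jump_measure J. G q) = (LINT q|lborel2. ind (- Id) q * J (fst q) (snd q) / 2 * (G q :: real))"
proof -
 have [measurable]: "(%q. J (fst q) (snd q)) : Borel2" using J by (rule jump_kernelD)
 have "(LINT q|jump_measure J. G q) = (LINT q|lborel2. (ind (- Id) q * J (fst q) (snd q) / 2) *\<^sub>R G q)"
  unfolding jump_measure_def
 proof (rule integral_density)
  show "AE q in lborel \<Otimes>\<^sub>M lborel. 0 <= ind (- Id) q * J (fst q) (snd q) / 2"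
   using jump_kernelD(2)[OF J] by (auto simp: indicator_def)
 qed measurable
 then show ?thesis by simp
qed

lemma jump_measure_nn_density:
 assumes J: "jump_kernel J" and [measurable]: "G : Borel2"
 shows "(nn_integral (jump_measure J) (%q. G q)) = (nn_integral lborel2 (%q. ennreal (ind (- Id) q * J (fst q) (snd q) / 2) * G q))"
proof -
 have [measurable]: "(%q. J (fst q) (snd q)) : Borel2" using J by (rule jump_kernelD)
 show ?thesis unfolding jump_measure_def by (rule nn_integral_density) measurable
qed

lemma band_integral:
 assumes J: "jump_kernel J" and [measurable]: "f : Borel" "g : Borel" and i: "0 < i"
 shows "(LINT q|jump_measure J. ind (band i) q * (inc f q * inc g q))
  = (1 / 2) * (LINT (x, y)|lborel2. (f x - f y) * (g x - g y) * J x y * ind {(x, y). i < norm (x - y) \<and> norm (x - y) < 1 / i} (x, y))"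
proof -
 have "(LINT q|jump_measure J. ind (band i) q * (inc f q * inc g q))
  = (LINT q|lborel2. ind (- Id) q * J (fst q) (snd q) / 2 * (ind (band i) q * (inc f q * inc g q)))"
  by (rule jump_measure_integral[OF J]) measurable
 also have "... = (LINT q|lborel2. (1 / 2) * (case q of (x, y) => (f x - f y) * (g x - g y) * J x y * ind {(x, y). i < norm (x - y) \<and> norm (x - y) < 1 / i} (x, y)))"
 proof (rule bint_cong[OF refl])
  fix q :: "'a \<times> 'a"
  obtain x y where q: "q = (x, y)" by (cases q)
  have "(x, y) \<notin> Id" if "i < norm (x - y)" using that i by auto
  then show "ind (- Id) q * J (fst q) (snd q) / 2 * (ind (band i) q * (inc f q * inc g q))
   = (1 / 2) * (case q of (x, y) => (f x - f y) * (g x - g y) * J x y * ind {(x, y). i < norm (x - y) \<and> norm (x - y) < 1 / i} (x, y))"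
   by (simp add: q band_def inc_def indicator_def)
 qed
 finally show ?thesis by simp
qed

lemma Limsup_finite_eventually:
 fixes f :: "real => ennreal"
 assumes "Limsup F f < \<infinity>"
 obtains S :: real where "0 <= S" "eventually (%x. f x <= ennreal S) F"
proof -
 obtain c where c: "Limsup F f < c" "c < \<infinity>" using dense[OF assms] by blast
 then obtain S where S: "0 <= S" "c = ennreal S" by (cases c) auto
 have "eventually (%x. f x < c) F" using c(1) by (rule Limsup_lessD)
 then have "eventually (%x. f x <= ennreal S) F" by eventually_elim (simp add: S(2))
 with S(1) that show thesis by blast
qed

text \<open>Puts the iterated limits of (ii) into the order in which they are used: the cutoff
  first, then a.\<close>

lemma iterated_Limsup_small:
 fixes f :: "real => real => ennreal"
 assumes "((%y. Limsup F (f y)) \<longlongrightarrow> 0) E" "0 < d"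
 shows "eventually (%y. eventually (%a. f y a <= ennreal d) F) E"
proof -
 have "eventually (%y. Limsup F (f y) < ennreal d) E" using assms by (intro order_tendstoD(2)) auto
 then show ?thesis
 proof eventually_elim
  case (elim y)
  then have "eventually (%a. f y a < ennreal d) F" by (rule Limsup_lessD)
  then show ?case by eventually_elim simp
 qed
qed

lemma kernel_product_bound:
 fixes a j c t d B :: real
 assumes "0 <= a" "j <= c * t" "0 <= j" "d <= 2 * B" "0 <= d" "0 <= t" "0 <= c"
 shows "j / 2 * (a * d) <= B * t * (a * c)"
proof -
 have "j * d <= (c * t) * (2 * B)" using assms by (intro mult_mono) auto
 then have "a / 2 * (j * d) <= a / 2 * ((c * t) * (2 * B))" using assms(1) by (intro mult_left_mono) auto
 then show ?thesis by (simp add: mult_ac)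
qed

section \<open>Homogenization\<close>

text \<open>The deterministic situation at one sample point: c a is the rescaled coefficient, rh a
  the density of the random measure, and nu the limit kernel with the cone included.\<close>

locale homogenization = weight_family rh p K + stable_like nu al C
 for rh :: "real => 'a::euclidean_space => real" and p K :: real and nu :: "'a => real" and al C :: real +
 fixes c :: "real => 'a => 'a => real" and \<Gamma> :: "'a set"
 assumes c_measurable: "!!a. (%q. c a (fst q) (snd q)) : Borel2"
  and c_nonneg: "!!a x y. 0 <= c a x y"
  and c_sym: "!!a x y. c a x y = c a y x"
  and Gamma_measurable [measurable]: "\<Gamma> : sets borel"
  and rho_pos: "!!a. a : {0<..1} ==> AE x in lborel. 0 < rh a x"
  and compactness: "!!u (e :: nat => real).
   [|\<forall>a\<in>{0<..1}. u a : form_domain (density lborel (%x. ennreal (rh a x))) (cone_kernel al \<Gamma> (c a));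
    Limsup at0 (%a. Linf_norm (u a) + jump_energy (cone_kernel al \<Gamma> (c a)) (u a)) < \<infinity>;
    range e \<subseteq> {0<..1}; e ~> 0|]
   ==> \<exists>s h. strict_mono (s :: nat => nat) \<and> h : L1_loc \<and>
      (\<forall>r>1. (%k. set_nnint (ball 0 r) (%x. ennreal \<bar>u (e (s k)) x - h x\<bar>)) ~> 0)"
  and small_jumps: "!!g. g : Cc_inf ==>
   ((%i. Limsup at0 (%a.
     set_nn_integral lborel2 (- Id)
      (%(x, y). ennreal ((g x - g y)^2 * stable_kernel al (c a) x y)
            * ind {(x, y). norm (x - y) <= i} (x, y))))
    \<longlongrightarrow> 0) at0"
  and large_jumps: "!!g. g : Cc_inf ==>
   ((%i. Limsup at0 (%a.
     nn_integral lborel2 (%(x, y). ennreal ((g x - g y)^2 * stable_kernel al (c a) x y)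
           * ind {(x, y). 1 / i <= norm (x - y)} (x, y))))
    \<longlongrightarrow> 0) at0"
  and coefficient_moment: "\<exists>q>1. \<forall>R\<ge>1.
   Limsup at0 (%a.
    set_nnint (ball 0 R) (%x. ennreal_powr
     (set_nnint (ball 0 R) (%y. ennreal (c a x y))) q)) < \<infinity>"
  and band_convergence: "!!i f g.
   [|0 < i; f : Borel; bounded (range f); g : Cc_inf|] ==>
   ((%a. LINT (x, y)|lborel2. (f x - f y) * (g x - g y) * cone_kernel al \<Gamma> (c a) x y
          * ind {(x, y). i < norm (x - y) \<and> norm (x - y) < 1 / i} (x, y))
    \<longlongrightarrow> (LINT (x, y)|lborel2. (f x - f y) * (g x - g y) * nu (x - y)
          * ind {(x, y). i < norm (x - y) \<and> norm (x - y) < 1 / i} (x, y))) at0"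
begin

abbreviation (input) m :: "real => 'a measure" where "m a \<equiv> density lborel (%x. ennreal (rh a x))"
abbreviation (input) J :: "real => 'a => 'a => real" where "J a \<equiv> cone_kernel al \<Gamma> (c a)"
abbreviation (input) jm :: "real => ('a \<times> 'a) measure" where "jm a \<equiv> jump_measure (J a)"
abbreviation (input) jl :: "('a \<times> 'a) measure" where "jl \<equiv> jump_measure (%x y. nu (x - y))"

lemma J_le: "J a x y <= stable_kernel al (c a) x y" "0 <= J a x y" "0 <= stable_kernel al (c a) x y"
 unfolding cone_kernel_def stable_kernel_def using c_nonneg by (auto simp: indicator_def)

lemma stable_measurable [measurable]: "(%q. stable_kernel al (c a) (fst q) (snd q)) : Borel2"
proof -
 note [measurable] = c_measurable
 show ?thesis unfolding stable_kernel_def by measurable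
qed

lemma J_measurable [measurable]: "(%q. J a (fst q) (snd q)) : Borel2"
 unfolding cone_kernel_def by measurable

lemma J_kernel: "jump_kernel (J a)"
 unfolding jump_kernel_def using J_le(2) by simp

lemma nu_kernel: "jump_kernel (%x y. nu (x - y))"
 unfolding jump_kernel_def using nu_nonneg by simp

lemma AE_m: "a : {0<..1} ==> (AE x in m a. P x) \<longleftrightarrow> (AE x in lborel. P x)"
proof -
 assume a: "a : {0<..1}"
 have "(AE x in m a. P x) \<longleftrightarrow> (AE x in lborel. 0 < ennreal (rh a x) \<longrightarrow> P x)" by (rule AE_density) simp
 also have "... \<longleftrightarrow> (AE x in lborel. P x)"
 proof
  assume "AE x in lborel. 0 < ennreal (rh a x) \<longrightarrow> P x"
  with rho_pos[OF a] show "AE x in lborel. P x" by eventually_elim simp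
 next
  assume "AE x in lborel. P x"
  then show "AE x in lborel. 0 < ennreal (rh a x) \<longrightarrow> P x" by eventually_elim simp
 qed
 finally show ?thesis .
qed

lemma random_space: "a : {0<..1} ==> jump_space (m a) (J a)"
 by (rule jump_space.intro) (simp_all add: J_kernel AE_m)

lemma m_integral:
 assumes [measurable]: "v : Borel"
 shows "(LINT x|m a. v x) = (LBINT x. v x * rh a x)"
  and "integrable (m a) v \<longleftrightarrow> integrable lborel (%x. v x * rh a x)"
proof -
 have "(LINT x|m a. v x) = (LBINT x. rh a x *\<^sub>R v x)" by (rule integral_density) (simp_all add: rho_nonneg)
 then show "(LINT x|m a. v x) = (LBINT x. v x * rh a x)" by (simp add: mult.commute)
 have "integrable (m a) v \<longleftrightarrow> integrable lborel (%x. rh a x *\<^sub>R v x)" by (rule integrable_density) (simp_all add: rho_nonneg)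
 then show "integrable (m a) v \<longleftrightarrow> integrable lborel (%x. v x * rh a x)" by (simp add: mult.commute)
qed

lemma bsupp_m_integrable: "bsupp A L v ==> a : {0<..1} ==> integrable (m a) v"
 using rho_integrable[of A L v a] by (simp add: m_integral bsuppD(1))

lemma bsupp_sq:
 assumes v: "bsupp A L v"
 shows "bsupp (A * A) L (%x. (v x)^2)" and "a : {0<..1} ==> sqint (m a) v" and "sqint lborel v"
proof -
 have vm [measurable]: "v : Borel" by (rule bsuppD(1)[OF v])
 show s: "bsupp (A * A) L (%x. (v x)^2)"
  unfolding power2_eq_square by (rule bsupp_mult[OF v vm bsuppD(2)[OF v]])
 show "sqint (m a) v" if "a : {0<..1}"
  unfolding sqint_def using bsupp_m_integrable[OF s that] by simp
 show "sqint lborel v"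
  unfolding sqint_def using bsupp_integrable[OF s] by simp
qed

lemma band_jump_integral:
 assumes f: "f : Borel" "bounded (range f)" and g: "g : Cc_inf" and y: "0 < y"
 shows "((%a. LINT q|jm a. ind (band y) q * (inc f q * inc g q))
  \<longlongrightarrow> (LINT q|jl. ind (band y) q * (inc f q * inc g q))) at0"
proof -
 have gm: "g : Borel" by (rule Cc_measurable[OF Cc_inf_Cc[OF g]])
 show ?thesis
  unfolding band_integral[OF J_kernel f(1) gm y] band_integral[OF nu_kernel f(1) gm y]
  by (rule tendsto_mult_left[OF band_convergence[OF y f g]])
qed

text \<open>Off the band there are only short and long jumps, to which the two halves of (ii) apply;
  restricting to the cone only lowers the kernel.\<close>

lemma outside_band:
 assumes g: "g : Cc_inf" and d: "0 < d"
 shows "eventually (%i. eventually (%a. (nn_integral (jm a) (%q. ennreal ((inc g q)^2) * ind (- band i) q)) <= ennreal d) at0) at0"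
proof -
 have gm [measurable]: "g : Borel" by (rule Cc_measurable[OF Cc_inf_Cc[OF g]])
 have d2: "0 < d / 2" using d by simp
 show ?thesis
  using iterated_Limsup_small[OF small_jumps[OF g] d2] iterated_Limsup_small[OF large_jumps[OF g] d2]
 proof eventually_elim
  case (elim i)
  let ?s = "%a. set_nn_integral lborel2 (- Id)
      (%(x, y). ennreal ((g x - g y)^2 * stable_kernel al (c a) x y) * ind {(x, y). norm (x - y) <= i} (x, y))"
  let ?l = "%a. nn_integral lborel2 (%(x, y). ennreal ((g x - g y)^2 * stable_kernel al (c a) x y)
           * ind {(x, y). 1 / i <= norm (x - y)} (x, y))"
  assume "eventually (%a. ?s a <= ennreal (d / 2)) at0" and "eventually (%a. ?l a <= ennreal (d / 2)) at0"
  then show ?case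
  proof eventually_elim
   case (elim a)
   note s = elim(1) and l = elim(2)
   let ?F = "%q. ennreal ((inc g q)^2 * stable_kernel al (c a) (fst q) (snd q))"
   let ?A = "(borel :: 'a measure) \<Otimes>\<^sub>M borel"
   have [measurable]: "{q. norm (fst q - snd q) <= i} : sets ?A"
    "{q. 1 / i <= norm (fst q - snd q)} : sets ?A"
   proof -
    have "{q : space ?A. norm (fst q - snd q) <= i} : sets borel2"
     "{q : space ?A. 1 / i <= norm (fst q - snd q)} : sets borel2"
     by measurable
    then show "{q. norm (fst q - snd q) <= i} : sets ?A"
     "{q. 1 / i <= norm (fst q - snd q)} : sets ?A" by (simp_all add: space_pair_measure)
   qed
   have "(nn_integral (jm a) (%q. ennreal ((inc g q)^2) * ind (- band i) q))
    = (nn_integral lborel2 (%q. ennreal (ind (- Id) q * J a (fst q) (snd q) / 2) * (ennreal ((inc g q)^2) * ind (- band i) q)))"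
    by (rule jump_measure_nn_density[OF J_kernel]) measurable
   also have "... <= (nn_integral lborel2 (%q. ?F q * ind {q. norm (fst q - snd q) <= i} q * ind (- Id) q + ?F q * ind {q. 1 / i <= norm (fst q - snd q)} q))"
   proof (rule nn_integral_mono, goal_cases)
    case (1 q)
    have Jq: "0 <= J a (fst q) (snd q)" "J a (fst q) (snd q) / 2 <= stable_kernel al (c a) (fst q) (snd q)"
     using J_le[of a "fst q" "snd q"] by auto
    have "ennreal (J a (fst q) (snd q) / 2) * ennreal ((inc g q)^2) = ennreal (J a (fst q) (snd q) / 2 * (inc g q)^2)"
     by (rule ennreal_mult[symmetric]) (use Jq(1) in simp_all)
    also have "... <= ?F q"
     using mult_right_mono[OF Jq(2), of "(inc g q)^2"] by (intro ennreal_leI) (simp add: mult.commute)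
    finally have le: "ennreal (J a (fst q) (snd q) / 2) * ennreal ((inc g q)^2) <= ?F q" .
    consider "q : Id \<or> q : band i" | "q \<notin> Id" "norm (fst q - snd q) <= i" | "q \<notin> Id" "1 / i <= norm (fst q - snd q)"
    proof -
     have "q : band i \<or> norm (fst q - snd q) <= i \<or> 1 / i <= norm (fst q - snd q)"
      unfolding band_def mem_Collect_eq by linarith
     then show thesis using that by blast
    qed
    then show ?case
    proof cases
     case 1
     then show ?thesis by (elim disjE) simp_all
    next
     case 2
     have "ennreal (ind (- Id) q * J a (fst q) (snd q) / 2) * (ennreal ((inc g q)^2) * ind (- band i) q)
      <= ennreal (J a (fst q) (snd q) / 2) * ennreal ((inc g q)^2)"
      using 2 by (cases "q : band i") simp_all
     also have "... <= ?F q * ind {q. norm (fst q - snd q) <= i} q * ind (- Id) q" using 2 le by simp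
     also have "... <= ... + ?F q * ind {q. 1 / i <= norm (fst q - snd q)} q" by simp
     finally show ?thesis .
    next
     case 3
     have "ennreal (ind (- Id) q * J a (fst q) (snd q) / 2) * (ennreal ((inc g q)^2) * ind (- band i) q)
      <= ennreal (J a (fst q) (snd q) / 2) * ennreal ((inc g q)^2)"
      using 3 by (cases "q : band i") simp_all
     also have "... <= ?F q * ind {q. 1 / i <= norm (fst q - snd q)} q" using 3 le by simp
     also have "... <= ?F q * ind {q. norm (fst q - snd q) <= i} q * ind (- Id) q + ?F q * ind {q. 1 / i <= norm (fst q - snd q)} q" by simp
     finally show ?thesis .
    qed
   qed
   also have "... = (nn_integral lborel2 (%q. ?F q * ind {q. norm (fst q - snd q) <= i} q * ind (- Id) q))
    + (nn_integral lborel2 (%q. ?F q * ind {q. 1 / i <= norm (fst q - snd q)} q))"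
    by (rule nn_integral_add) measurable
   also have "(nn_integral lborel2 (%q. ?F q * ind {q. norm (fst q - snd q) <= i} q * ind (- Id) q)) = ?s a"
    by (intro nn_integral_cong) (simp add: inc_def case_prod_unfold indicator_def)
   also have "(nn_integral lborel2 (%q. ?F q * ind {q. 1 / i <= norm (fst q - snd q)} q)) = ?l a"
    by (intro nn_integral_cong) (simp add: inc_def case_prod_unfold indicator_def)
   also have "?s a + ?l a <= ennreal (d / 2) + ennreal (d / 2)" by (rule add_mono[OF s l])
   also have "... = ennreal d" using d by (simp add: ennreal_plus[symmetric] del: ennreal_plus)
   finally show ?case .
  qed
 qed
qed

text \<open>The inner integral of (iii), treated below as a weight in x that varies with a.\<close>

definition W :: "real => real => 'a => ennreal" where
 "W R a x = (set_nnint (ball 0 R) (%y. ennreal (c a x y)))"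

lemma c_joint [measurable]: "(%q. c a (fst q) (snd q)) : Borel2"
 by (rule c_measurable)

lemma W_measurable [measurable]: "W R a : Borel"
proof -
 have "(%q. ennreal (c a (fst q) (snd q)) * ind (ball 0 R) (snd q)) : borel_measurable (borel \<Otimes>\<^sub>M lborel)" by measurable
 from lborel.borel_measurable_nn_integral_fst[OF this] show ?thesis by (simp add: W_def[abs_def])
qed

lemma W_moment:
 obtains q where "1 < q" "!!R. 1 <= R ==> \<exists>S. eventually (%a. (set_nnint (ball 0 R) (%x. ennreal_powr (W R a x) q)) <= ennreal S) at0"
proof -
 obtain q where q: "1 < q" "!!R. 1 <= R ==> Limsup at0 (%a. set_nnint (ball 0 R) (%x. ennreal_powr (W R a x) q)) < \<infinity>"
  using coefficient_moment unfolding W_def[symmetric] by blast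
 show thesis
 proof (rule that[OF q(1)])
  fix R :: real assume "1 <= R"
  from Limsup_finite_eventually[OF q(2)[OF this]]
  show "\<exists>S. eventually (%a. (set_nnint (ball 0 R) (%x. ennreal_powr (W R a x) q)) <= ennreal S) at0" by blast
 qed
qed

text \<open>On the band the kernel is at most i^-be times the coefficient. A nonzero increment of g
  puts one endpoint within distance S of the origin, hence both within R, and the symmetry of c lets
  both values of v be integrated in the first variable.\<close>

lemma band_weight:
 assumes [measurable]: "v : Borel" and v: "!!x. 0 <= v x"
  and [measurable]: "g : Borel" and B: "!!x. \<bar>g x\<bar> <= B" and S: "!!x. norm x > S ==> g x = 0"
  and i: "0 < i" and R: "S + 1 / i < R"
 shows "(nn_integral (jm a) (%q. ind (band i) q * ennreal ((v (fst q) + v (snd q)) * \<bar>inc g q\<bar>)))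
  <= ennreal (2 * B * i powr - be) * (set_nnint (ball 0 R) (%x. ennreal (v x) * W R a x))"
proof -
 have B0: "0 <= B" using B[of 0] by linarith
 define A where "A = B * i powr - be"
 have A0: "0 <= A" using B0 by (simp add: A_def)
 define H where "H x y = ennreal (v x) * ennreal (c a x y) * ind (ball 0 R) x * ind (ball 0 R) y" for x y
 have Hm: "(%q. H (fst q) (snd q)) : Borel2" unfolding H_def by measurable
 have Hm2: "(%q. H (snd q) (fst q)) : Borel2"
  unfolding H_def c_sym[of a "snd _"] by measurable
 have Hl: "(%q. H (fst q) (snd q)) : borel_measurable lborel2"
  and Hl2: "(%q. H (snd q) (fst q)) : borel_measurable lborel2"
  using Hm Hm2 by (simp_all only: measurable_cong_sets[OF sets_lborel_pair refl])
 let ?A = "set_nnint (ball 0 R) (%x. ennreal (v x) * W R a x)"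
 let ?B = "nn_integral (jm a) (%q. ind (band i) q * ennreal ((v (fst q) + v (snd q)) * \<bar>inc g q\<bar>))"
 let ?C = "nn_integral lborel2 (%q. ennreal A * (H (fst q) (snd q) + H (snd q) (fst q)))"
 let ?E = "nnint (%y. (nnint (%x. H y x)))"
 have "?B
  = (nn_integral lborel2 (%q. ennreal (ind (- Id) q * J a (fst q) (snd q) / 2) * (ind (band i) q * ennreal ((v (fst q) + v (snd q)) * \<bar>inc g q\<bar>))))"
  by (rule jump_measure_nn_density[OF J_kernel]) measurable
 also have "... <= ?C"
 proof (rule nn_integral_mono, goal_cases)
  case (1 q)
  obtain x y where q: "q = (x, y)" by (cases q)
  show ?case
  proof (cases "q : band i \<and> g x \<noteq> g y")
   case False
   then show ?thesis by (auto simp: q inc_def)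
  next
   case True
   then have n: "i < norm (x - y)" "norm (x - y) < 1 / i" and gg: "g x \<noteq> g y" by (auto simp: q band_def)
   have "norm x <= S \<or> norm y <= S" using S[of x] S[of y] gg by force
   moreover have "norm x <= norm y + norm (x - y)" "norm y <= norm x + norm (x - y)"
    using norm_triangle_sub[of x y] norm_triangle_sub[of y x] by (auto simp: norm_minus_commute)
   moreover have "0 < 1 / i" using i by simp
   ultimately have xy: "norm x < R" "norm y < R" using n R by linarith+
   define t where "t = i powr - be"
   have t0: "0 <= t" by (simp add: t_def)
   have pw: "norm (x - y) powr - be <= t" unfolding t_def using n(1) i beta_nonneg by (intro powr_mono2') auto
   have "J a x y <= c a x y * norm (x - y) powr - be"
    using J_le(1)[of a x y] unfolding stable_kernel_def be_def powr_minus_divide by (simp only: times_divide_eq_right mult_1_right)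
   also have "... <= c a x y * t" using pw c_nonneg by (rule mult_left_mono)
   finally have Jle: "J a x y <= c a x y * t" .
   have gB: "\<bar>g x - g y\<bar> <= 2 * B" using B[of x] B[of y] by linarith
   have vv: "0 <= v x + v y" using v[of x] v[of y] by linarith
   let ?D = "ind (band i) q * ennreal ((v (fst q) + v (snd q)) * \<bar>inc g q\<bar>)"
   have "J a x y / 2 * ((v x + v y) * \<bar>g x - g y\<bar>) <= A * ((v x + v y) * c a x y)"
    unfolding A_def t_def[symmetric] by (rule kernel_product_bound[OF vv Jle J_le(2) gB abs_ge_zero t0 c_nonneg])
   also have "(v x + v y) * c a x y = v x * c a x y + v y * c a y x"
    unfolding c_sym[of a y x] by (rule distrib_right)
   finally have "ennreal (J a x y / 2 * ((v x + v y) * \<bar>g x - g y\<bar>)) <= ennreal (A * (v x * c a x y + v y * c a y x))"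
    by (rule ennreal_leI)
   also have "... = ennreal A * (H x y + H y x)"
   proof -
    have "H x y = ennreal (v x * c a x y)" "H y x = ennreal (v y * c a y x)"
     using xy by (simp_all add: H_def ennreal_mult v c_nonneg)
    then have "H x y + H y x = ennreal (v x * c a x y + v y * c a y x)"
     by (simp add: ennreal_plus v c_nonneg)
    moreover have "0 <= v x * c a x y + v y * c a y x" by (intro add_nonneg_nonneg mult_nonneg_nonneg v c_nonneg)
    ultimately show ?thesis using A0 by (simp only: ennreal_mult)
   qed
   finally have "ennreal (J a x y / 2 * ((v x + v y) * \<bar>g x - g y\<bar>)) <= ennreal A * (H x y + H y x)" .
   moreover have "ennreal (ind (- Id) q * J a (fst q) (snd q) / 2) * ?D
    = ennreal (J a x y / 2 * ((v x + v y) * \<bar>g x - g y\<bar>))"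
   proof -
    have "x \<noteq> y" using gg by auto
    then have "ennreal (ind (- Id) q * J a (fst q) (snd q) / 2) * ?D
     = ennreal (J a x y / 2) * ennreal ((v x + v y) * \<bar>g x - g y\<bar>)"
     using True by (simp add: q inc_def)
    also have "... = ennreal (J a x y / 2 * ((v x + v y) * \<bar>g x - g y\<bar>))"
     by (rule ennreal_mult[symmetric]) (use J_le(2)[of a x y] vv in simp_all)
    finally show ?thesis .
   qed
   ultimately show ?thesis by (simp add: q)
  qed
 qed
 also have "... = ennreal A * ((nn_integral lborel2 (%q. H (fst q) (snd q))) + (nn_integral lborel2 (%q. H (snd q) (fst q))))"
 proof -
  have "?C = ennreal A * (nn_integral lborel2 (%q. H (fst q) (snd q) + H (snd q) (fst q)))"
   by (rule nn_integral_cmult[OF borel_measurable_add[OF Hl Hl2]])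
  then show ?thesis unfolding nn_integral_add[OF Hl Hl2] .
 qed
 also have "(nn_integral lborel2 (%q. H (snd q) (fst q))) = ?E"
  using lborel_pair.nn_integral_snd[OF Hl2] by simp
 also have "(nn_integral lborel2 (%q. H (fst q) (snd q))) = ?E"
  using lborel.nn_integral_fst[OF Hl] by simp
 also have "?E = ?A"
 proof (rule nn_integral_cong, goal_cases)
  case (1 x)
  have "(%y. (x, y)) : borel \<rightarrow>\<^sub>M borel \<Otimes>\<^sub>M borel" by measurable
  from measurable_compose[OF this c_joint[of a]] have [measurable]: "(%y. c a x y) : Borel" by simp
  have "(nnint (%y. H x y)) = (nnint (%y. (ennreal (v x) * ind (ball 0 R) x) * (ennreal (c a x y) * ind (ball 0 R) y)))"
   unfolding H_def by (intro nn_integral_cong) (simp add: mult_ac)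
  also have "... = (ennreal (v x) * ind (ball 0 R) x) * W R a x"
   unfolding W_def by (rule nn_integral_cmult) measurable
  finally show ?case by (simp add: mult_ac)
 qed
 finally have "?B
  <= ennreal A * (?A + ?A)" .
 also have "... = ennreal (2 * B * i powr - be) * ?A"
 proof -
  have "ennreal (2 * B * i powr - be) = ennreal A + ennreal A"
   using A0 by (subst ennreal_plus[symmetric]) (simp_all add: A_def)
  then show ?thesis by (simp only: distrib_left distrib_right)
 qed
 finally show ?thesis .
qed

end

lemma Cc_bsupp:
 assumes "g : Cc k"
 obtains B S where "0 < S" "bsupp B S g"
proof -
 obtain S where S: "S > 0" "!!x. norm x > S ==> g x = 0" by (rule Cc_support[OF assms]) blast
 obtain B where B: "B >= 0" "!!x. \<bar>g x\<bar> <= B" by (rule Cc_bounded[OF assms]) blast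
 have "bsupp B S g" unfolding bsupp_def using Cc_measurable[OF assms] S(2) B(2) by blast
 with S(1) that show thesis by blast
qed

context homogenization
begin

lemma eventually_W_finite:
 assumes R: "1 <= R"
 shows "eventually (%a. (set_nnint (ball 0 R) (%x. W R a x)) < \<infinity>) at0"
proof -
 obtain q where q: "1 < q" "!!R. 1 <= R ==> \<exists>S. eventually (%a. (set_nnint (ball 0 R) (%x. ennreal_powr (W R a x) q)) <= ennreal S) at0"
  by (rule W_moment) blast
 obtain S where "eventually (%a. (set_nnint (ball 0 R) (%x. ennreal_powr (W R a x) q)) <= ennreal S) at0"
  using q(2)[OF R] by blast
 then show ?thesis
 proof eventually_elim
  case S: (elim a)
  \<comment> \<open>Splitting at height T = 1.\<close>
  have le: "W R a x <= 1 + ennreal_powr (W R a x) q" for x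
   using weight_split[OF q(1), of 1 1 1 "W R a x"] by simp
  have "(set_nnint (ball 0 R) (%x. W R a x)) <= (nnint (%x. ind (ball 0 R) x + ennreal_powr (W R a x) q * ind (ball 0 R) x))"
  proof (rule nn_integral_mono, goal_cases)
   case (1 x)
   show ?case
    using le[of x] by (cases "x : ball 0 R") simp_all
  qed
  also have "... = emeasure lborel (ball (0::'a) R) + (set_nnint (ball 0 R) (%x. ennreal_powr (W R a x) q))"
   by (subst nn_integral_add) simp_all
  also have "... < \<infinity>"
  proof -
   have "emeasure lborel (ball (0::'a) R) < \<infinity>" by (rule emeasure_bounded_finite) simp
   moreover have "(set_nnint (ball 0 R) (%x. ennreal_powr (W R a x) q)) < \<infinity>" using S by (rule order_le_less_trans) simp
   ultimately show ?thesis by simp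
  qed
  finally show ?case .
 qed
qed

lemma band_nn_finite:
 assumes g: "bsupp B S g" and y: "0 < y" and R: "S + 1 / y < R" and b: "0 <= b"
  and W: "(set_nnint (ball 0 R) (%x. W R a x)) < \<infinity>"
 shows "(nn_integral (jm a) (%q. ind (band y) q * ennreal (2 * b * \<bar>inc g q\<bar>))) < \<infinity>"
proof -
 have "(nn_integral (jm a) (%q. ind (band y) q * ennreal ((b + b) * \<bar>inc g q\<bar>)))
  <= ennreal (2 * B * y powr - be) * (set_nnint (ball 0 R) (%x. ennreal b * W R a x))"
  by (rule band_weight[of "%_. b", OF _ b bsuppD(1)[OF g] bsuppD(2)[OF g] bsuppD(3)[OF g] y R]) simp_all
 also have "(set_nnint (ball 0 R) (%x. ennreal b * W R a x)) = ennreal b * (set_nnint (ball 0 R) (%x. W R a x))"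
  unfolding mult.assoc by (rule nn_integral_cmult) measurable
 also have "ennreal (2 * B * y powr - be) * (ennreal b * (set_nnint (ball 0 R) (%x. W R a x))) < \<infinity>"
  using W by (simp add: ennreal_mult_less_top less_top)
 finally show ?thesis by (simp only: mult_2)
qed

lemma band_integrable:
 assumes g: "bsupp B S g" and y: "0 < y" and R: "S + 1 / y < R"
  and W: "(set_nnint (ball 0 R) (%x. W R a x)) < \<infinity>"
  and [measurable]: "v : Borel" and v: "!!x. \<bar>v x\<bar> <= b"
 shows "integrable (jm a) (%q. ind (band y) q * (inc v q * inc g q))"
proof (rule integrableI_bounded)
 have b: "0 <= b" using v[of 0] by linarith
 have [measurable]: "g : Borel" by (rule bsuppD(1)[OF g])
 show "(%q. ind (band y) q * (inc v q * inc g q)) : borel_measurable (jm a)" by measurable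
 let ?A = "nn_integral (jm a) (%q. ennreal (norm (ind (band y) q * (inc v q * inc g q))))"
 have "?A
  <= (nn_integral (jm a) (%q. ind (band y) q * ennreal (2 * b * \<bar>inc g q\<bar>)))"
 proof (rule nn_integral_mono, goal_cases)
  case (1 q)
  have "\<bar>inc v q\<bar> <= 2 * b" using v[of "fst q"] v[of "snd q"] unfolding inc_def by linarith
  then have "\<bar>inc v q * inc g q\<bar> <= 2 * b * \<bar>inc g q\<bar>" unfolding abs_mult by (rule mult_right_mono) simp
  then show ?case
   by (cases "q : band y") (simp_all add: ennreal_leI)
 qed
 also have "... < \<infinity>" by (rule band_nn_finite[OF g y R b W])
 finally show "?A < \<infinity>" .
qed

lemma eventually_band_integrable:
 assumes g: "g : Cc_inf" and y: "0 < y"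
 shows "eventually (%a. \<forall>v b. v : Borel \<longrightarrow> (\<forall>x. \<bar>v x\<bar> <= b) \<longrightarrow>
  integrable (jm a) (%q. ind (band y) q * (inc v q * inc g q))) at0"
proof -
 obtain B S where BS: "0 < S" "bsupp B S g" by (rule Cc_bsupp[OF Cc_inf_Cc[OF g]])
 define R where "R = max 1 (S + 1 / y + 1)"
 have R: "1 <= R" "S + 1 / y < R" by (simp_all add: R_def less_max_iff_disj)
 show ?thesis
  using eventually_W_finite[OF R(1)]
 proof eventually_elim
  case W: (elim a)
  show ?case
   using band_integrable[OF BS(2) y R(2) W] by blast
 qed
qed

text \<open>Finite energy of a test function is available for small a: (iii) bounds its energy on a
  band and (ii) the energy off it.\<close>

lemma eventually_test_function:
 assumes g: "g : Cc_inf"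
 shows "eventually (%a. sqint (jm a) (inc g) \<and> g : form_domain (m a) (J a)) at0"
proof -
 obtain B S where BS: "0 < S" "bsupp B S g" by (rule Cc_bsupp[OF Cc_inf_Cc[OF g]])
 have gm [measurable]: "g : Borel" by (rule bsuppD(1)[OF BS(2)])
 have "eventually (%y. 0 < y \<and> eventually (%a. (nn_integral (jm a) (%q. ennreal ((inc g q)^2) * ind (- band y) q)) <= ennreal 1) at0) at0"
  using outside_band[OF g zero_less_one] eventually_at_right_less[of 0] by eventually_elim simp
 then obtain y where y: "0 < y" "eventually (%a. (nn_integral (jm a) (%q. ennreal ((inc g q)^2) * ind (- band y) q)) <= ennreal 1) at0"
  using eventually_happens[of _ "at_right (0::real)"] by (auto simp: trivial_limit_at_right_real)
 show ?thesis
  using y(2) eventually_band_integrable[OF g y(1)] eventually_unit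
 proof eventually_elim
  case (elim a)
  note out = elim(1) and int = elim(2) and a = elim(3)
  let ?A = "nn_integral (jm a) (%q. ennreal (norm (ind (band y) q * (inc g q * inc g q))))"
  let ?B = "nn_integral (jm a) (%q. ennreal ((inc g q)^2) * ind (- band y) q)"
  have "integrable (jm a) (%q. ind (band y) q * (inc g q * inc g q))"
   using int gm bsuppD(2)[OF BS(2)] by blast
  then have "?A < \<infinity>"
   by (simp add: integrable_iff_bounded)
  moreover have "ennreal ((inc g q)^2) = ennreal (norm (ind (band y) q * (inc g q * inc g q))) + ennreal ((inc g q)^2) * ind (- band y) q" for q
   by (cases "q : band y") (simp_all add: power2_eq_square)
  then have "(nn_integral (jm a) (%q. ennreal ((inc g q)^2))) = (nn_integral (jm a) (%q. ennreal (norm (ind (band y) q * (inc g q * inc g q))) + ennreal ((inc g q)^2) * ind (- band y) q))"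
   by (intro nn_integral_cong) blast
  moreover have "... = ?A + ?B"
   by (rule nn_integral_add) measurable
  moreover have "?B < \<infinity>"
   using out by (rule order_le_less_trans) simp
  ultimately have "(nn_integral (jm a) (%q. ennreal ((inc g q)^2))) < \<infinity>" by simp
  then have sq: "sqint (jm a) (inc g)" unfolding sqint_iff_nn by simp
  interpret R: jump_space "m a" "J a" by (rule random_space[OF a])
  have "R.fin g" unfolding R.fin_def using sq bsupp_sq(2)[OF BS(2) a] by simp
  then have "g : R.dom" by (rule R.Cc_dom[OF Cc_inf_Cc[OF g]])
  with sq show ?case by (simp add: R.form_domain_eq)
 qed
qed

section \<open>Kernels truncated to an annulus\<close>

lemma truncated_kernel: "0 < y ==> levy_kernel (%z. nu z * ind (ann y) z)"
proof
 have [measurable]: "(ann y) : sets (borel :: 'a measure)"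
 proof -
  have "{z : space (borel :: 'a measure). y < norm z \<and> norm z < 1 / y} : sets borel" by measurable
  then show ?thesis by simp
 qed
 show "(%z. nu z * ind (ann y) z) : Borel" by measurable
 show "0 <= nu z * ind (ann y) z" for z using nu_nonneg[of z] by simp
 have "(nnint (%z. ennreal (min 1 ((norm z)^2) * (nu z * ind (ann y) z))))
  <= (nnint (%z. ennreal (min 1 ((norm z)^2) * nu z)))"
 proof (rule nn_integral_mono, goal_cases)
  case (1 z)
  show ?case
   using nu_nonneg[of z] by (intro ennreal_leI mult_left_mono) (auto simp: indicator_def)
 qed
 also have "... < \<infinity>" by (rule nu_levy)
 finally show "(nnint (%z. ennreal (min 1 ((norm z)^2) * (nu z * ind (ann y) z)))) < \<infinity>" .
qed

lemma truncated_integral: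
 assumes i: "0 < i" and [measurable]: "F : Borel2"
 shows "(LINT q|jump_measure (%x y. nu (x - y) * ind (ann i) (x - y)). F q)
  = (LINT q|jl. ind (band i) q * (F q :: real))"
proof -
 interpret N: levy_kernel "%z. nu z * ind (ann i) z" by (rule truncated_kernel[OF i])
 have "(LINT q|jl. ind (band i) q * F q) = (LINT q|lborel2. ind (- Id) q * nu (fst q - snd q) / 2 * (ind (band i) q * F q))"
  by (rule jump_measure_integral[OF nu_kernel]) measurable
 also have "... = (LINT q|lborel2. ind (- Id) q * (nu (fst q - snd q) * ind (ann i) (fst q - snd q)) / 2 * F q)"
  by (intro bint_cong refl) (simp add: band_def indicator_def)
 also have "... = (LINT q|jump_measure (%x y. nu (x - y) * ind (ann i) (x - y)). F q)"
  by (rule jump_measure_integral[OF N.kernel, symmetric]) measurable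
 finally show ?thesis ..
qed

lemma truncated_nn_integral:
 assumes i: "0 < i" and [measurable]: "F : Borel2"
 shows "(nn_integral (jump_measure (%x y. nu (x - y) * ind (ann i) (x - y))) (%q. F q))
  = (nn_integral jl (%q. ind (band i) q * F q))"
proof -
 interpret N: levy_kernel "%z. nu z * ind (ann i) z" by (rule truncated_kernel[OF i])
 have "(nn_integral jl (%q. ind (band i) q * F q)) = (nn_integral lborel2 (%q. ennreal (ind (- Id) q * nu (fst q - snd q) / 2) * (ind (band i) q * F q)))"
  by (rule jump_measure_nn_density[OF nu_kernel]) measurable
 also have "... = (nn_integral lborel2 (%q. ennreal (ind (- Id) q * (nu (fst q - snd q) * ind (ann i) (fst q - snd q)) / 2) * F q))"
  by (intro nn_integral_cong) (simp add: band_def indicator_def)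
 also have "... = (nn_integral (jump_measure (%x y. nu (x - y) * ind (ann i) (x - y))) (%q. F q))"
  by (rule jump_measure_nn_density[OF N.kernel, symmetric]) measurable
 finally show ?thesis ..
qed

text \<open>The truncated kernel has finite mass, so square integrability alone gives finite
  truncated energy. Density of test functions thus becomes available for h before its full energy is
  known to be finite. The constant k bounds min(1, |z|^2) from below on the annulus.\<close>

lemma truncated_fin:
 assumes i: "0 < i" and h: "sqint lborel h" and hm [measurable]: "h : Borel"
 shows "jump_space.fin lborel (%x y. nu (x - y) * ind (ann i) (x - y)) h"
proof -
 interpret N: levy_kernel "%z. nu z * ind (ann i) z" by (rule truncated_kernel[OF i])
 define k where "k = min 1 (i^2)"
 have k: "0 < k" using i by (simp add: k_def)
 define H where "H = (nnint (%x. ennreal ((h x)^2)))"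
 have H: "H < \<infinity>" using h unfolding H_def sqint_iff_nn by simp
 have tr: "(nnint (%y. ennreal ((h (y + z) - h y)^2))) <= 4 * H" for z
 proof -
  have "(nnint (%y. ennreal ((h (y + z) - h y)^2))) <= (nnint (%y. 2 * ennreal ((h (z + y))^2) + 2 * ennreal ((h y)^2)))"
  proof (rule nn_integral_mono, goal_cases)
   case (1 y)
   have "0 <= (h (z + y) + h y)^2" by simp
   then have "(h (y + z) - h y)^2 <= 2 * (h (z + y))^2 + 2 * (h y)^2"
    unfolding add.commute[of y z] by (simp add: power2_eq_square algebra_simps)
   then have "ennreal ((h (y + z) - h y)^2) <= ennreal (2 * (h (z + y))^2 + 2 * (h y)^2)" by (rule ennreal_leI)
   also have "... = 2 * ennreal ((h (z + y))^2) + 2 * ennreal ((h y)^2)" by (simp add: ennreal_mult)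
   finally show ?case .
  qed
  also have "... = 2 * (nnint (%y. ennreal ((h (z + y))^2))) + 2 * H"
   unfolding H_def by (subst nn_integral_add) (simp_all add: nn_integral_cmult)
  also have "(nnint (%y. ennreal ((h (z + y))^2))) = H"
   unfolding H_def by (rule nn_integral_lborel_translate) measurable
  also have "2 * H + 2 * H = 4 * H" by (simp add: distrib_right[symmetric])
  finally show ?thesis .
 qed
 have "jump_energy (%x y. nu (x - y) * ind (ann i) (x - y)) h
  = (nnint (%z. N.w z * (nnint (%y. ennreal ((h (y + z) - h y)^2)))))" by (rule N.energy_levy) measurable
 also have "... <= (nnint (%z. ennreal (1 / k) * (N.w z * ennreal (min 1 ((norm z)^2))) * (4 * H)))"
 proof (rule nn_integral_mono, goal_cases)
  case (1 z)
  have "N.w z <= ennreal (1 / k) * (N.w z * ennreal (min 1 ((norm z)^2)))"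
  proof (cases "i < norm z")
   case True
   have "i^2 <= (norm z)^2" using True i by (intro power_mono) auto
   then have "k <= min 1 ((norm z)^2)" unfolding k_def by linarith
   then have "1 <= 1 / k * min 1 ((norm z)^2)" using k by (simp add: pos_le_divide_eq)
   then have "ennreal 1 <= ennreal (1 / k * min 1 ((norm z)^2))" by (rule ennreal_leI)
   also have "... = ennreal (1 / k) * ennreal (min 1 ((norm z)^2))" by (rule ennreal_mult) (use k in simp_all)
   finally have "N.w z * 1 <= N.w z * (ennreal (1 / k) * ennreal (min 1 ((norm z)^2)))" by (intro mult_left_mono) simp_all
   then show ?thesis by (simp add: mult.left_commute)
  next
   case False
   then show ?thesis by (simp add: N.w_def)
  qed
  then show ?case
   using tr[of z] by (rule mult_mono) simp_all
 qed
 also have "... = ennreal (1 / k) * (nnint (%z. N.w z * ennreal (min 1 ((norm z)^2)))) * (4 * H)"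
  by (subst nn_integral_multc) (simp_all add: nn_integral_cmult)
 also have "... < \<infinity>"
  using N.w_levy H by (simp add: ennreal_mult_less_top)
 finally have "jump_energy (%x y. nu (x - y) * ind (ann i) (x - y)) h < \<infinity>" .
 then show ?thesis unfolding N.fin_iff[OF hm] using H unfolding H_def by blast
qed

end

text \<open>The situation along a subsequence provided by (i). The v n stand for bounded versions of
  the random resolvents and h for their local limit, clamped to the same bound so that (iv) accepts
  it.\<close>

locale bounded_energy_sequence = homogenization rh p K nu al C c \<Gamma>
 for rh :: "real => 'a::euclidean_space => real" and p K :: real and nu :: "'a => real" and al C :: real
  and c :: "real => 'a => 'a => real" and \<Gamma> :: "'a set" +
 fixes e :: "nat => real" and v :: "nat => 'a => real" and h :: "'a => real" and b E :: real
 assumes e_unit: "!!n. e n : {0<..1}" and e_lim: "e ~> 0"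
  and v_measurable [measurable]: "!!n. v n : Borel" and v_bound: "!!n x. \<bar>v n x\<bar> <= b"
  and h_measurable [measurable]: "h : Borel" and h_bound: "!!x. \<bar>h x\<bar> <= b"
  and v_jump: "!!n. sqint (jm (e n)) (inc (v n))" and v_sq: "!!n. sqint (m (e n)) (v n)"
  and v_energy: "!!n. (LINT q|jm (e n). (inc (v n) q)^2) <= E" and v_mass: "!!n. (LINT x|m (e n). (v n x)^2) <= E"
  and v_lim: "!!r. 1 < r ==> (%n. set_nnint (ball 0 r) (%x. ennreal \<bar>v n x - h x\<bar>)) ~> 0"
begin

lemma b_nonneg: "0 <= b" using h_bound[of 0] by linarith

lemma E_nonneg: "0 <= E"
 by (rule order_trans[OF bint_nonneg v_mass[of 0]]) simp

lemma sqrt_E: "sqrt E <= E + 1"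
 by (rule real_le_lsqrt) (use E_nonneg in \<open>simp_all add: power2_eq_square algebra_simps\<close>)

lemma e_filter: "filterlim e at0 sequentially"
 by (rule tendsto_imp_filterlim_at_right[OF e_lim]) (use e_unit in auto)

lemmas eventually_e = filterlim_iff[THEN iffD1, OF e_filter, rule_format]

text \<open>On the support of g the products converge in L1 and stay bounded, which is what
  \<open>weak_convergence_variable\<close> asks of a varying test function.\<close>

lemma product_convergence:
 assumes g: "bsupp B L g"
 shows "(%n. LINT x|m (e n). v n x * g x) ~> (LBINT x. h x * g x)"
proof -
 have [measurable]: "g : Borel" by (rule bsuppD(1)[OF g])
 have B: "0 <= B" using bsuppD(2)[OF g, of 0] by linarith
 have vg: "bsupp (B * b) L (%x. v n x * g x)" for n
  using bsupp_mult[OF g v_measurable v_bound] by (simp add: mult.commute)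
 have hg: "bsupp (B * b) L (%x. h x * g x)"
  using bsupp_mult[OF g h_measurable h_bound] by (simp add: mult.commute)
 define r where "r = max 2 (L + 1)"
 have r: "1 < r" "L < r" by (simp_all add: r_def less_max_iff_disj)
 have "(%n. LBINT x. \<bar>v n x * g x - h x * g x\<bar>) ~> 0"
 proof (rule tendsto_0_le[where K="1", OF _ eventuallyI])
  have i: "integrable lborel (%x. \<bar>v n x * g x - h x * g x\<bar>)" for n
   using bsupp_integrable[OF vg[of n]] bsupp_integrable[OF hg] by simp
  have le: "ennreal (LBINT x. \<bar>v n x * g x - h x * g x\<bar>) <= ennreal B * (set_nnint (ball 0 r) (%x. ennreal \<bar>v n x - h x\<bar>))" for n
  proof -
   have "ennreal (LBINT x. \<bar>v n x * g x - h x * g x\<bar>) = (nnint (%x. ennreal \<bar>v n x * g x - h x * g x\<bar>))"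
    by (rule nn_integral_eq_integral[OF i, symmetric]) simp
   also have "... <= (nnint (%x. ennreal B * (ennreal \<bar>v n x - h x\<bar> * ind (ball 0 r) x)))"
   proof (rule nn_integral_mono, goal_cases)
    case (1 x)
    show ?case
    proof (cases "norm x > L")
     case True
     then show ?thesis using bsuppD(3)[OF g True] by simp
    next
     case False
     have "\<bar>v n x * g x - h x * g x\<bar> = \<bar>g x\<bar> * \<bar>v n x - h x\<bar>" by (simp add: abs_mult[symmetric] algebra_simps)
     also have "... <= B * \<bar>v n x - h x\<bar>" using bsuppD(2)[OF g] by (rule mult_right_mono) simp
     finally have "ennreal \<bar>v n x * g x - h x * g x\<bar> <= ennreal (B * \<bar>v n x - h x\<bar>)" by (rule ennreal_leI)
     then show ?thesis using False r B by (simp add: ennreal_mult)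
    qed
   qed
   also have "... = ennreal B * (set_nnint (ball 0 r) (%x. ennreal \<bar>v n x - h x\<bar>))" by (rule nn_integral_cmult) measurable
   finally show ?thesis .
  qed
  let ?A = "%n. ennreal B * (set_nnint (ball 0 r) (%x. ennreal \<bar>v n x - h x\<bar>))"
  have "?A ~> ennreal B * 0"
   by (rule ennreal_tendsto_cmult[OF _ v_lim[OF r(1)]]) simp
  then have lim: "?A ~> 0" by simp
  have "(%n. ennreal (LBINT x. \<bar>v n x * g x - h x * g x\<bar>)) ~> 0"
   by (rule tendsto_sandwich[OF always_eventually always_eventually tendsto_const lim]) (use le in auto)
  then show "(%n. LBINT x. \<bar>v n x * g x - h x * g x\<bar>) ~> 0" by (subst (asm) ennreal_tendsto_0_iff) simp_all
 qed simp
 moreover have "range e \<subseteq> {0<..1}" using e_unit by blast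
 ultimately have "(%n. LBINT x. v n x * g x * rh (e n) x) ~> (LBINT x. h x * g x)"
  by (intro weak_convergence_variable[OF _ e_lim vg hg])
 then show ?thesis by (simp add: m_integral)
qed

text \<open>Only expressions linear in v n pass to the limit, so the square is linearised: 2 v g -
  g^2 <= v^2, with g equal to h on a ball. The ball is then enlarged.\<close>

lemma h_mass: "sqint lborel h" "(LBINT x. (h x)^2) <= E"
proof -
 have loc: "(nnint (%x. ennreal ((h x)^2) * ind (cball 0 (real k)) x)) <= ennreal E" for k :: nat
 proof -
  define g where "g x = h x * ind (cball 0 (real k)) x" for x
  have g: "bsupp b (real k) g"
   unfolding bsupp_def
  proof (intro conjI allI impI)
   show "g : Borel" unfolding g_def by measurable
   show "\<bar>g x\<bar> <= b" for x using h_bound[of x] b_nonneg by (simp add: g_def indicator_def)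
   show "g x = 0" if "real k < norm x" for x using that by (simp add: g_def)
  qed
  have gm [measurable]: "g : Borel" by (rule bsuppD(1)[OF g])
  have fe: "(%n. LINT x|m (e n). (g x)^2) ~> (LBINT x. (g x)^2)"
   using filterlim_compose[OF weak_convergence[OF bsupp_sq(1)[OF g], unfolded homogenized_def] e_filter]
   by (simp add: m_integral)
  have "(%n. 2 * (LINT x|m (e n). v n x * g x) - (LINT x|m (e n). (g x)^2)) ~> 2 * (LBINT x. h x * g x) - (LBINT x. (g x)^2)"
   by (intro tendsto_intros product_convergence[OF g] fe)
  moreover have "2 * (LINT x|m (e n). v n x * g x) - (LINT x|m (e n). (g x)^2) <= E" for n
  proof -
   note gs = bsupp_sq(2)[OF g e_unit[of n]]
   note i = sqint_mult[OF v_sq[of n] gs] sqintD(2)[OF gs] sqintD(2)[OF v_sq[of n]]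
   have "2 * (LINT x|m (e n). v n x * g x) - (LINT x|m (e n). (g x)^2) = (LINT x|m (e n). 2 * (v n x * g x) - (g x)^2)" using i by simp
   also have "... <= (LINT x|m (e n). (v n x)^2)"
   proof (rule integral_mono)
    fix x
    have "0 <= (v n x - g x)^2" by simp
    then show "2 * (v n x * g x) - (g x)^2 <= (v n x)^2" by (simp add: power2_eq_square algebra_simps)
   qed (use i in auto)
   finally show ?thesis using v_mass[of n] by linarith
  qed
  ultimately have "2 * (LBINT x. h x * g x) - (LBINT x. (g x)^2) <= E" by (intro LIMSEQ_le_const2) auto
  moreover have "(%x. h x * g x) = (%x. (g x)^2)" by (simp add: g_def indicator_def power2_eq_square fun_eq_iff)
  ultimately have le: "(LBINT x. (g x)^2) <= E" by simp
  have "(nnint (%x. ennreal ((h x)^2) * ind (cball 0 (real k)) x)) = (nnint (%x. ennreal ((g x)^2)))"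
   by (intro nn_integral_cong) (simp add: g_def indicator_def)
  also have "... = ennreal (LBINT x. (g x)^2)" by (rule nn_integral_sq[OF bsupp_sq(3)[OF g]])
  also have "... <= ennreal E" using le by (rule ennreal_leI)
  finally show ?thesis .
 qed
 have "(nnint (%x. ennreal ((h x)^2))) = (nnint (%x. liminf (%k. ennreal ((h x)^2) * ind (cball 0 (real k)) x)))"
 proof (rule nn_integral_cong, goal_cases)
  case (1 x)
  obtain N :: nat where N: "norm x <= real N" using real_arch_simple by blast
  have "(%k. ennreal ((h x)^2) * ind (cball 0 (real k)) x) ~> ennreal ((h x)^2)"
  proof (rule tendsto_eventually, rule eventually_sequentiallyI[of N], goal_cases)
   case (1 k)
   then have "norm x <= real k" using N by linarith
   then show ?case by simp
  qed
  then show ?case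
   by (intro lim_imp_Liminf[symmetric]) simp_all
 qed
 also have "... <= liminf (%k. nnint (%x. ennreal ((h x)^2) * ind (cball 0 (real k)) x))"
  by (rule nn_integral_liminf) measurable
 also have "... <= ennreal E" by (rule Liminf_le) (use loc in auto)
 finally have fin: "(nnint (%x. ennreal ((h x)^2))) <= ennreal E" .
 then show sq: "sqint lborel h"
  unfolding sqint_iff_nn by (auto intro: order_le_less_trans)
 show "(LBINT x. (h x)^2) <= E" using fin E_nonneg unfolding nn_integral_sq[OF sq] by (simp add: ennreal_le_iff)
qed

text \<open>First v n is exchanged for h: the error is an integral of |v n - h| against the weights
  W and vanishes by (iii). Then (iv) applies to the bounded function h.\<close>

lemma band_cross_convergence:
 assumes g: "g : Cc_inf" and y: "0 < y"
 shows "(%n. LINT q|jm (e n). ind (band y) q * (inc (v n) q * inc g q))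
  ~> (LINT q|jl. ind (band y) q * (inc h q * inc g q))"
proof -
 obtain B S where BS: "0 < S" "bsupp B S g" by (rule Cc_bsupp[OF Cc_inf_Cc[OF g]])
 have [measurable]: "g : Borel" by (rule bsuppD(1)[OF BS(2)])
 define R where "R = max 2 (S + 1 / y + 1)"
 have R: "1 <= R" "S + 1 / y < R" "1 < R" by (simp_all add: R_def less_max_iff_disj)
 define d where "d n x = v n x - h x" for n x
 have [measurable]: "d n : Borel" for n unfolding d_def by measurable
 obtain t where t: "1 < t" "!!R. 1 <= R ==> \<exists>S. eventually (%a. (set_nnint (ball 0 R) (%x. ennreal_powr (W R a x) t)) <= ennreal S) at0"
  by (rule W_moment) blast
 obtain S' where S': "eventually (%a. (set_nnint (ball 0 R) (%x. ennreal_powr (W R a x) t)) <= ennreal S') at0"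
  using t(2)[OF R(1)] by blast
 have dlim: "(%n. set_nnint (ball 0 R) (%x. ennreal \<bar>d n x\<bar> * W R (e n) x)) ~> 0"
 proof (rule weighted_tendsto_zero[OF t(1)])
  show "AE x in lborel. \<bar>d n x\<bar> <= 2 * b" for n
  proof (rule AE_I2)
   fix x show "\<bar>d n x\<bar> <= 2 * b" using v_bound[of n x] h_bound[of x] unfolding d_def by linarith
  qed
  show "eventually (%n. (set_nnint (ball 0 R) (%x. ennreal_powr (W R (e n) x) t)) <= ennreal S') sequentially"
   by (rule eventually_e[OF S'])
  show "(%n. set_nnint (ball 0 R) (%x. ennreal \<bar>d n x\<bar>)) ~> 0" unfolding d_def by (rule v_lim[OF R(3)])
 qed simp_all
 let ?A = "%n. ennreal (2 * B * y powr - be) * (set_nnint (ball 0 R) (%x. ennreal \<bar>d n x\<bar> * W R (e n) x))"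
 have "?A ~> ennreal (2 * B * y powr - be) * 0"
  by (rule ennreal_tendsto_cmult[OF _ dlim]) simp
 then have dlim': "?A ~> 0" by simp
 define I where "I n = (LINT q|jm (e n). ind (band y) q * (inc (v n) q * inc g q))
   - (LINT q|jm (e n). ind (band y) q * (inc h q * inc g q))" for n
 have le: "eventually (%n. ennreal \<bar>I n\<bar> <= ennreal (2 * B * y powr - be) * (set_nnint (ball 0 R) (%x. ennreal \<bar>d n x\<bar> * W R (e n) x))) sequentially"
  using eventually_e[OF eventually_W_finite[OF R(1)]]
 proof eventually_elim
  case Wn: (elim n)
  have iv: "integrable (jm (e n)) (%q. ind (band y) q * (inc (v n) q * inc g q))"
   by (rule band_integrable[OF BS(2) y R(2) Wn v_measurable v_bound])
  have ih: "integrable (jm (e n)) (%q. ind (band y) q * (inc h q * inc g q))"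
   by (rule band_integrable[OF BS(2) y R(2) Wn h_measurable h_bound])
  have "I n = (LINT q|jm (e n). ind (band y) q * (inc (v n) q * inc g q) - ind (band y) q * (inc h q * inc g q))"
   unfolding I_def using iv ih by simp
  then have "ennreal \<bar>I n\<bar> <= (nn_integral (jm (e n)) (%q. ennreal \<bar>ind (band y) q * (inc (v n) q * inc g q) - ind (band y) q * (inc h q * inc g q)\<bar>))"
   using integral_norm_bound_ennreal[OF Bochner_Integration.integrable_diff[OF iv ih]] by simp
  also have "... <= (nn_integral (jm (e n)) (%q. ind (band y) q * ennreal ((\<bar>d n (fst q)\<bar> + \<bar>d n (snd q)\<bar>) * \<bar>inc g q\<bar>)))"
  proof (rule nn_integral_mono, goal_cases)
   case (1 q)
   have "\<bar>inc (v n) q - inc h q\<bar> <= \<bar>d n (fst q)\<bar> + \<bar>d n (snd q)\<bar>" unfolding inc_def d_def by linarith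
   then have "\<bar>inc (v n) q - inc h q\<bar> * \<bar>inc g q\<bar> <= (\<bar>d n (fst q)\<bar> + \<bar>d n (snd q)\<bar>) * \<bar>inc g q\<bar>"
    by (rule mult_right_mono) simp
   then have "\<bar>inc (v n) q * inc g q - inc h q * inc g q\<bar> <= (\<bar>d n (fst q)\<bar> + \<bar>d n (snd q)\<bar>) * \<bar>inc g q\<bar>"
    by (simp only: left_diff_distrib[symmetric] abs_mult)
   then show ?case
    by (cases "q : band y") (simp_all add: ennreal_leI)
  qed
  also have "... <= ennreal (2 * B * y powr - be) * (set_nnint (ball 0 R) (%x. ennreal \<bar>d n x\<bar> * W R (e n) x))"
   by (rule band_weight[of "%x. \<bar>d n x\<bar>", OF _ _ bsuppD(1)[OF BS(2)] bsuppD(2)[OF BS(2)] bsuppD(3)[OF BS(2)] y R(2)]) simp_all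
  finally show ?case .
 qed
 have "(%n. ennreal \<bar>I n\<bar>) ~> 0"
  by (rule tendsto_sandwich[OF always_eventually le tendsto_const dlim']) simp
 then have "(%n. \<bar>I n\<bar>) ~> 0" by (subst (asm) ennreal_tendsto_0_iff) simp_all
 then have "I ~> 0" by (rule tendsto_rabs_zero_cancel)
 moreover have "bounded (range h)" unfolding bounded_iff using h_bound by auto
 then have "(%n. LINT q|jm (e n). ind (band y) q * (inc h q * inc g q))
   ~> (LINT q|jl. ind (band y) q * (inc h q * inc g q))"
  by (intro filterlim_compose[OF band_jump_integral[OF h_measurable _ g y] e_filter])
 ultimately have "(%n. I n + (LINT q|jm (e n). ind (band y) q * (inc h q * inc g q)))
   ~> 0 + (LINT q|jl. ind (band y) q * (inc h q * inc g q))" by (rule tendsto_add)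
 then show ?thesis by (simp add: I_def)
qed

text \<open>Linearisation again: on the band the square of an increment of v n is at least 2 inc v
  inc ph - (inc ph)^2. A smooth ph close to h takes the place of h itself because (iv) requires a
  smooth factor.\<close>

lemma energy_band_lower:
 assumes i: "0 < i" and d: "0 < d"
 shows "integrable jl (%q. ind (band i) q * (inc h q * inc h q))"
  and "eventually (%n. (LINT q|jl. ind (band i) q * (inc h q * inc h q)) - d <= (LINT q|jm (e n). (inc (v n) q)^2)) sequentially"
proof -
 interpret N: levy_kernel "%z. nu z * ind (ann i) z" by (rule truncated_kernel[OF i])
 have Nh: "N.fin h" by (rule truncated_fin[OF i h_mass(1) h_measurable])
 show "integrable jl (%q. ind (band i) q * (inc h q * inc h q))"
 proof (rule integrableI_bounded)
  have "(nn_integral (jump_measure (%x y. nu (x - y) * ind (ann i) (x - y))) (%q. ennreal ((inc h q)^2))) < \<infinity>"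
   using N.finD(2)[OF Nh] unfolding sqint_iff_nn by blast
  then have "(nn_integral jl (%q. ind (band i) q * ennreal ((inc h q)^2))) < \<infinity>"
   by (subst (asm) truncated_nn_integral[OF i]) simp_all
  moreover have "ennreal (norm (ind (band i) q * (inc h q * inc h q))) = ind (band i) q * ennreal ((inc h q)^2)" for q
   by (cases "q : band i") (simp_all add: power2_eq_square)
  ultimately show "(nn_integral jl (%q. ennreal (norm (ind (band i) q * (inc h q * inc h q))))) < \<infinity>" by simp
 qed measurable
 define D where "D f g = (LINT q|jl. ind (band i) q * (inc f q * inc g q))" for f g
 define Dn where "Dn n f g = (LINT q|jm (e n). ind (band i) q * (inc f q * inc g q))" for n f g
 have ND: "N.Q 0 f g = D f g" if "N.fin f" "N.fin g" for f g
 proof -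
  have [measurable]: "f : Borel" "g : Borel" using that by (auto dest: N.finD)
  show ?thesis unfolding N.Q_eq[OF that] D_def by (simp add: truncated_integral[OF i])
 qed
 have d2: "0 < d / 2" using d by simp
 obtain ph where ph: "ph : Cc_inf" "N.fin ph" "N.QQ 1 (%x. ph x - h x) < d / 2"
  by (rule N.Cc_inf_dense[OF Nh h_bound d2])
 have "N.QQ 0 (%x. ph x - h x) <= 1 * N.QQ 1 (%x. ph x - h x)"
  by (rule N.Q_mono[OF N.fin_diff[OF ph(2) Nh]]) simp_all
 moreover have "N.QQ 0 (%x. ph x - h x) = D ph ph - 2 * D ph h + D h h"
  using N.Q_expand[OF ph(2) Nh, of 0 "-1"] by (simp add: ND ph(2) Nh)
 \<comment> \<open>Expanding the square: the linearised expression at ph misses the band energy of h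
   only by that of ph - h.\<close>
 ultimately have lower: "D h h - d < 2 * D h ph - D ph ph"
  using ph(3) d by (simp add: D_def mult.commute)
 have phm [measurable]: "ph : Borel" by (rule N.finD(1)[OF ph(2)])
 obtain B S where BS: "0 < S" "bsupp B S ph" by (rule Cc_bsupp[OF Cc_inf_Cc[OF ph(1)]])
 have "bounded (range ph)" unfolding bounded_iff using bsuppD(2)[OF BS(2)] by auto
 then have "(%n. Dn n ph ph) ~> D ph ph"
  unfolding D_def Dn_def by (intro filterlim_compose[OF band_jump_integral[OF phm _ ph(1) i] e_filter])
 moreover have "(%n. Dn n (v n) ph) ~> D h ph" unfolding D_def Dn_def by (rule band_cross_convergence[OF ph(1) i])
 ultimately have "(%n. 2 * Dn n (v n) ph - Dn n ph ph) ~> 2 * D h ph - D ph ph" by (intro tendsto_intros)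
 then have "eventually (%n. D h h - d < 2 * Dn n (v n) ph - Dn n ph ph) sequentially" using lower by (rule order_tendstoD(1))
 then have "eventually (%n. D h h - d <= (LINT q|jm (e n). (inc (v n) q)^2)) sequentially"
  using eventually_e[OF eventually_band_integrable[OF ph(1) i]]
 proof eventually_elim
  case (elim n)
  note lt = elim(1) and int = elim(2)
  have i1: "integrable (jm (e n)) (%q. ind (band i) q * (inc (v n) q * inc ph q))"
   using int v_measurable v_bound by blast
  have i2: "integrable (jm (e n)) (%q. ind (band i) q * (inc ph q * inc ph q))"
   using int phm bsuppD(2)[OF BS(2)] by blast
  have "2 * Dn n (v n) ph - Dn n ph ph = (LINT q|jm (e n). 2 * (ind (band i) q * (inc (v n) q * inc ph q)) - ind (band i) q * (inc ph q * inc ph q))"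
   unfolding Dn_def using i1 i2 by simp
  also have "... <= (LINT q|jm (e n). (inc (v n) q)^2)"
  proof (rule integral_mono)
   fix q
   have "0 <= (inc (v n) q - inc ph q)^2" by simp
   then have "2 * (inc (v n) q * inc ph q) - inc ph q * inc ph q <= (inc (v n) q)^2"
    by (simp add: power2_eq_square algebra_simps)
   then show "2 * (ind (band i) q * (inc (v n) q * inc ph q)) - ind (band i) q * (inc ph q * inc ph q) <= (inc (v n) q)^2"
    by (cases "q : band i") simp_all
  qed (use i1 i2 sqintD(2)[OF v_jump[of n]] in auto)
  finally show ?case using lt by linarith
 qed
 then show "eventually (%n. (LINT q|jl. ind (band i) q * (inc h q * inc h q)) - d <= (LINT q|jm (e n). (inc (v n) q)^2)) sequentially"
  unfolding D_def .
qed

definition scale :: "nat => real" where "scale k = 1 / real (Suc k)"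

lemma scale_pos: "0 < scale k" by (simp add: scale_def)

lemma scale_filter: "filterlim scale at0 sequentially"
proof (rule tendsto_imp_filterlim_at_right)
 show "scale ~> 0" unfolding scale_def[abs_def] by (rule LIMSEQ_Suc[OF lim_1_over_n])
qed (simp add: scale_pos always_eventually)

lemma eventually_band:
 assumes "q \<notin> Id"
 shows "eventually (%k. q : band (scale k)) sequentially"
proof -
 have "0 < norm (fst q - snd q)" using assms by (cases q) auto
 then have "eventually (%k. scale k < norm (fst q - snd q)) sequentially"
  using scale_filter by (auto simp: filterlim_at intro: order_tendstoD(2))
 moreover obtain N :: nat where N: "norm (fst q - snd q) < real N" using reals_Archimedean2 by blast
 have "eventually (%k. norm (fst q - snd q) < 1 / scale k) sequentially"
 proof (rule eventually_sequentiallyI[of N], goal_cases)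
  case (1 k)
  then have "real N <= 1 / scale k" by (simp add: scale_def)
  then show ?case using N by linarith
 qed
 ultimately show ?thesis by eventually_elim (simp add: band_def)
qed

lemma band_limit:
 assumes F: "!!q. q : Id ==> F q = (0::real)"
 shows "(%k. ind (band (scale k)) q * F q) ~> F q"
proof (cases "q : Id")
 case True
 then show ?thesis by (simp add: F)
next
 case False
 show ?thesis by (rule tendsto_eventually, use eventually_band[OF False] in eventually_elim) simp
qed

lemma increment_Id: "q : Id ==> inc f q = 0"
 by (auto simp: inc_def)

text \<open>Every band energy is at most E, and the bands exhaust the complement of the diagonal;
  Fatou concludes.\<close>

lemma h_fin: "fin h"
proof -
 have le: "(LINT q|jl. ind (band (scale k)) q * (inc h q * inc h q)) <= E" for k
 proof (rule field_le_epsilon, goal_cases)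
  case (1 d)
  from energy_band_lower(2)[OF scale_pos[of k] this] obtain n where
   "(LINT q|jl. ind (band (scale k)) q * (inc h q * inc h q)) - d <= (LINT q|jm (e n). (inc (v n) q)^2)"
   by (auto simp: eventually_sequentially)
  then show ?case using v_energy[of n] by linarith
 qed
 have nn: "(nn_integral jl (%q. ennreal (ind (band (scale k)) q * (inc h q * inc h q)))) <= ennreal E" for k
 proof -
  have "(nn_integral jl (%q. ennreal (ind (band (scale k)) q * (inc h q * inc h q))))
   = ennreal (LINT q|jl. ind (band (scale k)) q * (inc h q * inc h q))"
   by (rule nn_integral_eq_integral[OF energy_band_lower(1)[OF scale_pos zero_less_one]]) simp
  then show ?thesis using le[of k] by (simp add: ennreal_leI)
 qed
 have "(nn_integral jl (%q. ennreal ((inc h q)^2))) = (nn_integral jl (%q. liminf (%k. ennreal (ind (band (scale k)) q * (inc h q * inc h q)))))"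
 proof (rule nn_integral_cong, goal_cases)
  case (1 q)
  have "(%k. ind (band (scale k)) q * (inc h q * inc h q)) ~> inc h q * inc h q"
   by (rule band_limit) (simp add: increment_Id)
  then have "(%k. ennreal (ind (band (scale k)) q * (inc h q * inc h q))) ~> ennreal ((inc h q)^2)"
   unfolding power2_eq_square by (rule tendsto_ennrealI)
  then show ?case
   by (intro lim_imp_Liminf[symmetric]) simp_all
 qed
 also have "... <= liminf (%k. nn_integral jl (%q. ennreal (ind (band (scale k)) q * (inc h q * inc h q))))"
  by (rule nn_integral_liminf) measurable
 also have "... <= ennreal E" by (rule Liminf_le) (use nn in auto)
 finally have "(nn_integral jl (%q. ennreal ((inc h q)^2))) < \<infinity>" by (rule order_le_less_trans) simp
 then have "sqint jl (inc h)" unfolding sqint_iff_nn by simp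
 then show ?thesis unfolding fin_def using h_mass(1) by simp
qed

lemma band_integral_limit:
 assumes g: "fin g"
 shows "(%k. LINT q|jl. ind (band (scale k)) q * (inc h q * inc g q)) ~> (LINT q|jl. inc h q * inc g q)"
proof (rule integral_dominated_convergence[where w="%q. \<bar>inc h q * inc g q\<bar>"])
 have [measurable]: "g : Borel" by (rule finD(1)[OF g])
 show "(%q. inc h q * inc g q) : borel_measurable jl"
  "(%q. ind (band (scale k)) q * (inc h q * inc g q)) : borel_measurable jl" for k by measurable
 show "integrable jl (%q. \<bar>inc h q * inc g q\<bar>)"
  using sqint_mult[OF finD(2)[OF h_fin] finD(2)[OF g]] by simp
 show "AE q in jl. (%k. ind (band (scale k)) q * (inc h q * inc g q)) ~> inc h q * inc g q"
  by (rule AE_I2) (rule band_limit, simp add: increment_Id)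
 show "AE q in jl. norm (ind (band (scale k)) q * (inc h q * inc g q)) <= \<bar>inc h q * inc g q\<bar>" for k
  by (rule AE_I2) (simp add: indicator_def)
qed

lemma energy_lower:
 assumes d: "0 < d"
 shows "eventually (%n. QQ 0 h - d <= (LINT q|jm (e n). (inc (v n) q)^2)) sequentially"
proof -
 have d2: "0 < d / 2" using d by simp
 have "QQ 0 h = (LINT q|jl. inc h q * inc h q)" by (simp add: Q_eq[OF h_fin h_fin])
 then have "eventually (%k. QQ 0 h - d / 2 < (LINT q|jl. ind (band (scale k)) q * (inc h q * inc h q))) sequentially"
  using d2 by (intro order_tendstoD(1)[OF band_integral_limit[OF h_fin]]) simp
 then obtain k where k: "QQ 0 h - d / 2 < (LINT q|jl. ind (band (scale k)) q * (inc h q * inc h q))"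
  by (auto simp: eventually_sequentially)
 from energy_band_lower(2)[OF scale_pos[of k] d2] show ?thesis
 proof eventually_elim
  case (elim n)
  then show ?case using k by linarith
 qed
qed

text \<open>On a band this is \<open>band_cross_convergence\<close>. Off it, Cauchy-Schwarz pairs
  the energy bound E of v n with the small energy of g from (ii).\<close>

lemma form_convergence:
 assumes g: "g : Cc_inf"
 shows "(%n. LINT q|jm (e n). inc (v n) q * inc g q) ~> Q 0 h g"
proof (rule tendstoI, goal_cases)
 case r: (1 r)
 have gf: "fin g" by (rule dom_fin[OF Cc_inf_dom[OF g]])
 have [measurable]: "g : Borel" by (rule finD(1)[OF gf])
 \<comment> \<open>Gives sqrt E sqrt d <= r/3 through sqrt E <= E + 1, which avoids dividing by E =
   0.\<close>
 define d where "d = (r / (3 * (E + 1)))^2"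
 have E1: "0 < E + 1" using E_nonneg by linarith
 have d: "0 < d" unfolding d_def using r E1 by simp
 have small: "sqrt E * sqrt d <= r / 3"
 proof -
  note sqrt_E
  moreover have "sqrt d = r / (3 * (E + 1))" unfolding d_def using r E1 by simp
  moreover have "(E + 1) * (r / (3 * (E + 1))) = r / 3" using E1 by (simp add: field_simps)
  moreover have "0 <= r / (3 * (E + 1))" using r E1 by simp
  ultimately show ?thesis using mult_right_mono[of "sqrt E" "E + 1" "r / (3 * (E + 1))"] by (simp only:)
 qed
 let ?A = "LINT q|jl. inc h q * inc g q"
 have "eventually (%k. eventually (%a. (nn_integral (jm a) (%q. ennreal ((inc g q)^2) * ind (- band (scale k)) q)) <= ennreal d) at0) sequentially"
  using filterlim_iff[THEN iffD1, OF scale_filter, rule_format, OF outside_band[OF g d]] .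
 moreover have "eventually (%k. dist (LINT q|jl. ind (band (scale k)) q * (inc h q * inc g q)) ?A < r / 3) sequentially"
  using r by (intro tendstoD[OF band_integral_limit[OF gf]]) simp
 ultimately have "eventually (%k. eventually (%a. (nn_integral (jm a) (%q. ennreal ((inc g q)^2) * ind (- band (scale k)) q)) <= ennreal d) at0
  \<and> dist (LINT q|jl. ind (band (scale k)) q * (inc h q * inc g q)) ?A < r / 3) sequentially"
  by (rule eventually_conj)
 then obtain k where k: "eventually (%a. (nn_integral (jm a) (%q. ennreal ((inc g q)^2) * ind (- band (scale k)) q)) <= ennreal d) at0"
  "dist (LINT q|jl. ind (band (scale k)) q * (inc h q * inc g q)) ?A < r / 3"
  by (auto simp: eventually_sequentially)
 have r3: "0 < r / 3" using r by simp
 show ?case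
  using eventually_e[OF k(1)] eventually_e[OF eventually_test_function[OF g]] tendstoD[OF band_cross_convergence[OF g scale_pos[of k]] r3]
 proof eventually_elim
  case (elim n)
  note out = elim(1) and gs = elim(2) and cl = elim(3)
  define z where "z q = ind (- band (scale k)) q * inc g q" for q
  have om [measurable]: "z : Borel2" unfolding z_def by measurable
  have osq: "sqint (jm (e n)) z"
   by (rule sqint_bound[OF conjunct1[OF gs]]) (auto simp: z_def indicator_def)
  have "(nn_integral (jm (e n)) (%q. ennreal ((z q)^2))) <= ennreal d"
   using out by (subst nn_integral_cong[of _ _ "%q. ennreal ((inc g q)^2) * ind (- band (scale k)) q"]) (auto simp: z_def indicator_def)
  then have oI: "(LINT q|jm (e n). (z q)^2) <= d" unfolding nn_integral_sq[OF osq] using d by (simp add: ennreal_le_iff)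
  have vg: "integrable (jm (e n)) (%q. inc (v n) q * inc g q)" by (rule sqint_mult[OF v_jump conjunct1[OF gs]])
  have vo: "integrable (jm (e n)) (%q. inc (v n) q * z q)" by (rule sqint_mult[OF v_jump osq])
  have split: "ind (band (scale k)) q * (inc (v n) q * inc g q) = inc (v n) q * inc g q - inc (v n) q * z q" for q
   by (simp add: z_def indicator_def)
  have "(LINT q|jm (e n). ind (band (scale k)) q * (inc (v n) q * inc g q))
   = (LINT q|jm (e n). inc (v n) q * inc g q) - (LINT q|jm (e n). inc (v n) q * z q)"
   unfolding split using vg vo by simp
  moreover have "\<bar>LINT q|jm (e n). inc (v n) q * z q\<bar> <= r / 3"
  proof -
   have "\<bar>LINT q|jm (e n). inc (v n) q * z q\<bar> <= sqrt (LINT q|jm (e n). (inc (v n) q)^2) * sqrt (LINT q|jm (e n). (z q)^2)"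
    by (rule Cauchy_Schwarz_integral[OF v_jump osq])
   also have "... <= sqrt E * sqrt d"
    using v_energy[of n] oI E_nonneg by (intro mult_mono real_sqrt_le_mono) (auto intro!: bint_nonneg)
   finally show ?thesis using small by linarith
  qed
  moreover have "Q 0 h g = ?A" by (simp add: Q_eq[OF h_fin gf])
  ultimately show ?case
   using cl k(2) unfolding dist_real_def by linarith
 qed
qed

end

section \<open>Decaying functions under the random measures\<close>

context homogenization
begin

lemma rho_bound:
 assumes v: "bsupp A L v" and a: "a : {0<..1}" and L: "1 <= L"
 shows "\<bar>LINT x|m a. v x\<bar> <= A * (K * L ^ DIM('a))"
proof -
 have [measurable]: "v : Borel" by (rule bsuppD(1)[OF v])
 have A: "0 <= A" using bsuppD(2)[OF v, of 0] by linarith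
 have KL: "0 <= K * L ^ DIM('a)" using K_nonneg L by simp
 have "ennreal \<bar>LINT x|m a. v x\<bar> <= (nn_integral (m a) (%x. ennreal \<bar>v x\<bar>))"
  using integral_norm_bound_ennreal[OF bsupp_m_integrable[OF v a]] by simp
 also have "... = (nnint (%x. ennreal (rh a x) * ennreal \<bar>v x\<bar>))" by (rule nn_integral_density) simp_all
 also have "... <= (nnint (%x. ennreal A * (ennreal (rh a x) * ind (cball 0 L) x)))"
 proof (rule nn_integral_mono, goal_cases)
  case (1 x)
  show ?case
  proof (cases "norm x > L")
   case True
   then show ?thesis using bsuppD(3)[OF v True] by simp
  next
   case False
   have "ennreal (rh a x) * ennreal \<bar>v x\<bar> <= ennreal (rh a x) * ennreal A"
    using bsuppD(2)[OF v] by (intro mult_left_mono ennreal_leI) simp_all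
   then show ?thesis using False by (simp add: mult.commute)
  qed
 qed
 also have "... = ennreal A * (set_nnint (cball 0 L) (%x. ennreal (rh a x)))" by (rule nn_integral_cmult) measurable
 also have "... <= ennreal A * ennreal (K * L ^ DIM('a))" by (intro mult_left_mono rho_mass a L) simp
 also have "... = ennreal (A * (K * L ^ DIM('a)))" by (rule ennreal_mult[symmetric, OF A KL])
 finally show ?thesis using A KL by (simp add: ennreal_le_iff)
qed

text \<open>A decaying u splits into a bounded, compactly supported part, where weak convergence
  applies, and a remainder that is uniformly small in all the spaces L2(m a). The radius is the
  larger of one for the Lebesgue mass and one from \<open>rho_tail\<close>.\<close>

lemma decay_decomposition:
 assumes um [measurable]: "u : Borel" and ub: "!!x. \<bar>u x\<bar> <= b"
  and D: "0 <= D" "AE x in lborel. \<bar>u x\<bar> <= D * bump be x" and d: "0 < d"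
 obtains k :: nat where "bsupp b (2 ^ k) (%x. u x * ind (cball 0 (2 ^ k)) x)"
  "(LBINT x. (u x)^2) - d <= (LBINT x. (u x * ind (cball 0 (2 ^ k)) x)^2)"
  "(LBINT x. (u x * ind (cball 0 (2 ^ k)) x)^2) <= (LBINT x. (u x)^2)"
  "!!a. a : {0<..1} ==> sqint (m a) (%x. u x * ind (- cball 0 (2 ^ k)) x)"
  "!!a. a : {0<..1} ==> (LINT x|m a. (u x * ind (- cball 0 (2 ^ k)) x)^2) <= d"
  "sqint lborel u"
proof -
 have b: "0 <= b" using ub[of 0] by linarith
 have usq: "sqint lborel u"
  by (rule sqint_bound[OF sqint_cmult[OF bump_sqint, of D]], simp, use D(2) in eventually_elim)
   (use D(1) bump_pos(2) in \<open>simp add: abs_of_nonneg\<close>)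
 define T where "T k x = u x * ind (cball 0 (2 ^ k)) x" for k x
 have [measurable]: "T k : Borel" for k unfolding T_def by measurable
 have "(%k. LBINT x. (T k x)^2) ~> (LBINT x. (u x)^2)"
 proof (rule integral_dominated_convergence[where w="%x. (u x)^2"])
  show "AE x in lborel. (%k. (T k x)^2) ~> (u x)^2"
  proof (rule AE_I2)
   fix x :: 'a
   obtain N :: nat where N: "norm x < real N" using reals_Archimedean2 by blast
   show "(%k. (T k x)^2) ~> (u x)^2"
   proof (rule tendsto_eventually, rule eventually_sequentiallyI[of N], goal_cases)
    case (1 k)
    then have "norm x <= real k" using N by linarith
    also have "real k <= 2 ^ k" using of_nat_less_two_power[of k, where 'a=real] by simp
    finally show ?case by (simp add: T_def)
   qed
  qed
  show "AE x in lborel. norm ((T k x)^2) <= (u x)^2" for k by (rule AE_I2) (simp add: T_def indicator_def)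
 qed (use usq in auto)
 then have "eventually (%k. (LBINT x. (u x)^2) - d < (LBINT x. (T k x)^2)) sequentially"
  by (rule order_tendstoD(1)) (use d in simp)
 then obtain N where N: "!!k. N <= k ==> (LBINT x. (u x)^2) - d < (LBINT x. (T k x)^2)" by (auto simp: eventually_sequentially)
 have dim: "real DIM('a) < 2 * be"
 proof -
  have "x < 2 * (x + y)" if "0 < x" "0 < y" for x y :: real unfolding mult_2 using that by linarith
  then show ?thesis unfolding be_def using alpha(1) by simp
 qed
 obtain l where l: "!!a. a : {0<..1} ==> (set_nnint {x. 2 ^ l < norm x} (%x. ennreal ((u x)^2 * rh a x))) <= ennreal d"
  by (rule rho_tail[OF dim D um d]) blast
 define k where "k = max N l"
 define O' where "O' x = u x * ind (- cball 0 (2 ^ k)) x" for x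
 have Om [measurable]: "O' : Borel" unfolding O'_def by measurable
 have tail: "(nn_integral (m a) (%x. ennreal ((O' x)^2))) <= ennreal d" if a: "a : {0<..1}" for a
 proof -
  have "(nn_integral (m a) (%x. ennreal ((O' x)^2))) = (nnint (%x. ennreal (rh a x) * ennreal ((O' x)^2)))" by (rule nn_integral_density) simp_all
  also have "... <= (set_nnint {x. 2 ^ l < norm x} (%x. ennreal ((u x)^2 * rh a x)))"
  proof (rule nn_integral_mono, goal_cases)
   case (1 x)
   show ?case
   proof (cases "norm x <= 2 ^ k")
    case True
    then show ?thesis by (simp add: O'_def)
   next
    case False
    have "(2::real) ^ l <= 2 ^ k" by (rule power_increasing) (simp_all add: k_def)
    then have "2 ^ l < norm x" using False by linarith
    then show ?thesis using False rho_nonneg[of a x] by (simp add: O'_def ennreal_mult mult.commute)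
   qed
  qed
  also have "... <= ennreal d" by (rule l[OF a])
  finally show ?thesis .
 qed
 have Osq: "sqint (m a) O'" if "a : {0<..1}" for a
  unfolding sqint_iff_nn using order_le_less_trans[OF tail[OF that]] by simp
 show thesis
 proof (rule that[of k])
  show "bsupp b (2 ^ k) (%x. u x * ind (cball 0 (2 ^ k)) x)"
   unfolding bsupp_def
  proof (intro conjI allI impI)
   show "(%x. u x * ind (cball 0 (2 ^ k)) x) : Borel" by measurable
   show "\<bar>u x * ind (cball 0 (2 ^ k)) x\<bar> <= b" for x using ub[of x] b by (simp add: indicator_def)
   show "u x * ind (cball 0 (2 ^ k)) x = 0" if "norm x > 2 ^ k" for x using that by simp
  qed
  show "(LBINT x. (u x)^2) - d <= (LBINT x. (u x * ind (cball 0 (2 ^ k)) x)^2)"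
   using N[of k] unfolding T_def k_def by simp
  show "(LBINT x. (u x * ind (cball 0 (2 ^ k)) x)^2) <= (LBINT x. (u x)^2)"
  proof (rule integral_mono_AE')
   show "integrable lborel (%x. (u x)^2)" by (rule sqintD(2)[OF usq])
  qed (auto simp: indicator_def)
  show "sqint (m a) (%x. u x * ind (- cball 0 (2 ^ k)) x)" if "a : {0<..1}" for a
   using Osq[OF that] unfolding O'_def .
  show "(LINT x|m a. (u x * ind (- cball 0 (2 ^ k)) x)^2) <= d" if "a : {0<..1}" for a
   using tail[OF that] d unfolding nn_integral_sq[OF Osq[OF that]] unfolding O'_def by (simp add: ennreal_le_iff)
  show "sqint lborel u" by (rule usq)
 qed
qed

lemma decay_sqint:
 assumes um [measurable]: "u : Borel" and ub: "!!x. \<bar>u x\<bar> <= b"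
  and D: "0 <= D" "AE x in lborel. \<bar>u x\<bar> <= D * bump be x" and a: "a : {0<..1}"
 shows "sqint (m a) u"
proof -
 obtain k where k: "bsupp b (2 ^ k) (%x. u x * ind (cball 0 (2 ^ k)) x)"
  "!!a. a : {0<..1} ==> sqint (m a) (%x. u x * ind (- cball 0 (2 ^ k)) x)"
  by (rule decay_decomposition[OF um ub D zero_less_one]) blast
 have "(%x. u x * ind (cball 0 (2 ^ k)) x + u x * ind (- cball 0 (2 ^ k)) x) = u"
  by (simp add: indicator_def fun_eq_iff)
 with sqint_add[OF bsupp_sq(2)[OF k(1) a] k(2)[OF a]] show ?thesis by simp
qed

text \<open>The squares of the two parts add up since their supports are disjoint; weak convergence
  handles the inner one and the outer one is uniformly small.\<close>

lemma decay_mass_convergence: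
 assumes um [measurable]: "u : Borel" and ub: "!!x. \<bar>u x\<bar> <= b"
  and D: "0 <= D" "AE x in lborel. \<bar>u x\<bar> <= D * bump be x"
 shows "((%a. LINT x|m a. (u x)^2) \<longlongrightarrow> (LBINT x. (u x)^2)) at0"
proof (rule tendstoI, goal_cases)
 case r: (1 r)
 then have r3: "0 < r / 3" by simp
 obtain k where k: "bsupp b (2 ^ k) (%x. u x * ind (cball 0 (2 ^ k)) x)"
  "(LBINT x. (u x)^2) - r / 3 <= (LBINT x. (u x * ind (cball 0 (2 ^ k)) x)^2)"
  "(LBINT x. (u x * ind (cball 0 (2 ^ k)) x)^2) <= (LBINT x. (u x)^2)"
  "!!a. a : {0<..1} ==> sqint (m a) (%x. u x * ind (- cball 0 (2 ^ k)) x)"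
  "!!a. a : {0<..1} ==> (LINT x|m a. (u x * ind (- cball 0 (2 ^ k)) x)^2) <= r / 3"
  by (rule decay_decomposition[OF um ub D r3]) blast
 define T where "T x = u x * ind (cball 0 (2 ^ k)) x" for x
 define O' where "O' x = u x * ind (- cball 0 (2 ^ k)) x" for x
 note k = k[folded T_def O'_def]
 have [measurable]: "T : Borel" by (rule bsuppD(1)[OF k(1)])
 have "((%a. LINT x|m a. (T x)^2) \<longlongrightarrow> (LBINT x. (T x)^2)) at0"
  using weak_convergence[OF bsupp_sq(1)[OF k(1)]] by (simp add: homogenized_def m_integral)
 from tendstoD[OF this r3] eventually_unit
 show ?case
 proof eventually_elim
  case (elim a)
  note cl = elim(1) and a = elim(2)
  have "(u x)^2 = (T x)^2 + (O' x)^2" for x by (simp add: T_def O'_def indicator_def)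
  then have "(LINT x|m a. (u x)^2) = (LINT x|m a. (T x)^2) + (LINT x|m a. (O' x)^2)"
   using sqintD(2)[OF bsupp_sq(2)[OF k(1) a]] sqintD(2)[OF k(4)[OF a]] by simp
  moreover have "0 <= (LINT x|m a. (O' x)^2)" by simp
  ultimately show ?case
   using cl k(2,3) k(5)[OF a] unfolding dist_real_def by linarith
 qed
qed

end

section \<open>Identification of the limit and strong convergence\<close>

context bounded_energy_sequence
begin

text \<open>Since u may have unbounded support, \<open>product_convergence\<close> covers its inner
  part only; Cauchy-Schwarz with the mass bound E of v n handles the remainder.\<close>

lemma decay_product_convergence:
 assumes um [measurable]: "u : Borel" and ub: "!!x. \<bar>u x\<bar> <= b"
  and D: "0 <= D" "AE x in lborel. \<bar>u x\<bar> <= D * bump be x" and hu: "AE x in lborel. h x = u x"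
 shows "(%n. LINT x|m (e n). v n x * u x) ~> (LBINT x. (u x)^2)"
proof (rule tendstoI, goal_cases)
 case r: (1 r)
 define d where "d = min (r / 3) ((r / (3 * (E + 1)))^2)"
 have E1: "0 < E + 1" using E_nonneg by linarith
 have d: "0 < d" unfolding d_def using r E1 by simp
 have small: "sqrt E * sqrt d <= r / 3"
 proof -
  note sqrt_E
  moreover have "sqrt d <= r / (3 * (E + 1))"
   by (rule real_le_lsqrt) (use r E1 in \<open>simp_all add: d_def\<close>)
  ultimately have "sqrt E * sqrt d <= (E + 1) * (r / (3 * (E + 1)))" using E1 d by (intro mult_mono) auto
  moreover have "(E + 1) * (r / (3 * (E + 1))) = r / 3" using E1 by (simp add: field_simps)
  ultimately show ?thesis by (simp only:)
 qed
 obtain k where k: "bsupp b (2 ^ k) (%x. u x * ind (cball 0 (2 ^ k)) x)"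
  "(LBINT x. (u x)^2) - d <= (LBINT x. (u x * ind (cball 0 (2 ^ k)) x)^2)"
  "(LBINT x. (u x * ind (cball 0 (2 ^ k)) x)^2) <= (LBINT x. (u x)^2)"
  "!!a. a : {0<..1} ==> sqint (m a) (%x. u x * ind (- cball 0 (2 ^ k)) x)"
  "!!a. a : {0<..1} ==> (LINT x|m a. (u x * ind (- cball 0 (2 ^ k)) x)^2) <= d"
  by (rule decay_decomposition[OF um ub D d]) blast
 define T where "T x = u x * ind (cball 0 (2 ^ k)) x" for x
 define O' where "O' x = u x * ind (- cball 0 (2 ^ k)) x" for x
 note k = k[folded T_def O'_def]
 have [measurable]: "T : Borel" by (rule bsuppD(1)[OF k(1)])
 have hT: "(LBINT x. h x * T x) = (LBINT x. (T x)^2)"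
 proof (rule integral_cong_AE)
  show "AE x in lborel. h x * T x = (T x)^2"
   using hu by eventually_elim (simp add: T_def indicator_def power2_eq_square)
 qed measurable
 have r3: "0 < r / 3" using r by simp
 have dr: "d <= r / 3" by (simp add: d_def)
 from tendstoD[OF product_convergence[OF k(1)] r3]
 show ?case
 proof eventually_elim
  case cl: (elim n)
  have "v n x * u x = v n x * T x + v n x * O' x" for x by (simp add: T_def O'_def indicator_def)
  then have "(LINT x|m (e n). v n x * u x) = (LINT x|m (e n). v n x * T x) + (LINT x|m (e n). v n x * O' x)"
   using sqint_mult[OF v_sq bsupp_sq(2)[OF k(1) e_unit]] sqint_mult[OF v_sq k(4)[OF e_unit]] by simp
  moreover have "\<bar>LINT x|m (e n). v n x * O' x\<bar> <= r / 3"
  proof -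
   have "\<bar>LINT x|m (e n). v n x * O' x\<bar> <= sqrt (LINT x|m (e n). (v n x)^2) * sqrt (LINT x|m (e n). (O' x)^2)"
    by (rule Cauchy_Schwarz_integral[OF v_sq k(4)[OF e_unit]])
   also have "... <= sqrt E * sqrt d"
    using v_mass[of n] k(5)[OF e_unit[of n]] E_nonneg by (intro mult_mono real_sqrt_le_mono) (auto intro!: bint_nonneg)
   finally show ?thesis using small by linarith
  qed
  ultimately show ?case
   using cl k(2,3) dr unfolding dist_real_def hT by linarith
 qed
qed

text \<open>The limit equation holds against test functions; it extends to the difference of the two
 solutions because that difference is bounded and of finite energy.\<close>

lemma limit_is_resolvent:
 assumes f: "bsupp F S f" and l: "0 < l"
  and eq: "!!n g. g : form_domain (m (e n)) (J (e n)) ==>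
   jump_form (J (e n)) (v n) g + l * (LINT x|m (e n). v n x * g x) = (LINT x|m (e n). f x * g x)"
  and u: "is_resolvent lborel (%x y. nu (x - y)) l f u" and ub: "!!x. \<bar>u x\<bar> <= b"
 shows "AE x in lborel. h x = u x"
proof -
 have ud: "u : dom" by (rule is_resolventD(1)[OF u])
 have uf: "fin u" by (rule dom_fin[OF ud])
 have weak: "Q l h g = (LBINT x. f x * g x)" if g: "g : Cc_inf" for g
 proof -
  have gf: "fin g" by (rule dom_fin[OF Cc_inf_dom[OF g]])
  have gm [measurable]: "g : Borel" by (rule finD(1)[OF gf])
  have fm [measurable]: "f : Borel" by (rule bsuppD(1)[OF f])
  obtain B L where BL: "0 < L" "bsupp B L g" by (rule Cc_bsupp[OF Cc_inf_Cc[OF g]])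
  have fg: "bsupp (F * B) S (%x. f x * g x)" by (rule bsupp_mult[OF f gm bsuppD(2)[OF BL(2)]])
  have rhs: "(%n. LINT x|m (e n). f x * g x) ~> (LBINT x. f x * g x)"
   using filterlim_compose[OF weak_convergence[OF fg, unfolded homogenized_def] e_filter] by (simp add: m_integral)
  have lhs: "(%n. (LINT q|jm (e n). inc (v n) q * inc g q) + l * (LINT x|m (e n). v n x * g x)) ~> Q 0 h g + l * (LBINT x. h x * g x)"
   by (intro tendsto_intros form_convergence[OF g] product_convergence[OF BL(2)])
  have "eventually (%n. (LINT q|jm (e n). inc (v n) q * inc g q) + l * (LINT x|m (e n). v n x * g x) = (LINT x|m (e n). f x * g x)) sequentially"
   using eventually_e[OF eventually_test_function[OF g]]
  proof eventually_elim
   case (elim n)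
   then show ?case
    using eq[of g n] by (simp add: jump_form_eq[OF J_kernel v_measurable gm])
  qed
  from LIMSEQ_unique[OF Lim_transform_eventually[OF lhs this] rhs] show ?thesis by (simp add: Q_eq[OF h_fin gf])
 qed
 define d where "d x = h x - u x" for x
 have df: "fin d" unfolding d_def by (rule fin_diff[OF h_fin uf])
 have db: "\<bar>d x\<bar> <= 2 * b" for x using h_bound[of x] ub[of x] unfolding d_def by linarith
 have orth: "Q l d g = 0" if g: "g : Cc_inf" for g
  unfolding d_def Q_diff_left[OF h_fin uf dom_fin[OF Cc_inf_dom[OF g]]]
  using weak[OF g] is_resolventD(2)[OF u Cc_inf_dom[OF g]] by simp
 have Qd0: "0 <= QQ l d" by (rule Q_nonneg[OF df]) (use l in simp)
 \<comment> \<open>Test functions j close to d are orthogonal to d, so QQ l d is minus the pairing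
   of j - d with d, and Cauchy-Schwarz makes it as small as desired.\<close>
 have "QQ l d <= 0"
 proof (rule field_le_epsilon, goal_cases)
  case r: (1 r)
  define c' where "c' = max 1 l"
  have c': "0 < c'" "1 <= c'" "l <= c' * 1" by (simp_all add: c'_def)
  have rc: "0 < r / c'" using r c' by simp
  obtain j where j: "j : Cc_inf" "fin j" "QQ 1 (%x. j x - d x) < r / c'"
   by (rule Cc_inf_dense[OF df db rc])
  have fd: "fin (%x. j x - d x)" by (rule fin_diff[OF j(2) df])
  have "Q l (%x. j x - d x) d = - QQ l d"
   unfolding Q_diff_left[OF j(2) df df] using orth[OF j(1)] by (simp add: Q_sym[of l j d])
  moreover have "(Q l (%x. j x - d x) d)^2 <= QQ l (%x. j x - d x) * QQ l d"
   by (rule Q_CS[OF fd df]) (use l in simp)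
  moreover have "QQ l (%x. j x - d x) <= c' * QQ 1 (%x. j x - d x)"
   by (rule Q_mono[OF fd]) (use l c' in simp_all)
  moreover have "c' * QQ 1 (%x. j x - d x) <= r"
   using j(3) c'(1) by (simp add: pos_less_divide_eq mult.commute)
  ultimately have "QQ l d * QQ l d <= r * QQ l d"
   using mult_right_mono[OF _ Qd0, of "QQ l (%x. j x - d x)" r] by (simp add: power2_eq_square)
  then show ?case using Qd0 r by (cases "QQ l d = 0") (simp_all add: mult_le_cancel_right)
 qed
 moreover have "l * (LBINT x. (d x)^2) <= QQ l d" by (rule Q_parts(2)[OF df]) (use l in simp)
 ultimately have "l * (LBINT x. (d x)^2) <= 0" by linarith
 then have "(LBINT x. (d x)^2) <= 0" using l by (simp add: mult_le_0_iff)
 then have "(LBINT x. (d x)^2) = 0" by (simp add: order_antisym)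
 then have "AE x in lborel. (d x)^2 = 0"
  by (subst (asm) integral_nonneg_eq_0_iff_AE) (use sqintD(2)[OF finD(3)[OF df]] in simp_all)
 then show ?thesis by eventually_elim (simp add: d_def)
qed

text \<open>The energy of v n plus l times its mass is the integral of f v n, which converges to the
  energy of h plus l times the mass of u. As the energy of h is at most the lower limit of the
  energies, the masses of v n cannot asymptotically exceed that of u; expanding (v n - u)^2 with the
  known cross term concludes.\<close>

lemma strong_convergence:
 assumes f: "bsupp F S f" and l: "0 < l"
  and vd: "!!n. v n : form_domain (m (e n)) (J (e n))"
  and eq: "!!n g. g : form_domain (m (e n)) (J (e n)) ==>
   jump_form (J (e n)) (v n) g + l * (LINT x|m (e n). v n x * g x) = (LINT x|m (e n). f x * g x)"
  and u: "is_resolvent lborel (%x y. nu (x - y)) l f u" and ub: "!!x. \<bar>u x\<bar> <= b"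
  and D: "0 <= D" "AE x in lborel. \<bar>u x\<bar> <= D * bump be x"
 shows "(%n. LINT x|m (e n). (v n x - u x)^2) ~> 0"
proof (rule tendstoI, goal_cases)
 case r: (1 r)
 have ud: "u : dom" by (rule is_resolventD(1)[OF u])
 have uf: "fin u" by (rule dom_fin[OF ud])
 have um [measurable]: "u : Borel" by (rule finD(1)[OF uf])
 have fm [measurable]: "f : Borel" by (rule bsuppD(1)[OF f])
 have hu: "AE x in lborel. h x = u x" by (rule limit_is_resolvent[OF f l eq u ub])
 \<comment> \<open>By \<open>fin_dom\<close> the limit h is an admissible test function in the
   equation of u.\<close>
 have fh: "(LBINT x. f x * h x) = QQ 0 h + l * (LBINT x. (u x)^2)"
 proof -
  have z: "AE x in lborel. h x - u x = 0" using hu by eventually_elim simp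
  have "(Q l (%x. h x - u x) h)^2 <= QQ l (%x. h x - u x) * QQ l h"
   by (rule Q_CS[OF fin_diff[OF h_fin uf] h_fin]) (use l in simp)
  then have "QQ l h = Q l u h"
   using Q_AE_zero[OF fin_diff[OF h_fin uf] z, of l] by (simp add: Q_diff_left[OF h_fin uf h_fin])
  also have "... = (LBINT x. f x * h x)" by (rule is_resolventD(2)[OF u fin_dom[OF h_fin]])
  finally have "(LBINT x. f x * h x) = QQ 0 h + l * (LBINT x. (h x)^2)" by (simp add: Q_diag[OF h_fin])
  moreover have "(LBINT x. (h x)^2) = (LBINT x. (u x)^2)"
   by (rule integral_cong_AE, measurable, use hu in eventually_elim) simp
  ultimately show ?thesis by simp
 qed
 \<comment> \<open>Five errors of size r/5: two in the mass of v n, two from the doubled cross term,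
   one from the mass of u. The first two are divided by l, hence the tolerance l r/5.\<close>
 have r5: "0 < r / 5" "0 < l * (r / 5)" using r l by simp_all
 have "(%n. LINT x|m (e n). v n x * f x) ~> (LBINT x. f x * h x)"
  using product_convergence[OF f] by (simp add: mult.commute)
 from tendstoD[OF this r5(2)] energy_lower[OF r5(2)]
  tendstoD[OF decay_product_convergence[OF um ub D hu] r5(1)]
  tendstoD[OF filterlim_compose[OF decay_mass_convergence[OF um ub D] e_filter] r5(1)]
 show ?case
 proof eventually_elim
  case (elim n)
  note c1 = elim(1) and c2 = elim(2) and c3 = elim(3) and c4 = elim(4)
  have us: "sqint (m (e n)) u" by (rule decay_sqint[OF um ub D e_unit])
  let ?A = "LINT x|m (e n). (v n x)^2"
  have "(LINT q|jm (e n). (inc (v n) q)^2) + l * ?A = (LINT x|m (e n). v n x * f x)"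
   using eq[OF vd] by (simp add: jump_form_eq[OF J_kernel v_measurable v_measurable] power2_eq_square mult.commute)
  then have "l * ?A <= l * (LBINT x. (u x)^2) + l * (r / 5) + l * (r / 5)"
   using c1 c2 fh unfolding dist_real_def by linarith
  also have "... = l * ((LBINT x. (u x)^2) + r / 5 + r / 5)" by (simp only: distrib_left)
  finally have N: "?A <= (LBINT x. (u x)^2) + r / 5 + r / 5" using l by (simp only: mult_le_cancel_left_pos)
  note i = sqintD(2)[OF v_sq[of n]] sqint_mult[OF v_sq[of n] us] sqintD(2)[OF us]
  have "(LINT x|m (e n). (v n x - u x)^2) = (LINT x|m (e n). (v n x)^2 - 2 * (v n x * u x) + (u x)^2)"
   by (intro bint_cong) (auto simp: power2_eq_square algebra_simps)
  also have "... = ?A - 2 * (LINT x|m (e n). v n x * u x) + (LINT x|m (e n). (u x)^2)"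
   using i by simp
  finally have "(LINT x|m (e n). (v n x - u x)^2) < r" using N c3 c4 unfolding dist_real_def by linarith
  then show ?case by (simp add: abs_of_nonneg bint_nonneg)
 qed
qed

end

section \<open>From integrals to norms\<close>

lemma L2_norm_eq:
 assumes "sqint M f"
 shows "L2_norm M f = ennreal (sqrt (LINT x|M. (f x)^2))"
 unfolding L2_norm_def nn_integral_sq[OF assms]
 by (subst ennreal_powr_ennreal) (simp_all add: powr_half_sqrt)

lemma sqrt_integral_sq_triangle:
 assumes f: "sqint M f" and g: "sqint M g"
 shows "sqrt (LINT x|M. (f x + g x)^2) <= sqrt (LINT x|M. (f x)^2) + sqrt (LINT x|M. (g x)^2)"
proof (rule real_le_lsqrt)
 have "(LINT x|M. (f x + g x)^2) = (LINT x|M. (f x)^2) + 2 * (LINT x|M. f x * g x) + (LINT x|M. (g x)^2)"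
  by (rule integral_sq_add[OF f g])
 also have "... <= (LINT x|M. (f x)^2) + 2 * (sqrt (LINT x|M. (f x)^2) * sqrt (LINT x|M. (g x)^2)) + (LINT x|M. (g x)^2)"
  using Cauchy_Schwarz_integral[OF f g] by linarith
 also have "... = (sqrt (LINT x|M. (f x)^2) + sqrt (LINT x|M. (g x)^2))^2"
  by (simp add: power2_sum)
 finally show "(LINT x|M. (f x + g x)^2) <= (sqrt (LINT x|M. (f x)^2) + sqrt (LINT x|M. (g x)^2))^2" .
qed simp

context homogenization
begin

text \<open>The chosen representatives u0 and U a are exchanged for versions u and V a bounded
  everywhere by F/l, which suit (i) and (iv); the integrals in the statement do not see the
  difference.\<close>

lemma resolvent_convergence:
 assumes f: "f : Cc 0" and l: "0 < l"
 defines "u0 \<equiv> resolvent lborel (%x y. nu (x - y)) l f" and "U \<equiv> %a. resolvent (m a) (J a) l f"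
 shows "sqint lborel u0"
  and "!!a. a : {0<..1} ==> sqint (m a) u0"
  and "!!a. a : {0<..1} ==> sqint (m a) (U a)"
  and "((%a. LINT x|m a. (u0 x)^2) \<longlongrightarrow> (LBINT x. (u0 x)^2)) at0"
  and "((%a. LINT x|m a. (U a x - u0 x)^2) \<longlongrightarrow> 0) at0"
proof -
 obtain F S where FS: "0 < S" "bsupp F S f" by (rule Cc_bsupp[OF f])
 have fm [measurable]: "f : Borel" by (rule bsuppD(1)[OF FS(2)])
 have fF: "\<bar>f x\<bar> <= F" for x by (rule bsuppD(2)[OF FS(2)])
 have F0: "0 <= F" using fF[of 0] by linarith
 define b where "b = F / l"
 have b0: "0 <= b" using F0 l by (simp add: b_def)
 have fsq: "sqint lborel f" by (rule bsupp_sq(3)[OF FS(2)])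
 have u0r: "is_resolvent lborel (%x y. nu (x - y)) l f u0" unfolding u0_def by (rule resolvent_is_resolvent[OF fsq l])
 have u0m [measurable]: "u0 : Borel" by (rule finD(1)[OF dom_fin[OF is_resolventD(1)[OF u0r]]])
 show "sqint lborel u0" by (rule finD(3)[OF dom_fin[OF is_resolventD(1)[OF u0r]]])
 obtain u where u: "is_resolvent lborel (%x y. nu (x - y)) l f u" "!!x. \<bar>u x\<bar> <= b" "AE x in lborel. u x = u0 x"
  unfolding b_def by (rule resolvent_bounded_version[OF fsq l u0r fF]) blast
 have um [measurable]: "u : Borel" by (rule finD(1)[OF dom_fin[OF is_resolventD(1)[OF u(1)]]])
 obtain D where D: "0 <= D" "AE x in lborel. \<bar>u x\<bar> <= D * bump be x"
  by (rule resolvent_decay[OF fsq l u(1) fF bsuppD(3)[OF FS(2)]]) blast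
 have uu0: "AE x in m a. u x = u0 x" if "a : {0<..1}" for a unfolding AE_m[OF that] by (rule u(3))
 \<comment> \<open>Square integrability under the random measures comes from the decay of the
   bounded version u.\<close>
 show u0sq: "sqint (m a) u0" if a: "a : {0<..1}" for a
  by (rule sqint_bound[OF decay_sqint[OF um u(2) D a]], simp, use uu0[OF a] in eventually_elim) simp
 have mass: "(LINT x|m a. (u0 x)^2) = (LINT x|m a. (u x)^2)" if a: "a : {0<..1}" for a
  by (rule integral_cong_AE, simp, simp, use uu0[OF a] in eventually_elim) simp
 have mass0: "(LBINT x. (u0 x)^2) = (LBINT x. (u x)^2)"
  by (rule integral_cong_AE, simp, simp, use u(3) in eventually_elim) simp
 have "eventually (%a. (LINT x|m a. (u x)^2) = (LINT x|m a. (u0 x)^2)) at0"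
  using eventually_unit by eventually_elim (simp add: mass)
 from Lim_transform_eventually[OF decay_mass_convergence[OF um u(2) D] this]
 show "((%a. LINT x|m a. (u0 x)^2) \<longlongrightarrow> (LBINT x. (u0 x)^2)) at0" by (simp only: mass0)
 have Ur: "is_resolvent (m a) (J a) l f (U a)" if a: "a : {0<..1}" for a
 proof -
  interpret R: jump_space "m a" "J a" by (rule random_space[OF a])
  show ?thesis unfolding U_def by (rule R.resolvent_is_resolvent[OF bsupp_sq(2)[OF FS(2) a] l])
 qed
 have UD: "U a : Borel" "sqint (m a) (U a)" if a: "a : {0<..1}" for a
 proof -
  interpret R: jump_space "m a" "J a" by (rule random_space[OF a])
  note fin = R.dom_fin[OF R.is_resolventD(1)[OF Ur[OF a]]]
  show "U a : Borel" "sqint (m a) (U a)" by (rule R.finD[OF fin])+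
 qed
 then show "!!a. a : {0<..1} ==> sqint (m a) (U a)" by blast
 have "\<exists>w. is_resolvent (m a) (J a) l f w \<and> (\<forall>x. \<bar>w x\<bar> <= b) \<and> (AE x in lborel. w x = U a x)" if a: "a : {0<..1}" for a
 proof -
  interpret R: jump_space "m a" "J a" by (rule random_space[OF a])
  obtain w where "is_resolvent (m a) (J a) l f w" "!!x. \<bar>w x\<bar> <= b" "AE x in lborel. w x = U a x"
   unfolding b_def by (rule R.resolvent_bounded_version[OF bsupp_sq(2)[OF FS(2) a] l Ur[OF a] fF]) blast
  then show ?thesis by blast
 qed
 then obtain V where V: "!!a. a : {0<..1} ==> is_resolvent (m a) (J a) l f (V a)"
  "!!a x. a : {0<..1} ==> \<bar>V a x\<bar> <= b" "!!a. a : {0<..1} ==> AE x in lborel. V a x = U a x"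
  by metis
 have Vdom: "V a : form_domain (m a) (J a)" if "a : {0<..1}" for a
  using V(1)[OF that] by (simp add: is_resolvent_def)
 have Veq: "jump_form (J a) (V a) g + l * (LINT x|m a. V a x * g x) = (LINT x|m a. f x * g x)"
  if "a : {0<..1}" "g : form_domain (m a) (J a)" for a g
  using V(1)[OF that(1)] that(2) by (simp add: is_resolvent_def)
 define L where "L = max 1 S"
 have L: "1 <= L" by (simp add: L_def)
 \<comment> \<open>Bounds the integral of f V a. Testing the equation with V a itself then bounds
   its energy by E0 and its mass by E0/l.\<close>
 define E0 where "E0 = F * b * (K * L ^ DIM('a))"
 have E0: "0 <= E0" unfolding E0_def using F0 b0 K_nonneg L by (intro mult_nonneg_nonneg) auto
 define E where "E = E0 + E0 / l"
 have VD: "V a : Borel" "sqint (jm a) (inc (V a))" "sqint (m a) (V a)"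
  "(LINT q|jm a. (inc (V a) q)^2) <= E" "(LINT x|m a. (V a x)^2) <= E"
  if a: "a : {0<..1}" for a
 proof -
  interpret R: jump_space "m a" "J a" by (rule random_space[OF a])
  have Vd: "V a : R.dom" by (rule R.is_resolventD(1)[OF V(1)[OF a]])
  note fin = R.dom_fin[OF Vd]
  show Vm: "V a : Borel" and "sqint (jm a) (inc (V a))" "sqint (m a) (V a)"
   by (rule R.finD[OF fin])+
  have "bsupp (F * b) L (%x. f x * V a x)"
   by (rule bsupp_mono[OF bsupp_mult[OF FS(2) Vm V(2)[OF a]]]) (simp_all add: L_def)
  from rho_bound[OF this a L] have "(LINT x|m a. f x * V a x) <= E0" unfolding E0_def by linarith
  then have "(LINT q|jm a. (inc (V a) q)^2) + l * (LINT x|m a. (V a x)^2) <= E0"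
   using R.is_resolventD(2)[OF V(1)[OF a] Vd] R.Q_diag[OF fin, of l] by simp
  moreover have "0 <= (LINT q|jm a. (inc (V a) q)^2)" "0 <= l * (LINT x|m a. (V a x)^2)" using l by simp_all
  ultimately have "(LINT q|jm a. (inc (V a) q)^2) <= E0" "l * (LINT x|m a. (V a x)^2) <= E0" by linarith+
  moreover from this(2) have "(LINT x|m a. (V a x)^2) <= E0 / l" using l by (simp add: pos_le_divide_eq mult.commute)
  moreover have "0 <= E0 / l" using E0 l by simp
  ultimately show "(LINT q|jm a. (inc (V a) q)^2) <= E" "(LINT x|m a. (V a x)^2) <= E"
   using E0 unfolding E_def by linarith+
 qed
 have lim: "Limsup at0 (%a. Linf_norm (V a) + jump_energy (J a) (V a)) < \<infinity>"
 proof -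
  have "eventually (%a. Linf_norm (V a) + jump_energy (J a) (V a) <= ennreal b + ennreal E) at0"
   using eventually_unit
  proof eventually_elim
   case a: (elim a)
   have [measurable]: "V a : Borel" by (rule VD(1)[OF a])
   have "Linf_norm (V a) <= ennreal b"
    unfolding Linf_norm_def by (rule esssup_I) (use V(2)[OF a] in \<open>auto intro!: ennreal_leI\<close>)
   moreover have "jump_energy (J a) (V a) <= ennreal E"
    unfolding jump_energy_eq[OF J_kernel VD(1)[OF a]] nn_integral_sq[OF VD(2)[OF a]] by (rule ennreal_leI[OF VD(4)[OF a]])
   ultimately show ?case by (rule add_mono)
  qed
  then have "Limsup at0 (%a. Linf_norm (V a) + jump_energy (J a) (V a)) <= ennreal b + ennreal E" by (rule Limsup_bounded)
  also have "... < \<infinity>" by simp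
  finally show ?thesis .
 qed
 show "((%a. LINT x|m a. (U a x - u0 x)^2) \<longlongrightarrow> 0) at0"
 proof (rule tendsto_at_right_subseqI)
  fix e :: "nat => real" assume e: "range e \<subseteq> {0<..1}" "e ~> 0"
  have eu: "e n : {0<..1}" for n using e(1) by blast
  obtain s h0 where s: "strict_mono s" and h0: "h0 : L1_loc"
   and conv: "!!r. r > 1 ==> (%k. set_nnint (ball 0 r) (%x. ennreal \<bar>V (e (s k)) x - h0 x\<bar>)) ~> 0"
   using compactness[OF _ lim e] Vdom by blast
  have h0m [measurable]: "h0 : Borel" using h0 by (simp add: L1_loc_def)
  \<comment> \<open>Clamping the local limit does not increase its distance to V, whose values
    already lie in [-b, b].\<close>
  define h where "h x = max (- b) (min b (h0 x))" for x
  interpret B: bounded_energy_sequence rh p K nu al C c \<Gamma> "%n. e (s n)" "%n. V (e (s n))" h b E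
  proof
   show "e (s n) : {0<..1}" for n by (rule eu)
   show "(%n. e (s n)) ~> 0" using LIMSEQ_subseq_LIMSEQ[OF e(2) s] by (simp add: o_def)
   show "V (e (s n)) : Borel" "\<bar>V (e (s n)) x\<bar> <= b" "sqint (jm (e (s n))) (inc (V (e (s n))))"
    "sqint (m (e (s n))) (V (e (s n)))" "(LINT q|jm (e (s n)). (inc (V (e (s n))) q)^2) <= E"
    "(LINT x|m (e (s n)). (V (e (s n)) x)^2) <= E" for n x
    using VD[OF eu] V(2)[OF eu] by blast+
   show "h : Borel" unfolding h_def by measurable
   show "\<bar>h x\<bar> <= b" for x using b0 unfolding h_def by linarith
   show "(%n. set_nnint (ball 0 r) (%x. ennreal \<bar>V (e (s n)) x - h x\<bar>)) ~> 0" if "1 < r" for r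
   proof (rule tendsto_sandwich[OF always_eventually always_eventually tendsto_const conv[OF that]]; intro allI)
    fix n
    show "(set_nnint (ball 0 r) (%x. ennreal \<bar>V (e (s n)) x - h x\<bar>)) <= (set_nnint (ball 0 r) (%x. ennreal \<bar>V (e (s n)) x - h0 x\<bar>))"
    proof (intro nn_integral_mono mult_right_mono ennreal_leI)
     fix x show "\<bar>V (e (s n)) x - h x\<bar> <= \<bar>V (e (s n)) x - h0 x\<bar>"
      using V(2)[OF eu, of "s n" x] unfolding h_def by linarith
    qed simp
   qed simp
  qed
  have "(%n. LINT x|m (e (s n)). (V (e (s n)) x - u x)^2) ~> 0"
   by (rule B.strong_convergence[OF FS(2) l Vdom[OF eu] Veq[OF eu] u(1,2) D])
  moreover have "(LINT x|m a. (V a x - u x)^2) = (LINT x|m a. (U a x - u0 x)^2)" if a: "a : {0<..1}" for a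
  proof (rule integral_cong_AE)
   show "(%x. (V a x - u x)^2) : borel_measurable (m a)" "(%x. (U a x - u0 x)^2) : borel_measurable (m a)"
    using VD(1)[OF a] UD(1)[OF a] by simp_all
   show "AE x in m a. (V a x - u x)^2 = (U a x - u0 x)^2"
    unfolding AE_m[OF a] using V(3)[OF a] u(3) by eventually_elim simp
  qed
  ultimately show "\<exists>s. strict_mono s \<and> (%k. LINT x|m (e (s k)). (U (e (s k)) x - u0 x)^2) ~> 0"
   using s eu by (intro exI[of _ s]) simp
 qed
qed

text \<open>The third limit follows from the first two by the triangle inequality in L2(m
  s).\<close>

lemma resolvent_norm_convergence:
 assumes f: "f : Cc 0" and l: "0 < l"
 defines "u \<equiv> resolvent lborel (%x y. nu (x - y)) l f" and "U \<equiv> %s. resolvent (m s) (J s) l f"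
 shows "((%s. L2_norm (m s) u) \<longlongrightarrow> L2_norm lborel u) at0"
  and "((%s. L2_norm (m s) (%x. U s x - u x)) \<longlongrightarrow> 0) at0"
  and "((%s. L2_norm (m s) (U s)) \<longlongrightarrow> L2_norm lborel u) at0"
proof -
 have U: "resolvent (m s) (J s) l f = U s" for s by (simp add: U_def)
 note R = resolvent_convergence[OF f l, folded u_def, unfolded U]
 define a where "a s = sqrt (LINT x|m s. (u x)^2)" for s
 define d where "d s = sqrt (LINT x|m s. (U s x - u x)^2)" for s
 define t where "t = sqrt (LBINT x. (u x)^2)"
 have a: "(a \<longlongrightarrow> t) at0" unfolding a_def t_def by (rule tendsto_real_sqrt[OF R(4)])
 have d: "(d \<longlongrightarrow> 0) at0" unfolding d_def using tendsto_real_sqrt[OF R(5)] by simp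
 have tt: "L2_norm lborel u = ennreal t" unfolding t_def by (rule L2_norm_eq[OF R(1)])
 have "eventually (%s. ennreal (a s) = L2_norm (m s) u) at0"
  using eventually_unit by eventually_elim (simp add: a_def L2_norm_eq[OF R(2)])
 from Lim_transform_eventually[OF tendsto_ennrealI[OF a] this]
 show "((%s. L2_norm (m s) u) \<longlongrightarrow> L2_norm lborel u) at0" unfolding tt .
 have "eventually (%s. ennreal (d s) = L2_norm (m s) (%x. U s x - u x)) at0"
  using eventually_unit by eventually_elim (simp add: d_def L2_norm_eq[OF sqint_diff[OF R(3) R(2)]])
 from Lim_transform_eventually[OF tendsto_ennrealI[OF d] this]
 show "((%s. L2_norm (m s) (%x. U s x - u x)) \<longlongrightarrow> 0) at0" by simp
 define w where "w s = sqrt (LINT x|m s. (U s x)^2)" for s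
 have bounds: "a s - d s <= w s \<and> w s <= a s + d s" if s: "s : {0<..1}" for s
 proof -
  note du = sqint_diff[OF R(3)[OF s] R(2)[OF s]] and ud = sqint_diff[OF R(2)[OF s] R(3)[OF s]]
  have "w s <= d s + a s"
   using sqrt_integral_sq_triangle[OF du R(2)[OF s]] unfolding w_def d_def a_def by simp
  moreover have "a s <= d s + w s"
   using sqrt_integral_sq_triangle[OF ud R(3)[OF s]] unfolding w_def d_def a_def by (simp add: power2_commute)
  ultimately show ?thesis by linarith
 qed
 have "((%s. a s - d s) \<longlongrightarrow> t - 0) at0" "((%s. a s + d s) \<longlongrightarrow> t + 0) at0"
  by (rule tendsto_diff[OF a d], rule tendsto_add[OF a d])
 then have ad: "((%s. a s - d s) \<longlongrightarrow> t) at0" "((%s. a s + d s) \<longlongrightarrow> t) at0" by simp_all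
 have w: "(w \<longlongrightarrow> t) at0"
  by (rule tendsto_sandwich[OF _ _ ad]) (use bounds in \<open>auto intro: eventually_mono[OF eventually_unit]\<close>)
 have "eventually (%s. ennreal (w s) = L2_norm (m s) (U s)) at0"
  using eventually_unit by eventually_elim (simp add: w_def L2_norm_eq[OF R(3)])
 from Lim_transform_eventually[OF tendsto_ennrealI[OF w] this]
 show "((%s. L2_norm (m s) (U s)) \<longlongrightarrow> L2_norm lborel u) at0" unfolding tt .
qed

end

text \<open>Dilations preserve null sets. This carries positivity of mu along an orbit over to every
  scale.\<close>

lemma AE_lborel_scale:
 fixes P :: "'a::euclidean_space => bool"
 assumes P: "{x. P x} : sets borel" and ae: "AE x in lborel. P x" and r: "0 < r"
 shows "AE x in lborel. P (x /\<^sub>R r)"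
proof -
 have [measurable]: "Measurable.pred borel P" using P by (simp add: pred_def)
 let ?A = "nnint (%x. ind {x. \<not> P x} ((r *\<^sub>R x) /\<^sub>R r))"
 have "(nnint (%x. ind {x. \<not> P x} (x /\<^sub>R r))) = ennreal (r ^ DIM('a)) * ?A"
  by (rule nn_integral_lborel_scale[OF _ r]) (simp add: indicator_def)
 also have "?A = (nn_integral (lborel :: 'a measure) (%x. 0))"
  by (rule nn_integral_cong_AE, use ae in eventually_elim) (use r in simp)
 finally have "(nnint (%x. ind {x. \<not> P x} (x /\<^sub>R r))) = 0" by simp
 then have "AE x in lborel. ind {x. \<not> P x} (x /\<^sub>R r) = (0::ennreal)"
  by (subst (asm) nn_integral_0_iff_AE) (simp_all add: indicator_def)
 then show ?thesis by eventually_elim (simp add: indicator_def split: if_splits)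
qed

theorem theorem2p3:
  fixes M :: "'w measure"
    and \<tau> :: "'a::euclidean_space \<Rightarrow> 'w \<Rightarrow> 'w"
    and \<alpha> C1 C2 :: real
    and \<mu> :: "'w \<Rightarrow> real"
    and \<kappa> :: "'a \<Rightarrow> 'a \<Rightarrow> 'w \<Rightarrow> real"
    and \<Gamma> :: "'a set"
    and K :: "'a \<Rightarrow> real"
    and \<Omega>0 :: "'w set"
  assumes setting: "random_coefficients M \<tau> \<alpha> \<mu> \<kappa> \<Gamma>"
    and mu_moment: "\<exists>p>1. integrable M (\<lambda>\<omega>. \<mu> \<omega> powr p)"
    and K_measurable: "K \<in> borel_measurable borel"
    and K_even: "\<And>z. K (- z) = K z"
    and K_bounds: "0 < C1" "0 < C2" "\<And>z. C1 \<le> K z \<and> K z \<le> C2"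
    and Omega0: "\<Omega>0 \<in> sets M" "measure M \<Omega>0 = 1"
    and cond_i: "\<And>\<omega> f (e :: nat \<Rightarrow> real).
      \<lbrakk>\<omega> \<in> \<Omega>0;
       \<forall>\<epsilon>\<in>{0<..1}. f \<epsilon> \<in> form_domain (rescaled_measure \<tau> \<mu> \<epsilon> \<omega>) (random_kernel \<alpha> \<Gamma> \<kappa> \<epsilon> \<omega>);
       Limsup (at_right 0) (\<lambda>\<epsilon>. Linf_norm (f \<epsilon>) + jump_energy (random_kernel \<alpha> \<Gamma> \<kappa> \<epsilon> \<omega>) (f \<epsilon>)) < \<infinity>;
       range e \<subseteq> {0<..1}; e \<longlonglongrightarrow> 0\<rbrakk>
      \<Longrightarrow> \<exists>s h. strict_mono (s :: nat \<Rightarrow> nat) \<and> h \<in> L1_loc \<and>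
            (\<forall>r>1. (\<lambda>k. \<integral>\<^sup>+x\<in>ball 0 r. ennreal \<bar>f (e (s k)) x - h x\<bar> \<partial>lborel) \<longlonglongrightarrow> 0)"
    and cond_ii_small: "\<And>\<omega> g. \<lbrakk>\<omega> \<in> \<Omega>0; g \<in> Cc_inf\<rbrakk> \<Longrightarrow>
      ((\<lambda>\<eta>. Limsup (at_right 0) (\<lambda>\<epsilon>.
          set_nn_integral (lborel \<Otimes>\<^sub>M lborel) (- Id)
            (\<lambda>(x, y). ennreal ((g x - g y)\<^sup>2 * stable_kernel \<alpha> (rescaled_coeff \<kappa> \<epsilon> \<omega>) x y)
                       * indicator {(x, y). norm (x - y) \<le> \<eta>} (x, y))))
        \<longlongrightarrow> 0) (at_right 0)"
    and cond_ii_large: "\<And>\<omega> g. \<lbrakk>\<omega> \<in> \<Omega>0; g \<in> Cc_inf\<rbrakk> \<Longrightarrow>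
      ((\<lambda>\<eta>. Limsup (at_right 0) (\<lambda>\<epsilon>.
          \<integral>\<^sup>+(x, y). ennreal ((g x - g y)\<^sup>2 * stable_kernel \<alpha> (rescaled_coeff \<kappa> \<epsilon> \<omega>) x y)
                     * indicator {(x, y). 1 / \<eta> \<le> norm (x - y)} (x, y) \<partial>(lborel \<Otimes>\<^sub>M lborel)))
        \<longlongrightarrow> 0) (at_right 0)"
    and cond_iii: "\<And>\<omega>. \<omega> \<in> \<Omega>0 \<Longrightarrow> \<exists>p>1. \<forall>R\<ge>1.
      Limsup (at_right 0) (\<lambda>\<epsilon>.
        \<integral>\<^sup>+x\<in>ball 0 R. ennreal_powr
          (\<integral>\<^sup>+y\<in>ball 0 R. ennreal (rescaled_coeff \<kappa> \<epsilon> \<omega> x y) \<partial>lborel) p \<partial>lborel) < \<infinity>"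
    and cond_iv: "\<And>\<omega> \<eta> f g.
      \<lbrakk>\<omega> \<in> \<Omega>0; 0 < \<eta>; f \<in> borel_measurable borel; bounded (range f); g \<in> Cc_inf\<rbrakk> \<Longrightarrow>
      ((\<lambda>\<epsilon>. \<integral>(x, y). (f x - f y) * (g x - g y) * random_kernel \<alpha> \<Gamma> \<kappa> \<epsilon> \<omega> x y
                   * indicator {(x, y). \<eta> < norm (x - y) \<and> norm (x - y) < 1 / \<eta>} (x, y)
              \<partial>(lborel \<Otimes>\<^sub>M lborel))
        \<longlongrightarrow> (\<integral>(x, y). (f x - f y) * (g x - g y) * limit_kernel \<alpha> \<Gamma> K x y
                   * indicator {(x, y). \<eta> < norm (x - y) \<and> norm (x - y) < 1 / \<eta>} (x, y)
              \<partial>(lborel \<Otimes>\<^sub>M lborel))) (at_right 0)"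
  shows "\<exists>\<Omega>2\<in>sets M. measure M \<Omega>2 = 1 \<and>
    (\<forall>\<omega>\<in>\<Omega>2. \<forall>l>0. \<forall>f\<in>Cc 0.
      ((\<lambda>\<epsilon>. L2_norm (rescaled_measure \<tau> \<mu> \<epsilon> \<omega>) (limit_resolvent \<alpha> \<Gamma> K l f))
         \<longlongrightarrow> L2_norm lborel (limit_resolvent \<alpha> \<Gamma> K l f)) (at_right 0) \<and>
      ((\<lambda>\<epsilon>. L2_norm (rescaled_measure \<tau> \<mu> \<epsilon> \<omega>)
              (\<lambda>x. random_resolvent \<tau> \<alpha> \<mu> \<kappa> \<Gamma> \<epsilon> \<omega> l f x - limit_resolvent \<alpha> \<Gamma> K l f x))
         \<longlongrightarrow> 0) (at_right 0) \<and>
      ((\<lambda>\<epsilon>. L2_norm (rescaled_measure \<tau> \<mu> \<epsilon> \<omega>) (random_resolvent \<tau> \<alpha> \<mu> \<kappa> \<Gamma> \<epsilon> \<omega> l f))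
         \<longlongrightarrow> L2_norm lborel (limit_resolvent \<alpha> \<Gamma> K l f)) (at_right 0))"
proof -
 interpret random_coefficients M \<tau> \<alpha> \<mu> \<kappa> \<Gamma> by (rule setting)
 obtain p where p: "1 < p" "integrable M (%\<omega>. \<mu> \<omega> powr p)" using mu_moment by blast
 obtain N where N: "{\<omega> : space M. \<not> (\<exists>K. weight_family (%\<epsilon> x. \<mu> (\<tau> (x /\<^sub>R \<epsilon>) \<omega>)) p K)} \<subseteq> N" "N : null_sets M"
  using weights_AE[OF p] by (auto elim!: AE_E simp: null_sets_def)
 \<comment> \<open>All that is removed is the exceptional set of \<open>weights_AE\<close>, which
   depends on neither l nor f.\<close>
 define \<Omega>2 where "\<Omega>2 = \<Omega>0 - N"
 have \<Omega>2: "\<Omega>2 : sets M" unfolding \<Omega>2_def using Omega0(1) N(2) by auto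
 have prob: "measure M \<Omega>2 = 1"
  unfolding \<Omega>2_def using measure_Diff_null_set[OF Omega0(1) N(2)] Omega0(2) by simp
 \<comment> \<open>The limit kernel as a function of x - y, cone included, to fit the
   translation-invariant setting.\<close>
 define \<nu> where "\<nu> z = K z / norm z powr (real DIM('a) + \<alpha>) * ind \<Gamma> z" for z
 have K0: "0 <= K z" for z using K_bounds(1) K_bounds(3)[of z] by linarith
 have \<Gamma>m [measurable]: "\<Gamma> : sets borel" by (rule borel_open[OF cone_open])
 have \<nu>m: "\<nu> : Borel" unfolding \<nu>_def using K_measurable by measurable
 have \<nu>0: "0 <= \<nu> z" for z unfolding \<nu>_def using K0[of z] by simp
 have \<nu>C: "\<nu> z <= C2 * norm z powr - (real DIM('a) + \<alpha>)" for z
 proof -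
  have "\<nu> z <= K z / norm z powr (real DIM('a) + \<alpha>)" unfolding \<nu>_def using K0[of z] by (simp add: indicator_def)
  also have "... <= C2 / norm z powr (real DIM('a) + \<alpha>)" using K_bounds(3)[of z] by (intro divide_right_mono) auto
  also have "... = C2 * norm z powr - (real DIM('a) + \<alpha>)" unfolding powr_minus_divide by simp
  finally show ?thesis .
 qed
 have limit: "limit_kernel \<alpha> \<Gamma> K = (%x y. \<nu> (x - y))"
  by (simp add: limit_kernel_def cone_kernel_def stable_kernel_def \<nu>_def fun_eq_iff)
 have stable: "stable_like \<nu> \<alpha> C2"
 proof
  have "(nnint (%z. ennreal (min 1 ((norm z)^2) * \<nu> z)))
   <= (nn_integral (lborel :: 'a measure) (%z. ennreal C2 * ennreal (min 1 ((norm z)^2) * norm z powr - (real DIM('a) + \<alpha>))))"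
  proof (rule nn_integral_mono, goal_cases)
   case (1 z)
   have "min 1 ((norm z)^2) * \<nu> z <= min 1 ((norm z)^2) * (C2 * norm z powr - (real DIM('a) + \<alpha>))"
    by (rule mult_left_mono[OF \<nu>C]) simp
   also have "... = C2 * (min 1 ((norm z)^2) * norm z powr - (real DIM('a) + \<alpha>))" by (rule mult.left_commute)
   finally have "ennreal (min 1 ((norm z)^2) * \<nu> z) <= ennreal (C2 * (min 1 ((norm z)^2) * norm z powr - (real DIM('a) + \<alpha>)))"
    by (rule ennreal_leI)
   also have "... = ennreal C2 * ennreal (min 1 ((norm z)^2) * norm z powr - (real DIM('a) + \<alpha>))"
    by (rule ennreal_mult) (use K_bounds(2) in simp_all)
   finally show ?case .
  qed
  also have "... = ennreal C2 * (nn_integral (lborel :: 'a measure) (%z. ennreal (min 1 ((norm z)^2) * norm z powr - (real DIM('a) + \<alpha>))))"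
   by (rule nn_integral_cmult) measurable
  also have "... < \<infinity>" using stable_levy_integral[OF alpha, where 'a='a] by (simp add: ennreal_mult_less_top)
  finally show "(nnint (%z. ennreal (min 1 ((norm z)^2) * \<nu> z))) < \<infinity>" .
  show "\<nu> : Borel" by (rule \<nu>m)
  show "0 <= \<nu> z" "\<nu> z <= C2 * norm z powr - (real DIM('a) + \<alpha>)" for z by (rule \<nu>0, rule \<nu>C)
  show "0 < \<alpha>" "\<alpha> < 2" by (rule alpha)+
  show "0 <= C2" using K_bounds(2) by simp
 qed
 show ?thesis
 proof (intro bexI[OF _ \<Omega>2] conjI[OF prob] ballI allI impI, goal_cases)
  case (1 \<omega> l f)
  then have \<omega>2: "\<omega> : \<Omega>2" and l: "0 < l" and f: "f : Cc 0" by auto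
  have \<omega>0: "\<omega> : \<Omega>0" and \<omega>N: "\<omega> \<notin> N" using \<omega>2 by (auto simp: \<Omega>2_def)
  have \<omega>: "\<omega> : space M" using sets.sets_into_space[OF Omega0(1)] \<omega>0 by blast
  obtain K' where W: "weight_family (%\<epsilon> x. \<mu> (\<tau> (x /\<^sub>R \<epsilon>) \<omega>)) p K'" using N(1) \<omega> \<omega>N by blast
  interpret W: weight_family "%\<epsilon> x. \<mu> (\<tau> (x /\<^sub>R \<epsilon>) \<omega>)" p K' by (rule W)
  interpret S: stable_like \<nu> \<alpha> C2 by (rule stable)
  interpret H: homogenization "%\<epsilon> x. \<mu> (\<tau> (x /\<^sub>R \<epsilon>) \<omega>)" p K' \<nu> \<alpha> C2 "%\<epsilon>. rescaled_coeff \<kappa> \<epsilon> \<omega>" \<Gamma>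
  proof
   show "(%q. rescaled_coeff \<kappa> \<epsilon> \<omega> (fst q) (snd q)) : Borel2" for \<epsilon>
   proof -
    have "(%q :: 'a \<times> 'a. (fst q /\<^sub>R \<epsilon>, snd q /\<^sub>R \<epsilon>, \<omega>)) : borel \<Otimes>\<^sub>M borel \<rightarrow>\<^sub>M borel \<Otimes>\<^sub>M (borel \<Otimes>\<^sub>M M)"
     using \<omega> by measurable
    from measurable_compose[OF this kappa_measurable] show ?thesis by (simp add: rescaled_coeff_def)
   qed
   show "0 <= rescaled_coeff \<kappa> \<epsilon> \<omega> x y" for \<epsilon> x y unfolding rescaled_coeff_def by (rule kappa_nonneg[OF \<omega>])
   show "rescaled_coeff \<kappa> \<epsilon> \<omega> x y = rescaled_coeff \<kappa> \<epsilon> \<omega> y x" for \<epsilon> x y unfolding rescaled_coeff_def by (rule kappa_sym[OF \<omega>])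
   show "\<Gamma> : sets borel" by (rule \<Gamma>m)
   show "AE x in lborel. 0 < \<mu> (\<tau> (x /\<^sub>R \<epsilon>) \<omega>)" if "\<epsilon> : {0<..1}" for \<epsilon>
   proof (rule AE_lborel_scale[where P="%x. 0 < \<mu> (\<tau> x \<omega>)", OF _ mu_pos[OF \<omega>]])
    have "(%x. \<mu> (\<tau> x \<omega>)) : Borel" using orbit_measurable[OF mu_measurable \<omega>, of 1] by simp
    then have "{x : space borel. 0 < \<mu> (\<tau> x \<omega>)} : sets borel" by measurable
    then show "{x. 0 < \<mu> (\<tau> x \<omega>)} : sets borel" by simp
   qed (use that in simp)
  qed (rule cond_i[OF \<omega>0, unfolded rescaled_measure_def random_kernel_def] cond_ii_small[OF \<omega>0] cond_ii_large[OF \<omega>0] cond_iii[OF \<omega>0] cond_iv[OF \<omega>0, unfolded random_kernel_def limit]; assumption)+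
  show ?case
   unfolding rescaled_measure_def limit_resolvent_def random_resolvent_def random_kernel_def limit
   by (intro conjI H.resolvent_norm_convergence[OF f l])
 qed
qed

end
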